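(* Let $T>0$. The set of closed finite gap curves in $\mathbb{H}^3$ with respect to the period $T$ is $W^{2,2}$-dense in the Sobolev space of all closed $W^{2,2}$-curves of length $T$ in $\mathbb{H}^3$. Moreover, near any closed curve $\gamma$ in $\mathbb{H}^3$ (i.e. in every $W^{2,2}$-neighbourhood of any closed $W^{2,2}$-curve $\gamma$ of length $T$) there are closed finite gap curves with the same total torsion as $\gamma$.
   Context: Model. $\mathbb{H}^3=\{gg^*: g\in \mathrm{SL}_2(\mathbb{C})\}$, a subset of the real 4-space of Hermitian $2\times 2$ matrices, with its metric of constant curvature $-1$; $\mathrm{SL}_2(\mathbb{C})$ acts on it by $X\mapsto AXA^*$. Closed curves of length $T$ are $T$-periodic unit-speed curves $\gamma:\mathbb{R}\to\mathbb{H}^3$ of class $W^{2,2}_{loc}$; the $W^{2,2}$-topology is that of $W^{2,2}([0,T])$-maps into the space of Hermitian matrices. Frames. Put $\varepsilon=\begin{pmatrix} i&0\\0&-i\end{pmatrix}$, $\varepsilon_+=\begin{pmatrix}0&1\\0&0\end{pmatrix}$, $\varepsilon_-=\begin{pmatrix}0&0\\-1&0\end{pmatrix}$. For $q\in L^2_{loc}(\mathbb{R},\mathbb{C})$ let $\alpha^q=\tfrac12(\lambda\varepsilon+q\varepsilon_++\bar q\varepsilon_-)$ and let the extended frame $F^q(t,\lambda)\in \mathrm{SL}_2(\mathbb{C})$ be the solution of $\tfrac{d}{dt}F=F\alpha^q$, $F(0,\lambda)=\mathbb{1}$. Complex curvature and total torsion. A unit-speed $W^{2,2}_{loc}$-curve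 $\gamma$ has a complex curvature $q\in L^2_{loc}(\mathbb{R},\mathbb{C})$, characterised by: up to the action of $\mathrm{SL}_2(\mathbb{C})$, $\gamma(t)=F^q(t,i)\,F^q(t,-i)^{-1}$. (If curvature $\kappa$ and torsion $\tau$ are defined, $q(t)=\kappa(t)e^{i\int_0^t\tau(s)\,ds}$.) If $\gamma$ is closed of length $T$, then $q$ is quasi-periodic, $q(t+T)=e^{i\theta T}q(t)$ for all $t\in\mathbb{R}$, with a unique number $\theta\in\mathbb{R}$; if $\gamma$ is three times differentiable, so that its torsion function $\tau$ is well-defined, then $\theta=\tfrac1T\int_0^T\tau$ is the average torsion of $\gamma$. The real number $\theta T$ is called the total torsion of $\gamma$, also when $\gamma$ is only twice differentiable. The function $\tilde q(t)=e^{-i\theta t}q(t)$ is $T$-periodic and is called the periodic potential of $\gamma$. Finite gap. For a $T$-periodic $q\in L^2([0,T],\mathbb{C})$ let $M(\lambda)=F^q(T,\lambda)$ (the monodromy, entire in $\lambda$), $\Delta=\operatorname{tr}M$ and $N=M-\tfrac12\Delta\mathbb{1}$. The potential $q$ is of finite gap if $\sum_{\lambda\in\mathbb{C}}\bigl(\operatorname{ord}_\lambda(\Delta^2-4)-2\operatorname{ord}_\lambda N\bigr)<\infty$ (all summands are $\ge 0$; this expresses that the eigenline curve of $M$ has finite arithmetic genus; equivalently, $q$ is stationary under all but finitely many flows of the self-focusing nonlinear Schrödinger hierarchy). A closed curve of length $T$ is a finite gap curve with respect to the period $T$ if its periodic potential is of finite gap.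
   Formalization: The number θ is only determined modulo 2π/T by quasi-periodicity; total torsion is the exact real number if the curve has nowhere zero curvature and continuous torsion, otherwise it is taken modulo 2π, and "same total torsion" means the two curves share a common value. *)

theory Defs
  imports "HOL-Complex_Analysis.Complex_Analysis"
begin

unbundle no fps_syntax

section \<open>The matrix model of hyperbolic 3-space\<close>

type_synonym cmat2 = "complex^2^2"

definition conj_transpose :: "cmat2 \<Rightarrow> cmat2" where
  "conj_transpose A = (\<chi> i j. cnj (A $ j $ i))"

definition SL2C :: "cmat2 set" where
  "SL2C = {g. det g = 1}"

definition H3 :: "cmat2 set" where
  "H3 = {g ** conj_transpose g | g. g \<in> SL2C}"

text \<open>
  On Hermitian matrices, \<open>X \<mapsto> - det X\<close> is a real quadratic form of signature (3,1), and \<open>H3\<close> is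
  the sheet \<open>det X = 1\<close>, \<open>X > 0\<close> of its unit hyperboloid. The metric of constant curvature \<open>-1\<close>
  is the restriction of this form to the tangent spaces, where it is positive definite.
\<close>

definition hyp_norm :: "cmat2 \<Rightarrow> real" where
  "hyp_norm v = sqrt (- Re (det v))"


section \<open>Closed Sobolev curves\<close>

definition L2_loc :: "(real \<Rightarrow> 'a::euclidean_space) \<Rightarrow> bool" where
  "L2_loc f \<longleftrightarrow> f \<in> borel_measurable lebesgue \<and>
     (\<forall>a b. (\<lambda>t. (norm (f t))\<^sup>2) absolutely_integrable_on {a..b})"

text \<open>
  \<open>f\<close> is locally absolutely continuous with almost everywhere derivative (equivalently, weak
  derivative) \<open>g\<close>.
\<close>

definition has_ac_derivative ::
    "(real \<Rightarrow> 'a::euclidean_space) \<Rightarrow> (real \<Rightarrow> 'a) \<Rightarrow> bool" where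
  "has_ac_derivative f g \<longleftrightarrow>
     (\<forall>a b. a \<le> b \<longrightarrow> g absolutely_integrable_on {a..b} \<and> (g has_integral (f b - f a)) {a..b})"

abbreviation velocity :: "(real \<Rightarrow> cmat2) \<Rightarrow> real \<Rightarrow> cmat2" where
  "velocity \<gamma> \<equiv> (\<lambda>t. vector_derivative \<gamma> (at t))"

definition W22_loc :: "(real \<Rightarrow> cmat2) \<Rightarrow> bool" where
  "W22_loc \<gamma> \<longleftrightarrow> (\<forall>t. \<gamma> differentiable (at t)) \<and>
     (\<exists>g. L2_loc g \<and> has_ac_derivative (velocity \<gamma>) g)"

text \<open>
  The choice of representative below only matters on a null set, hence not in \<open>W22_dist\<close>.
\<close>

definition second_derivative :: "(real \<Rightarrow> cmat2) \<Rightarrow> real \<Rightarrow> cmat2" where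
  "second_derivative \<gamma> = (SOME g. L2_loc g \<and> has_ac_derivative (velocity \<gamma>) g)"

definition W22_dist :: "real \<Rightarrow> (real \<Rightarrow> cmat2) \<Rightarrow> (real \<Rightarrow> cmat2) \<Rightarrow> real" where
  "W22_dist T \<gamma> \<eta> = sqrt (integral {0..T} (\<lambda>t. (norm (\<gamma> t - \<eta> t))\<^sup>2
      + (norm (velocity \<gamma> t - velocity \<eta> t))\<^sup>2
      + (norm (second_derivative \<gamma> t - second_derivative \<eta> t))\<^sup>2))"

definition closed_curves :: "real \<Rightarrow> (real \<Rightarrow> cmat2) set" where
  "closed_curves T = {\<gamma>. W22_loc \<gamma> \<and> range \<gamma> \<subseteq> H3 \<and>
     (\<forall>t. hyp_norm (velocity \<gamma> t) = 1) \<and> (\<forall>t. \<gamma> (t + T) = \<gamma> t)}"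


section \<open>Extended frames\<close>

definition eps :: cmat2 where
  "eps = vector [vector [\<i>, 0], vector [0, - \<i>]]"

definition eps_plus :: cmat2 where
  "eps_plus = vector [vector [0, 1], vector [0, 0]]"

definition eps_minus :: cmat2 where
  "eps_minus = vector [vector [0, 0], vector [-1, 0]]"

text \<open>The product with \<open>mat c\<close> is multiplication by the complex scalar \<open>c\<close>.\<close>

definition alpha :: "(real \<Rightarrow> complex) \<Rightarrow> complex \<Rightarrow> real \<Rightarrow> cmat2" where
  "alpha q z t = mat (1/2) ** (mat z ** eps + mat (q t) ** eps_plus + mat (cnj (q t)) ** eps_minus)"

text \<open>
  As \<open>q\<close> is only in \<open>L\<^sup>2\<close>, the equation \<open>F' = F \<alpha>\<close> is meant in the sense of Caratheodory; for
  such \<open>q\<close> the solution exists on all of \<open>\<real>\<close> and is unique.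
\<close>

definition extended_frame :: "(real \<Rightarrow> complex) \<Rightarrow> real \<Rightarrow> complex \<Rightarrow> cmat2" where
  "extended_frame q t z =
     (THE F. F 0 = mat 1 \<and> has_ac_derivative F (\<lambda>s. F s ** alpha q z s)) t"


section \<open>Complex curvature and total torsion\<close>

definition complex_curvature :: "(real \<Rightarrow> cmat2) \<Rightarrow> (real \<Rightarrow> complex) \<Rightarrow> bool" where
  "complex_curvature \<gamma> q \<longleftrightarrow> L2_loc q \<and>
     (\<exists>A\<in>SL2C. \<forall>t. A ** \<gamma> t ** conj_transpose A =
        extended_frame q t \<i> ** matrix_inv (extended_frame q t (- \<i>)))"

text \<open>An identity between elements of \<open>L\<^sup>2_loc\<close>, hence required almost everywhere.\<close>

definition quasi_periodic :: "real \<Rightarrow> real \<Rightarrow> (real \<Rightarrow> complex) \<Rightarrow> bool" where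
  "quasi_periodic T \<theta> q \<longleftrightarrow> (AE t in lebesgue. q (t + T) = cis (\<theta> * T) * q t)"

text \<open>
  \<open>\<gamma>\<close> is regular enough to have curvature and torsion functions, namely \<open>\<kappa>\<close> and \<open>\<tau>\<close>.
\<close>

definition curvature_torsion :: "(real \<Rightarrow> cmat2) \<Rightarrow> (real \<Rightarrow> real) \<Rightarrow> (real \<Rightarrow> real) \<Rightarrow> bool" where
  "curvature_torsion \<gamma> \<kappa> \<tau> \<longleftrightarrow>
     (\<forall>t. \<kappa> t > 0) \<and> (\<forall>t. \<kappa> differentiable (at t)) \<and> continuous_on UNIV \<tau> \<and>
     complex_curvature \<gamma> (\<lambda>t. complex_of_real (\<kappa> t) * cis (LBINT s=0..t. \<tau> s))"

text \<open>
  Quasi-periodicity of the complex curvature determines \<open>\<theta>\<close> only modulo \<open>2 * pi / T\<close>. The second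
  condition singles out the average torsion as the value of \<open>\<theta>\<close> whenever \<open>\<gamma>\<close> has a torsion
  function; otherwise \<open>\<theta>\<close> remains a number modulo \<open>2 * pi / T\<close>. Hence \<open>average_torsion\<close> and
  \<open>total_torsion\<close> are relations.
\<close>

definition average_torsion :: "real \<Rightarrow> (real \<Rightarrow> cmat2) \<Rightarrow> real \<Rightarrow> bool" where
  "average_torsion T \<gamma> \<theta> \<longleftrightarrow>
     (\<exists>q. complex_curvature \<gamma> q \<and> quasi_periodic T \<theta> q) \<and>
     (\<forall>\<kappa> \<tau>. curvature_torsion \<gamma> \<kappa> \<tau> \<longrightarrow> \<theta> = (LBINT s=0..T. \<tau> s) / T)"

definition total_torsion :: "real \<Rightarrow> (real \<Rightarrow> cmat2) \<Rightarrow> real \<Rightarrow> bool" where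
  "total_torsion T \<gamma> \<Theta> \<longleftrightarrow> (\<exists>\<theta>. average_torsion T \<gamma> \<theta> \<and> \<Theta> = \<theta> * T)"

definition periodic_potential :: "real \<Rightarrow> (real \<Rightarrow> cmat2) \<Rightarrow> (real \<Rightarrow> complex) \<Rightarrow> bool" where
  "periodic_potential T \<gamma> p \<longleftrightarrow>
     (\<exists>q \<theta>. complex_curvature \<gamma> q \<and> quasi_periodic T \<theta> q \<and> average_torsion T \<gamma> \<theta> \<and>
            p = (\<lambda>t. cis (- \<theta> * t) * q t))"


section \<open>Finite gap curves\<close>

definition monodromy :: "real \<Rightarrow> (real \<Rightarrow> complex) \<Rightarrow> complex \<Rightarrow> cmat2" where
  "monodromy T q z = extended_frame q T z"

definition Delta :: "real \<Rightarrow> (real \<Rightarrow> complex) \<Rightarrow> complex \<Rightarrow> complex" where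
  "Delta T q z = trace (monodromy T q z)"

definition N_mat :: "real \<Rightarrow> (real \<Rightarrow> complex) \<Rightarrow> complex \<Rightarrow> cmat2" where
  "N_mat T q z = monodromy T q z - mat (Delta T q z / 2)"

text \<open>
  Vanishing order of a matrix of entire functions, not all zero: the minimum over the entries,
  where \<open>zorder\<close> is meaningless on entries that vanish identically (these have order infinity).
\<close>

definition mat_zorder :: "(complex \<Rightarrow> cmat2) \<Rightarrow> complex \<Rightarrow> int" where
  "mat_zorder G z =
     Min {zorder (\<lambda>\<mu>. G \<mu> $ i $ j) z | i j. \<exists>\<mu>. G \<mu> $ i $ j \<noteq> 0}"

text \<open>The summands are nonnegative integers, so summability says that their sum is finite.\<close>

definition finite_gap :: "real \<Rightarrow> (real \<Rightarrow> complex) \<Rightarrow> bool" where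
  "finite_gap T q \<longleftrightarrow>
     (\<lambda>z. real_of_int (zorder (\<lambda>\<mu>. (Delta T q \<mu>)\<^sup>2 - 4) z - 2 * mat_zorder (N_mat T q) z))
       summable_on UNIV"

definition finite_gap_curves :: "real \<Rightarrow> (real \<Rightarrow> cmat2) set" where
  "finite_gap_curves T =
     {\<gamma> \<in> closed_curves T. \<exists>p. periodic_potential T \<gamma> p \<and> finite_gap T p}"

end

theory Submission
 imports Defs "HOL-Library.Real_Mod"
begin

text \<open>
 A curve with periodic potential \<open>p\<close> is closed iff the monodromy of \<open>p\<close> at \<open>\<i> + \<theta>\<close> is \<open>1\<close> or \<open>-1\<close>, and
 \<open>p\<close> is of finite gap as soon as there is a double point (a parameter where the monodromy is \<open>1\<close> or
 \<open>-1\<close>) near \<open>2 \<pi> k / T\<close> for all but finitely many integers \<open>k\<close>. In Fourier space the condition that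
 all these double points exist is a fixed point equation, which determines the high modes of \<open>p\<close> by
 contraction while the low ones remain free. Unless \<open>p\<close> is a single exponential, when all double
 points are explicit, the derivative of the monodromy is onto, so that Brouwer's theorem adjusts six
 real parameters among the low modes to restore the closing condition.

 If \<open>\<gamma>\<close> has a torsion function, its potential is continuous and is approximated uniformly; the phases
 then stay close and the total torsion cannot jump by a multiple of \<open>2 \<pi>\<close>. Otherwise \<open>\<theta>\<close> is free
 modulo \<open>2 \<pi> / T\<close>, and it is chosen to fit the approximating curve; a change of \<open>\<theta>\<close> by \<open>2 \<pi> m / T\<close>
 merely permutes the double points.
\<close>

text \<open>The closing condition sits at a spectral point with imaginary part 1. There the
  monodromy ranges over SL(2,C), whose six real dimensions are the six parameters; at real points it
  would be unitary. Keeping a double point costs one complex equation for each high index k, and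
  this equation is solvable for the coefficient of index -k; this is why the high modes can be
  slaved to the low ones. The dependence of the slaved modes is only shown to be Lipschitz, hence
  Brouwer's theorem and not an implicit function theorem. It suffices because the slaved tail, the
  trigonometric approximation error and the Taylor remainder of the monodromy are all of second
  order in the radius of the parameter ball. Coefficients are kept of order |n|^-3, so that the
  potentials are continuously differentiable, as the asymptotics of the monodromy require. At a
  surviving double point the discriminant has a double and \<open>N_mat\<close> a simple zero, so
  the summand is 2 - 2 * 1 = 0. Since \<open>\<theta>\<close> is kept while the potential changes,
  the total torsion is preserved modulo 2 pi from the outset.\<close>

no_notation fps_nth (infixl \<open>$\<close> 75)

abbreviation frame :: "(real \<Rightarrow> complex) \<Rightarrow> real \<Rightarrow> complex \<Rightarrow> cmat2" where
 "frame \<equiv> extended_frame"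

section \<open>Locally integrable functions and their absolutely continuous primitives\<close>

definition loc_int :: "(real \<Rightarrow> 'a::euclidean_space) \<Rightarrow> bool" where
 "loc_int g \<longleftrightarrow> (\<forall>a b. g absolutely_integrable_on {a..b})"

lemma loc_int_abs: "loc_int g \<Longrightarrow> g absolutely_integrable_on {a..b}"
 by (simp add: loc_int_def)

lemma loc_int_integrable: "loc_int g \<Longrightarrow> g integrable_on {a..b}"
 using loc_int_abs absolutely_integrable_on_def by blast

lemma loc_int_norm_integrable: "loc_int g \<Longrightarrow> (\<lambda>t. norm (g t)) integrable_on {a..b}"
 using loc_int_abs absolutely_integrable_on_def by blast

lemma loc_int_norm: "loc_int g \<Longrightarrow> loc_int (\<lambda>t. norm (g t))"
 unfolding loc_int_def using absolutely_integrable_norm by (auto simp: o_def)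

lemma loc_int_const [simp]: "loc_int (\<lambda>t. c)"
 unfolding loc_int_def by auto

lemma loc_int_add: "loc_int f \<Longrightarrow> loc_int g \<Longrightarrow> loc_int (\<lambda>t. f t + g t)"
 unfolding loc_int_def by auto

lemma loc_int_diff: "loc_int f \<Longrightarrow> loc_int g \<Longrightarrow> loc_int (\<lambda>t. f t - g t)"
 unfolding loc_int_def by auto

lemma loc_int_linear: "bounded_linear h \<Longrightarrow> loc_int f \<Longrightarrow> loc_int (\<lambda>t. h (f t))"
 unfolding loc_int_def using absolutely_integrable_linear by (fastforce simp: o_def)

lemma loc_int_cmult: "loc_int h \<Longrightarrow> loc_int (\<lambda>t. (c::real) * h t)"
 by (rule loc_int_linear[OF bounded_linear_mult_right])

lemma loc_int_bilinear:
 fixes bp :: "'a::euclidean_space \<Rightarrow> 'b::euclidean_space \<Rightarrow> 'c::euclidean_space"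
 assumes "bounded_bilinear bp" "continuous_on UNIV f" "loc_int g"
 shows "loc_int (\<lambda>t. bp (f t) (g t))"
 unfolding loc_int_def
proof (intro allI)
 fix a b :: real
 have bl: "bilinear bp"
  using assms(1) by (simp add: bilinear_conv_bounded_bilinear)
 have c: "continuous_on {a..b} f"
  using assms(2) continuous_on_subset by blast
 show "(\<lambda>t. bp (f t) (g t)) absolutely_integrable_on {a..b}"
 proof (rule absolutely_integrable_bounded_measurable_product[OF bl])
  show "f \<in> borel_measurable (lebesgue_on {a..b})"
   by (rule continuous_imp_measurable_on_sets_lebesgue[OF c]) simp
  show "bounded (f ` {a..b})"
   by (intro compact_imp_bounded compact_continuous_image c compact_Icc)
  show "g absolutely_integrable_on {a..b}" by (rule loc_int_abs[OF assms(3)])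
 qed simp
qed

lemma loc_int_bilinear_right:
 fixes bp :: "'a::euclidean_space \<Rightarrow> 'b::euclidean_space \<Rightarrow> 'c::euclidean_space"
 assumes "bounded_bilinear bp" "continuous_on UNIV f" "loc_int g"
 shows "loc_int (\<lambda>t. bp (g t) (f t))"
 using loc_int_bilinear[OF bounded_bilinear.flip[OF assms(1)] assms(2,3)] .

lemma loc_int_continuous: "continuous_on UNIV f \<Longrightarrow> loc_int f"
 unfolding loc_int_def
 by (metis absolutely_integrable_continuous_real continuous_on_subset subset_UNIV)

lemma L2_loc_imp_loc_int:
 assumes "L2_loc f" shows "loc_int f"
 unfolding loc_int_def
proof (intro allI)
 fix a b :: real
 have m: "f \<in> borel_measurable (lebesgue_on {a..b})"
  using assms unfolding L2_loc_def by (simp add: measurable_restrict_space1)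
 have i: "(\<lambda>t. 1 + (norm (f t))\<^sup>2) integrable_on {a..b}"
  using assms unfolding L2_loc_def
  by (intro integrable_add) (auto simp: absolutely_integrable_on_def)
 have "norm (f x) \<le> 1 + (norm (f x))\<^sup>2" for x
  using sum_squares_bound[of 1 "norm (f x)"] zero_le_power2[of "norm (f x)"] norm_ge_zero[of "f x"]
  unfolding one_power2 by linarith
 then show "f absolutely_integrable_on {a..b}"
  by (intro measurable_bounded_by_integrable_imp_absolutely_integrable[OF m _ i]) auto
qed

lemma has_ac_loc_int: "has_ac_derivative f g \<Longrightarrow> loc_int g"
 unfolding has_ac_derivative_def loc_int_def
proof (intro allI)
 fix a b :: real
 assume "\<forall>a b. a \<le> b \<longrightarrow> g absolutely_integrable_on {a..b} \<and> (g has_integral f b - f a) {a..b}"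
 then show "g absolutely_integrable_on {a..b}"
  by (cases "a \<le> b") (auto simp: set_integrable_def)
qed

lemma has_ac_integral: "has_ac_derivative f g \<Longrightarrow> a \<le> b \<Longrightarrow> integral {a..b} g = f b - f a"
 unfolding has_ac_derivative_def by auto

lemma has_acI:
 assumes "loc_int g" "\<And>a b. a \<le> b \<Longrightarrow> integral {a..b} g = f b - f a"
 shows "has_ac_derivative f g"
 unfolding has_ac_derivative_def
 using assms by (metis has_integral_integral loc_int_abs loc_int_integrable)

lemma has_ac_continuous:
 assumes "has_ac_derivative f g" shows "continuous_on UNIV f"
proof -
 have "continuous_on {-n<..<n} f" for n :: real
 proof (cases "n > 0")
  case True
  have "continuous_on {-n..n} (\<lambda>x. integral {-n..x} g)"
   by (intro indefinite_integral_continuous_1 loc_int_integrable has_ac_loc_int[OF assms])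
  then have "continuous_on {-n..n} (\<lambda>x. integral {-n..x} g + f (-n))"
   by (intro continuous_intros)
  then have "continuous_on {-n..n} f"
   by (rule continuous_on_eq) (simp add: has_ac_integral[OF assms])
  then show ?thesis by (rule continuous_on_subset) auto
 qed auto
 then have "continuous_on (\<Union>n::real. {-n<..<n}) f"
  by (intro continuous_on_open_UN) auto
 moreover have "(\<Union>n::real. {-n<..<n}) = UNIV"
 proof (intro set_eqI iffI UN_I UNIV_I)
  show "x \<in> {- (\<bar>x\<bar> + 1)<..<\<bar>x\<bar> + 1}" for x :: real by auto
 qed
 ultimately show ?thesis by simp
qed

lemma has_ac_norm_bound:
 assumes "has_ac_derivative f g" "a \<le> b"
 shows "norm (f b - f a) \<le> integral {a..b} (\<lambda>t. norm (g t))"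
 using has_ac_integral[OF assms]
 by (metis absolutely_integrable_on_def has_ac_loc_int[OF assms(1)] loc_int_abs
   integral_norm_bound_integral order_refl)

lemma has_ac_const: "has_ac_derivative (\<lambda>t. c) (\<lambda>t. 0)"
 by (intro has_acI) auto

lemma has_ac_zero_imp_const:
 assumes "has_ac_derivative f (\<lambda>t. 0)" shows "f s = f t"
 using has_ac_integral[OF assms, of s t] has_ac_integral[OF assms, of t s] by (cases "s \<le> t") auto

lemma has_ac_linear:
 assumes "bounded_linear h" "has_ac_derivative f g"
 shows "has_ac_derivative (\<lambda>t. h (f t)) (\<lambda>t. h (g t))"
proof (intro has_acI)
 show "loc_int (\<lambda>t. h (g t))" using loc_int_linear assms has_ac_loc_int by blast
 show "integral {a..b} (\<lambda>t. h (g t)) = h (f b) - h (f a)" if "a \<le> b" for a b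
  using integral_linear[OF loc_int_integrable[OF has_ac_loc_int[OF assms(2)]] assms(1), of a b]
   has_ac_integral[OF assms(2) that]
  by (simp add: o_def linear_diff[OF bounded_linear.linear[OF assms(1)]])
qed

lemma has_ac_add:
 assumes "has_ac_derivative f f'" "has_ac_derivative g g'"
 shows "has_ac_derivative (\<lambda>t. f t + g t) (\<lambda>t. f' t + g' t)"
proof (intro has_acI loc_int_add)
 show "integral {a..b} (\<lambda>t. f' t + g' t) = f b + g b - (f a + g a)" if "a \<le> b" for a b
  by (subst Henstock_Kurzweil_Integration.integral_add)
   (use assms that in \<open>auto intro!: loc_int_integrable has_ac_loc_int simp: has_ac_integral\<close>)
qed (use assms has_ac_loc_int in blast)+

lemma has_ac_minus: "has_ac_derivative f f' \<Longrightarrow> has_ac_derivative (\<lambda>t. - f t) (\<lambda>t. - f' t)"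
 by (rule has_ac_linear[OF bounded_linear_minus[OF bounded_linear_ident]])

lemma has_ac_diff:
 assumes "has_ac_derivative f f'" "has_ac_derivative g g'"
 shows "has_ac_derivative (\<lambda>t. f t - g t) (\<lambda>t. f' t - g' t)"
 using has_ac_add[OF assms(1) has_ac_minus[OF assms(2)]] by simp

lemma loc_int_cong_AE:
 assumes "loc_int g" "negligible N" "\<And>t. t \<notin> N \<Longrightarrow> g t = g' t"
 shows "loc_int g'"
 unfolding loc_int_def
proof (intro allI)
 fix a b :: real
 show "g' absolutely_integrable_on {a..b}"
  by (rule absolutely_integrable_spike[OF loc_int_abs[OF assms(1)] assms(2)]) (simp add: assms(3))
qed

lemma has_ac_cong_negl:
 assumes "has_ac_derivative f g" "negligible N" "\<And>t. t \<notin> N \<Longrightarrow> g t = g' t"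
 shows "has_ac_derivative f g'"
proof (intro has_acI)
 show "loc_int g'" using loc_int_cong_AE[OF has_ac_loc_int[OF assms(1)] assms(2,3)] .
 show "integral {a..b} g' = f b - f a" if "a \<le> b" for a b
  using has_ac_integral[OF assms(1) that] integral_spike[OF assms(2), of "{a..b}" g' g] assms(3)
  by auto
qed

lemma AE_imp_negligible:
 fixes P :: "real \<Rightarrow> bool"
 assumes "AE t in lebesgue. P t"
 obtains N where "negligible N" "\<And>t. t \<notin> N \<Longrightarrow> P t"
proof -
 obtain N where "{t \<in> space lebesgue. \<not> P t} \<subseteq> N" "N \<in> null_sets lebesgue"
  using assms unfolding eventually_ae_filter by blast
 then show thesis using that[of N] by (auto simp: negligible_iff_null_sets)
qed

lemma negligible_imp_AE:
 fixes P :: "real \<Rightarrow> bool"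
 assumes "negligible N" "\<And>t. t \<notin> N \<Longrightarrow> P t"
 shows "AE t in lebesgue. P t"
 by (rule AE_I'[of N]) (use assms in \<open>auto simp: negligible_iff_null_sets\<close>)

lemma has_ac_cong_AE:
 assumes "has_ac_derivative f g" "AE t in lebesgue. g t = g' t"
 shows "has_ac_derivative f g'"
proof -
 obtain N where "negligible N" "\<And>t. t \<notin> N \<Longrightarrow> g t = g' t"
  using AE_imp_negligible[OF assms(2)] by blast
 then show ?thesis by (rule has_ac_cong_negl[OF assms(1)])
qed

lemma has_integral_shift:
 fixes h :: "real \<Rightarrow> 'a::euclidean_space"
 assumes "(h has_integral x) {a + c..b + c}"
 shows "((\<lambda>t. h (t + c)) has_integral x) {a..b}"
 using has_integral_affinity'[of h x "a + c" "b + c" 1 c] assms by (simp add: cbox_interval)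

lemma loc_int_shift:
 assumes "loc_int g" shows "loc_int (\<lambda>t. g (t + c))"
 unfolding loc_int_def absolutely_integrable_on_def
proof (intro allI conjI)
 fix a b :: real
 show "(\<lambda>t. g (t + c)) integrable_on {a..b}"
  by (rule has_integral_integrable[OF has_integral_shift[OF integrable_integral[OF loc_int_integrable[OF assms]]]])
 show "(\<lambda>t. norm (g (t + c))) integrable_on {a..b}"
  by (rule has_integral_integrable[OF has_integral_shift[OF integrable_integral[OF loc_int_norm_integrable[OF assms]]]])
qed

lemma has_ac_shift:
 assumes "has_ac_derivative f g"
 shows "has_ac_derivative (\<lambda>t. f (t + c)) (\<lambda>t. g (t + c))"
proof (rule has_acI[OF loc_int_shift[OF has_ac_loc_int[OF assms]]])
 fix a b :: real assume "a \<le> b"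
 then show "integral {a..b} (\<lambda>t. g (t + c)) = f (b + c) - f (a + c)"
  using assms unfolding has_ac_derivative_def by (intro integral_unique has_integral_shift) auto
qed

definition prim :: "(real \<Rightarrow> 'a::euclidean_space) \<Rightarrow> real \<Rightarrow> 'a" where
 "prim g t = (if 0 \<le> t then integral {0..t} g else - integral {t..0} g)"

lemma prim_0 [simp]: "prim g 0 = 0"
 by (simp add: prim_def)

lemma prim_diff:
 assumes "loc_int g" "a \<le> b" shows "prim g b - prim g a = integral {a..b} g"
proof -
 have c: "integral {x..y} g + integral {y..z} g = integral {x..z} g" if "x \<le> y" "y \<le> z" for x y z
  by (intro Henstock_Kurzweil_Integration.integral_combine that loc_int_integrable assms)
 show ?thesis
  using assms(2) c[of 0 a b] c[of a 0 b] c[of a b 0] by (auto simp: prim_def algebra_simps)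
qed

lemma has_ac_prim: "loc_int g \<Longrightarrow> has_ac_derivative (prim g) g"
 by (intro has_acI) (auto simp: prim_diff)

text \<open>Stands in for the Lebesgue differentiation theorem.\<close>

lemma small_oscillation_imp_eq:
 fixes H :: "real \<Rightarrow> 'a::real_normed_vector" and m :: "real \<Rightarrow> real"
 assumes "a \<le> b"
  and "\<And>e. e > 0 \<Longrightarrow> \<exists>d>0. \<forall>s t. a \<le> s \<and> s \<le> t \<and> t \<le> b \<and> t - s < d \<longrightarrow> norm (H t - H s) \<le> e * (m t - m s)"
 shows "H b = H a"
proof -
 have key: "norm (H b - H a) \<le> e * (m b - m a)" if "e > 0" for e
 proof -
  note \<open>e > 0\<close>
  obtain d where d: "d > 0" "\<And>s t. a \<le> s \<Longrightarrow> s \<le> t \<Longrightarrow> t \<le> b \<Longrightarrow> t - s < d \<Longrightarrow> norm (H t - H s) \<le> e * (m t - m s)"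
   using assms(2) \<open>e > 0\<close> by meson
  obtain n :: nat where n: "n > 0" "(b - a) / real n < d"
  proof -
   obtain n0 :: nat where "(b - a) / d < real n0" using reals_Archimedean2 by blast
   then have "(b - a) / real (Suc n0) < d"
    using d(1) by (simp add: field_simps)
   then show ?thesis using that[of "Suc n0"] by simp
  qed
  \<comment> \<open>Telescoping over n equal steps shorter than d bounds the total increment by e *
    (m b - m a), and e is arbitrary.\<close>
  define t where "t i = a + real i * ((b - a) / real n)" for i
  have t0: "t 0 = a" "t n = b" using n(1) by (auto simp: t_def)
  have h0: "(b - a) / real n \<ge> 0" using assms(1) by simp
  have tS: "t (Suc i) = t i + (b - a) / real n" for i by (simp add: t_def distrib_right del: times_divide_eq_right)
  have step: "norm (H (t (Suc i)) - H (t i)) \<le> e * (m (t (Suc i)) - m (t i))" if "i < n" for i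
  proof (rule d(2))
   show "a \<le> t i" using mult_nonneg_nonneg[OF of_nat_0_le_iff h0] unfolding t_def by (simp del: times_divide_eq_right)
   show "t i \<le> t (Suc i)" using h0 unfolding tS by linarith
   have "real (Suc i) * ((b - a) / real n) \<le> real n * ((b - a) / real n)"
    using that h0 by (intro mult_right_mono) auto
   then show "t (Suc i) \<le> b" using n(1) by (simp add: t_def)
   show "t (Suc i) - t i < d" using n(2) unfolding tS by linarith
  qed
  have "norm (H (t j) - H (t 0)) \<le> e * (m (t j) - m (t 0))" if "j \<le> n" for j
   using that
  proof (induction j)
   case (Suc j)
   have "norm (H (t (Suc j)) - H (t 0)) \<le> norm (H (t (Suc j)) - H (t j)) + norm (H (t j) - H (t 0))"
    using norm_triangle_ineq[of "H (t (Suc j)) - H (t j)" "H (t j) - H (t 0)"] by simp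
   then show ?case using Suc step[of j] by (simp add: algebra_simps)
  qed simp
  from this[of n] show ?thesis by (simp add: t0)
 qed
 have "norm (H b - H a) \<le> 0"
 proof (rule field_le_epsilon)
  fix e :: real assume "e > 0"
  define M where "M = \<bar>m b - m a\<bar> + 1"
  have "M > 0" by (simp add: M_def)
  have "norm (H b - H a) \<le> e / M * (m b - m a)" using key[of "e / M"] \<open>e > 0\<close> \<open>M > 0\<close> by simp
  also have "\<dots> \<le> e / M * M" using \<open>e > 0\<close> \<open>M > 0\<close> by (intro mult_left_mono) (auto simp: M_def)
  finally show "norm (H b - H a) \<le> 0 + e" using \<open>M > 0\<close> by simp
 qed
 then show ?thesis by simp
qed

lemma uniform_osc:
 fixes f :: "real \<Rightarrow> 'a::euclidean_space"
 assumes "continuous_on UNIV f" "e > 0"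
 obtains d where "d > 0" "\<And>s t. a \<le> s \<Longrightarrow> s \<le> b \<Longrightarrow> a \<le> t \<Longrightarrow> t \<le> b \<Longrightarrow> \<bar>t - s\<bar> < d \<Longrightarrow> norm (f t - f s) \<le> e"
proof -
 have "uniformly_continuous_on {a..b} f"
  by (intro compact_uniformly_continuous continuous_on_subset[OF assms(1)]) auto
 then obtain d where "d > 0" "\<forall>x\<in>{a..b}. \<forall>x'\<in>{a..b}. dist x' x < d \<longrightarrow> dist (f x') (f x) < e"
  unfolding uniformly_continuous_on_def using assms(2) by metis
 then show ?thesis using that[of d] by (force simp: dist_norm)
qed

lemma diff_eq_transfer:
 fixes x :: "'a::ab_group_add"
 assumes "x - p = y - q" "p - q = i" shows "x - y = i"
proof -
 have "x = y - q + p" using assms(1) diff_add_cancel[of x p] by simp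
 then show ?thesis using assms(2) by (simp add: algebra_simps)
qed

text \<open>The product rule, obtained without differentiating almost everywhere: on a short
  interval the increment of the product is the integral of the proposed derivative with one factor
  frozen at an endpoint, and the error is the oscillation of a continuous factor times the L1 mass
  of the derivatives. \<open>small_oscillation_imp_eq\<close> makes these errors disappear.\<close>

lemma has_ac_bilinear:
 fixes bp :: "'a::euclidean_space \<Rightarrow> 'b::euclidean_space \<Rightarrow> 'c::euclidean_space"
 assumes "bounded_bilinear bp" "has_ac_derivative f f'" "has_ac_derivative g g'"
 shows "has_ac_derivative (\<lambda>t. bp (f t) (g t)) (\<lambda>t. bp (f' t) (g t) + bp (f t) (g' t))"
proof -
 interpret bounded_bilinear bp by fact
 obtain C where C: "C > 0" "\<And>x y. norm (bp x y) \<le> norm x * norm y * C" using pos_bounded by metis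
 define D where "D = (\<lambda>t. bp (f' t) (g t) + bp (f t) (g' t))"
 have li: "loc_int f'" "loc_int g'" using assms has_ac_loc_int by auto
 have ct: "continuous_on UNIV f" "continuous_on UNIV g" using assms has_ac_continuous by auto
 have l1: "loc_int (\<lambda>t. bp (f' t) (g t))" "loc_int (\<lambda>t. bp (f t) (g' t))"
  using loc_int_bilinear[OF assms(1)] loc_int_bilinear_right[OF assms(1)] li ct by auto
 have lD: "loc_int D" unfolding D_def by (intro loc_int_add l1)
 define n where "n = (\<lambda>t. norm (f' t) + norm (g' t))"
 have ln: "loc_int n" unfolding n_def by (intro loc_int_add loc_int_norm li)
 define m where "m = prim n"
 define H where "H = (\<lambda>t. bp (f t) (g t) - prim D t)"
 have Heq: "H b = H a" if "a \<le> b" for a b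
 proof (rule small_oscillation_imp_eq[where m = m, OF that])
  fix e :: real assume e: "e > 0"
  have "e / C > 0" using e C by simp
  obtain d1 where d1: "d1 > 0" "\<And>s t. a \<le> s \<Longrightarrow> s \<le> b \<Longrightarrow> a \<le> t \<Longrightarrow> t \<le> b \<Longrightarrow> \<bar>t - s\<bar> < d1 \<Longrightarrow> norm (f t - f s) \<le> e / C"
   using uniform_osc[OF ct(1) \<open>e / C > 0\<close>] by metis
  obtain d2 where d2: "d2 > 0" "\<And>s t. a \<le> s \<Longrightarrow> s \<le> b \<Longrightarrow> a \<le> t \<Longrightarrow> t \<le> b \<Longrightarrow> \<bar>t - s\<bar> < d2 \<Longrightarrow> norm (g t - g s) \<le> e / C"
   using uniform_osc[OF ct(2) \<open>e / C > 0\<close>] by metis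
  show "\<exists>d>0. \<forall>s t. a \<le> s \<and> s \<le> t \<and> t \<le> b \<and> t - s < d \<longrightarrow> norm (H t - H s) \<le> e * (m t - m s)"
  proof (intro exI[of _ "min d1 d2"] conjI allI impI)
   show "min d1 d2 > 0" using d1 d2 by simp
   fix s t assume st: "a \<le> s \<and> s \<le> t \<and> t \<le> b \<and> t - s < min d1 d2"
   then have st': "s \<le> t" by simp
   \<comment> \<open>Freezing \<open>g\<close> at the right end and \<open>f\<close> at the left end
     makes the two integrals add up exactly to the increment of the product.\<close>
   have i1: "integral {s..t} (\<lambda>u. bp (f' u) (g t)) = bp (f t - f s) (g t)"
    using integral_linear[OF loc_int_integrable[OF li(1)] bounded_linear_left, of s t "g t"]
     has_ac_integral[OF assms(2) st'] by (simp add: o_def)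
   have i2: "integral {s..t} (\<lambda>u. bp (f s) (g' u)) = bp (f s) (g t - g s)"
    using integral_linear[OF loc_int_integrable[OF li(2)] bounded_linear_right, of s t "f s"]
     has_ac_integral[OF assms(3) st'] by (simp add: o_def)
   have l2: "loc_int (\<lambda>u. bp (f' u) (g t))" "loc_int (\<lambda>u. bp (f s) (g' u))"
    using loc_int_linear[OF bounded_linear_left li(1)] loc_int_linear[OF bounded_linear_right li(2)] by auto
   have "H t - H s = (integral {s..t} (\<lambda>u. bp (f' u) (g t)) + integral {s..t} (\<lambda>u. bp (f s) (g' u))) - integral {s..t} D"
    unfolding i1 i2 using prim_diff[OF lD st'] by (simp add: H_def diff_left diff_right algebra_simps)
   also have "\<dots> = integral {s..t} (\<lambda>u. (bp (f' u) (g t) + bp (f s) (g' u)) - D u)"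
    using l2 lD by (simp add: Henstock_Kurzweil_Integration.integral_add Henstock_Kurzweil_Integration.integral_diff loc_int_integrable integrable_add)
   finally have eq: "H t - H s = integral {s..t} (\<lambda>u. (bp (f' u) (g t) + bp (f s) (g' u)) - D u)" .
   have "norm (H t - H s) \<le> integral {s..t} (\<lambda>u. e * n u)"
    unfolding eq
   proof (rule integral_norm_bound_integral)
    show "(\<lambda>u. bp (f' u) (g t) + bp (f s) (g' u) - D u) integrable_on {s..t}"
     by (intro loc_int_integrable loc_int_diff loc_int_add l2 lD)
    show "(\<lambda>u. e * n u) integrable_on {s..t}"
     by (intro loc_int_integrable loc_int_cmult ln)
    fix u assume u: "u \<in> {s..t}"
    have a1: "norm (g t - g u) \<le> e / C" using d2(2)[of u t] u st by auto
    have a2: "norm (f u - f s) \<le> e / C" using d1(2)[of s u] u st by auto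
    have "(bp (f' u) (g t) + bp (f s) (g' u)) - D u = bp (f' u) (g t - g u) - bp (f u - f s) (g' u)"
     by (simp add: D_def diff_left diff_right)
    also have "norm \<dots> \<le> norm (bp (f' u) (g t - g u)) + norm (bp (f u - f s) (g' u))"
     by (rule norm_triangle_ineq4)
    also have "\<dots> \<le> norm (f' u) * norm (g t - g u) * C + norm (f u - f s) * norm (g' u) * C"
     using C(2) add_mono by blast
    also have "\<dots> \<le> norm (f' u) * (e / C) * C + (e / C) * norm (g' u) * C"
     using a1 a2 C(1) by (intro add_mono mult_right_mono mult_left_mono) auto
    also have "\<dots> = e * n u" using C(1) by (simp add: n_def algebra_simps)
    finally show "norm ((bp (f' u) (g t) + bp (f s) (g' u)) - D u) \<le> e * n u" .
   qed
   also have "\<dots> = e * (m t - m s)" by (simp add: m_def prim_diff[OF ln st'])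
   finally show "norm (H t - H s) \<le> e * (m t - m s)" .
  qed
 qed
 have "bp (f b) (g b) - bp (f a) (g a) = integral {a..b} D" if "a \<le> b" for a b
  by (rule diff_eq_transfer[OF Heq[OF that, unfolded H_def] prim_diff[OF lD that]])
 then show ?thesis
  using has_acI[OF lD] unfolding D_def by auto
qed

lemma has_vector_derivative_imp_ac:
 fixes f :: "real \<Rightarrow> 'a::euclidean_space"
 assumes "\<And>t. (f has_vector_derivative g t) (at t)" "continuous_on UNIV g"
 shows "has_ac_derivative f g"
 unfolding has_ac_derivative_def
proof (intro allI impI conjI)
 fix a b :: real assume "a \<le> b"
 show "g absolutely_integrable_on {a..b}" using loc_int_continuous[OF assms(2)] loc_int_abs by blast
 show "(g has_integral f b - f a) {a..b}"
  by (rule fundamental_theorem_of_calculus[OF \<open>a \<le> b\<close>])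
   (use assms(1) has_vector_derivative_at_within in blast)
qed

lemma has_ac_imp_vector_derivative:
 fixes f :: "real \<Rightarrow> 'a::euclidean_space"
 assumes "has_ac_derivative f g" "continuous_on UNIV g"
 shows "(f has_vector_derivative g t) (at t)"
proof -
 have "((\<lambda>u. integral {t-1..u} g) has_vector_derivative g t) (at t within {t-1..t+1})"
  by (rule integral_has_vector_derivative) (use assms(2) continuous_on_subset in auto)
 then have "((\<lambda>u. integral {t-1..u} g) has_vector_derivative g t) (at t)"
  by (simp add: at_within_Icc_at)
 then have "((\<lambda>u. integral {t-1..u} g + f (t - 1)) has_vector_derivative g t) (at t)"
  by (simp add: has_vector_derivative_add_const)
 then show ?thesis
  by (rule has_vector_derivative_transform_within_open[of _ _ _ "{t-1<..}"])
   (auto simp: has_ac_integral[OF assms(1)])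
qed

text \<open>Projecting a continuous approximation onto the closed ball of radius B keeps it
  continuous and leaves the limit \<open>f t\<close>, which lies in the ball, unchanged.\<close>

lemma bounded_continuous_approx:
 fixes f :: "real \<Rightarrow> 'a::euclidean_space"
 assumes "f \<in> borel_measurable lebesgue" "\<And>t. norm (f t) \<le> B"
 obtains g N where "negligible N" "\<And>n. continuous_on UNIV (g n)" "\<And>n t. norm (g n t) \<le> B"
  "\<And>t. t \<notin> N \<Longrightarrow> (\<lambda>n::nat. g n t) \<longlonglongrightarrow> f t"
proof -
 have B: "B \<ge> 0" using assms(2)[of 0] norm_ge_zero order_trans by blast
 have "f measurable_on UNIV" using assms(1) by (simp add: lebesgue_measurable_imp_measurable_on)
 then obtain N g where g: "negligible N" "\<And>n::nat. continuous_on UNIV (g n)" "\<And>x. x \<notin> N \<Longrightarrow> (\<lambda>n. g n x) \<longlonglongrightarrow> f x"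
  unfolding measurable_on_def by auto
 define h where "h n x = closest_point (cball 0 B) (g n x)" for n x
 have cc: "continuous_on UNIV (closest_point (cball (0::'a) B))"
  using B by (intro continuous_on_closest_point) auto
 show ?thesis
 proof (rule that[OF g(1), of h])
  show "continuous_on UNIV (h n)" for n
   unfolding h_def using continuous_on_compose2[OF cc g(2)] by simp
  show "norm (h n t) \<le> B" for n t
   using closest_point_in_set[of "cball (0::'a) B" "g n t"] B by (simp add: h_def)
  show "(\<lambda>n. h n t) \<longlonglongrightarrow> f t" if "t \<notin> N" for t
  proof -
   have "(\<lambda>n. h n t) \<longlonglongrightarrow> closest_point (cball 0 B) (f t)"
    unfolding h_def by (rule continuous_on_tendsto_compose[OF cc g(3)[OF that]]) auto
   then show ?thesis using assms(2) by (simp add: closest_point_self)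
  qed
 qed
qed

text \<open>On a short interval \<phi> may be replaced by its value at the left end, for which the
  integral vanishes by assumption; the error is the oscillation of \<phi> times the integral of the
  norm of \<open>f\<close>.\<close>

lemma integral_mult_continuous_zero:
 fixes f :: "real \<Rightarrow> 'a::euclidean_space"
 assumes "loc_int f" "\<And>a b. a \<le> b \<Longrightarrow> integral {a..b} f = 0" "continuous_on UNIV (\<phi>::real \<Rightarrow> 'a)"
  and "a \<le> b"
 shows "integral {a..b} (\<lambda>t. f t \<bullet> \<phi> t) = 0"
proof -
 have l: "loc_int (\<lambda>t. f t \<bullet> \<phi> t)"
  by (rule loc_int_bilinear_right[OF bounded_bilinear_inner assms(3,1)])
 have ln: "loc_int (\<lambda>t. norm (f t))" by (rule loc_int_norm[OF assms(1)])
 define H where "H = prim (\<lambda>t. f t \<bullet> \<phi> t)"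
 have "H b = H a"
 proof (rule small_oscillation_imp_eq[where m = "prim (\<lambda>t. norm (f t))", OF assms(4)])
  fix e :: real assume "e > 0"
  obtain d where d: "d > 0" "\<And>s t. a \<le> s \<Longrightarrow> s \<le> b \<Longrightarrow> a \<le> t \<Longrightarrow> t \<le> b \<Longrightarrow> \<bar>t - s\<bar> < d \<Longrightarrow> norm (\<phi> t - \<phi> s) \<le> e"
   using uniform_osc[OF assms(3) \<open>e > 0\<close>] by metis
  show "\<exists>d>0. \<forall>s t. a \<le> s \<and> s \<le> t \<and> t \<le> b \<and> t - s < d \<longrightarrow>
    norm (H t - H s) \<le> e * (prim (\<lambda>t. norm (f t)) t - prim (\<lambda>t. norm (f t)) s)"
  proof (intro exI[of _ d] conjI allI impI d(1))
   fix s t assume st: "a \<le> s \<and> s \<le> t \<and> t \<le> b \<and> t - s < d"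
   then have st': "s \<le> t" by simp
   have "integral {s..t} (\<lambda>u. f u \<bullet> \<phi> s) = 0"
    using integral_linear[OF loc_int_integrable[OF assms(1)] bounded_linear_inner_left, of s t "\<phi> s"]
     assms(2)[OF st'] by (simp add: o_def)
   then have "H t - H s = integral {s..t} (\<lambda>u. f u \<bullet> \<phi> u) - integral {s..t} (\<lambda>u. f u \<bullet> \<phi> s)"
    using prim_diff[OF l st'] by (simp add: H_def)
   also have "\<dots> = integral {s..t} (\<lambda>u. f u \<bullet> \<phi> u - f u \<bullet> \<phi> s)"
    by (intro Henstock_Kurzweil_Integration.integral_diff[symmetric] loc_int_integrable l
      loc_int_linear[OF bounded_linear_inner_left] assms(1))
   finally have eq: "H t - H s = integral {s..t} (\<lambda>u. f u \<bullet> \<phi> u - f u \<bullet> \<phi> s)" .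
   have "norm (H t - H s) \<le> integral {s..t} (\<lambda>u. e * norm (f u))"
    unfolding eq
   proof (rule integral_norm_bound_integral)
    show "(\<lambda>u. f u \<bullet> \<phi> u - f u \<bullet> \<phi> s) integrable_on {s..t}"
     by (intro loc_int_integrable loc_int_diff l loc_int_linear[OF bounded_linear_inner_left] assms(1))
    show "(\<lambda>u. e * norm (f u)) integrable_on {s..t}"
     by (intro loc_int_integrable loc_int_cmult ln)
    fix u assume u: "u \<in> {s..t}"
    have "norm (\<phi> u - \<phi> s) \<le> e" using d(2)[of s u] u st by auto
    then have "norm (f u) * norm (\<phi> u - \<phi> s) \<le> norm (f u) * e" by (intro mult_left_mono) auto
    then show "norm (f u \<bullet> \<phi> u - f u \<bullet> \<phi> s) \<le> e * norm (f u)"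
     using Cauchy_Schwarz_ineq2[of "f u" "\<phi> u - \<phi> s"]
     by (simp add: inner_diff_right mult.commute)
   qed
   then show "norm (H t - H s) \<le> e * (prim (\<lambda>t. norm (f t)) t - prim (\<lambda>t. norm (f t)) s)"
    by (simp add: prim_diff[OF ln st'])
  qed
 qed
 then show ?thesis using prim_diff[OF l assms(4)] by (simp add: H_def)
qed

lemma loc_int_measurable:
 fixes f :: "real \<Rightarrow> 'a::euclidean_space"
 assumes "loc_int f" shows "f \<in> borel_measurable lebesgue"
proof -
 have "(\<lambda>t. indicat_real {- real n..real n} t *\<^sub>R f t) \<in> borel_measurable lebesgue" for n
  using loc_int_abs[OF assms, of "- real n" "real n"] unfolding set_integrable_def
  by (rule borel_measurable_integrable)
 then show ?thesis
 proof (rule borel_measurable_LIMSEQ_metric)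
  fix t :: real
  obtain n0 :: nat where n0: "\<bar>t\<bar> < n0" using reals_Archimedean2 by blast
  have "\<forall>\<^sub>F n in sequentially. indicat_real {- real n..real n} t *\<^sub>R f t = f t"
   using eventually_ge_at_top[of n0] by eventually_elim (use n0 in \<open>auto simp: indicator_def\<close>)
  then show "(\<lambda>n. indicat_real {- real n..real n} t *\<^sub>R f t) \<longlonglongrightarrow> f t"
   by (rule tendsto_eventually)
 qed
qed

text \<open>Testing \<open>f\<close> against continuous functions that converge to its unit
  direction \<open>f / norm f\<close> gives, by dominated convergence, that the integral of
  \<open>norm f\<close> vanishes on every interval.\<close>

lemma integral_zero_imp_AE_zero:
 fixes f :: "real \<Rightarrow> 'a::euclidean_space"
 assumes "loc_int f" "\<And>a b. a \<le> b \<Longrightarrow> integral {a..b} f = 0"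
 shows "AE t in lebesgue. f t = 0"
proof -
 have fm: "f \<in> borel_measurable lebesgue" using loc_int_measurable[OF assms(1)] .
 \<comment> \<open>At zeros of \<open>f\<close> the value is 0, because
   \<open>inverse 0 = 0\<close>.\<close>
 define s where "s t = f t /\<^sub>R norm (f t)" for t
 have sm: "s \<in> borel_measurable lebesgue"
  unfolding s_def using fm by measurable
 have sb: "norm (s t) \<le> 1" for t by (cases "f t = 0") (auto simp: s_def intro: left_inverse)
 obtain g N where g: "negligible N" "\<And>n. continuous_on UNIV (g n)" "\<And>n t. norm (g n t) \<le> 1"
  "\<And>t. t \<notin> N \<Longrightarrow> (\<lambda>n::nat. g n t) \<longlonglongrightarrow> s t"
  using bounded_continuous_approx[OF sm sb] by metis
 have fs: "f t \<bullet> s t = norm (f t)" for t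
  by (cases "f t = 0") (auto simp: s_def dot_square_norm power2_eq_square)
 have zero: "integral {a..b} (\<lambda>t. norm (f t)) = 0" if "a \<le> b" for a b
 proof -
  \<comment> \<open>Dominated convergence asks for convergence at every point, so the sequence is
    replaced by its limit on the null set \<open>N\<close>.\<close>
  define h where "h n t = (if t \<in> N then norm (f t) else f t \<bullet> g n t)" for n t
  have l: "loc_int (\<lambda>t. f t \<bullet> g n t)" for n
   by (rule loc_int_bilinear_right[OF bounded_bilinear_inner g(2) assms(1)])
  have hi: "h n integrable_on {a..b}" for n
   by (rule integrable_spike[OF loc_int_integrable[OF l] g(1)]) (simp add: h_def)
  have hz: "integral {a..b} (h n) = 0" for n
   using integral_spike[OF g(1), of "{a..b}" "h n" "\<lambda>t. f t \<bullet> g n t"]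
    integral_mult_continuous_zero[OF assms g(2) that] by (simp add: h_def)
  have "(\<lambda>n. integral {a..b} (h n)) \<longlonglongrightarrow> integral {a..b} (\<lambda>t. norm (f t))"
  proof (rule dominated_convergence(2)[OF hi loc_int_norm_integrable[OF assms(1)]])
   fix n t
   have "\<bar>f t \<bullet> g n t\<bar> \<le> norm (f t) * 1"
    by (rule order_trans[OF Cauchy_Schwarz_ineq2 mult_left_mono[OF g(3)]]) simp
   then show "norm (h n t) \<le> norm (f t)" by (simp add: h_def)
   show "(\<lambda>n. h n t) \<longlonglongrightarrow> norm (f t)"
   proof (cases "t \<in> N")
    case False
    then have "(\<lambda>n. f t \<bullet> g n t) \<longlonglongrightarrow> f t \<bullet> s t" by (intro tendsto_intros g(4))
    then show ?thesis using False by (simp add: h_def fs)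
   qed (simp add: h_def)
  qed
  then show ?thesis using hz by (simp add: LIMSEQ_const_iff)
 qed
 have "AE t in lebesgue. t \<in> {- real n..real n} \<longrightarrow> f t = 0" for n
 proof -
  have i: "set_integrable lebesgue {- real n..real n} (\<lambda>t. norm (f t))"
   using loc_int_abs[OF loc_int_norm[OF assms(1)]] .
  have "integral\<^sup>L lebesgue (\<lambda>t. indicat_real {- real n..real n} t *\<^sub>R norm (f t)) = 0"
   using set_lebesgue_integral_eq_integral(2)[OF i] zero[of "- real n" "real n"]
   by (simp add: set_lebesgue_integral_def)
  then have "AE t in lebesgue. indicat_real {- real n..real n} t *\<^sub>R norm (f t) = 0"
   using integral_nonneg_eq_0_iff_AE[of lebesgue "\<lambda>t. indicat_real {- real n..real n} t *\<^sub>R norm (f t)"] i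
   unfolding set_integrable_def by simp
  then show ?thesis by eventually_elim (auto simp: indicator_def)
 qed
 then have "AE t in lebesgue. \<forall>n::nat. t \<in> {- real n..real n} \<longrightarrow> f t = 0"
  unfolding AE_all_countable by blast
 then show ?thesis
 proof eventually_elim
  case (elim t)
  obtain n0 :: nat where n0: "\<bar>t\<bar> < n0" using reals_Archimedean2 by blast
  then have "t \<in> {- real n0..real n0}" by auto
  with elim show ?case by blast
 qed
qed

section \<open>Algebra and analysis of complex 2 x 2 matrices\<close>

definition mk2 :: "complex \<Rightarrow> complex \<Rightarrow> complex \<Rightarrow> complex \<Rightarrow> cmat2" where
 "mk2 a b c d = vector [vector [a, b], vector [c, d]]"

lemma mk2_nth [simp]:
 "mk2 a b c d $ 1 $ 1 = a" "mk2 a b c d $ 1 $ 2 = b" "mk2 a b c d $ 2 $ 1 = c" "mk2 a b c d $ 2 $ 2 = d"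
 by (simp_all add: mk2_def)

lemma cmat2_eq_iff:
 "(A :: cmat2) = B \<longleftrightarrow> A $ 1 $ 1 = B $ 1 $ 1 \<and> A $ 1 $ 2 = B $ 1 $ 2 \<and> A $ 2 $ 1 = B $ 2 $ 1 \<and> A $ 2 $ 2 = B $ 2 $ 2"
 by (auto simp: vec_eq_iff forall_2)

lemma mm_nth: "((A :: cmat2) ** B) $ i $ j = A $ i $ 1 * B $ 1 $ j + A $ i $ 2 * B $ 2 $ j"
 by (simp add: matrix_matrix_mult_def sum_2)

lemma mat_nth [simp]:
 "(mat c :: cmat2) $ 1 $ 1 = c" "(mat c :: cmat2) $ 1 $ 2 = 0"
 "(mat c :: cmat2) $ 2 $ 1 = 0" "(mat c :: cmat2) $ 2 $ 2 = c"
 by (simp_all add: mat_def)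

text \<open>The adjugate. It is the inverse where the determinant is 1, but it is defined everywhere
  and linear, so it passes through derivatives and integrals.\<close>

definition adj2 :: "cmat2 \<Rightarrow> cmat2" where
 "adj2 A = mk2 (A $ 2 $ 2) (- A $ 1 $ 2) (- A $ 2 $ 1) (A $ 1 $ 1)"

lemma adj2_nth [simp]:
 "adj2 A $ 1 $ 1 = A $ 2 $ 2" "adj2 A $ 1 $ 2 = - A $ 1 $ 2"
 "adj2 A $ 2 $ 1 = - A $ 2 $ 1" "adj2 A $ 2 $ 2 = A $ 1 $ 1"
 by (simp_all add: adj2_def)

lemma ct_nth [simp]: "conj_transpose A $ i $ j = cnj (A $ j $ i)"
 by (simp add: conj_transpose_def)

lemmas m2 = cmat2_eq_iff mm_nth det_2 trace_def sum_2

lemma adj2_mult: "A ** adj2 A = mat (det A)" "adj2 A ** A = mat (det A)"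
 by (simp_all add: m2 algebra_simps)

lemma adj2_mm: "adj2 (A ** B) = adj2 B ** adj2 A"
 by (simp add: m2 algebra_simps)

lemma adj2_trace0: "trace A = 0 \<Longrightarrow> adj2 A = - A"
 by (simp add: m2 algebra_simps eq_neg_iff_add_eq_0)

lemma adj2_adj2 [simp]: "adj2 (adj2 A) = A" by (simp add: m2)

lemma adj2_mat [simp]: "adj2 (mat c) = mat c" by (simp add: m2)

lemma det_adj2 [simp]: "det (adj2 A) = det A" by (simp add: m2)

lemma det_ct [simp]: "det (conj_transpose A) = cnj (det A)" by (simp add: m2 mult.commute)

lemma ct_mm: "conj_transpose (A ** B) = conj_transpose B ** conj_transpose A"
 by (simp add: m2 algebra_simps)

lemma ct_ct [simp]: "conj_transpose (conj_transpose A) = A" by (simp add: m2)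

lemma ct_mat [simp]: "conj_transpose (mat c) = mat (cnj c)" by (simp add: m2)

lemma ct_adj2: "conj_transpose (adj2 A) = adj2 (conj_transpose A)" by (simp add: m2)

lemma det_mm: "det ((A::cmat2) ** B) = det A * det B" by (simp add: m2 algebra_simps)

lemma mat_mm: "(mat c ** A :: cmat2) $ i $ j = c * A $ i $ j"
 using exhaust_2[of i] by (auto simp: mm_nth)

lemma mm_mat: "(A ** mat c :: cmat2) $ i $ j = A $ i $ j * c"
 using exhaust_2[of j] by (auto simp: mm_nth)

lemma mm_assoc: "(A :: cmat2) ** B ** C = A ** (B ** C)"
 by (simp add: matrix_mul_assoc)

lemma adj2_cancel:
 assumes "det A = 1"
 shows "A ** adj2 A = mat 1" "adj2 A ** A = mat 1" "A ** (adj2 A ** B) = B" "adj2 A ** (A ** B) = B"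
 using adj2_mult[of A] assms by (auto simp: matrix_mul_assoc)

lemma matrix_inv_adj2:
 assumes "det A = 1" shows "matrix_inv A = adj2 A"
proof -
 have "A ** matrix_inv A = mat 1 \<and> matrix_inv A ** A = mat 1"
  unfolding matrix_inv_def by (rule someI[of _ "adj2 A"]) (simp add: adj2_mult assms)
 then have "adj2 A ** (A ** matrix_inv A) = adj2 A" by simp
 then show ?thesis unfolding adj2_cancel(4)[OF assms] .
qed

lemma bounded_bilinear_mm: "bounded_bilinear ((**) :: cmat2 \<Rightarrow> cmat2 \<Rightarrow> cmat2)"
proof -
 have "bilinear ((**) :: cmat2 \<Rightarrow> cmat2 \<Rightarrow> cmat2)"
  unfolding bilinear_def
  by (auto intro!: linearI simp: cmat2_eq_iff mm_nth algebra_simps)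
 then show ?thesis by (simp add: bilinear_conv_bounded_bilinear)
qed

lemma bounded_linear_adj2: "bounded_linear adj2"
proof -
 have "linear adj2" by (intro linearI) (auto simp: cmat2_eq_iff)
 then show ?thesis by (simp add: linear_conv_bounded_linear)
qed

lemma bounded_linear_ct: "bounded_linear conj_transpose"
proof -
 have "linear conj_transpose" by (intro linearI) (auto simp: cmat2_eq_iff)
 then show ?thesis by (simp add: linear_conv_bounded_linear)
qed

lemma bounded_linear_entry: "bounded_linear (\<lambda>A :: cmat2. A $ i $ j)"
 by (rule bounded_linear_compose[OF bounded_linear_vec_nth bounded_linear_vec_nth])

lemmas continuous_on_mm = bounded_bilinear.continuous_on[OF bounded_bilinear_mm]
lemmas continuous_on_adj2 = bounded_linear.continuous_on[OF bounded_linear_adj2]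
lemmas continuous_on_ct = bounded_linear.continuous_on[OF bounded_linear_ct]
lemmas continuous_on_entry = bounded_linear.continuous_on[OF bounded_linear_entry]

lemma norm_entry_le: "norm ((A :: cmat2) $ i $ j) \<le> norm A"
 by (rule order_trans[OF Finite_Cartesian_Product.norm_nth_le Finite_Cartesian_Product.norm_nth_le])

lemma norm_le_entries:
 "norm (A :: cmat2) \<le> norm (A $ 1 $ 1) + norm (A $ 1 $ 2) + norm (A $ 2 $ 1) + norm (A $ 2 $ 2)"
proof -
 have "norm A \<le> norm (A $ 1) + norm (A $ 2)"
  unfolding norm_vec_def[of A] using L2_set_le_sum[of "UNIV :: 2 set" "\<lambda>i. norm (A $ i)"] by (simp add: sum_2)
 moreover have "norm (A $ i) \<le> norm (A $ i $ 1) + norm (A $ i $ 2)" for i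
  unfolding norm_vec_def[of "A $ i"] using L2_set_le_sum[of "UNIV :: 2 set" "\<lambda>j. norm (A $ i $ j)"] by (simp add: sum_2)
 ultimately show ?thesis by (smt (verit))
qed

section \<open>Linear differential equations with locally integrable coefficients\<close>

text \<open>Picard iteration in Caratheodory's setting. The n-th term \<open>V n\<close> is bounded
  by |m|^n / n!, where \<open>m\<close> is the primitive of the norm of the coefficient, so the
  series converges like the exponential series although the coefficient is only integrable.\<close>

lemma linear_ode_exists:
 fixes bp :: "'a::euclidean_space \<Rightarrow> 'b::euclidean_space \<Rightarrow> 'a"
 assumes bb: "bounded_bilinear bp" and a: "loc_int a"
 obtains F where "F 0 = c" "has_ac_derivative F (\<lambda>t. bp (F t) (a t))"
proof -
 obtain C where C: "C > 0" "\<And>x y. norm (bp x y) \<le> norm x * norm y * C"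
  using bounded_bilinear.pos_bounded[OF bb] by blast
 define k where "k t = C * norm (a t)" for t
 have k0: "k t \<ge> 0" for t using C by (simp add: k_def)
 have lk: "loc_int k" unfolding k_def by (intro loc_int_cmult loc_int_norm a)
 define m where "m = prim k"
 have acm: "has_ac_derivative m k" unfolding m_def by (rule has_ac_prim[OF lk])
 have cm: "continuous_on UNIV m" by (rule has_ac_continuous[OF acm])
 have m0: "m 0 = 0" by (simp add: m_def)
 have mono: "m s \<le> m t" if "s \<le> t" for s t
  using has_ac_integral[OF acm that] integral_nonneg[OF loc_int_integrable[OF lk], of s t] k0 by simp
 \<comment> \<open>As \<open>m\<close> is absolutely continuous, m^n / n! * k has the exact
   primitive m^(n+1) / (n+1)!; this is where the factorials come from.\<close>
 have pow: "has_ac_derivative (\<lambda>t. m t ^ Suc n / fact (Suc n)) (\<lambda>t. m t ^ n / fact n * k t)" for n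
 proof (induction n)
  case 0 then show ?case using acm by simp
 next
  case (Suc n)
  have "has_ac_derivative (\<lambda>t. m t * (m t ^ Suc n / fact (Suc n)) )
    (\<lambda>t. k t * (m t ^ Suc n / fact (Suc n)) + m t * (m t ^ n / fact n * k t))"
   by (rule has_ac_bilinear[OF bounded_bilinear_mult acm Suc])
  then have "has_ac_derivative (\<lambda>t. (1 / real (Suc (Suc n))) * (m t * (m t ^ Suc n / fact (Suc n))))
    (\<lambda>t. (1 / real (Suc (Suc n))) * (k t * (m t ^ Suc n / fact (Suc n)) + m t * (m t ^ n / fact n * k t)))"
   by (rule has_ac_linear[OF bounded_linear_mult_right])
  moreover have "(1 / real (Suc (Suc n))) * (m t * (m t ^ Suc n / fact (Suc n))) = m t ^ Suc (Suc n) / fact (Suc (Suc n))" for t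
   by simp
  moreover have "(1 / real (Suc (Suc n))) * (k t * (m t ^ Suc n / fact (Suc n)) + m t * (m t ^ n / fact n * k t))
    = m t ^ Suc n / fact (Suc n) * k t" for t
  proof -
   have "m t * (m t ^ n / fact n * k t) = real (Suc n) * (m t ^ Suc n / fact (Suc n) * k t)"
    by simp
   moreover have "(1 / real (Suc (Suc n))) * (x + real (Suc n) * x) = x" for x
    by (simp add: field_simps)
   moreover have "k t * (m t ^ Suc n / fact (Suc n)) = m t ^ Suc n / fact (Suc n) * k t"
    by (rule mult.commute)
   ultimately show ?thesis by metis
  qed
  ultimately show ?case by simp
 qed
 define V where "V = rec_nat (\<lambda>t. c) (\<lambda>n v. prim (\<lambda>t. bp (v t) (a t)))"
 have V0: "V 0 = (\<lambda>t. c)" and VS: "V (Suc n) = prim (\<lambda>t. bp (V n t) (a t))" for n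
  by (simp_all add: V_def)
 have cV: "continuous_on UNIV (V n)" for n
 proof (induction n)
  case (Suc n)
  show ?case unfolding VS
   by (rule has_ac_continuous[OF has_ac_prim[OF loc_int_bilinear[OF bb Suc a]]])
 qed (simp add: V0)
 have lV: "loc_int (\<lambda>t. bp (V n t) (a t))" for n by (rule loc_int_bilinear[OF bb cV a])
 have acV: "has_ac_derivative (V (Suc n)) (\<lambda>t. bp (V n t) (a t))" for n
  unfolding VS by (rule has_ac_prim[OF lV])
 have bV: "norm (V n t) \<le> norm c * (\<bar>m t\<bar> ^ n / fact n)" for n t
 proof (induction n arbitrary: t)
  case (Suc n)
  have g: "norm (bp (V n s) (a s)) \<le> norm c * (\<bar>m s\<bar> ^ n / fact n * k s)" for s
  proof -
   have "norm (bp (V n s) (a s)) \<le> norm (V n s) * k s" using C(2)[of "V n s" "a s"] by (simp add: k_def ac_simps)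
   also have "\<dots> \<le> norm c * (\<bar>m s\<bar> ^ n / fact n) * k s" by (intro mult_right_mono Suc k0)
   finally show ?thesis by (simp add: ac_simps)
  qed
  have lp: "loc_int (\<lambda>s. m s ^ n / fact n * k s)" by (rule has_ac_loc_int[OF pow])
  show ?case
  proof (cases "0 \<le> t")
   case True
   have "norm (V (Suc n) t) = norm (integral {0..t} (\<lambda>s. bp (V n s) (a s)))"
    using True by (simp add: VS prim_def)
   also have "\<dots> \<le> integral {0..t} (\<lambda>s. norm c * (m s ^ n / fact n * k s))"
   proof (rule integral_norm_bound_integral[OF loc_int_integrable[OF lV] loc_int_integrable[OF loc_int_cmult[OF lp]]])
    fix s assume "s \<in> {0..t}"
    then have "\<bar>m s\<bar> = m s" using mono[of 0 s] m0 by auto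
    then show "norm (bp (V n s) (a s)) \<le> norm c * (m s ^ n / fact n * k s)" using g[of s] by simp
   qed
   also have "\<dots> = norm c * (m t ^ Suc n / fact (Suc n))"
    unfolding Henstock_Kurzweil_Integration.integral_mult_right has_ac_integral[OF pow True] using m0 by simp
   finally show ?thesis using mono[of 0 t] m0 True by simp
  next
   \<comment> \<open>To the left of 0 the primitive \<open>m\<close> is nonpositive; the sign (-1)^n
     turns m^n into |m|^n.\<close>
   case False
   then have t: "t \<le> 0" by simp
   have "norm (V (Suc n) t) = norm (integral {t..0} (\<lambda>s. bp (V n s) (a s)))"
    using False by (simp add: VS prim_def)
   also have "\<dots> \<le> integral {t..0} (\<lambda>s. (norm c * (-1) ^ n) * (m s ^ n / fact n * k s))"
   proof (rule integral_norm_bound_integral[OF loc_int_integrable[OF lV] loc_int_integrable[OF loc_int_cmult[OF lp]]])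
    fix s assume "s \<in> {t..0}"
    then have "\<bar>m s\<bar> = - m s" using mono[of s 0] m0 by auto
    then have "\<bar>m s\<bar> ^ n = (-1) ^ n * m s ^ n" by (metis power_minus)
    then show "norm (bp (V n s) (a s)) \<le> (norm c * (-1) ^ n) * (m s ^ n / fact n * k s)" using g[of s] by (simp add: ac_simps)
   qed
   also have "\<dots> = (norm c * (-1) ^ n) * (- (m t ^ Suc n / fact (Suc n)))"
    unfolding Henstock_Kurzweil_Integration.integral_mult_right has_ac_integral[OF pow t] using m0 by simp
   also have "\<dots> = norm c * ((- m t) ^ Suc n / fact (Suc n))"
    by (subst power_minus[of "m t" "Suc n"]) simp
   finally show ?thesis using mono[of t 0] m0 t by simp
  qed
 qed (simp add: V0)
 have sexp: "(\<lambda>n. norm c * (\<bar>m t\<bar> ^ n / fact n)) sums (norm c * exp \<bar>m t\<bar>)" for t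
  using sums_mult[OF exp_converges[of "\<bar>m t\<bar>"]] by (simp add: field_simps)
 have sV: "summable (\<lambda>n. V n t)" for t
  by (rule summable_comparison_test'[OF sums_summable[OF sexp] bV])
 define F where "F t = (\<Sum>n. V n t)" for t
 define S where "S N t = (\<Sum>n<N. V n t)" for N t
 have SF: "(\<lambda>N. S N t) \<longlonglongrightarrow> F t" for t
  unfolding S_def F_def by (rule summable_LIMSEQ[OF sV])
 have bS: "norm (S N t) \<le> norm c * exp \<bar>m t\<bar>" for N t
 proof -
  have "norm (S N t) \<le> (\<Sum>n<N. norm c * (\<bar>m t\<bar> ^ n / fact n))"
   unfolding S_def by (rule sum_norm_le[OF bV])
  also have "\<dots> \<le> norm c * exp \<bar>m t\<bar>"
   using sum_le_suminf[OF sums_summable[OF sexp[of t]], of "{..<N}"] sums_unique[OF sexp[of t]] by simp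
  finally show ?thesis .
 qed
 \<comment> \<open>An integrable bound for all partial sums at once, which lets the integral
   equation pass to the limit.\<close>
 define h where "h s = norm c * exp \<bar>m s\<bar> * k s" for s
 have lh: "loc_int h" unfolding h_def
  by (rule loc_int_bilinear[OF bounded_bilinear_mult _ lk]) (intro continuous_intros cm)
 interpret bp: bounded_bilinear bp by fact
 have cS: "continuous_on UNIV (S N)" for N unfolding S_def by (intro continuous_intros cV)
 have lS: "loc_int (\<lambda>s. bp (S N s) (a s))" for N by (rule loc_int_bilinear[OF bb cS a])
 have bh: "norm (bp (S N s) (a s)) \<le> h s" for N s
 proof -
  have "norm (bp (S N s) (a s)) \<le> norm (S N s) * k s" using C(2)[of "S N s" "a s"] by (simp add: k_def ac_simps)
  also have "\<dots> \<le> h s" unfolding h_def by (intro mult_right_mono bS k0)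
  finally show ?thesis .
 qed
 have lim: "(\<lambda>N. bp (S N s) (a s)) \<longlonglongrightarrow> bp (F s) (a s)" for s
  by (intro bp.tendsto SF tendsto_const)
 have iS: "integral {x..y} (\<lambda>s. bp (S N s) (a s)) = S (Suc N) y - S (Suc N) x" if "x \<le> y" for N x y
 proof -
  have "integral {x..y} (\<lambda>s. bp (S N s) (a s)) = integral {x..y} (\<lambda>s. \<Sum>n<N. bp (V n s) (a s))"
   by (simp add: S_def bp.sum_left)
  also have "\<dots> = (\<Sum>n<N. integral {x..y} (\<lambda>s. bp (V n s) (a s)))"
   by (intro integral_sum loc_int_integrable lV) simp
  also have "\<dots> = (\<Sum>n<N. V (Suc n) y - V (Suc n) x)"
   by (intro sum.cong refl has_ac_integral[OF acV that])
  also have "\<dots> = S (Suc N) y - S (Suc N) x"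
   unfolding S_def sum_subtractf sum.lessThan_Suc_shift[of _ N] by (simp add: V0)
  finally show ?thesis .
 qed
 have dc: "(\<lambda>s. bp (F s) (a s)) integrable_on {x..y}"
  "(\<lambda>N. integral {x..y} (\<lambda>s. bp (S N s) (a s))) \<longlonglongrightarrow> integral {x..y} (\<lambda>s. bp (F s) (a s))" for x y
  using dominated_convergence[OF loc_int_integrable[OF lS] loc_int_integrable[OF lh] bh lim] by blast+
 have "norm (bp (F s) (a s)) \<le> h s" for s
  by (rule LIMSEQ_le_const2[OF tendsto_norm[OF lim]]) (use bh in blast)
 then have lF: "loc_int (\<lambda>s. bp (F s) (a s))"
  unfolding loc_int_def
  by (intro allI absolutely_integrable_integrable_bound[OF _ dc(1) loc_int_integrable[OF lh]])
 have "has_ac_derivative F (\<lambda>t. bp (F t) (a t))"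
 proof (rule has_acI[OF lF])
  fix x y :: real assume "x \<le> y"
  have "(\<lambda>N. S (Suc N) y - S (Suc N) x) \<longlonglongrightarrow> F y - F x"
   by (intro tendsto_diff LIMSEQ_Suc SF)
  then show "integral {x..y} (\<lambda>s. bp (F s) (a s)) = F y - F x"
   using dc(2)[of x y] LIMSEQ_unique unfolding iS[OF \<open>x \<le> y\<close>] by blast
 qed
 moreover have "F 0 = c"
 proof -
  have "V (Suc n) 0 = 0" for n by (simp add: VS)
  then have "F 0 = V 0 0" unfolding F_def
   by (subst suminf_finite[of "{0}"]) (auto, metis gr0_implies_Suc)
  then show ?thesis by (simp add: V0)
 qed
 ultimately show ?thesis using that by blast
qed

section \<open>The extended frame, its symmetries and gauge transformations\<close>

definition offd :: "complex \<Rightarrow> cmat2" where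
 "offd c = mk2 0 (c / 2) (- cnj c / 2) 0"

definition dgn :: "complex \<Rightarrow> cmat2" where
 "dgn z = mk2 z 0 0 (- z)"

lemma offd_nth [simp]:
 "offd c $ 1 $ 1 = 0" "offd c $ 1 $ 2 = c / 2" "offd c $ 2 $ 1 = - cnj c / 2" "offd c $ 2 $ 2 = 0"
 by (simp_all add: offd_def)

lemma dgn_nth [simp]:
 "dgn c $ 1 $ 1 = c" "dgn c $ 1 $ 2 = 0" "dgn c $ 2 $ 1 = 0" "dgn c $ 2 $ 2 = - c"
 by (simp_all add: dgn_def)

text \<open>Only real-linear, as the lower entry contains the conjugate; this is why real parameters
  are counted later.\<close>

lemma bounded_linear_offd: "bounded_linear offd"
proof -
 have "linear offd" by (intro linearI) (auto simp: cmat2_eq_iff add_divide_distrib)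
 then show ?thesis by (simp add: linear_conv_bounded_linear)
qed

lemma eps_nths [simp]:
 "eps $ 1 $ 1 = \<i>" "eps $ 1 $ 2 = 0" "eps $ 2 $ 1 = 0" "eps $ 2 $ 2 = - \<i>"
 "eps_plus $ 1 $ 1 = 0" "eps_plus $ 1 $ 2 = 1" "eps_plus $ 2 $ 1 = 0" "eps_plus $ 2 $ 2 = 0"
 "eps_minus $ 1 $ 1 = 0" "eps_minus $ 1 $ 2 = 0" "eps_minus $ 2 $ 1 = -1" "eps_minus $ 2 $ 2 = 0"
 by (simp_all add: eps_def eps_plus_def eps_minus_def)

lemma alpha_eq: "alpha q z t = dgn (\<i> * z / 2) + offd (q t)"
 by (simp add: alpha_def cmat2_eq_iff mm_nth)

lemma alpha_nth [simp]:
 "alpha q z t $ 1 $ 1 = \<i> * z / 2" "alpha q z t $ 1 $ 2 = q t / 2"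
 "alpha q z t $ 2 $ 1 = - cnj (q t) / 2" "alpha q z t $ 2 $ 2 = - \<i> * z / 2"
 by (simp_all add: alpha_eq)

lemma trace_alpha [simp]: "trace (alpha q z t) = 0"
 by (simp add: trace_def sum_2)

lemma loc_int_alpha: "loc_int q \<Longrightarrow> loc_int (alpha q z)"
 unfolding alpha_eq by (intro loc_int_add loc_int_const loc_int_linear[OF bounded_linear_offd])

lemma norm_offd_le: "norm (offd c) \<le> norm c"
 by (rule order_trans[OF norm_le_entries]) (simp add: norm_divide)

lemma has_ac_mm:
 fixes F G :: "real \<Rightarrow> cmat2"
 assumes "has_ac_derivative F F'" "has_ac_derivative G G'"
 shows "has_ac_derivative (\<lambda>t. F t ** G t) (\<lambda>t. F' t ** G t + F t ** G' t)"
 by (rule has_ac_bilinear[OF bounded_bilinear_mm assms])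

interpretation mm: bounded_bilinear "(**) :: cmat2 \<Rightarrow> cmat2 \<Rightarrow> cmat2"
 by (rule bounded_bilinear_mm)

lemma mat_left_commute: "(A :: cmat2) ** (mat c ** (B :: cmat2)) = mat c ** (A ** B)"
 by (simp add: m2 algebra_simps)

lemma has_ac_eq_rhs: "has_ac_derivative f g \<Longrightarrow> (\<And>t. g t = g' t) \<Longrightarrow> has_ac_derivative f g'"
proof -
 assume "has_ac_derivative f g" "\<And>t. g t = g' t"
 then show ?thesis using ext[of g g'] by simp
qed

lemma has_ac_const_mm: "has_ac_derivative (F :: real \<Rightarrow> cmat2) F' \<Longrightarrow> has_ac_derivative (\<lambda>t. (A :: cmat2) ** F t) (\<lambda>t. A ** F' t)"
 by (rule has_ac_linear[OF mm.bounded_linear_right])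

lemma has_ac_mm_const: "has_ac_derivative (F :: real \<Rightarrow> cmat2) F' \<Longrightarrow> has_ac_derivative (\<lambda>t. F t ** (A :: cmat2)) (\<lambda>t. F' t ** A)"
 by (rule has_ac_linear[OF mm.bounded_linear_left])

lemma ode_adj2:
 assumes "has_ac_derivative F (\<lambda>t. F t ** a t)" "\<And>t. trace (a t) = 0"
 shows "has_ac_derivative (\<lambda>t. adj2 (F t)) (\<lambda>t. - (a t ** adj2 (F t)))"
 by (rule has_ac_eq_rhs[OF has_ac_linear[OF bounded_linear_adj2 assms(1)]])
  (simp add: adj2_mm adj2_trace0[OF assms(2)] mm.minus_left)

text \<open>The derivative of \<open>G\<close> times the inverse of \<open>F\<close> only sees the
  difference of the coefficients. Equal coefficients give uniqueness and the constancy of the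
  determinant, different ones give Duhamel's formula for perturbations.\<close>

lemma ode_diff:
 fixes F G :: "real \<Rightarrow> cmat2"
 assumes "has_ac_derivative F (\<lambda>t. F t ** a t)" "\<And>t. trace (a t) = 0"
  and "has_ac_derivative G (\<lambda>t. G t ** b t)"
 shows "has_ac_derivative (\<lambda>t. G t ** adj2 (F t)) (\<lambda>t. G t ** (b t - a t) ** adj2 (F t))"
 by (rule has_ac_eq_rhs[OF has_ac_mm[OF assms(3) ode_adj2[OF assms(1,2)]]])
  (simp add: mm.diff_left mm.diff_right mm_assoc mm.minus_right)

lemma ode_det:
 fixes F :: "real \<Rightarrow> cmat2"
 assumes "has_ac_derivative F (\<lambda>t. F t ** a t)" "\<And>t. trace (a t) = 0"
 shows "det (F t) = det (F 0)"
proof -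
 have "has_ac_derivative (\<lambda>t. F t ** adj2 (F t)) (\<lambda>t. 0)"
  by (rule has_ac_eq_rhs[OF ode_diff[OF assms assms(1)]]) simp
 then have "F t ** adj2 (F t) = F 0 ** adj2 (F 0)" by (rule has_ac_zero_imp_const)
 then have "(mat (det (F t)) :: cmat2) = mat (det (F 0))" by (simp add: adj2_mult)
 then show ?thesis by (simp add: cmat2_eq_iff)
qed

lemma ode_unique:
 fixes F G :: "real \<Rightarrow> cmat2"
 assumes F: "has_ac_derivative F (\<lambda>t. F t ** a t)" "\<And>t. trace (a t) = 0" "det (F 0) = 1"
  and G: "has_ac_derivative G (\<lambda>t. G t ** a t)"
 shows "G t = G 0 ** adj2 (F 0) ** F t"
proof -
 have "has_ac_derivative (\<lambda>t. G t ** adj2 (F t)) (\<lambda>t. 0)"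
  by (rule has_ac_eq_rhs[OF ode_diff[OF F(1,2) G]]) simp
 then have "G t ** adj2 (F t) = G 0 ** adj2 (F 0)" by (rule has_ac_zero_imp_const)
 then have "G t ** adj2 (F t) ** F t = G 0 ** adj2 (F 0) ** F t" by simp
 moreover have "det (F t) = 1" using ode_det[OF F(1,2)] F(3) by simp
 ultimately show ?thesis by (simp add: mm_assoc adj2_cancel)
qed

text \<open>This makes the \<open>THE\<close> in \<open>extended_frame\<close> meaningful.\<close>

lemma frame_ex1:
 assumes "loc_int q"
 shows "\<exists>!F. F 0 = mat 1 \<and> has_ac_derivative F (\<lambda>s. F s ** alpha q z s)"
proof -
 obtain F where F: "F 0 = mat 1" "has_ac_derivative F (\<lambda>s. F s ** alpha q z s)"
  by (rule linear_ode_exists[OF bounded_bilinear_mm loc_int_alpha[OF assms], of "mat 1"])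
 show ?thesis
 proof (rule ex1I[of _ F])
  fix G assume G: "G 0 = mat 1 \<and> has_ac_derivative G (\<lambda>s. G s ** alpha q z s)"
  show "G = F"
  proof
   fix t
   have "G t = G 0 ** adj2 (F 0) ** F t"
    by (rule ode_unique[OF F(2) trace_alpha]) (use F G in auto)
   then show "G t = F t" using F G by simp
  qed
 qed (use F in blast)
qed

lemma
 assumes "loc_int q"
 shows frame_0 [simp]: "frame q 0 z = mat 1"
  and has_ac_frame: "has_ac_derivative (\<lambda>t. frame q t z) (\<lambda>t. frame q t z ** alpha q z t)"
 using theI'[OF frame_ex1[OF assms, of z]] unfolding extended_frame_def by auto

lemma frame_eqI:
 assumes "loc_int q" "F 0 = mat 1" "has_ac_derivative F (\<lambda>s. F s ** alpha q z s)"
 shows "frame q t z = F t"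
 unfolding extended_frame_def using the1_equality[OF frame_ex1[OF assms(1)]] assms(2,3) by blast

lemma det_frame: "loc_int q \<Longrightarrow> det (frame q t z) = 1"
 using ode_det[OF has_ac_frame[of q z] trace_alpha, of t] by simp

lemma continuous_on_frame: "loc_int q \<Longrightarrow> continuous_on UNIV (\<lambda>t. frame q t z)"
 by (rule has_ac_continuous[OF has_ac_frame])

lemma frame_solution:
 fixes G :: "real \<Rightarrow> cmat2"
 assumes "loc_int q" "has_ac_derivative G (\<lambda>t. G t ** alpha q z t)"
 shows "G t = G 0 ** frame q t z"
proof -
 have "det (frame q 0 z) = 1" using assms(1) by simp
 from ode_unique[OF has_ac_frame[OF assms(1)] trace_alpha this assms(2)] show ?thesis
  unfolding frame_0[OF assms(1)] adj2_mat matrix_mul_rid .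
qed

lemma ct_alpha: "conj_transpose (alpha q (cnj z) t) = - alpha q z t"
 by (simp add: cmat2_eq_iff)

text \<open>The reality condition of the self-focusing case: the adjoint of
  \<open>alpha q (cnj z)\<close> is \<open>- alpha q z\<close>, so the product has derivative 0. In
  particular the frame is unitary at real parameters.\<close>

lemma frame_ct:
 assumes "loc_int q"
 shows "frame q t z ** conj_transpose (frame q t (cnj z)) = mat 1"
proof -
 let ?F = "\<lambda>z t. frame q t z"
 have "has_ac_derivative (\<lambda>t. ?F z t ** conj_transpose (?F (cnj z) t)) (\<lambda>t. 0)"
  by (rule has_ac_eq_rhs[OF has_ac_mm[OF has_ac_frame[OF assms]
      has_ac_linear[OF bounded_linear_ct has_ac_frame[OF assms]]]])
   (simp add: ct_mm ct_alpha mm_assoc mm.minus_left mm.minus_right)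
 then have "?F z t ** conj_transpose (?F (cnj z) t) = ?F z 0 ** conj_transpose (?F (cnj z) 0)"
  by (rule has_ac_zero_imp_const)
 then show ?thesis using assms by simp
qed

lemma frame_cnj:
 assumes "loc_int q"
 shows "frame q t (cnj z) = adj2 (conj_transpose (frame q t z))"
proof -
 have d: "det (frame q t z) = 1" by (rule det_frame[OF assms])
 have "adj2 (frame q t z) ** (frame q t z ** conj_transpose (frame q t (cnj z)))
  = adj2 (frame q t z)" using frame_ct[OF assms, of t z] by simp
 then have "conj_transpose (frame q t (cnj z)) = adj2 (frame q t z)"
  unfolding adj2_cancel(4)[OF d] .
 then have "conj_transpose (conj_transpose (frame q t (cnj z))) = conj_transpose (adj2 (frame q t z))"
  by simp
 then show ?thesis by (simp add: ct_adj2)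
qed

lemma matrix_inv_frame:
 assumes "loc_int q"
 shows "matrix_inv (frame q t (cnj z)) = conj_transpose (frame q t z)"
 by (simp add: matrix_inv_adj2 det_frame[OF assms] frame_cnj[OF assms, of t z])

lemma frame_shift:
 assumes "loc_int q"
 shows "frame q (t + c) z = frame q c z ** frame (\<lambda>t. q (t + c)) t z"
proof -
 have "has_ac_derivative (\<lambda>t. frame q (t + c) z) (\<lambda>t. frame q (t + c) z ** alpha (\<lambda>t. q (t + c)) z t)"
  by (rule has_ac_eq_rhs[OF has_ac_shift[OF has_ac_frame[OF assms], of c]]) (simp add: alpha_def)
 from frame_solution[OF loc_int_shift[OF assms] this] show ?thesis by simp
qed

lemma frame_cong_AE:
 assumes "loc_int q" "AE t in lebesgue. q t = q' t"
 shows "frame q t z = frame q' t z"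
proof -
 obtain N where N: "negligible N" "\<And>t. t \<notin> N \<Longrightarrow> q t = q' t" using AE_imp_negligible[OF assms(2)] by blast
 have l: "loc_int q'" by (rule loc_int_cong_AE[OF assms(1) N])
 have "has_ac_derivative (\<lambda>t. frame q' t z) (\<lambda>t. frame q' t z ** alpha q z t)"
  by (rule has_ac_cong_negl[OF has_ac_frame[OF l] N(1)]) (simp add: N(2) alpha_def)
 from frame_eqI[OF assms(1) frame_0[OF l] this] show ?thesis .
qed

lemma frame_periodic:
 assumes "loc_int q" "AE t in lebesgue. q (t + T) = q t"
 shows "frame q (t + T) z = frame q T z ** frame q t z"
 by (simp add: frame_shift[OF assms(1)] frame_cong_AE[OF loc_int_shift[OF assms(1)] assms(2)])

text \<open>The exponential of \<open>s / 2\<close> times \<open>eps\<close>, used as a diagonal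
  gauge transformation.\<close>

definition dphase :: "real \<Rightarrow> cmat2" where
 "dphase s = mk2 (cis (s / 2)) 0 0 (cis (- s / 2))"

lemma dphase_nth [simp]:
 "dphase s $ 1 $ 1 = cis (s / 2)" "dphase s $ 1 $ 2 = 0" "dphase s $ 2 $ 1 = 0" "dphase s $ 2 $ 2 = cis (- s / 2)"
 by (simp_all add: dphase_def)

lemma dphase_mm: "dphase s ** dphase t = dphase (s + t)"
 by (simp add: m2 cis_mult add_divide_distrib diff_divide_distrib)

lemma dphase_0 [simp]: "dphase 0 = mat 1" by (simp add: m2)

lemma ct_dphase: "conj_transpose (dphase s) = dphase (- s)" by (simp add: m2 cis_cnj)

lemma has_ac_mk2:
 assumes "has_ac_derivative a a'" "has_ac_derivative b b'" "has_ac_derivative c c'" "has_ac_derivative d d'"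
 shows "has_ac_derivative (\<lambda>t. mk2 (a t) (b t) (c t) (d t)) (\<lambda>t. mk2 (a' t) (b' t) (c' t) (d' t))"
proof -
 have l: "bounded_linear (\<lambda>z. mk2 z 0 0 0)" "bounded_linear (\<lambda>z. mk2 0 z 0 0)"
  "bounded_linear (\<lambda>z. mk2 0 0 z 0)" "bounded_linear (\<lambda>z. mk2 0 0 0 z)"
  unfolding linear_conv_bounded_linear[symmetric] by (auto intro!: linearI simp: cmat2_eq_iff)
 have eq: "mk2 a b c d = mk2 a 0 0 0 + mk2 0 b 0 0 + mk2 0 0 c 0 + mk2 0 0 0 d" for a b c d
  by (simp add: cmat2_eq_iff)
 have "has_ac_derivative (\<lambda>t. mk2 (a t) 0 0 0 + mk2 0 (b t) 0 0 + mk2 0 0 (c t) 0 + mk2 0 0 0 (d t))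
   (\<lambda>t. mk2 (a' t) 0 0 0 + mk2 0 (b' t) 0 0 + mk2 0 0 (c' t) 0 + mk2 0 0 0 (d' t))"
  by (intro has_ac_add has_ac_linear[OF l(1) assms(1)] has_ac_linear[OF l(2) assms(2)]
    has_ac_linear[OF l(3) assms(3)] has_ac_linear[OF l(4) assms(4)])
 then show ?thesis by (simp add: eq[symmetric])
qed

lemma has_ac_exp:
 fixes c :: complex
 shows "has_ac_derivative (\<lambda>t. exp (c * of_real t)) (\<lambda>t. c * exp (c * of_real t))"
proof (rule has_vector_derivative_imp_ac)
 fix t
 have "((\<lambda>x. exp (c * x)) has_field_derivative exp (c * of_real t) * c) (at (of_real t))"
  by (auto intro!: derivative_eq_intros)
 from has_vector_derivative_real_field[OF this]
 show "((\<lambda>t. exp (c * of_real t)) has_vector_derivative c * exp (c * of_real t)) (at t)"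
  by (simp add: mult.commute)
qed (intro continuous_intros)

lemma cis_eq_exp: "cis (s * t) = exp (\<i> * of_real s * of_real t)"
 by (simp add: cis_conv_exp mult.assoc)

lemma has_ac_cis: "has_ac_derivative (\<lambda>t. cis (s * t)) (\<lambda>t. \<i> * of_real s * cis (s * t))"
 unfolding cis_eq_exp by (rule has_ac_exp)

lemma has_ac_dphase:
 "has_ac_derivative (\<lambda>t. dphase (s * t)) (\<lambda>t. dphase (s * t) ** dgn (\<i> * of_real s / 2))"
proof -
 have z: "has_ac_derivative (\<lambda>t. 0) (\<lambda>t. 0 :: complex)" by (rule has_ac_const)
 have "has_ac_derivative (\<lambda>t. mk2 (cis (s / 2 * t)) 0 0 (cis (- s / 2 * t)))
  (\<lambda>t. mk2 (\<i> * of_real (s / 2) * cis (s / 2 * t)) 0 0 (\<i> * of_real (- s / 2) * cis (- s / 2 * t)))"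
  by (intro has_ac_mk2 has_ac_cis z)
 moreover have "mk2 (cis (s / 2 * t)) 0 0 (cis (- s / 2 * t)) = dphase (s * t)" for t
  by (simp add: dphase_def)
 moreover have "mk2 (\<i> * of_real (s / 2) * cis (s / 2 * t)) 0 0 (\<i> * of_real (- s / 2) * cis (- s / 2 * t))
   = dphase (s * t) ** dgn (\<i> * of_real s / 2)" for t
  by (simp add: m2 mult.commute)
 ultimately show ?thesis by simp
qed

text \<open>Conjugation with \<open>dphase\<close> multiplies the off-diagonal part of
  \<open>alpha\<close> by a phase, and its derivative adds to the diagonal. Thus a phase linear in t
  in the potential is traded for a real shift of the spectral parameter; this turns the
  quasi-periodic curvature at \<open>\<i>\<close> into the periodic potential at
  \<open>\<i> + \<theta>\<close>.\<close>

lemma frame_gauge: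
 assumes "loc_int q"
 shows "frame q t z ** dphase (s * t) = frame (\<lambda>t. cis (- s * t) * q t) t (z + of_real s)"
proof -
 have c: "continuous_on UNIV (\<lambda>t. cis (- s * t))" by (rule has_ac_continuous[OF has_ac_cis])
 have l: "loc_int (\<lambda>t. cis (- s * t) * q t)"
  by (rule loc_int_bilinear[OF bounded_bilinear_mult c assms])
 have key: "alpha q z t ** dphase (s * t) + dphase (s * t) ** dgn (\<i> * of_real s / 2)
   = dphase (s * t) ** alpha (\<lambda>t. cis (- s * t) * q t) (z + of_real s) t" for t
 proof -
  have e: "cis (s * t / 2) * cis (- s * t) = cis (- s * t / 2)"
   "cis (- s * t / 2) * cis (s * t) = cis (s * t / 2)" by (simp_all add: cis_mult field_simps)
  have e1: "q t / 2 * cis (- (s * t) / 2) = cis (s * t / 2) * (cis (- s * t) * q t / 2)"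
   using e(1) by (simp add: ac_simps)
  have e2: "- cnj (q t) / 2 * cis (s * t / 2) = cis (- (s * t) / 2) * (- cnj (cis (- s * t) * q t) / 2)"
   using e(2) by (simp add: ac_simps cis_cnj)
  show ?thesis
   unfolding cmat2_eq_iff using e1 e2 by (simp add: mm_nth algebra_simps add_divide_distrib)
 qed
 have "has_ac_derivative (\<lambda>t. frame q t z ** dphase (s * t))
   (\<lambda>t. frame q t z ** dphase (s * t) ** alpha (\<lambda>t. cis (- s * t) * q t) (z + of_real s) t)"
  by (rule has_ac_eq_rhs[OF has_ac_mm[OF has_ac_frame[OF assms] has_ac_dphase]])
   (simp only: mm_assoc mm.add_right[symmetric] key)
 from frame_eqI[OF l _ this] show ?thesis using assms by simp
qed

section \<open>Dependence of the frame on the potential and on the spectral parameter\<close>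

lemma norm_mm_bound: obtains K where "K \<ge> 1" "\<And>(A :: cmat2) (B :: cmat2). norm (A ** B) \<le> K * norm A * norm B"
proof -
 obtain K where "0 < K \<and> (\<forall>(A :: cmat2) (B :: cmat2). norm (A ** B) \<le> norm A * norm B * K)"
  using mm.pos_bounded by blast
 then have K: "K > 0" "\<And>(A :: cmat2) (B :: cmat2). norm (A ** B) \<le> norm A * norm B * K" by auto
 show ?thesis
 proof (rule that[of "max K 1"])
  fix A B :: cmat2
  have "norm A * norm B * K \<le> norm A * norm B * max K 1" by (intro mult_left_mono) auto
  then show "norm (A ** B) \<le> max K 1 * norm A * norm B" using K(2)[of A B] by (simp add: ac_simps)
 qed simp
qed

text \<open>
 With \<open>H = G adj F\<close> and \<open>w = F (b - a) adj F\<close> one has \<open>H' = H w\<close>, so all the estimates come from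
 integrating this equation once and twice.
\<close>

lemma ode_stability:
 fixes F :: "real \<Rightarrow> cmat2"
 assumes F: "has_ac_derivative F (\<lambda>t. F t ** a t)" "\<And>t. trace (a t) = 0" "F 0 = mat 1" and T: "T \<ge> 0"
 obtains B where "B > 0"
  "\<And>G b d t. has_ac_derivative G (\<lambda>t. G t ** b t) \<Longrightarrow> loc_int b \<Longrightarrow> G 0 = mat 1 \<Longrightarrow>
    integral {0..T} (\<lambda>s. norm (b s - a s)) \<le> d \<Longrightarrow> B * d \<le> 1 \<Longrightarrow> 0 \<le> t \<Longrightarrow> t \<le> T \<Longrightarrow> loc_int a \<Longrightarrow>
    norm (G t - F t) \<le> B * d \<and>
    norm (G t - F t - integral {0..t} (\<lambda>s. F s ** (b s - a s) ** adj2 (F s)) ** F t) \<le> B * d\<^sup>2"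
proof -
 obtain K where K: "K \<ge> 1" "\<And>(A :: cmat2) (B :: cmat2). norm (A ** B) \<le> K * norm A * norm B" by (rule norm_mm_bound) (rule that)
 have cF: "continuous_on UNIV F" by (rule has_ac_continuous[OF F(1)])
 have "bounded (F ` {0..T})" "bounded ((\<lambda>t. adj2 (F t)) ` {0..T})"
  by (rule compact_imp_bounded[OF compact_continuous_image[OF continuous_on_subset[OF cF] compact_Icc]], simp)
   (rule compact_imp_bounded[OF compact_continuous_image[OF continuous_on_subset[OF continuous_on_adj2[OF cF]] compact_Icc]], simp)
 then obtain c1 c2 where c12: "\<forall>x\<in>F ` {0..T}. norm x \<le> c1" "\<forall>x\<in>(\<lambda>t. adj2 (F t)) ` {0..T}. norm x \<le> c2"
  unfolding bounded_iff by meson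
 define c where "c = max 1 (max c1 c2)"
 have c: "c > 0" by (simp add: c_def)
 have cFt: "norm (F t) \<le> c" "norm (adj2 (F t)) \<le> c" if "0 \<le> t" "t \<le> T" for t
  using c12 that by (auto simp: c_def le_max_iff_disj)
 define e1 where "e1 = norm (mat 1 :: cmat2)"
 define \<kappa> where "\<kappa> = K * (K * (K * c) * c)"
 have pos: "\<kappa> > 0" "e1 \<ge> 0" using K c by (auto simp: \<kappa>_def e1_def)
 \<comment> \<open>Three demands in one constant: the first summand makes
   \<open>B * d \<le> 1\<close> imply \<kappa> d <= 1/2, the other two dominate the constants of the
   first and the second order estimate.\<close>
 define B where "B = 2 * \<kappa> + K * (2 * e1 * \<kappa>) * c + K * (2 * e1 * \<kappa> * \<kappa>) * c"
 have Kc: "K * (2 * e1 * \<kappa>) * c \<ge> 0" "K * (2 * e1 * \<kappa> * \<kappa>) * c \<ge> 0" using K c pos by auto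
 have B0: "B > 0" "2 * \<kappa> \<le> B" "K * (2 * e1 * \<kappa>) * c \<le> B" "K * (2 * e1 * \<kappa> * \<kappa>) * c \<le> B"
  using Kc pos unfolding B_def by linarith+
 show ?thesis
 proof (rule that[OF B0(1)])
  fix G b d t
  assume G: "has_ac_derivative G (\<lambda>t. G t ** b t)" "loc_int b" "G 0 = mat 1"
   and d: "integral {0..T} (\<lambda>s. norm (b s - a s)) \<le> d" "B * d \<le> 1" and t: "0 \<le> t" "t \<le> T" and la: "loc_int a"
  define H where "H t = G t ** adj2 (F t)" for t
  define n where "n s = norm (b s - a s)" for s
  define w where "w s = F s ** (b s - a s) ** adj2 (F s)" for s
  have detF: "det (F s) = 1" for s using ode_det[OF F(1,2), of s] F(3) by simp
  have lba: "loc_int (\<lambda>s. b s - a s)" by (intro loc_int_diff G la)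
  have ln: "loc_int n" unfolding n_def by (intro loc_int_norm lba)
  have lw: "loc_int w" unfolding w_def
   by (intro loc_int_bilinear_right[OF bounded_bilinear_mm] loc_int_bilinear[OF bounded_bilinear_mm] cF continuous_on_adj2 lba)
  have acH: "has_ac_derivative H (\<lambda>s. H s ** w s)"
   unfolding H_def by (rule has_ac_eq_rhs[OF ode_diff[OF F(1,2) G(1)]])
    (simp add: w_def mm_assoc adj2_cancel[OF detF])
  have cH: "continuous_on UNIV H" by (rule has_ac_continuous[OF acH])
  have lHw: "loc_int (\<lambda>s. H s ** w s)" by (rule has_ac_loc_int[OF acH])
  have H0: "H 0 = mat 1" using F G by (simp add: H_def)
  have nw: "norm (A ** w s) \<le> \<kappa> * norm A * n s" if "0 \<le> s" "s \<le> T" for A :: cmat2 and s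
  proof -
   have "norm (F s ** (b s - a s)) \<le> K * c * n s"
    using K(2)[of "F s" "b s - a s"] cFt(1)[OF that] K(1)
    by (smt (verit, best) mult_left_mono mult_right_mono n_def norm_ge_zero)
   then have "norm (w s) \<le> K * (K * c * n s) * c"
    using K(2)[of "F s ** (b s - a s)" "adj2 (F s)"] cFt(2)[OF that] K(1) c
    unfolding w_def by (smt (verit, best) mult_left_mono mult_right_mono norm_ge_zero mult_nonneg_nonneg)
   then have "K * norm A * norm (w s) \<le> K * norm A * (K * (K * c * n s) * c)"
    using K(1) by (intro mult_left_mono) auto
   then show ?thesis using K(2)[of A "w s"] by (simp add: \<kappa>_def ac_simps)
  qed
  have in_le: "integral {0..s} n \<le> d" if "0 \<le> s" "s \<le> T" for s
  proof -
   have "integral {0..s} n \<le> integral {0..T} n"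
    by (rule integral_subset_le) (use that ln in \<open>auto intro: loc_int_integrable simp: n_def\<close>)
   then show ?thesis using d(1) unfolding n_def by linarith
  qed
  have d0: "d \<ge> 0" using in_le[of 0] T by simp
  have kd: "\<kappa> * d \<le> 1 / 2"
   using mult_right_mono[OF B0(2) d0] d(2) by simp
  have intb: "norm (integral {0..s} (\<lambda>u. A u ** w u)) \<le> \<kappa> * S * d"
   if "\<And>u. 0 \<le> u \<Longrightarrow> u \<le> T \<Longrightarrow> norm (A u) \<le> S" "continuous_on UNIV A" "0 \<le> s" "s \<le> T" for A :: "real \<Rightarrow> cmat2" and S s
  proof -
   have S0: "S \<ge> 0" using that(1)[of 0] T norm_ge_zero order_trans by blast
   have "norm (integral {0..s} (\<lambda>u. A u ** w u)) \<le> integral {0..s} (\<lambda>u. (\<kappa> * S) * n u)"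
   proof (rule integral_norm_bound_integral[OF loc_int_integrable loc_int_integrable[OF loc_int_cmult[OF ln]]])
    show "loc_int (\<lambda>u. A u ** w u)" by (rule loc_int_bilinear[OF bounded_bilinear_mm that(2) lw])
    fix u assume u: "u \<in> {0..s}"
    then have "norm (A u ** w u) \<le> \<kappa> * norm (A u) * n u" using nw that by auto
    also have "\<dots> \<le> \<kappa> * S * n u" using that u pos by (intro mult_right_mono mult_left_mono) (auto simp: n_def)
    finally show "norm (A u ** w u) \<le> \<kappa> * S * n u" .
   qed
   also have "\<dots> = (\<kappa> * S) * integral {0..s} n" by (rule Henstock_Kurzweil_Integration.integral_mult_right)
   also have "\<dots> \<le> (\<kappa> * S) * d" using in_le[OF that(3,4)] S0 pos by (intro mult_left_mono) auto
   finally show ?thesis .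
  qed
  have Hint: "H s - mat 1 = integral {0..s} (\<lambda>u. H u ** w u)" if "0 \<le> s" for s
   using has_ac_integral[OF acH that] H0 by simp
  \<comment> \<open>A substitute for Gronwall's inequality: at a maximum of the norm of
    \<open>H\<close> the integral equation bounds the maximum by \<open>e1\<close> plus half of
    itself.\<close>
  obtain tm where tm: "tm \<in> {0..T}" "\<And>s. s \<in> {0..T} \<Longrightarrow> norm (H s) \<le> norm (H tm)"
  proof -
   have "continuous_on {0..T} (\<lambda>s. norm (H s))"
    by (rule continuous_on_norm[OF continuous_on_subset[OF cH]]) simp
   then show ?thesis using continuous_attains_sup[of "{0..T}" "\<lambda>s. norm (H s)"] T that by auto
  qed
  have "norm (H tm - mat 1) \<le> \<kappa> * norm (H tm) * d"
   using intb[of H "norm (H tm)" tm] tm cH Hint[of tm] by auto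
  then have "norm (H tm) \<le> e1 + \<kappa> * norm (H tm) * d"
   using norm_triangle_ineq2[of "H tm" "mat 1"] by (simp add: e1_def)
  also have "\<kappa> * norm (H tm) * d \<le> norm (H tm) * (1 / 2)"
   using mult_left_mono[OF kd norm_ge_zero[of "H tm"]] by (simp add: ac_simps)
  finally have "norm (H tm) \<le> 2 * e1" by simp
  then have Hb: "norm (H s) \<le> 2 * e1" if "0 \<le> s" "s \<le> T" for s using tm(2)[of s] that by auto
  have H1: "norm (H s - mat 1) \<le> \<kappa> * (2 * e1) * d" if "0 \<le> s" "s \<le> T" for s
   using intb[OF Hb cH that] Hint[OF that(1)] by simp
  \<comment> \<open>Inserting the first order estimate \<open>H1\<close> into the integral equation
    once more leaves a remainder quadratic in \<open>d\<close>.\<close>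
  have H2: "norm (H t - mat 1 - integral {0..t} w) \<le> \<kappa> * (\<kappa> * (2 * e1) * d) * d"
  proof -
   have "H t - mat 1 - integral {0..t} w = integral {0..t} (\<lambda>u. H u ** w u - w u)"
    unfolding Hint[OF t(1)] by (intro Henstock_Kurzweil_Integration.integral_diff[symmetric] loc_int_integrable lHw lw)
   also have "\<dots> = integral {0..t} (\<lambda>u. (H u - mat 1) ** w u)" by (simp add: mm.diff_left)
   also have "norm \<dots> \<le> \<kappa> * (\<kappa> * (2 * e1) * d) * d"
    by (rule intb[OF H1 _ t]) (auto intro!: continuous_intros cH)
   finally show ?thesis .
  qed
  have GF: "G t = H t ** F t" by (simp add: H_def mm_assoc adj2_cancel[OF detF])
  have mb: "norm (A ** F t) \<le> K * x * c" if "norm A \<le> x" for A :: cmat2 and x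
   using K(2)[of A "F t"] cFt(1)[OF t] that K(1) c
   by (smt (verit, best) mult_left_mono mult_right_mono norm_ge_zero mult_nonneg_nonneg)
  have "norm (G t - F t) \<le> K * (\<kappa> * (2 * e1) * d) * c"
   using mb[OF H1[OF t]] by (simp add: GF mm.diff_left)
  also have "\<dots> = (K * (2 * e1 * \<kappa>) * c) * d" by (simp add: ac_simps)
  also have "\<dots> \<le> B * d" by (intro mult_right_mono B0 d0)
  finally have r1: "norm (G t - F t) \<le> B * d" .
  have "norm (G t - F t - integral {0..t} w ** F t) \<le> K * (\<kappa> * (\<kappa> * (2 * e1) * d) * d) * c"
   using mb[OF H2] by (simp add: GF mm.diff_left)
  also have "\<dots> = (K * (2 * e1 * \<kappa> * \<kappa>) * c) * d\<^sup>2" by (simp add: ac_simps power2_eq_square)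
  also have "\<dots> \<le> B * d\<^sup>2" by (intro mult_right_mono B0) simp
  finally show "norm (G t - F t) \<le> B * d \<and>
    norm (G t - F t - integral {0..t} (\<lambda>s. F s ** (b s - a s) ** adj2 (F s)) ** F t) \<le> B * d\<^sup>2"
   using r1 by (simp add: w_def[abs_def])
 qed
qed

text \<open>The perturbation is measured in L1, and the remainder of the linearisation is quadratic
  in that norm. Continuity in the potential, the first variation of the monodromy and the W22
  estimate of curves all rest on it.\<close>

lemma frame_stability:
 assumes q: "loc_int q" and T: "T \<ge> 0"
 obtains B where "B > 0"
  "\<And>p d t. loc_int p \<Longrightarrow> integral {0..T} (\<lambda>s. norm (p s - q s)) \<le> d \<Longrightarrow> B * d \<le> 1 \<Longrightarrow> 0 \<le> t \<Longrightarrow> t \<le> T \<Longrightarrow>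
    norm (frame p t z - frame q t z) \<le> B * d \<and>
    norm (frame p t z - frame q t z - integral {0..t} (\<lambda>s. frame q s z **
     offd (p s - q s) ** adj2 (frame q s z)) ** frame q t z) \<le> B * d\<^sup>2"
proof -
 obtain B where B: "B > 0"
  "\<And>G b d t. has_ac_derivative G (\<lambda>t. G t ** b t) \<Longrightarrow> loc_int b \<Longrightarrow> G 0 = mat 1 \<Longrightarrow>
    integral {0..T} (\<lambda>s. norm (b s - alpha q z s)) \<le> d \<Longrightarrow> B * d \<le> 1 \<Longrightarrow> 0 \<le> t \<Longrightarrow> t \<le> T \<Longrightarrow> loc_int (alpha q z) \<Longrightarrow>
    norm (G t - frame q t z) \<le> B * d \<and>
    norm (G t - frame q t z - integral {0..t} (\<lambda>s. frame q s z ** (b s - alpha q z s) ** adj2 (frame q s z)) ** frame q t z) \<le> B * d\<^sup>2"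
  using ode_stability[OF has_ac_frame[OF q, of z] trace_alpha frame_0[OF q] T] by blast
 show ?thesis
 proof (rule that[OF B(1)])
  fix p d t
  assume p: "loc_int p" "integral {0..T} (\<lambda>s. norm (p s - q s)) \<le> d" "B * d \<le> 1" "0 \<le> t" "t \<le> T"
  have eq: "alpha p z s - alpha q z s = offd (p s - q s)" for s
   by (simp add: cmat2_eq_iff diff_divide_distrib)
  have lpq: "loc_int (\<lambda>s. p s - q s)" by (intro loc_int_diff p q)
  have "integral {0..T} (\<lambda>s. norm (alpha p z s - alpha q z s)) \<le> integral {0..T} (\<lambda>s. norm (p s - q s))"
   unfolding eq by (intro integral_le norm_offd_le loc_int_norm_integrable lpq
     loc_int_linear[OF bounded_linear_offd])
  then have "integral {0..T} (\<lambda>s. norm (alpha p z s - alpha q z s)) \<le> d" using p(2) by linarith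
  from B(2)[OF has_ac_frame[OF p(1)] loc_int_alpha[OF p(1)] frame_0[OF p(1)] this p(3-5) loc_int_alpha[OF q]]
  show "norm (frame p t z - frame q t z) \<le> B * d \<and>
    norm (frame p t z - frame q t z - integral {0..t} (\<lambda>s. frame q s z **
     offd (p s - q s) ** adj2 (frame q s z)) ** frame q t z) \<le> B * d\<^sup>2"
   unfolding eq .
 qed
qed

text \<open>Duhamel's formula with no remainder. The factor \<open>w - z\<close> comes out exactly,
  which is what the analysis of zeros near a double point needs.\<close>

lemma frame_spectral_diff:
 assumes q: "loc_int q" and T: "T \<ge> 0"
 shows "frame q T w - frame q T z =
  mat (w - z) ** (integral {0..T} (\<lambda>s. frame q s w ** dgn (\<i> / 2) ** adj2 (frame q s z)) ** frame q T z)"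
proof -
 let ?D = "\<lambda>s. frame q s w ** dgn (\<i> / 2) ** adj2 (frame q s z)"
 have c: "continuous_on UNIV ?D"
  by (intro continuous_on_mm continuous_on_adj2 continuous_on_frame q continuous_intros)
 have eq: "alpha q w s - alpha q z s = mat (w - z) ** dgn (\<i> / 2)" for s
  by (simp add: m2 field_simps)
 have "has_ac_derivative (\<lambda>t. frame q t w ** adj2 (frame q t z)) (\<lambda>s. mat (w - z) ** ?D s)"
  by (rule has_ac_eq_rhs[OF ode_diff[OF has_ac_frame[OF q] trace_alpha has_ac_frame[OF q]]])
   (simp add: eq mm_assoc mat_left_commute)
 from has_ac_integral[OF this T]
 have "integral {0..T} (\<lambda>s. mat (w - z) ** ?D s) = frame q T w ** adj2 (frame q T z) - mat 1"
  using q by simp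
 moreover have "integral {0..T} (\<lambda>s. mat (w - z) ** ?D s) = mat (w - z) ** integral {0..T} ?D"
  using integral_linear[OF loc_int_integrable[OF loc_int_continuous[OF c]] mm.bounded_linear_right, of 0 T "mat (w - z)"]
  by (simp add: o_def)
 ultimately have "mat (w - z) ** integral {0..T} ?D ** frame q T z =
   (frame q T w ** adj2 (frame q T z) - mat 1) ** frame q T z" by simp
 also have "\<dots> = frame q T w - frame q T z"
  by (simp add: mm.diff_left mm_assoc adj2_cancel[OF det_frame[OF q]])
 finally show ?thesis by (simp add: mm_assoc)
qed

text \<open>A change of the spectral parameter changes \<open>alpha\<close> by \<open>w - z\<close>
  times a constant matrix, so the quadratic estimate of \<open>ode_stability\<close> is complex
  differentiability.\<close>

lemma frame_holomorphic:
 assumes q: "loc_int q" and T: "T \<ge> 0"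
 shows "(\<lambda>z. frame q T z $ i $ j) holomorphic_on UNIV"
proof -
 have "\<exists>D. ((\<lambda>z. frame q T z $ i $ j) has_field_derivative D) (at z)" for z
 proof -
  define R where "R w = integral {0..T} (\<lambda>s. frame q s w ** dgn (\<i> / 2) ** adj2 (frame q s z)) ** frame q T z" for w
  obtain B where B: "B > 0"
   "\<And>G b d t. has_ac_derivative G (\<lambda>t. G t ** b t) \<Longrightarrow> loc_int b \<Longrightarrow> G 0 = mat 1 \<Longrightarrow>
    integral {0..T} (\<lambda>s. norm (b s - alpha q z s)) \<le> d \<Longrightarrow> B * d \<le> 1 \<Longrightarrow> 0 \<le> t \<Longrightarrow> t \<le> T \<Longrightarrow> loc_int (alpha q z) \<Longrightarrow>
    norm (G t - frame q t z) \<le> B * d \<and>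
    norm (G t - frame q t z - integral {0..t} (\<lambda>s. frame q s z ** (b s - alpha q z s) ** adj2 (frame q s z)) ** frame q t z) \<le> B * d\<^sup>2"
   using ode_stability[OF has_ac_frame[OF q, of z] trace_alpha frame_0[OF q] T] by blast
  define D where "D = (integral {0..T} (\<lambda>s. frame q s z ** dgn (\<i> / 2) ** adj2 (frame q s z)) ** frame q T z)"
  have est: "norm (frame q T w $ i $ j - frame q T z $ i $ j - (w - z) * D $ i $ j) \<le> (B * T\<^sup>2) * norm (w - z) * norm (w - z)"
   if "B * (T * norm (w - z)) \<le> 1" for w
  proof -
   have eq: "alpha q w s - alpha q z s = mat (w - z) ** dgn (\<i> / 2)" for s
    by (simp add: m2 field_simps)
   have n: "norm (mat (w - z) ** dgn (\<i> / 2)) \<le> norm (w - z)"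
    by (rule order_trans[OF norm_le_entries]) (simp add: mat_mm norm_mult)
   have "integral {0..T} (\<lambda>s. norm (alpha q w s - alpha q z s)) \<le> integral {0..T} (\<lambda>s::real. norm (w - z))"
    unfolding eq by (intro integral_le n) auto
   then have i: "integral {0..T} (\<lambda>s. norm (alpha q w s - alpha q z s)) \<le> T * norm (w - z)" using T by simp
   have c: "continuous_on UNIV (\<lambda>s. frame q s z ** dgn (\<i> / 2) ** adj2 (frame q s z))"
    by (intro continuous_on_mm continuous_on_adj2 continuous_on_frame q continuous_intros)
   have "integral {0..T} (\<lambda>s. frame q s z ** (alpha q w s - alpha q z s) ** adj2 (frame q s z))
     = integral {0..T} (\<lambda>s. mat (w - z) ** (frame q s z ** dgn (\<i> / 2) ** adj2 (frame q s z)))"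
    by (simp add: eq mm_assoc mat_left_commute)
   also have "\<dots> = mat (w - z) ** integral {0..T} (\<lambda>s. frame q s z ** dgn (\<i> / 2) ** adj2 (frame q s z))"
    using integral_linear[OF loc_int_integrable[OF loc_int_continuous[OF c]] mm.bounded_linear_right, of 0 T "mat (w - z)"]
    by (simp add: o_def)
   finally have "integral {0..T} (\<lambda>s. frame q s z ** (alpha q w s - alpha q z s) ** adj2 (frame q s z)) ** frame q T z
     = mat (w - z) ** D" by (simp add: D_def mm_assoc)
   with B(2)[OF has_ac_frame[OF q] loc_int_alpha[OF q] frame_0[OF q] i that T order_refl loc_int_alpha[OF q]]
   have "norm (frame q T w - frame q T z - mat (w - z) ** D) \<le> B * (T * norm (w - z))\<^sup>2" by simp
   then have "norm ((frame q T w - frame q T z - mat (w - z) ** D) $ i $ j) \<le> B * (T * norm (w - z))\<^sup>2"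
    using norm_entry_le order_trans by blast
   then show ?thesis by (simp add: mat_mm power2_eq_square ac_simps)
  qed
  have "((\<lambda>w. frame q T w $ i $ j) has_field_derivative D $ i $ j) (at z)"
   unfolding has_field_derivative_def has_derivative_at_alt
  proof (intro conjI allI impI)
   show "bounded_linear ((*) (D $ i $ j))" by (rule bounded_linear_mult_right)
   fix e :: real assume e: "e > 0"
   \<comment> \<open>The first bound keeps the stability estimate applicable, the second makes its
     quadratic remainder at most e |w - z|.\<close>
   define d where "d = min (1 / (B * (T + 1))) (e / (B * T\<^sup>2 + 1))"
   have BT: "B * T\<^sup>2 \<ge> 0" using B(1) by simp
   have "d > 0" using B(1) T e BT by (simp add: d_def add_nonneg_pos)
   moreover have "norm (frame q T w $ i $ j - frame q T z $ i $ j - D $ i $ j * (w - z)) \<le> e * norm (w - z)"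
    if "norm (w - z) < d" for w
   proof -
    have "norm (w - z) \<le> 1 / (B * (T + 1))" using that by (simp add: d_def)
    moreover have "B * (T + 1) > 0" using B(1) T by simp
    ultimately have "norm (w - z) * (B * (T + 1)) \<le> 1" by (simp only: pos_le_divide_eq)
    moreover have "B * (T * norm (w - z)) \<le> norm (w - z) * (B * (T + 1))"
     using B(1) T by (simp add: algebra_simps)
    ultimately have a: "B * (T * norm (w - z)) \<le> 1" by linarith
    have "norm (w - z) \<le> e / (B * T\<^sup>2 + 1)" using that by (simp add: d_def)
    moreover have "B * T\<^sup>2 + 1 > 0" using BT by simp
    ultimately have "norm (w - z) * (B * T\<^sup>2 + 1) \<le> e" by (simp only: pos_le_divide_eq)
    moreover have "(B * T\<^sup>2) * norm (w - z) \<le> norm (w - z) * (B * T\<^sup>2 + 1)" by (simp add: algebra_simps)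
    ultimately have b: "(B * T\<^sup>2) * norm (w - z) \<le> e" by linarith
    show ?thesis
     using est[OF a] mult_right_mono[OF b norm_ge_zero[of "w - z"]] by (simp add: mult.commute)
   qed
   ultimately show "\<exists>d>0. \<forall>y. norm (y - z) < d \<longrightarrow> norm (frame q T y $ i $ j - frame q T z $ i $ j - D $ i $ j * (y - z)) \<le> e * norm (y - z)"
    by blast
  qed
  then show ?thesis by blast
 qed
 then show ?thesis by (auto simp: holomorphic_on_def field_differentiable_def)
qed

section \<open>Asymptotics of the monodromy\<close>

lemma vector_derivative_bound:
 fixes f :: "real \<Rightarrow> complex"
 assumes d: "\<And>s. (f has_vector_derivative f' s) (at s)" and c: "continuous_on UNIV f'" and t: "0 \<le> t"
  and b: "\<And>s. 0 \<le> s \<Longrightarrow> s \<le> t \<Longrightarrow> norm (f' s) \<le> B"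
 shows "norm (f t - f 0) \<le> B * t"
proof -
 have "norm (f t - f 0) \<le> integral {0..t} (\<lambda>s. norm (f' s))"
  by (rule has_ac_norm_bound[OF has_vector_derivative_imp_ac[OF d c] t])
 also have "\<dots> \<le> integral {0..t} (\<lambda>s. B)"
  by (rule integral_le) (use b loc_int_norm_integrable[OF loc_int_continuous[OF c]] in auto)
 also have "\<dots> = B * t" using t by simp
 finally show ?thesis .
qed

lemma has_vd_exp: "((\<lambda>t. exp ((c :: complex) * of_real t)) has_vector_derivative c * exp (c * of_real t)) (at t)"
 by (rule has_ac_imp_vector_derivative[OF has_ac_exp]) (intro continuous_intros)

lemma has_vd_cnj: "(f has_vector_derivative f') (at t) \<Longrightarrow> ((\<lambda>t. cnj (f t)) has_vector_derivative cnj f') (at t)"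
 by (rule bounded_linear.has_vector_derivative[OF bounded_linear_cnj])

lemma has_vd_mult:
 fixes f g :: "real \<Rightarrow> complex"
 assumes "(f has_vector_derivative f') (at t)" "(g has_vector_derivative g') (at t)"
 shows "((\<lambda>t. f t * g t) has_vector_derivative f t * g' + f' * g t) (at t)"
 by (rule has_vector_derivative_mult[OF assms])

lemma vd_continuous: "(\<And>t. (f has_vector_derivative f' t) (at t)) \<Longrightarrow> continuous_on UNIV f"
 by (meson continuous_at_imp_continuous_on has_vector_derivative_continuous)

text \<open>
 For \<open>Im z \<le> 0\<close> the sum \<open>|u|\<^sup>2 + |v|\<^sup>2\<close> decreases, so that no exponential bound is lost.
\<close>

lemma row_asymp:
 fixes q q' u v :: "real \<Rightarrow> complex"
 assumes q: "\<And>t. (q has_vector_derivative q' t) (at t)" "continuous_on UNIV q'"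
  and u: "\<And>t. (u has_vector_derivative - cnj (q t) * v t / 2) (at t)"
  and v: "\<And>t. (v has_vector_derivative q t * u t / 2 - \<i> * z * v t) (at t)"
  and init: "(norm (u 0))\<^sup>2 + (norm (v 0))\<^sup>2 \<le> 1"
  and z: "Im z \<le> 0" "z \<noteq> 0" and t: "0 \<le> t" "t \<le> T"
  and Q: "\<And>t. 0 \<le> t \<Longrightarrow> t \<le> T \<Longrightarrow> norm (q t) \<le> Q" "\<And>t. 0 \<le> t \<Longrightarrow> t \<le> T \<Longrightarrow> norm (q' t) \<le> Q"
 shows "norm (v t - exp (- \<i> * z * t) * v 0) \<le> (Q + T * (Q + Q * Q)) / norm z"
  and "norm (u t - u 0) \<le> (Q + T * (Q + Q * (Q + T * (Q + Q * Q)))) / norm z"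
proof -
 have cq: "continuous_on UNIV q" by (rule vd_continuous[OF q(1)])
 have cu: "continuous_on UNIV u" by (rule vd_continuous[OF u])
 have cv: "continuous_on UNIV v" by (rule vd_continuous[OF v])
 have Q0: "Q \<ge> 0" using Q(1)[of t] t norm_ge_zero order_trans by blast
 have nz: "norm z > 0" using z by simp
 define E where "E t = (norm (u t))\<^sup>2 + (norm (v t))\<^sup>2" for t
 have Ed: "(E has_real_derivative 2 * Im z * (norm (v t))\<^sup>2) (at t)" for t
 proof -
  have "((\<lambda>t. u t * cnj (u t) + v t * cnj (v t)) has_vector_derivative
   ((u t * cnj (- cnj (q t) * v t / 2) + (- cnj (q t) * v t / 2) * cnj (u t)) +
    (v t * cnj (q t * u t / 2 - \<i> * z * v t) + (q t * u t / 2 - \<i> * z * v t) * cnj (v t)))) (at t)"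
   by (intro has_vector_derivative_add has_vd_mult has_vd_cnj u v)
  from bounded_linear.has_vector_derivative[OF bounded_linear_Re this]
  have "((\<lambda>t. Re (u t * cnj (u t) + v t * cnj (v t))) has_vector_derivative
   Re ((u t * cnj (- cnj (q t) * v t / 2) + (- cnj (q t) * v t / 2) * cnj (u t)) +
    (v t * cnj (q t * u t / 2 - \<i> * z * v t) + (q t * u t / 2 - \<i> * z * v t) * cnj (v t)))) (at t)" .
  moreover have "Re (u t * cnj (u t) + v t * cnj (v t)) = E t" for t
   unfolding E_def cmod_power2 by (simp add: power2_eq_square)
  moreover have "Re ((u t * cnj (- cnj (q t) * v t / 2) + (- cnj (q t) * v t / 2) * cnj (u t)) +
    (v t * cnj (q t * u t / 2 - \<i> * z * v t) + (q t * u t / 2 - \<i> * z * v t) * cnj (v t))) = 2 * Im z * (norm (v t))\<^sup>2"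
   unfolding cmod_power2 by (simp add: power2_eq_square algebra_simps)
  ultimately show ?thesis by (simp add: has_real_derivative_iff_has_vector_derivative)
 qed
 have E1: "E s \<le> 1" if "0 \<le> s" for s
 proof -
  have "E s \<le> E 0"
  proof (rule DERIV_nonpos_imp_nonincreasing[OF that])
   fix x
   show "\<exists>y. (E has_real_derivative y) (at x) \<and> y \<le> 0"
    by (rule exI[of _ "2 * Im z * (norm (v x))\<^sup>2"]) (use Ed z(1) in \<open>simp add: mult_nonpos_nonneg\<close>)
  qed
  then show ?thesis using init by (simp add: E_def)
 qed
 have n1: "norm (u s) \<le> 1" "norm (v s) \<le> 1" if "0 \<le> s" for s
 proof -
  have "(norm (u s))\<^sup>2 \<le> 1" "(norm (v s))\<^sup>2 \<le> 1" using E1[OF that] by (auto simp: E_def intro: order_trans[rotated])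
  then show "norm (u s) \<le> 1" "norm (v s) \<le> 1" by (auto simp: power_le_one_iff abs_square_le_1)
 qed
 have ex: "norm (exp (\<i> * z * complex_of_real s)) = exp (- Im z * s)" for s by simp
 define c where "c = 1 / (2 * (\<i> * z))"
 have nc: "norm c = 1 / (2 * norm z)" by (simp add: c_def norm_divide norm_mult)
 have ciz: "c * (\<i> * z) = 1 / 2" using z(2) by (simp add: c_def)
 let ?e = "\<lambda>t. exp (\<i> * z * complex_of_real t)"
 let ?f = "\<lambda>t. exp (- (\<i> * z) * complex_of_real t)"
 have ef: "?f s * ?e s = 1" for s by (simp flip: exp_add)
 have cev: "continuous_on UNIV ?e" "continuous_on UNIV ?f" by (intro continuous_intros)+
 have vb: "norm (v s - ?f s * v 0) \<le> (Q + T * (Q + Q * Q)) / norm z" if s: "0 \<le> s" "s \<le> T" for s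
 proof -
  \<comment> \<open>Integration by parts: \<open>v * ?e\<close> has the oscillating derivative
    \<open>q u ?e / 2\<close>, and subtracting its leading antiderivative \<open>c q u ?e\<close>
    with c = 1 / (2 i z) leaves a derivative of order 1 / |z|.\<close>
  define V where "V t = v t * ?e t - c * (q t * u t * ?e t)" for t
  define V' where "V' t = - c * ((q' t * u t - q t * cnj (q t) * v t / 2) * ?e t)" for t
  have Vd: "(V has_vector_derivative V' t) (at t)" for t
  proof -
   have "((\<lambda>t. v t * ?e t - c * (q t * u t * ?e t)) has_vector_derivative
     (v t * (\<i> * z * ?e t) + (q t * u t / 2 - \<i> * z * v t) * ?e t)
     - c * ((q t * u t) * (\<i> * z * ?e t) + (q t * (- cnj (q t) * v t / 2) + q' t * u t) * ?e t)) (at t)"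
    by (intro has_vector_derivative_diff has_vd_mult v has_vd_exp q u
      bounded_linear.has_vector_derivative[OF bounded_linear_mult_right])
   moreover have "(v t * (\<i> * z * ?e t) + (q t * u t / 2 - \<i> * z * v t) * ?e t)
     - c * ((q t * u t) * (\<i> * z * ?e t) + (q t * (- cnj (q t) * v t / 2) + q' t * u t) * ?e t) = V' t"
   proof -
    have "c * ((q t * u t) * (\<i> * z * ?e t)) = (c * (\<i> * z)) * (q t * u t) * ?e t" by simp
    also have "\<dots> = q t * u t * ?e t / 2" unfolding ciz by simp
    finally have "c * ((q t * u t) * (\<i> * z * ?e t)) = q t * u t * ?e t / 2" .
    then show ?thesis unfolding V'_def distrib_left by (simp add: algebra_simps)
   qed
   ultimately show ?thesis unfolding V_def[abs_def] by simp
  qed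
  have cV: "continuous_on UNIV V'" unfolding V'_def
   by (intro continuous_intros cq q(2) cu cv) auto
  have "norm (V s - V 0) \<le> ((Q + Q * Q) * exp (- Im z * s) / (2 * norm z)) * s"
  proof (rule vector_derivative_bound[OF Vd cV s(1)])
   fix r assume r: "0 \<le> r" "r \<le> s"
   have "norm (q' r * u r - q r * cnj (q r) * v r / 2) \<le> norm (q' r) * norm (u r) + norm (q r) * norm (q r) * norm (v r) / 2"
    by (rule order_trans[OF norm_triangle_ineq4]) (simp add: norm_mult norm_divide)
   also have "\<dots> \<le> Q * 1 + Q * Q * 1 / 2"
    using Q(1,2)[of r] n1[of r] r s Q0 by (intro add_mono mult_mono divide_right_mono) auto
   also have "\<dots> \<le> Q + Q * Q" using Q0 by simp
   finally have a: "norm (q' r * u r - q r * cnj (q r) * v r / 2) \<le> Q + Q * Q" .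
   have b: "norm (?e r) \<le> exp (- Im z * s)" unfolding ex using z(1) r by (simp add: mult_left_mono_neg)
   have "norm (V' r) = norm (q' r * u r - q r * cnj (q r) * v r / 2) * norm (?e r) / (2 * norm z)"
    by (simp only: V'_def norm_mult norm_minus_cancel nc) simp
   also have "\<dots> \<le> (Q + Q * Q) * exp (- Im z * s) / (2 * norm z)"
    using a b Q0 nz by (intro divide_right_mono mult_mono) auto
   finally show "norm (V' r) \<le> (Q + Q * Q) * exp (- Im z * s) / (2 * norm z)" .
  qed
  then have "norm (?f s * (V s - V 0)) \<le> norm (?f s) * (((Q + Q * Q) * exp (- Im z * s) / (2 * norm z)) * s)"
   unfolding norm_mult by (rule mult_left_mono) simp
  also have "norm (?f s) = exp (Im z * s)" by simp
  also have "exp (Im z * s) * (((Q + Q * Q) * exp (- Im z * s) / (2 * norm z)) * s) = (Q + Q * Q) / (2 * norm z) * s"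
  proof -
   have gen: "a * ((x * b / n) * s) = (a * b) * (x / n * s)" for a b x n s :: real by simp
   have ee: "exp (Im z * s) * exp (- Im z * s) = 1" by (simp flip: exp_add)
   show ?thesis unfolding gen ee by simp
  qed
  also have "\<dots> \<le> (Q + Q * Q) / norm z * T" using s Q0 nz by (intro mult_mono) (auto simp: field_simps)
  finally have A: "norm (?f s * (V s - V 0)) \<le> (Q + Q * Q) / norm z * T" .
  have "?f s * V s = v s - c * (q s * u s)"
  proof -
   have "?f s * V s = (?f s * ?e s) * (v s - c * (q s * u s))" by (simp add: V_def algebra_simps)
   then show ?thesis unfolding ef by simp
  qed
  moreover have "?f s * V 0 = ?f s * v 0 - c * (?f s * q 0 * u 0)" by (simp add: V_def algebra_simps)
  ultimately have eq: "v s - ?f s * v 0 = ?f s * (V s - V 0) + c * (q s * u s) - c * (?f s * q 0 * u 0)"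
   by (simp add: algebra_simps)
  have B1: "norm (c * (q s * u s)) \<le> Q / (2 * norm z)"
   using mult_mono[OF Q(1)[OF s] n1(1)[OF s(1)]] Q0 nz by (simp add: norm_mult nc divide_right_mono)
  have "norm (?f s) \<le> 1" using z(1) s by (simp add: mult_nonpos_nonneg)
  then have "norm (?f s) * (norm (q 0) * norm (u 0)) \<le> 1 * (Q * 1)"
   using Q(1)[of 0] n1(1)[of 0] s Q0 by (intro mult_mono) auto
  then have B2: "norm (c * (?f s * q 0 * u 0)) \<le> Q / (2 * norm z)"
   using nz by (simp add: norm_mult nc divide_right_mono mult.assoc del: norm_exp_eq_Re)
  have "norm (v s - ?f s * v 0) \<le> norm (?f s * (V s - V 0)) + norm (c * (q s * u s)) + norm (c * (?f s * q 0 * u 0))"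
   unfolding eq by (rule order_trans[OF norm_triangle_ineq4 add_right_mono[OF norm_triangle_ineq]])
  also have "\<dots> \<le> (Q + Q * Q) / norm z * T + Q / (2 * norm z) + Q / (2 * norm z)" using A B1 B2 by linarith
  also have "\<dots> = (Q + T * (Q + Q * Q)) / norm z" using nz by (simp add: field_simps)
  finally show ?thesis .
 qed
 show "norm (v t - exp (- \<i> * z * t) * v 0) \<le> (Q + T * (Q + Q * Q)) / norm z"
  using vb[OF t] by simp
 define C1 where "C1 = Q + T * (Q + Q * Q)"
 have C1: "C1 \<ge> 0" using Q0 t by (simp add: C1_def)
 \<comment> \<open>In the equation of \<open>u\<close> the estimate just proved replaces
   \<open>v\<close> by the free solution \<open>?f t * v 0\<close>, whose oscillation is integrated
   by parts in turn.\<close>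
 define U where "U t = u t - c * (cnj (q t) * v 0 * ?f t)" for t
 define U' where "U' t = - cnj (q t) * (v t - ?f t * v 0) / 2 - c * (cnj (q' t) * v 0 * ?f t)" for t
 have Ud: "(U has_vector_derivative U' s) (at s)" for s
 proof -
  have "(U has_vector_derivative - cnj (q s) * v s / 2 - c * ((cnj (q s) * v 0) * (- (\<i> * z) * ?f s) + (cnj (q s) * 0 + cnj (q' s) * v 0) * ?f s)) (at s)"
   unfolding U_def[abs_def]
   by (intro has_vector_derivative_diff has_vd_mult v has_vd_exp q u has_vd_cnj has_vector_derivative_const
      bounded_linear.has_vector_derivative[OF bounded_linear_mult_right])
  moreover have "- cnj (q s) * v s / 2 - c * ((cnj (q s) * v 0) * (- (\<i> * z) * ?f s) + (cnj (q s) * 0 + cnj (q' s) * v 0) * ?f s) = U' s"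
  proof -
   have "c * ((cnj (q s) * v 0) * (- (\<i> * z) * ?f s)) = - ((c * (\<i> * z)) * (cnj (q s) * v 0) * ?f s)" by simp
   also have "\<dots> = - (cnj (q s) * v 0 * ?f s / 2)" unfolding ciz by simp
   finally have "c * ((cnj (q s) * v 0) * (- (\<i> * z) * ?f s)) = - (cnj (q s) * v 0 * ?f s / 2)" .
   then show ?thesis unfolding U'_def distrib_left by (simp add: algebra_simps diff_divide_distrib)
  qed
  ultimately show ?thesis by simp
 qed
 have cU: "continuous_on UNIV U'" unfolding U'_def
  by (intro continuous_intros cq q(2) cu cv) auto
 have fb: "norm (?f s) \<le> 1" if "0 \<le> s" for s using z(1) that by (simp add: mult_nonpos_nonneg)
 have v0: "norm (v 0) \<le> 1" using n1(2)[of 0] by simp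
 have A: "norm (U t - U 0) \<le> ((Q * C1 + Q) / norm z) * t"
 proof (rule vector_derivative_bound[OF Ud cU t(1)])
  fix s assume s: "0 \<le> s" "s \<le> t"
  have "norm (cnj (q s) * (v s - ?f s * v 0) / 2) \<le> Q * (C1 / norm z) / 2"
   unfolding norm_divide norm_mult complex_mod_cnj norm_numeral
   using Q(1)[of s] vb[of s] s t Q0 by (intro divide_right_mono mult_mono) (auto simp: C1_def)
  moreover have "norm (c * (cnj (q' s) * v 0 * ?f s)) \<le> 1 / (2 * norm z) * (Q * 1 * 1)"
   unfolding norm_mult complex_mod_cnj nc
   using Q(2)[of s] v0 fb[OF s(1)] s t Q0 by (intro mult_left_mono mult_mono) auto
  moreover have "norm (U' s) \<le> norm (cnj (q s) * (v s - ?f s * v 0) / 2) + norm (c * (cnj (q' s) * v 0 * ?f s))"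
   unfolding U'_def by (rule order_trans[OF norm_triangle_ineq4]) simp
  ultimately have "norm (U' s) \<le> Q * (C1 / norm z) / 2 + 1 / (2 * norm z) * (Q * 1 * 1)" by linarith
  also have "\<dots> = ((Q * C1 + Q) / norm z) / 2" using nz by (simp add: field_simps)
  also have "\<dots> \<le> (Q * C1 + Q) / norm z"
  proof -
   have "0 \<le> (Q * C1 + Q) / norm z" using Q0 C1 by simp
   moreover have "x / 2 \<le> x" if "0 \<le> x" for x :: real using that by simp
   ultimately show ?thesis by blast
  qed
  finally show "norm (U' s) \<le> (Q * C1 + Q) / norm z" .
 qed
 have eq: "u t - u 0 = (U t - U 0) + c * (cnj (q t) * v 0 * ?f t) - c * (cnj (q 0) * v 0 * ?f 0)"
  by (simp add: U_def)
 have cb: "norm (c * (cnj (q s) * v 0 * ?f s)) \<le> 1 / (2 * norm z) * (Q * 1 * 1)" if "0 \<le> s" "s \<le> T" for s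
  unfolding norm_mult complex_mod_cnj nc
  using Q(1)[of s] v0 fb[OF that(1)] that Q0 by (intro mult_left_mono mult_mono) auto
 have "norm (u t - u 0) \<le> norm (U t - U 0) + norm (c * (cnj (q t) * v 0 * ?f t)) + norm (c * (cnj (q 0) * v 0 * ?f 0))"
  unfolding eq by (rule order_trans[OF norm_triangle_ineq4 add_right_mono[OF norm_triangle_ineq]])
 also have "\<dots> \<le> ((Q * C1 + Q) / norm z) * t + Q / norm z"
  using A cb[OF t] cb[of 0] t by simp
 also have "\<dots> \<le> ((Q * C1 + Q) / norm z) * T + Q / norm z"
  using t Q0 C1 nz by (intro add_mono mult_left_mono) auto
 also have "\<dots> = (Q + T * (Q + Q * C1)) / norm z" using nz by (simp add: field_simps)
 finally show "norm (u t - u 0) \<le> (Q + T * (Q + Q * (Q + T * (Q + Q * Q)))) / norm z"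
  unfolding C1_def .
qed

lemma frame_vd:
 assumes "continuous_on UNIV q"
 shows "((\<lambda>t. frame q t z $ i $ j) has_vector_derivative (frame q t z ** alpha q z t) $ i $ j) (at t)"
proof -
 have l: "loc_int q" by (rule loc_int_continuous[OF assms])
 have c: "continuous_on UNIV (alpha q z)"
  unfolding alpha_eq by (intro continuous_intros bounded_linear.continuous_on[OF bounded_linear_offd] assms)
 have "((\<lambda>t. frame q t z) has_vector_derivative frame q t z ** alpha q z t) (at t)"
  by (rule has_ac_imp_vector_derivative[OF has_ac_frame[OF l]]) (intro continuous_on_mm continuous_on_frame l c)
 from bounded_linear.has_vector_derivative[OF bounded_linear_entry this] show ?thesis .
qed

text \<open>Comparison with the free frame diag(exp(i z t / 2), exp(-i z t / 2)): relative to its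
  exponential growth, the error decays like 1 / |z| uniformly on [0, T].\<close>

definition asymp_bound :: "(real \<Rightarrow> complex) \<Rightarrow> real \<Rightarrow> real \<Rightarrow> bool" where
 "asymp_bound q T C \<longleftrightarrow> (\<forall>z t. z \<noteq> 0 \<longrightarrow> 0 \<le> t \<longrightarrow> t \<le> T \<longrightarrow>
   (let F = frame q t z; b = C * exp (\<bar>Im z\<bar> * t / 2) / norm z in
   norm (F $ 1 $ 1 - exp (\<i> * z * t / 2)) \<le> b \<and> norm (F $ 1 $ 2) \<le> b \<and> norm (F $ 2 $ 1) \<le> b \<and>
   norm (F $ 2 $ 2 - exp (- \<i> * z * t / 2)) \<le> b))"

text \<open>Each row of the frame, rescaled by exp(-i z t / 2), satisfies the system of
  \<open>row_asymp\<close> in the closed lower half plane; the upper half plane follows by the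
  reflection \<open>frame_cnj\<close>. The potential is assumed continuously differentiable because
  of the integration by parts there.\<close>

lemma frame_asymp:
 assumes q: "\<And>t. (q has_vector_derivative q' t) (at t)" "continuous_on UNIV q'" and T: "T > 0"
 obtains C where "C > 0" "asymp_bound q T C"
proof -
 have cq: "continuous_on UNIV q" by (rule vd_continuous[OF q(1)])
 have l: "loc_int q" by (rule loc_int_continuous[OF cq])
 have "bounded (q ` {0..T})" "bounded (q' ` {0..T})"
  by (intro compact_imp_bounded compact_continuous_image compact_Icc continuous_on_subset[OF cq] continuous_on_subset[OF q(2)], simp)+
 then obtain B1 B2 where B: "\<forall>x\<in>q ` {0..T}. norm x \<le> B1" "\<forall>x\<in>q' ` {0..T}. norm x \<le> B2"
  unfolding bounded_iff by meson
 define Q where "Q = max 1 (max B1 B2)"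
 have Q: "\<And>t. 0 \<le> t \<Longrightarrow> t \<le> T \<Longrightarrow> norm (q t) \<le> Q" "\<And>t. 0 \<le> t \<Longrightarrow> t \<le> T \<Longrightarrow> norm (q' t) \<le> Q"
  using B by (auto simp: Q_def le_max_iff_disj)
 have Q1: "Q \<ge> 1" by (simp add: Q_def)
 define C1 where "C1 = Q + T * (Q + Q * Q)"
 define C2 where "C2 = Q + T * (Q + Q * C1)"
 have C12: "C1 > 0" "C2 > 0" using Q1 T by (auto simp: C1_def C2_def intro!: add_pos_nonneg)
 define C where "C = C1 + C2"
 have lower: "norm (frame q t z $ 1 $ 1 - exp (\<i> * z * t / 2)) \<le> C * exp (\<bar>Im z\<bar> * t / 2) / norm z"
   "norm (frame q t z $ 1 $ 2) \<le> C * exp (\<bar>Im z\<bar> * t / 2) / norm z"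
   "norm (frame q t z $ 2 $ 1) \<le> C * exp (\<bar>Im z\<bar> * t / 2) / norm z"
   "norm (frame q t z $ 2 $ 2 - exp (- \<i> * z * t / 2)) \<le> C * exp (\<bar>Im z\<bar> * t / 2) / norm z"
  if z: "z \<noteq> 0" "Im z \<le> 0" and t: "0 \<le> t" "t \<le> T" for z t
 proof -
  have row: "norm (frame q t z $ i $ 2 - exp (- \<i> * z * t / 2) * (mat 1 :: cmat2) $ i $ 2) \<le> C * exp (\<bar>Im z\<bar> * t / 2) / norm z \<and>
    norm (frame q t z $ i $ 1 - exp (\<i> * z * t / 2) * (mat 1 :: cmat2) $ i $ 1) \<le> C * exp (\<bar>Im z\<bar> * t / 2) / norm z" for i :: 2
  proof -
   \<comment> \<open>This factor freezes the free evolution of the first entry and leaves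
     \<open>v\<close> with the factor exp(-i z t), bounded for Im z <= 0.\<close>
   define g where "g = (\<lambda>t. exp (- (\<i> * z / 2) * complex_of_real t))"
   have gd: "(g has_vector_derivative - (\<i> * z / 2) * g t) (at t)" for t unfolding g_def by (rule has_vd_exp)
   define u where "u t = g t * frame q t z $ i $ 1" for t
   define v where "v t = g t * frame q t z $ i $ 2" for t
   have ud: "(u has_vector_derivative - cnj (q t) * v t / 2) (at t)" for t
    unfolding u_def[abs_def]
    by (rule has_vector_derivative_eq_rhs[OF has_vd_mult[OF gd frame_vd[OF cq]]])
     (simp add: mm_nth v_def algebra_simps)
   have vd: "(v has_vector_derivative q t * u t / 2 - \<i> * z * v t) (at t)" for t
    unfolding v_def[abs_def]
    by (rule has_vector_derivative_eq_rhs[OF has_vd_mult[OF gd frame_vd[OF cq]]])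
     (simp add: mm_nth u_def algebra_simps)
   have g0: "g 0 = 1" by (simp add: g_def)
   have init: "u 0 = (mat 1 :: cmat2) $ i $ 1" "v 0 = (mat 1 :: cmat2) $ i $ 2"
    by (auto simp: u_def v_def g0 l)
   have init2: "(norm (u 0))\<^sup>2 + (norm (v 0))\<^sup>2 \<le> 1" using exhaust_2[of i] by (auto simp: init)
   note b = row_asymp[OF q ud vd init2 z(2,1) t Q]
   have gi: "g t * exp (\<i> * z * t / 2) = 1" by (simp add: g_def flip: exp_add)
   have gi2: "g t * exp (- \<i> * z * t / 2) = exp (- \<i> * z * t)" by (simp add: g_def mult.assoc flip: exp_add)
   have ng: "norm (g t) = exp (Im z * t / 2)" by (simp add: g_def)
   have pos: "exp (Im z * t / 2) > 0" by simp
   have aim: "exp (\<bar>Im z\<bar> * t / 2) * exp (Im z * t / 2) = 1" using z(2) by (simp flip: exp_add)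
   have scale: "norm x \<le> C * exp (\<bar>Im z\<bar> * t / 2) / norm z" if "norm (g t * x) \<le> D / norm z" "D \<le> C" for x D
   proof -
    have "exp (Im z * t / 2) * norm x \<le> C / norm z"
     using that divide_right_mono[OF that(2) norm_ge_zero[of z]] by (simp add: norm_mult ng)
    then have "exp (\<bar>Im z\<bar> * t / 2) * (exp (Im z * t / 2) * norm x) \<le> exp (\<bar>Im z\<bar> * t / 2) * (C / norm z)"
     by (rule mult_left_mono) simp
    moreover have "exp (\<bar>Im z\<bar> * t / 2) * (exp (Im z * t / 2) * norm x) = norm x"
     by (metis aim mult.assoc mult_1)
    moreover have "exp (\<bar>Im z\<bar> * t / 2) * (C / norm z) = C * exp (\<bar>Im z\<bar> * t / 2) / norm z" by simp
    ultimately show ?thesis by metis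
   qed
   have "g t * (frame q t z $ i $ 2 - exp (- \<i> * z * t / 2) * (mat 1 :: cmat2) $ i $ 2) = v t - exp (- \<i> * z * t) * v 0"
    unfolding right_diff_distrib mult.assoc[symmetric] gi2 by (simp add: v_def init(2)[unfolded v_def] g0 l)
   moreover have "g t * (frame q t z $ i $ 1 - exp (\<i> * z * t / 2) * (mat 1 :: cmat2) $ i $ 1) = u t - u 0"
    unfolding right_diff_distrib mult.assoc[symmetric] gi by (simp add: u_def init(1)[unfolded u_def] g0 l)
   ultimately show ?thesis
    using scale[of "frame q t z $ i $ 2 - exp (- \<i> * z * t / 2) * (mat 1 :: cmat2) $ i $ 2" C1]
     scale[of "frame q t z $ i $ 1 - exp (\<i> * z * t / 2) * (mat 1 :: cmat2) $ i $ 1" C2]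
     b C12 unfolding C1_def[symmetric] C2_def[symmetric] by (simp add: C_def)
  qed
  show "norm (frame q t z $ 1 $ 1 - exp (\<i> * z * t / 2)) \<le> C * exp (\<bar>Im z\<bar> * t / 2) / norm z"
   "norm (frame q t z $ 1 $ 2) \<le> C * exp (\<bar>Im z\<bar> * t / 2) / norm z"
   "norm (frame q t z $ 2 $ 1) \<le> C * exp (\<bar>Im z\<bar> * t / 2) / norm z"
   "norm (frame q t z $ 2 $ 2 - exp (- \<i> * z * t / 2)) \<le> C * exp (\<bar>Im z\<bar> * t / 2) / norm z"
   using row[of 1] row[of 2] by simp_all
 qed
 \<comment> \<open>Conjugation of the spectral parameter exchanges the diagonal entries and the
   off-diagonal entries up to sign and conjugation, so the bounds for the lower half plane carry
   over.\<close>
 have upper: "norm (frame q t z $ 1 $ 1 - exp (\<i> * z * t / 2)) \<le> C * exp (\<bar>Im z\<bar> * t / 2) / norm z"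
   "norm (frame q t z $ 1 $ 2) \<le> C * exp (\<bar>Im z\<bar> * t / 2) / norm z"
   "norm (frame q t z $ 2 $ 1) \<le> C * exp (\<bar>Im z\<bar> * t / 2) / norm z"
   "norm (frame q t z $ 2 $ 2 - exp (- \<i> * z * t / 2)) \<le> C * exp (\<bar>Im z\<bar> * t / 2) / norm z"
  if z: "z \<noteq> 0" "Im z > 0" and t: "0 \<le> t" "t \<le> T" for z t
 proof -
  have z': "cnj z \<noteq> 0" "Im (cnj z) \<le> 0" using z by auto
  note lw = lower[OF z' t]
  let ?X = "frame q t (cnj z)"
  have F: "frame q t z = adj2 (conj_transpose ?X)"
   using frame_cnj[OF l, of t "cnj z"] by simp
  have e: "cnj (exp (\<i> * cnj z * t / 2)) = exp (- \<i> * z * t / 2)" "cnj (exp (- \<i> * cnj z * t / 2)) = exp (\<i> * z * t / 2)"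
   by (simp_all add: exp_cnj)
  have nc: "norm (cnj a - cnj b) = norm (a - b)" for a b
   by (simp only: complex_cnj_diff[symmetric] complex_mod_cnj)
  have h: "norm (frame q t z $ 1 $ 1 - exp (\<i> * z * t / 2)) = norm (?X $ 2 $ 2 - exp (- \<i> * cnj z * t / 2))"
   "norm (frame q t z $ 2 $ 2 - exp (- \<i> * z * t / 2)) = norm (?X $ 1 $ 1 - exp (\<i> * cnj z * t / 2))"
   "norm (frame q t z $ 1 $ 2) = norm (?X $ 2 $ 1)" "norm (frame q t z $ 2 $ 1) = norm (?X $ 1 $ 2)"
   unfolding F by (simp_all only: adj2_nth ct_nth e[symmetric] nc norm_minus_cancel complex_mod_cnj)
  have m: "\<bar>Im (cnj z)\<bar> = \<bar>Im z\<bar>" "norm (cnj z) = norm z" by simp_all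
  show "norm (frame q t z $ 1 $ 1 - exp (\<i> * z * t / 2)) \<le> C * exp (\<bar>Im z\<bar> * t / 2) / norm z"
   "norm (frame q t z $ 1 $ 2) \<le> C * exp (\<bar>Im z\<bar> * t / 2) / norm z"
   "norm (frame q t z $ 2 $ 1) \<le> C * exp (\<bar>Im z\<bar> * t / 2) / norm z"
   "norm (frame q t z $ 2 $ 2 - exp (- \<i> * z * t / 2)) \<le> C * exp (\<bar>Im z\<bar> * t / 2) / norm z"
   unfolding h using lw unfolding m by blast+
 qed
 have "asymp_bound q T C"
  unfolding asymp_bound_def Let_def
 proof (intro allI impI)
  fix z :: complex and t :: real assume "z \<noteq> 0" "0 \<le> t" "t \<le> T"
  then show "norm (frame q t z $ 1 $ 1 - exp (\<i> * z * t / 2)) \<le> C * exp (\<bar>Im z\<bar> * t / 2) / norm z \<and>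
   norm (frame q t z $ 1 $ 2) \<le> C * exp (\<bar>Im z\<bar> * t / 2) / norm z \<and>
   norm (frame q t z $ 2 $ 1) \<le> C * exp (\<bar>Im z\<bar> * t / 2) / norm z \<and>
   norm (frame q t z $ 2 $ 2 - exp (- \<i> * z * t / 2)) \<le> C * exp (\<bar>Im z\<bar> * t / 2) / norm z"
   using lower upper by (cases "Im z \<le> 0") auto
 qed
 moreover have "C > 0" using C12 by (simp add: C_def)
 ultimately show ?thesis using that by blast
qed

text \<open>The square of |sin w| is sinh(y)^2 + sin(x)^2 with w = x + i y. A point at distance
  \<rho> from all multiples of pi either has |y| >= \<rho>/2, where sinh dominates, or has x at
  distance at least \<rho>/2 from these multiples while exp |y| is bounded.\<close>

lemma norm_sin_lower:
 assumes "\<rho> > 0" "\<rho> \<le> 1"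
 obtains c where "c > 0" "\<And>w. (\<And>k::int. norm (w - of_real (pi * of_int k)) \<ge> \<rho>) \<Longrightarrow> norm (sin w) \<ge> c * exp \<bar>Im w\<bar>"
proof -
 define c1 where "c1 = (1 - exp (- \<rho>)) / 2"
 define c2 where "c2 = sin (\<rho> / 2) * exp (- (\<rho> / 2))"
 have pi1: "\<rho> / 2 < pi / 2" using assms pi_gt3 by linarith
 have s0: "sin (\<rho> / 2) > 0" using assms pi1 by (intro sin_gt_zero) auto
 have c12: "c1 > 0" "c2 > 0" using assms s0 by (auto simp: c1_def c2_def)
 show ?thesis
 proof (rule that[of "min c1 c2"])
  show "min c1 c2 > 0" using c12 by simp
  fix w :: complex assume w: "\<And>k::int. norm (w - of_real (pi * of_int k)) \<ge> \<rho>"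
  define x y where "x = Re w" and "y = \<bar>Im w\<bar>"
  have eq: "(norm (sin w))\<^sup>2 = ((exp y - exp (- y)) / 2)\<^sup>2 + (sin x)\<^sup>2"
  proof -
   have "exp (2 * Im w) + inverse (exp (2 * Im w)) = exp (2 * y) + exp (- 2 * y)"
    by (cases "Im w \<ge> 0") (auto simp: y_def exp_minus[symmetric])
   moreover have "exp (2 * y) + exp (- 2 * y) = (exp y - exp (- y))\<^sup>2 + 2"
    by (simp add: power2_diff exp_double[symmetric] flip: exp_add)
   moreover have "cos (2 * x) = 1 - 2 * (sin x)\<^sup>2" by (simp add: cos_double_sin)
   ultimately show ?thesis unfolding norm_sin_squared x_def[symmetric] by (simp add: power_divide)
  qed
  show "norm (sin w) \<ge> min c1 c2 * exp \<bar>Im w\<bar>"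
  proof (cases "y \<ge> \<rho> / 2")
   case True
   have "exp (- y) = exp (- 2 * y) * exp y" by (simp flip: exp_add)
   also have "\<dots> \<le> exp (- \<rho>) * exp y" using True by (intro mult_right_mono) auto
   finally have "exp (- y) \<le> exp (- \<rho>) * exp y" .
   moreover have "c1 * exp y = (exp y - exp (- \<rho>) * exp y) / 2" by (simp add: c1_def left_diff_distrib)
   ultimately have "c1 * exp y \<le> (exp y - exp (- y)) / 2"
    by (metis diff_left_mono divide_right_mono zero_le_numeral)
   moreover have "(exp y - exp (- y)) / 2 \<le> norm (sin w)"
    by (rule power2_le_imp_le) (use eq in auto)
   moreover have "min c1 c2 * exp y \<le> c1 * exp y" by (intro mult_right_mono) auto
   ultimately show ?thesis unfolding y_def[symmetric] by linarith
  next
   case False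
   \<comment> \<open>The nearest multiple of pi, so that \<open>d\<close> lies in [-pi/2, pi/2],
     where the sine is monotone.\<close>
   define k where "k = round (x / pi)"
   define d where "d = x - pi * of_int k"
   have "\<bar>x / pi - of_int k\<bar> \<le> 1 / 2" using of_int_round_abs_le[of "x / pi"] by (simp add: k_def abs_minus_commute)
   moreover have "d = pi * (x / pi - of_int k)" by (simp add: d_def field_simps)
   ultimately have d1: "\<bar>d\<bar> \<le> pi / 2" by (simp add: abs_mult)
   have "norm (w - of_real (pi * of_int k)) \<le> \<bar>d\<bar> + y"
    using cmod_le[of "w - of_real (pi * of_int k)"] by (simp add: d_def x_def y_def)
   then have d2: "\<bar>d\<bar> \<ge> \<rho> / 2" using w[of k] False by linarith
   have "\<bar>sin x\<bar> = \<bar>sin d\<bar>"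
   proof -
    have s: "sin (pi * of_int k) = 0" unfolding sin_zero_iff_int2 by (intro exI[of _ k]) (simp add: mult.commute)
    have "(cos (pi * of_int k))\<^sup>2 = 1" using sin_cos_squared_add[of "pi * of_int k"] s by simp
    then have "\<bar>cos (pi * of_int k)\<bar> = 1" by (auto simp: power2_eq_1_iff)
    then show ?thesis unfolding d_def sin_diff s by (simp add: abs_mult)
   qed
   also have "\<dots> = sin \<bar>d\<bar>" using d1 sin_ge_zero[of d] sin_ge_zero[of "- d"] by (cases "d \<ge> 0") auto
   also have "\<dots> \<ge> sin (\<rho> / 2)" using d1 d2 assms by (intro sin_mono_le_eq[THEN iffD2]) auto
   finally have "\<bar>sin x\<bar> \<ge> sin (\<rho> / 2)" .
   moreover have "\<bar>sin x\<bar> \<le> norm (sin w)" by (rule power2_le_imp_le) (use eq in auto)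
   moreover have "min c1 c2 * exp y \<le> c2 * exp y" by (intro mult_right_mono) auto
   moreover have "c2 * exp y \<le> sin (\<rho> / 2)"
   proof -
    have "exp (- (\<rho> / 2)) * exp y \<le> 1" using False by (simp flip: exp_add)
    then show ?thesis using mult_left_mono[of "exp (- (\<rho> / 2)) * exp y" 1 "sin (\<rho> / 2)"] s0 by (simp add: c2_def mult.assoc)
   qed
   ultimately show ?thesis unfolding y_def[symmetric] by linarith
  qed
 qed
qed

section \<open>Weighted sequences over the integers\<close>

text \<open>Order 3 is the decay of the potentials: their Fourier series may then be differentiated
  termwise. From order 2 on, sequences of this decay are summable and closed under
  convolution.\<close>

definition wt :: "nat \<Rightarrow> int \<Rightarrow> real" where
 "wt p n = 1 / (1 + \<bar>real_of_int n\<bar>) ^ p"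

lemma wt_pos [simp]: "wt p n > 0"
 unfolding wt_def by (intro divide_pos_pos zero_less_power) auto

lemma wt_nonneg [simp]: "wt p n \<ge> 0"
 using wt_pos[of p n] by linarith

lemma wt_Suc: "wt p n = (1 + \<bar>real_of_int n\<bar>) * wt (Suc p) n"
proof -
 have "1 + \<bar>real_of_int n\<bar> \<noteq> 0" by linarith
 then show ?thesis by (simp add: wt_def)
qed

lemma wt_32: "wt 2 n = (1 + \<bar>real_of_int n\<bar>) * wt 3 n"
 using wt_Suc[of 2 n] by (simp add: numeral_3_eq_3)

lemma wt_3_le_2: "wt 3 n \<le> wt 2 n"
 unfolding wt_32 using mult_right_mono[of 1 "1 + \<bar>real_of_int n\<bar>" "wt 3 n"] by simp

lemma wt_zero [simp]: "wt p 0 = 1" by (simp add: wt_def)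

lemma wt_summable:
 assumes "p \<ge> 2" shows "wt p summable_on UNIV"
proof -
 have s: "summable (\<lambda>n::nat. 1 / (1 + real n) ^ p)"
 proof -
  have "summable (\<lambda>n. inverse (real (Suc n) ^ p))"
   using inverse_power_summable[OF assms, where ?'a = real] summable_Suc_iff[of "\<lambda>n. inverse (real n ^ p)"] by simp
  then show ?thesis by (simp add: field_simps)
 qed
 have n: "(\<lambda>n::nat. 1 / (1 + real n) ^ p) summable_on UNIV"
  by (rule norm_summable_imp_summable_on) (use s in simp)
 have b1: "bij_betw int UNIV {0..}"
  by (rule bij_betwI[where g = nat]) auto
 have b2: "bij_betw (\<lambda>n. - int n - 1) UNIV {..<0}"
  by (rule bij_betwI[where g = "\<lambda>k. nat (- k - 1)"]) auto
 have b3: "bij_betw (\<lambda>n. - int n) UNIV {..0}"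
  by (rule bij_betwI[where g = "\<lambda>k. nat (- k)"]) auto
 have "wt p summable_on {0..}"
  using summable_on_reindex_bij_betw[OF b1, of "wt p"] n by (simp add: wt_def)
 moreover have "wt p summable_on {..0}"
  using summable_on_reindex_bij_betw[OF b3, of "wt p"] n by (simp add: wt_def)
 then have "wt p summable_on {..<0}" by (rule summable_on_subset_banach) auto
 ultimately have "wt p summable_on ({0..} \<union> {..<0})" by (intro summable_on_Un_disjoint) auto
 moreover have "{0..} \<union> {..<0} = (UNIV :: int set)" by auto
 ultimately show ?thesis by simp
qed

definition wsum :: "nat \<Rightarrow> real" where "wsum p = infsum (wt p) UNIV"

text \<open>One of 1 + |j| and 1 + |n - j| is at least half of 1 + |n|, so one of the two weights is
  at most 2^p times \<open>wt p n\<close>, and the other is kept.\<close>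

lemma wt_conv: "wt p j * wt p (n - j) \<le> 2 ^ p * wt p n * (wt p j + wt p (n - j))"
proof -
 define a b m where "a = 1 + \<bar>real_of_int j\<bar>" and "b = 1 + \<bar>real_of_int (n - j)\<bar>" and "m = 1 + \<bar>real_of_int n\<bar>"
 have pos: "a > 0" "b > 0" "m > 0" by (auto simp: a_def b_def m_def)
 have m: "m \<le> a + b" unfolding a_def b_def m_def of_int_diff by linarith
 have key: "1 / x ^ p \<le> 2 ^ p * (1 / m ^ p)" if "m \<le> 2 * x" "x > 0" for x
 proof -
  have "m ^ p \<le> 2 ^ p * x ^ p" using power_mono[OF that(1), of p] pos by (simp add: power_mult_distrib)
  then show ?thesis using pos that by (simp add: field_simps)
 qed
 have w: "wt p j = 1 / a ^ p" "wt p (n - j) = 1 / b ^ p" "wt p n = 1 / m ^ p"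
  by (simp_all add: wt_def a_def b_def m_def)
 show ?thesis
 proof (cases "a \<ge> b")
  case True
  then have "wt p j \<le> 2 ^ p * wt p n" unfolding w by (intro key) (use m pos in auto)
  then have "wt p j * wt p (n - j) \<le> 2 ^ p * wt p n * wt p (n - j)" by (intro mult_right_mono) auto
  also have "\<dots> \<le> 2 ^ p * wt p n * (wt p j + wt p (n - j))" by (intro mult_left_mono) auto
  finally show ?thesis .
 next
  case False
  then have "wt p (n - j) \<le> 2 ^ p * wt p n" unfolding w by (intro key) (use m pos in auto)
  then have "wt p j * wt p (n - j) \<le> wt p j * (2 ^ p * wt p n)" by (intro mult_left_mono) auto
  also have "\<dots> = 2 ^ p * wt p n * wt p j" by simp
  also have "\<dots> \<le> 2 ^ p * wt p n * (wt p j + wt p (n - j))" by (intro mult_left_mono) auto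
  finally show ?thesis .
 qed
qed

lemma summable_flip:
 fixes f :: "int \<Rightarrow> 'a::{comm_monoid_add,t2_space}"
 shows "(\<lambda>j. f (n - j)) summable_on UNIV \<longleftrightarrow> f summable_on UNIV"
  and "infsum (\<lambda>j. f (n - j)) UNIV = infsum f UNIV"
proof -
 have b: "bij_betw (\<lambda>j. n - j) UNIV UNIV"
  by (rule bij_betwI[where g = "\<lambda>j. n - j"]) auto
 show "(\<lambda>j. f (n - j)) summable_on UNIV \<longleftrightarrow> f summable_on UNIV"
  using summable_on_reindex_bij_betw[OF b, of f] .
 show "infsum (\<lambda>j. f (n - j)) UNIV = infsum f UNIV"
  using infsum_reindex_bij_betw[OF b, of f] .
qed

lemma wt_conv_sum:
 assumes "p \<ge> 2"
 shows "(\<lambda>j. wt p j * wt p (n - j)) summable_on UNIV"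
  and "infsum (\<lambda>j. wt p j * wt p (n - j)) UNIV \<le> 2 * 2 ^ p * wsum p * wt p n"
proof -
 have s: "(\<lambda>j. 2 ^ p * wt p n * (wt p j + wt p (n - j))) summable_on UNIV"
  by (intro summable_on_cmult_right summable_on_add wt_summable assms summable_flip(1)[THEN iffD2])
 show 1: "(\<lambda>j. wt p j * wt p (n - j)) summable_on UNIV"
  by (rule summable_on_comparison_test[OF s]) (use wt_conv in auto)
 have "infsum (\<lambda>j. wt p j * wt p (n - j)) UNIV \<le> infsum (\<lambda>j. 2 ^ p * wt p n * (wt p j + wt p (n - j))) UNIV"
  by (rule infsum_mono[OF 1 s]) (rule wt_conv)
 also have "\<dots> = 2 ^ p * wt p n * (infsum (wt p) UNIV + infsum (\<lambda>j. wt p (n - j)) UNIV)"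
  using infsum_add[OF wt_summable[OF assms], of "\<lambda>j. wt p (n - j)"]
   wt_summable[OF assms] by (simp add: infsum_cmult_right' summable_flip)
 also have "\<dots> = 2 * 2 ^ p * wsum p * wt p n"
  by (simp add: summable_flip wsum_def)
 finally show "infsum (\<lambda>j. wt p j * wt p (n - j)) UNIV \<le> 2 * 2 ^ p * wsum p * wt p n" .
qed

definition bnd :: "nat \<Rightarrow> real \<Rightarrow> (int \<Rightarrow> complex) \<Rightarrow> bool" where
 "bnd p A a \<longleftrightarrow> (\<forall>n. norm (a n) \<le> A * wt p n)"

definition conv :: "(int \<Rightarrow> complex) \<Rightarrow> (int \<Rightarrow> complex) \<Rightarrow> int \<Rightarrow> complex" where
 "conv a b n = infsum (\<lambda>j. a j * b (n - j)) UNIV"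

lemma bndD: "bnd p A a \<Longrightarrow> norm (a n) \<le> A * wt p n" by (simp add: bnd_def)

lemma bnd_mono: "bnd p A a \<Longrightarrow> A \<le> B \<Longrightarrow> bnd p B a"
 unfolding bnd_def by (meson mult_right_mono order_trans wt_nonneg)

lemma bnd_nonneg: "bnd p A a \<Longrightarrow> 0 \<le> A"
 using bndD[of p A a 0] norm_ge_zero[of "a 0"] by (simp del: norm_ge_zero)

lemma bnd_32: "bnd 3 A a \<Longrightarrow> bnd 2 A a"
 using bnd_nonneg[of 3 A a] unfolding bnd_def by (meson mult_left_mono order_trans wt_3_le_2)

lemma bnd_add: "bnd p A a \<Longrightarrow> bnd p B b \<Longrightarrow> bnd p (A + B) (\<lambda>n. a n + b n)"
 unfolding bnd_def by (metis (no_types, lifting) add_mono distrib_right norm_triangle_mono)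

lemma bnd_scale: "bnd p A a \<Longrightarrow> bnd p (norm c * A) (\<lambda>n. c * a n)"
 unfolding bnd_def by (simp add: norm_mult mult.assoc mult_left_mono)

lemma bnd_minus: "bnd p A a \<Longrightarrow> bnd p A (\<lambda>n. - a n)"
 unfolding bnd_def by simp

lemma bnd_flip: "bnd p A a \<Longrightarrow> bnd p A (\<lambda>n. cnj (a (- n)))"
 unfolding bnd_def wt_def by (metis abs_minus_cancel complex_mod_cnj of_int_minus)

lemma bnd_abs_summable: "bnd p A a \<Longrightarrow> p \<ge> 2 \<Longrightarrow> (\<lambda>n. norm (a n)) summable_on UNIV"
 by (rule summable_on_comparison_test[OF summable_on_cmult_right[OF wt_summable]]) (auto dest: bndD)

lemma conv_abs_summable:
 assumes "bnd p A a" "bnd p B b" "p \<ge> 2"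
 shows "(\<lambda>j. norm (a j * b (n - j))) summable_on UNIV"
proof (rule summable_on_comparison_test[OF summable_on_cmult_right[OF wt_conv_sum(1)[OF assms(3)]]])
 fix j
 have "norm (a j * b (n - j)) \<le> (A * wt p j) * (B * wt p (n - j))"
  unfolding norm_mult by (intro mult_mono bndD assms) (use bnd_nonneg[OF assms(1)] in auto)
 then show "norm (a j * b (n - j)) \<le> A * B * (wt p j * wt p (n - j))" by (simp add: ac_simps)
qed auto

lemma bnd_conv:
 assumes "bnd p A a" "bnd p B b" "p \<ge> 2"
 shows "bnd p (2 * 2 ^ p * wsum p * A * B) (conv a b)"
 unfolding bnd_def
proof
 fix n
 have AB: "A \<ge> 0" "B \<ge> 0" using bnd_nonneg assms by auto
 have "norm (conv a b n) \<le> infsum (\<lambda>j. norm (a j * b (n - j))) UNIV"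
  unfolding conv_def by (rule norm_infsum_bound[OF conv_abs_summable[OF assms]])
 also have "\<dots> \<le> infsum (\<lambda>j. A * B * (wt p j * wt p (n - j))) UNIV"
 proof (rule infsum_mono[OF conv_abs_summable[OF assms] summable_on_cmult_right[OF wt_conv_sum(1)[OF assms(3)]]])
  fix j
  have "norm (a j * b (n - j)) \<le> (A * wt p j) * (B * wt p (n - j))"
   unfolding norm_mult by (intro mult_mono bndD assms) (use AB in auto)
  then show "norm (a j * b (n - j)) \<le> A * B * (wt p j * wt p (n - j))" by (simp add: ac_simps)
 qed
 also have "\<dots> = A * B * infsum (\<lambda>j. wt p j * wt p (n - j)) UNIV" by (rule infsum_cmult_right')
 also have "\<dots> \<le> A * B * (2 * 2 ^ p * wsum p * wt p n)"
  by (intro mult_left_mono wt_conv_sum assms) (use AB in auto)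
 finally show "norm (conv a b n) \<le> 2 * 2 ^ p * wsum p * A * B * wt p n" by (simp add: ac_simps)
qed

lemma conv_diff:
 assumes "bnd p A a" "bnd p A' a'" "bnd p B b" "bnd p B' b'" "p \<ge> 2"
 shows "conv a b n - conv a' b' n = conv (\<lambda>n. a n - a' n) b n + conv a' (\<lambda>n. b n - b' n) n"
proof -
 have s: "(\<lambda>j. a j * b (n - j)) summable_on UNIV" "(\<lambda>j. a' j * b (n - j)) summable_on UNIV"
  "(\<lambda>j. a' j * b' (n - j)) summable_on UNIV"
  using abs_summable_summable[OF conv_abs_summable[OF assms(1,3,5)]]
   abs_summable_summable[OF conv_abs_summable[OF assms(2,3,5)]]
   abs_summable_summable[OF conv_abs_summable[OF assms(2,4,5)]] by blast+
 have d: "infsum (\<lambda>j. f j - g j) UNIV = infsum f UNIV - infsum g UNIV"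
  if "f summable_on UNIV" "g summable_on UNIV" for f g :: "int \<Rightarrow> complex"
  using infsum_add[OF that(1) summable_on_uminus[THEN iffD2, OF that(2)]] by (simp add: infsum_uminus)
 show ?thesis unfolding conv_def left_diff_distrib right_diff_distrib
  using d[OF s(1,2)] d[OF s(2,3)] by simp
qed

text \<open>Banach's argument in a box with coordinatewise radii \<open>w i\<close>: all distances
  are measured relative to the radii, the iterates from 0 converge in each coordinate, and the error
  after n steps is uniform relative to \<open>w\<close>.\<close>

lemma weighted_fixpoint:
 fixes \<Phi> :: "('i \<Rightarrow> complex) \<Rightarrow> 'i \<Rightarrow> complex" and w :: "'i \<Rightarrow> real"
 assumes w: "\<And>i. w i \<ge> 0"
  and self: "\<And>z i. (\<And>i. norm (z i) \<le> w i) \<Longrightarrow> norm (\<Phi> z i) \<le> w i"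
  and contr: "\<And>z z' d i. (\<And>i. norm (z i) \<le> w i) \<Longrightarrow> (\<And>i. norm (z' i) \<le> w i) \<Longrightarrow> d \<ge> 0 \<Longrightarrow>
    (\<And>i. norm (z i - z' i) \<le> d * w i) \<Longrightarrow> norm (\<Phi> z i - \<Phi> z' i) \<le> d / 2 * w i"
 obtains z where "\<And>i. norm (z i) \<le> w i" "\<Phi> z = z"
proof -
 define S where "S n = (\<Phi> ^^ n) (\<lambda>_. 0)" for n
 have SS: "S (Suc n) = \<Phi> (S n)" for n by (simp add: S_def)
 have ball: "norm (S n i) \<le> w i" for n i
 proof (induction n arbitrary: i)
  case (Suc n) show ?case unfolding SS by (rule self[OF Suc])
 qed (simp add: S_def w)
 have step: "norm (S (Suc n) i - S n i) \<le> (1 / 2) ^ n * w i" for n i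
 proof (induction n arbitrary: i)
  case 0 then show ?case using ball[of 1 i] by (simp add: S_def)
 next
  case (Suc n)
  from contr[OF ball ball _ Suc] show ?case by (simp add: SS)
 qed
 have sm: "summable (\<lambda>n. S (Suc n) i - S n i)" for i
  by (rule summable_comparison_test'[where g = "\<lambda>n. (1 / 2) ^ n * w i"]) (use step in \<open>auto intro: summable_mult2 summable_geometric\<close>)
 have conv: "convergent (\<lambda>n. S n i)" for i
 proof -
  have "(\<lambda>n. \<Sum>k<n. S (Suc k) i - S k i) \<longlonglongrightarrow> (\<Sum>k. S (Suc k) i - S k i)" by (rule summable_LIMSEQ[OF sm])
  moreover have "(\<Sum>k<n. S (Suc k) i - S k i) = S n i" for n
   using sum_lessThan_telescope[of "\<lambda>k. S k i" n] by (simp add: S_def)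
  ultimately show ?thesis by (auto simp: convergent_def)
 qed
 define z where "z i = lim (\<lambda>n. S n i)" for i
 have lim: "(\<lambda>n. S n i) \<longlonglongrightarrow> z i" for i using conv by (simp add: z_def convergent_LIMSEQ_iff)
 have zb: "norm (z i) \<le> w i" for i by (rule LIMSEQ_le_const2[OF tendsto_norm[OF lim]]) (use ball in blast)
 \<comment> \<open>Geometric tail: the steps from n on add up to at most 2 * (1/2)^n.\<close>
 have tail: "norm (S m i - S n i) \<le> 2 * (1 / 2) ^ n * w i" if "n \<le> m" for m n i
 proof -
  have "norm (S m i - S n i) \<le> (2 * (1 / 2) ^ n - 2 * (1 / 2) ^ m) * w i"
   using that
  proof (induction m rule: dec_induct)
   case (step m)
   have "norm (S (Suc m) i - S n i) \<le> norm (S (Suc m) i - S m i) + norm (S m i - S n i)"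
    using norm_triangle_ineq[of "S (Suc m) i - S m i" "S m i - S n i"] by simp
   also have "\<dots> \<le> (1 / 2) ^ m * w i + (2 * (1 / 2) ^ n - 2 * (1 / 2) ^ m) * w i"
    using step \<open>\<And>n i. norm (S (Suc n) i - S n i) \<le> (1 / 2) ^ n * w i\<close>[of m i] by linarith
   finally show ?case by (simp add: algebra_simps)
  qed simp
  also have "\<dots> \<le> 2 * (1 / 2) ^ n * w i" by (intro mult_right_mono w) simp
  finally show ?thesis .
 qed
 have zS: "norm (z i - S n i) \<le> 2 * (1 / 2) ^ n * w i" for n i
  by (rule LIMSEQ_le_const2[OF tendsto_norm[OF tendsto_diff[OF lim tendsto_const]]]) (use tail in blast)
 have "\<Phi> z i = z i" for i
 proof -
  have "norm (\<Phi> z i - S (Suc n) i) \<le> (1 / 2) ^ n * w i" for n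
   using contr[OF zb ball _ zS, of n i] by (simp add: SS)
  then have "\<forall>\<^sub>F n in sequentially. norm (\<Phi> z i - S (Suc n) i) \<le> (1 / 2) ^ n * w i"
   by (intro always_eventually allI)
  moreover have "(\<lambda>n. (1 / 2) ^ n * w i) \<longlonglongrightarrow> 0"
   by (rule tendsto_mult_left_zero[OF LIMSEQ_power_zero]) simp
  ultimately have "(\<lambda>n. \<Phi> z i - S (Suc n) i) \<longlonglongrightarrow> 0"
   by (rule Lim_null_comparison)
  from tendsto_diff[OF tendsto_const[of "\<Phi> z i"] this]
  have "(\<lambda>n. S (Suc n) i) \<longlonglongrightarrow> \<Phi> z i" by simp
  then show ?thesis by (rule LIMSEQ_unique[OF _ LIMSEQ_Suc[OF lim]])
 qed
 then show ?thesis using that[of z] zb by blast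
qed

section \<open>The fixed point equation for the double points\<close>

text \<open>
 For \<open>\<bar>k\<bar> \<ge> K\<close> one looks for a point \<open>z = \<omega> k + 2 \<nu>\<close> and a \<open>T\<close>-periodic pair \<open>(x, y)\<close> such that
 \<open>exp (\<i> \<omega> k t / 2) (x, y)\<close> is a row solution of the frame equation. The Fourier modes \<open>x 0 = 1\<close> and
 \<open>y (- k) = 0\<close> are the two resonant ones; their equations determine \<open>\<nu>\<close> (component \<open>Vc k\<close>)
 and the coefficient \<open>q (- k)\<close> (component \<open>Uc (- k)\<close>).
\<close>

datatype idx = Uc int | Vc int | Xc int int | Yc int int

definition qpot :: "int \<Rightarrow> (int \<Rightarrow> complex) \<Rightarrow> (idx \<Rightarrow> complex) \<Rightarrow> int \<Rightarrow> complex" where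
 "qpot K P z n = (if \<bar>n\<bar> < K then P n else z (Uc n))"

definition Xt :: "(idx \<Rightarrow> complex) \<Rightarrow> int \<Rightarrow> int \<Rightarrow> complex" where
 "Xt z k n = (if n = 0 then 0 else z (Xc k n))"

definition Yt :: "(idx \<Rightarrow> complex) \<Rightarrow> int \<Rightarrow> int \<Rightarrow> complex" where
 "Yt z k n = (if n = - k then 0 else z (Yc k n))"

definition rv :: "(int \<Rightarrow> complex) \<Rightarrow> int \<Rightarrow> complex" where
 "rv a n = cnj (a (- n))"

text \<open>Inserting the Fourier series into the row equations gives \<omega> n x_n = \<nu> x_n +
  (i/2) (rv q * y)_n and \<omega> (n + k) y_n = - \<nu> y_n - (i/2) (q * x)_n. The off-resonant
  equations are solved for x_n and y_n by division. At n = 0 the first yields \<nu>; at n = - k the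
  second says that q * x has no mode - k, which yields q at - k because x_0 = 1. Hence the row
  belonging to the mode n of the potential is the one with index - n.\<close>

fun Phi :: "real \<Rightarrow> int \<Rightarrow> (int \<Rightarrow> complex) \<Rightarrow> (idx \<Rightarrow> complex) \<Rightarrow> idx \<Rightarrow> complex" where
 "Phi \<omega> K P z (Uc n) = (if \<bar>n\<bar> \<ge> K then - conv (qpot K P z) (Xt z (- n)) n else 0)"
| "Phi \<omega> K P z (Vc k) = (if \<bar>k\<bar> \<ge> K then - (\<i> / 2) * conv (rv (qpot K P z)) (Yt z k) 0 else 0)"
| "Phi \<omega> K P z (Xc k n) = (if \<bar>k\<bar> \<ge> K \<and> n \<noteq> 0 then
   (z (Vc k) * z (Xc k n) + (\<i> / 2) * conv (rv (qpot K P z)) (Yt z k) n) / of_real (\<omega> * of_int n) else 0)"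
| "Phi \<omega> K P z (Yc k n) = (if \<bar>k\<bar> \<ge> K \<and> n \<noteq> - k then
   (- (\<i> / 2) * (qpot K P z n + conv (qpot K P z) (Xt z k) n) - z (Vc k) * z (Yc k n)) / of_real (\<omega> * of_int (n + k)) else 0)"

text \<open>The second component y has one power of decay less than x and q. This loss buys
  smallness: |k| <= (1 + |n|) |n + k|, so dividing the forcing q_n by n + k gives order 2 with a
  factor 1 / K. The division by n in the equation of x recovers the lost power.\<close>

fun wgt :: "real \<Rightarrow> real \<Rightarrow> real \<Rightarrow> idx \<Rightarrow> real" where
 "wgt \<delta> \<beta> c (Uc n) = \<delta> * wt 3 n"
| "wgt \<delta> \<beta> c (Vc k) = \<beta>"
| "wgt \<delta> \<beta> c (Xc k n) = \<beta> * wt 3 n"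
| "wgt \<delta> \<beta> c (Yc k n) = c * wt 2 n"

text \<open>One estimate for two purposes: with \<open>P = P'\<close> and \<open>e = 0\<close> it is
  a contraction by 1/2, with general \<open>e\<close> it gives the Lipschitz dependence of the fixed
  point on the low modes. The smallness assumptions pay for one component each:
  \<open>C * Q * \<beta>\<close> against \<delta> for \<open>Uc\<close>, \<open>C * Q * c\<close>
  against \<beta> for \<open>Vc\<close> and against \<omega> \<beta> for \<open>Xc\<close>, and
  large \<open>K\<close> for \<open>Yc\<close>; \<open>\<beta> \<le> \<omega> / 8\<close> absorbs
  the terms with \<nu>.\<close>

lemma Phi_estimate:
 assumes C: "C \<ge> 1" "2 * 2 ^ 2 * wsum 2 \<le> C" "2 * 2 ^ 3 * wsum 3 \<le> C"
  and par: "Q \<ge> 1" "0 < \<delta>" "\<delta> \<le> 1" "0 < \<beta>" "0 < c" "\<omega> > 0" "C * Q * \<beta> \<le> \<delta> / 4" "\<beta> \<le> \<omega> / 8"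
   "C * Q * c \<le> \<beta> / 2" "8 * (C * Q * c) \<le> \<omega> * \<beta>" "K \<ge> 1" "4 * Q \<le> \<omega> * of_int K * c"
  and P: "bnd 3 Q P" "bnd 3 Q P'" "e \<ge> 0" "bnd 3 e (\<lambda>n. P n - P' n)"
  and z: "\<And>i. norm (z i) \<le> wgt \<delta> \<beta> c i" "\<And>i. norm (z' i) \<le> wgt \<delta> \<beta> c i" "d \<ge> 0"
   "\<And>i. norm (z i - z' i) \<le> d * wgt \<delta> \<beta> c i"
 shows "norm (Phi \<omega> K P z i - Phi \<omega> K P' z' i) \<le> (d / 2 + e) * wgt \<delta> \<beta> c i"
proof -
 define q q' where "q = qpot K P z" and "q' = qpot K P' z'"
 \<comment> \<open>The bound for the change of the full potential: \<open>d * \<delta>\<close> from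
   the unknown high modes and \<open>e\<close> from the prescribed low ones.\<close>
 define a where "a = d * \<delta> + e"
 have dd: "d * \<delta> \<le> d" using par(3) z(3) by (simp add: mult_left_le)
 have a0: "a \<ge> 0" "a \<le> d + e" using P(3) z(3) par dd by (auto simp: a_def)
 have dQ: "\<delta> \<le> Q" using par by simp
 have bq: "bnd 3 Q (qpot K P0 z0)" if "bnd 3 Q P0" "\<And>i. norm (z0 i) \<le> wgt \<delta> \<beta> c i" for P0 z0
  unfolding bnd_def
 proof
  fix n
  have "norm (z0 (Uc n)) \<le> \<delta> * wt 3 n" using that(2)[of "Uc n"] by simp
  also have "\<dots> \<le> Q * wt 3 n" using dQ by (intro mult_right_mono) auto
  finally show "norm (qpot K P0 z0 n) \<le> Q * wt 3 n" using bndD[OF that(1), of n] by (simp add: qpot_def)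
 qed
 have q: "bnd 3 Q q" "bnd 3 Q q'" unfolding q_def q'_def by (intro bq P z)+
 have dq: "bnd 3 a (\<lambda>n. q n - q' n)"
  unfolding bnd_def
 proof
  fix n
  have "norm (z (Uc n) - z' (Uc n)) \<le> d * \<delta> * wt 3 n" using z(4)[of "Uc n"] by simp
  also have "\<dots> \<le> a * wt 3 n" using P(3) by (intro mult_right_mono) (auto simp: a_def)
  finally have 1: "norm (z (Uc n) - z' (Uc n)) \<le> a * wt 3 n" .
  have "norm (P n - P' n) \<le> e * wt 3 n" using bndD[OF P(4)] .
  also have "\<dots> \<le> a * wt 3 n" using z(3) par by (intro mult_right_mono) (auto simp: a_def)
  finally show "norm (q n - q' n) \<le> a * wt 3 n" using 1 by (simp add: q_def q'_def qpot_def)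
 qed
 have X: "bnd 3 \<beta> (Xt z k)" "bnd 3 \<beta> (Xt z' k)" "bnd 3 (d * \<beta>) (\<lambda>n. Xt z k n - Xt z' k n)" for k
  using z(1)[of "Xc k _"] z(2)[of "Xc k _"] z(4)[of "Xc k _"] par z(3)
  by (auto simp: bnd_def Xt_def mult.assoc)
 have Y: "bnd 2 c (Yt z k)" "bnd 2 c (Yt z' k)" "bnd 2 (d * c) (\<lambda>n. Yt z k n - Yt z' k n)" for k
  using z(1)[of "Yc k _"] z(2)[of "Yc k _"] z(4)[of "Yc k _"] par z(3)
  by (auto simp: bnd_def Yt_def mult.assoc)
 have conv_est: "norm (conv f g n - conv f' g' n) \<le> C * (A' * B + A * B') * wt p n"
  if "bnd p A f" "bnd p A f'" "bnd p A' (\<lambda>n. f n - f' n)" "bnd p B g" "bnd p B g'" "bnd p B' (\<lambda>n. g n - g' n)"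
   "p = 2 \<or> p = 3" for f g f' g' A A' B B' p n
 proof -
  have p2: "p \<ge> 2" "2 * 2 ^ p * wsum p \<le> C" using that(7) C by auto
  have nn: "A \<ge> 0" "A' \<ge> 0" "B \<ge> 0" "B' \<ge> 0" using bnd_nonneg that by auto
  have "norm (conv f g n - conv f' g' n) \<le> norm (conv (\<lambda>n. f n - f' n) g n) + norm (conv f' (\<lambda>n. g n - g' n) n)"
   unfolding conv_diff[OF that(1,2,4,5) p2(1)] by (rule norm_triangle_ineq)
  also have "\<dots> \<le> 2 * 2 ^ p * wsum p * A' * B * wt p n + 2 * 2 ^ p * wsum p * A * B' * wt p n"
   by (intro add_mono bndD bnd_conv that p2)
  also have "\<dots> = (2 * 2 ^ p * wsum p) * ((A' * B + A * B') * wt p n)" by (simp add: algebra_simps)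
  also have "\<dots> \<le> C * ((A' * B + A * B') * wt p n)" using nn by (intro mult_right_mono p2) auto
  finally show ?thesis by (simp add: mult.assoc)
 qed
 have CQ0: "C * \<beta> \<le> C * Q * \<beta>" "C * c \<le> C * Q * c"
  using C(1) par by (simp_all add: mult_le_cancel_right1 mult_right_mono)
 have CB: "C * \<beta> \<le> \<delta> / 4" "C * c \<le> \<beta> / 2" "8 * (C * c) \<le> \<omega> * \<beta>" using CQ0 par by linarith+
 have aQ: "a + Q * d \<le> 2 * (Q * d) + e"
  using dd z(3) par mult_right_mono[of 1 Q d] by (simp add: a_def)
 have UX: "norm (conv q (Xt z k) n - conv q' (Xt z' k) n) \<le> (\<delta> * (d / 2 + e)) * wt 3 n" for k n
 proof -
  have "C * (a * \<beta> + Q * (d * \<beta>)) = (C * \<beta>) * (a + Q * d)" by (simp add: algebra_simps)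
  also have "\<dots> \<le> (C * \<beta>) * (2 * (Q * d) + e)" using aQ C par by (intro mult_left_mono) auto
  also have "\<dots> = 2 * d * (C * Q * \<beta>) + (C * \<beta>) * e" by (simp add: algebra_simps)
  also have "\<dots> \<le> 2 * d * (\<delta> / 4) + (\<delta> / 4) * e"
   using CB par z(3) P(3) by (intro add_mono mult_left_mono mult_right_mono) auto
  also have "\<dots> \<le> \<delta> * (d / 2 + e)" using par P(3) by (simp add: algebra_simps)
  finally have "C * (a * \<beta> + Q * (d * \<beta>)) \<le> \<delta> * (d / 2 + e)" .
  then show ?thesis
   using conv_est[OF q dq X[of k], of n] mult_right_mono[of _ _ "wt 3 n"] wt_nonneg order_trans by blast
 qed
 \<comment> \<open>The bound for the change of \<open>rv q\<close> convolved with y. It is compared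
   with \<beta> for the frequency and with \<omega> \<beta> for x.\<close>
 define g where "g = (C * c) * (2 * (Q * d) + e)"
 have g1: "g \<le> \<beta> * d + \<beta> / 2 * e"
 proof -
  have "g = 2 * d * (C * Q * c) + (C * c) * e" by (simp add: g_def algebra_simps)
  also have "\<dots> \<le> 2 * d * (\<beta> / 2) + (\<beta> / 2) * e"
   using CB par z(3) P(3) by (intro add_mono mult_left_mono mult_right_mono) auto
  finally show ?thesis by (simp add: algebra_simps)
 qed
 have g2: "g \<le> \<omega> * (\<beta> * (d / 4 + e / 8))"
 proof -
  have "8 * g = 2 * d * (8 * (C * Q * c)) + (8 * (C * c)) * e" by (simp add: g_def algebra_simps)
  also have "\<dots> \<le> 2 * d * (\<omega> * \<beta>) + (\<omega> * \<beta>) * e"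
   using CB par z(3) P(3) by (intro add_mono mult_left_mono mult_right_mono) auto
  finally show ?thesis by (simp add: algebra_simps)
 qed
 have QY: "norm (conv (rv q) (Yt z k) n - conv (rv q') (Yt z' k) n) \<le> g * wt 2 n" for k n
 proof -
  have r: "bnd 2 Q (rv q)" "bnd 2 Q (rv q')" "bnd 2 a (\<lambda>n. rv q n - rv q' n)"
   using bnd_flip[OF bnd_32[OF q(1)]] bnd_flip[OF bnd_32[OF q(2)]] bnd_flip[OF bnd_32[OF dq]]
   by (simp_all add: rv_def[abs_def])
  have "C * (a * c + Q * (d * c)) = (C * c) * (a + Q * d)" by (simp add: algebra_simps)
  also have "\<dots> \<le> g" unfolding g_def using aQ C par by (intro mult_left_mono) auto
  finally have "C * (a * c + Q * (d * c)) \<le> g" .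
  then show ?thesis
   using conv_est[OF r Y[of k], of n] mult_right_mono[of _ _ "wt 2 n"] wt_nonneg order_trans by blast
 qed
 have Vb: "norm (z (Vc k)) \<le> \<beta>" "norm (z' (Vc k)) \<le> \<beta>" "norm (z (Vc k) - z' (Vc k)) \<le> d * \<beta>" for k
  using z(1)[of "Vc k"] z(2)[of "Vc k"] z(4)[of "Vc k"] by auto
 have VW: "norm (z (Vc k) * f - z' (Vc k) * f') \<le> 2 * \<beta> * d * w"
  if "norm f \<le> w" "norm (f - f') \<le> d * w" "w \<ge> 0" for k f f' w
 proof -
  have "z (Vc k) * f - z' (Vc k) * f' = (z (Vc k) - z' (Vc k)) * f + z' (Vc k) * (f - f')" by (simp add: algebra_simps)
  also have "norm \<dots> \<le> norm (z (Vc k) - z' (Vc k)) * norm f + norm (z' (Vc k)) * norm (f - f')"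
   by (rule order_trans[OF norm_triangle_ineq]) (simp add: norm_mult)
  also have "\<dots> \<le> (d * \<beta>) * w + \<beta> * (d * w)"
   using that Vb z(3) par by (intro add_mono mult_mono) auto
  finally show ?thesis by (simp add: algebra_simps)
 qed
 have half: "norm (\<i> / 2 :: complex) = 1 / 2" by (simp add: norm_divide)
 show ?thesis
 proof (cases i)
  case (Uc n)
  have "norm (Phi \<omega> K P z (Uc n) - Phi \<omega> K P' z' (Uc n)) \<le> (\<delta> * (d / 2 + e)) * wt 3 n"
   using UX[of "- n" n] z(3) P(3) par by (simp add: q_def q'_def norm_minus_commute)
  then show ?thesis using Uc by (simp add: algebra_simps)
 next
  case (Vc k)
  have "norm (Phi \<omega> K P z (Vc k) - Phi \<omega> K P' z' (Vc k)) \<le> 1 / 2 * g"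
  proof (cases "\<bar>k\<bar> \<ge> K")
   case True
   have "Phi \<omega> K P z (Vc k) - Phi \<omega> K P' z' (Vc k) = - (\<i> / 2) * (conv (rv q) (Yt z k) 0 - conv (rv q') (Yt z' k) 0)"
    using True by (simp add: q_def q'_def algebra_simps)
   then show ?thesis using QY[of k 0] by (simp only: norm_mult norm_minus_cancel half) simp
  next
   case False
   have "g \<ge> 0" using C par z(3) P(3) by (auto simp: g_def)
   then show ?thesis using False by simp
  qed
  also have "\<dots> \<le> (d / 2 + e) * \<beta>"
  proof -
   have "0 \<le> \<beta> * e" using par P(3) by simp
   moreover have "(d / 2 + e) * \<beta> = 1 / 2 * (\<beta> * d) + \<beta> * e" by (simp add: algebra_simps)
   moreover have "\<beta> / 2 * e = 1 / 2 * (\<beta> * e)" by simp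
   ultimately show ?thesis using g1 by linarith
  qed
  finally show ?thesis using Vc by simp
 next
  case (Xc k n)
  show ?thesis
  proof (cases "\<bar>k\<bar> \<ge> K \<and> n \<noteq> 0")
   case True
   define m where "m = \<bar>real_of_int n\<bar>"
   have "1 \<le> \<bar>n\<bar>" using True by linarith
   then have "real_of_int 1 \<le> real_of_int \<bar>n\<bar>" by (simp only: of_int_le_iff)
   then have m1: "m \<ge> 1" by (simp add: m_def)
   \<comment> \<open>Here the division by n, with |n| >= 1, returns from order 2 to order 3.\<close>
   have s2: "wt 2 n \<le> 2 * m * wt 3 n" unfolding wt_32 using m1 by (intro mult_right_mono) (auto simp: m_def)
   have "Phi \<omega> K P z (Xc k n) - Phi \<omega> K P' z' (Xc k n) =
    ((z (Vc k) * z (Xc k n) - z' (Vc k) * z' (Xc k n)) + (\<i> / 2) * (conv (rv q) (Yt z k) n - conv (rv q') (Yt z' k) n)) / of_real (\<omega> * of_int n)"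
    using True by (simp add: q_def q'_def diff_divide_distrib[symmetric] algebra_simps)
   also have "norm \<dots> = norm ((z (Vc k) * z (Xc k n) - z' (Vc k) * z' (Xc k n)) + (\<i> / 2) * (conv (rv q) (Yt z k) n - conv (rv q') (Yt z' k) n)) / (\<omega> * m)"
    using par unfolding norm_divide m_def norm_of_real abs_mult by simp
   also have "\<dots> \<le> (2 * \<beta> * d * (\<beta> * wt 3 n) + 1 / 2 * (g * wt 2 n)) / (\<omega> * m)"
   proof (intro divide_right_mono order_trans[OF norm_triangle_ineq] add_mono)
    show "norm (z (Vc k) * z (Xc k n) - z' (Vc k) * z' (Xc k n)) \<le> 2 * \<beta> * d * (\<beta> * wt 3 n)"
     by (rule VW) (use z(1)[of "Xc k n"] z(4)[of "Xc k n"] par in auto)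
    show "norm (\<i> / 2 * (conv (rv q) (Yt z k) n - conv (rv q') (Yt z' k) n)) \<le> 1 / 2 * (g * wt 2 n)"
     unfolding norm_mult half by (intro mult_left_mono QY) simp
   qed (use par m1 in auto)
   also have "\<dots> \<le> (\<omega> * m * ((d / 2 + e) * (\<beta> * wt 3 n))) / (\<omega> * m)"
   proof (intro divide_right_mono)
    have "2 * \<beta> * d * (\<beta> * wt 3 n) = (2 * d * \<beta> * wt 3 n) * \<beta>" by simp
    also have "\<dots> \<le> (2 * d * \<beta> * wt 3 n) * (\<omega> / 8)" using par z(3) by (intro mult_left_mono) auto
    also have "\<dots> \<le> (2 * d * \<beta> * wt 3 n) * (\<omega> / 8) * m" using m1 par z(3) mult_left_mono[OF m1, of "(2 * d * \<beta> * wt 3 n) * (\<omega> / 8)"] by simp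
    finally have A: "2 * \<beta> * d * (\<beta> * wt 3 n) \<le> \<omega> * m * (d / 4 * (\<beta> * wt 3 n))" by (simp add: algebra_simps)
    have g0: "g \<ge> 0" using C par z(3) P(3) by (auto simp: g_def)
    have "1 / 2 * (g * wt 2 n) \<le> 1 / 2 * (g * (2 * m * wt 3 n))" using g0 s2 by (intro mult_left_mono) auto
    also have "\<dots> = g * (m * wt 3 n)" by simp
    also have "\<dots> \<le> (\<omega> * (\<beta> * (d / 4 + e / 8))) * (m * wt 3 n)" using g2 m1 by (intro mult_right_mono) auto
    finally have B: "1 / 2 * (g * wt 2 n) \<le> \<omega> * m * ((d / 4 + e / 8) * (\<beta> * wt 3 n))" by (simp add: algebra_simps)
    have "\<omega> * m * (d / 4 * (\<beta> * wt 3 n)) + \<omega> * m * ((d / 4 + e / 8) * (\<beta> * wt 3 n)) = \<omega> * m * ((d / 2 + e / 8) * (\<beta> * wt 3 n))"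
     by (simp add: algebra_simps)
    also have "\<dots> \<le> \<omega> * m * ((d / 2 + e) * (\<beta> * wt 3 n))" using par m1 P(3) by (intro mult_left_mono mult_right_mono) auto
    finally show "2 * \<beta> * d * (\<beta> * wt 3 n) + 1 / 2 * (g * wt 2 n) \<le> \<omega> * m * ((d / 2 + e) * (\<beta> * wt 3 n))"
     using A B by linarith
   qed (use par m1 in auto)
   also have "\<dots> = (d / 2 + e) * (\<beta> * wt 3 n)" using par m1 by simp
   finally show ?thesis using Xc by simp
  next
   case False
   have "Phi \<omega> K P z (Xc k n) = 0" "Phi \<omega> K P' z' (Xc k n) = 0" using False by auto
   then show ?thesis using Xc z(3) P(3) par by simp
  qed
 next
  case (Yc k n)
  show ?thesis
  proof (cases "\<bar>k\<bar> \<ge> K \<and> n \<noteq> - k")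
   case True
   define m where "m = \<bar>real_of_int (n + k)\<bar>"
   have "1 \<le> \<bar>n + k\<bar>" using True by linarith
   then have "real_of_int 1 \<le> real_of_int \<bar>n + k\<bar>" by (simp only: of_int_le_iff)
   then have m1: "m \<ge> 1" by (simp add: m_def)
   define l where "l = 1 + \<bar>real_of_int n\<bar>"
   \<comment> \<open>The trade between decay and smallness: K <= |k| <= |n| + |n + k| <= (1 + |n|)
     |n + k|.\<close>
   have "real_of_int K \<le> \<bar>real_of_int k\<bar>" using True by linarith
   also have "\<dots> \<le> \<bar>real_of_int n\<bar> + m" unfolding m_def by simp
   also have "\<dots> \<le> \<bar>real_of_int n\<bar> * m + m" using m1 mult_left_mono[OF m1, of "\<bar>real_of_int n\<bar>"] by simp
   also have "\<dots> = l * m" by (simp add: l_def algebra_simps)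
   finally have Kl: "of_int K \<le> l * m" .
   have s2: "wt 2 n = l * wt 3 n" by (simp add: wt_32 l_def)
   let ?D = "(q n - q' n) + (conv q (Xt z k) n - conv q' (Xt z' k) n)"
   have "Phi \<omega> K P z (Yc k n) - Phi \<omega> K P' z' (Yc k n) =
    (- (\<i> / 2) * ?D - (z (Vc k) * z (Yc k n) - z' (Vc k) * z' (Yc k n))) / of_real (\<omega> * of_int (n + k))"
   proof -
    have gen: "(h * (p + f) - v) / m - (h * (p' + f') - v') / m = (h * ((p - p') + (f - f')) - (v - v')) / m"
     for h p f v m p' f' v' :: complex
     by (simp add: diff_divide_distrib[symmetric] algebra_simps)
    show ?thesis unfolding Phi.simps if_P[OF True] q_def[symmetric] q'_def[symmetric] by (rule gen)
   qed
   also have "norm \<dots> = norm (- (\<i> / 2) * ?D - (z (Vc k) * z (Yc k n) - z' (Vc k) * z' (Yc k n))) / (\<omega> * m)"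
    using par unfolding norm_divide m_def norm_of_real abs_mult by simp
   also have "\<dots> \<le> (1 / 2 * ((a + \<delta> * (d / 2 + e)) * wt 3 n) + 2 * \<beta> * d * (c * wt 2 n)) / (\<omega> * m)"
   proof (rule divide_right_mono[OF order_trans[OF norm_triangle_ineq4 add_mono]])
    have "norm ?D \<le> a * wt 3 n + (\<delta> * (d / 2 + e)) * wt 3 n"
     by (intro order_trans[OF norm_triangle_ineq] add_mono UX bndD[OF dq])
    then show "norm (- (\<i> / 2) * ?D) \<le> 1 / 2 * ((a + \<delta> * (d / 2 + e)) * wt 3 n)"
     by (simp only: norm_mult norm_minus_cancel half) (simp add: algebra_simps)
    show "norm (z (Vc k) * z (Yc k n) - z' (Vc k) * z' (Yc k n)) \<le> 2 * \<beta> * d * (c * wt 2 n)"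
     by (rule VW) (use z(1)[of "Yc k n"] z(4)[of "Yc k n"] par in auto)
   qed (use par m1 in auto)
   also have "\<dots> \<le> (\<omega> * m * ((d / 2 + e) * (c * wt 2 n))) / (\<omega> * m)"
   proof (intro divide_right_mono)
    have "\<delta> * (d / 2 + e) \<le> 1 * (d / 2 + e)" using par z(3) P(3) by (intro mult_right_mono) auto
    then have "1 / 2 * (a + \<delta> * (d / 2 + e)) \<le> d + e" using a0 z(3) by simp
    then have "1 / 2 * ((a + \<delta> * (d / 2 + e)) * wt 3 n) \<le> (d + e) * wt 3 n"
     using mult_right_mono[of _ _ "wt 3 n"] by (metis mult.assoc wt_nonneg)
    also have "\<dots> \<le> ((d + e) * wt 3 n) * (\<omega> * of_int K * c / 4)"
    proof -
     have "1 \<le> \<omega> * of_int K * c / 4" using par by linarith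
     then show ?thesis using mult_left_mono[of 1 "\<omega> * of_int K * c / 4" "(d + e) * wt 3 n"] z(3) P(3) by simp
    qed
    also have "\<dots> \<le> ((d + e) * wt 3 n) * (\<omega> * (l * m) * c / 4)"
     using Kl par z(3) P(3) by (intro mult_left_mono divide_right_mono mult_right_mono) auto
    finally have A: "1 / 2 * ((a + \<delta> * (d / 2 + e)) * wt 3 n) \<le> \<omega> * m * ((d / 4 + e / 4) * (c * wt 2 n))"
     unfolding s2 by (simp add: algebra_simps)
    have "2 * \<beta> * d * (c * wt 2 n) = (2 * d * (c * wt 2 n)) * \<beta>" by simp
    also have "\<dots> \<le> (2 * d * (c * wt 2 n)) * (\<omega> / 8)" using par z(3) by (intro mult_left_mono) auto
    also have "\<dots> \<le> (2 * d * (c * wt 2 n)) * (\<omega> / 8) * m" using m1 par z(3) mult_left_mono[OF m1, of "(2 * d * (c * wt 2 n)) * (\<omega> / 8)"] by simp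
    finally have B: "2 * \<beta> * d * (c * wt 2 n) \<le> \<omega> * m * (d / 4 * (c * wt 2 n))" by (simp add: algebra_simps)
    have "\<omega> * m * (d / 4 * (c * wt 2 n)) + \<omega> * m * ((d / 4 + e / 4) * (c * wt 2 n)) = \<omega> * m * ((d / 2 + e / 4) * (c * wt 2 n))"
     by (simp add: algebra_simps)
    also have "\<dots> \<le> \<omega> * m * ((d / 2 + e) * (c * wt 2 n))" using par m1 P(3) by (intro mult_left_mono mult_right_mono) auto
    finally show "1 / 2 * ((a + \<delta> * (d / 2 + e)) * wt 3 n) + 2 * \<beta> * d * (c * wt 2 n) \<le> \<omega> * m * ((d / 2 + e) * (c * wt 2 n))"
     using A B by linarith
   qed (use par m1 in auto)
   also have "\<dots> = (d / 2 + e) * (c * wt 2 n)" using par m1 by simp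
   finally show ?thesis using Yc by simp
  next
   case False
   have "Phi \<omega> K P z (Yc k n) = 0" "Phi \<omega> K P' z' (Yc k n) = 0" using False by auto
   then show ?thesis using Yc z(3) P(3) par by simp
  qed
 qed
qed

section \<open>A criterion for finite gap potentials\<close>

lemma integral_near_const:
 fixes f :: "real \<Rightarrow> complex"
 assumes "continuous_on UNIV f" "T \<ge> 0" "\<And>t. 0 \<le> t \<Longrightarrow> t \<le> T \<Longrightarrow> norm (f t - c) \<le> e"
 shows "norm (integral {0..T} f - T * c) \<le> T * e"
proof -
 have i: "f integrable_on {0..T}" by (rule loc_int_integrable[OF loc_int_continuous[OF assms(1)]])
 have l: "loc_int (\<lambda>t. f t - c)" by (intro loc_int_continuous continuous_intros assms)
 have "integral {0..T} f - T * c = integral {0..T} (\<lambda>t. f t - c)"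
  using assms(2) i by (subst Henstock_Kurzweil_Integration.integral_diff) (auto simp: scaleR_conv_of_real)
 also have "norm \<dots> \<le> integral {0..T} (\<lambda>t. e)"
  by (rule integral_norm_bound_integral) (use assms(3) loc_int_integrable[OF l] in auto)
 finally show ?thesis using assms(2) by simp
qed

text \<open>For determinant 1 the discriminant (m11 - m22)^2 + 4 m12 m21 equals the squared trace
  minus 4, which is 0 here.\<close>

lemma disc_bound:
 fixes m11 m22 m12 m21 :: complex
 assumes "m11 * m22 - m12 * m21 = 1" "(m11 + m22)\<^sup>2 = 4" "norm m12 \<le> b" "norm m21 \<le> b"
 shows "norm (m11 - m22) \<le> 2 * b"
proof -
 have "(m11 - m22)\<^sup>2 = - 4 * (m12 * m21)"
  using assms(1,2) by (simp add: power2_eq_square algebra_simps)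
 then have "(norm (m11 - m22))\<^sup>2 = 4 * (norm m12 * norm m21)"
  by (metis norm_power norm_mult norm_minus_cancel norm_numeral mult_minus_left)
 also have "\<dots> \<le> 4 * (b * b)" using assms(3,4) order_trans[OF norm_ge_zero assms(3)] by (intro mult_left_mono mult_mono) auto
 also have "\<dots> = (2 * b)\<^sup>2" by (simp add: power2_eq_square)
 finally show ?thesis
 proof (rule power2_le_imp_le)
  show "0 \<le> 2 * b" using norm_ge_zero[of m12] assms(3) by linarith
 qed
qed

lemma exp_i_bound: "norm (exp (\<i> * z * of_real s)) \<le> exp (\<bar>Im z\<bar> * \<bar>s\<bar>)"
proof -
 have "- (Im z * s) \<le> \<bar>Im z\<bar> * \<bar>s\<bar>" by (metis abs_ge_minus_self abs_mult)
 then show ?thesis by simp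
qed

text \<open>
 Away from the points \<open>2 \<pi> k / T\<close> the free term \<open>2 \<i> sin (z T / 2)\<close> of \<open>M 1 1 - M 2 2\<close> dominates.
\<close>

lemma no_roots_off_lattice:
 assumes a: "asymp_bound q T C" "C > 0" and T: "T > 0" and l: "loc_int q" and r: "r > 0" "r * T \<le> 1"
 obtains R where "R > 0" "\<And>z. norm z \<ge> R \<Longrightarrow> (\<And>k::int. norm (z - of_real (2 * pi * k / T)) \<ge> 2 * r) \<Longrightarrow>
   (trace (frame q T z))\<^sup>2 \<noteq> 4"
proof -
 obtain c where c: "c > 0" "\<And>w. (\<And>k::int. norm (w - of_real (pi * of_int k)) \<ge> r * T) \<Longrightarrow> norm (sin w) \<ge> c * exp \<bar>Im w\<bar>"
  using norm_sin_lower[of "r * T"] r T by auto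
 \<comment> \<open>A root would give c e <= 2 C e / |z| with e = exp(|Im z| T / 2), that is |z| <= 2
   C / c.\<close>
 define R where "R = 2 * C / c + 1"
 have "2 * C / c > 0" using a c by simp
 then have R: "R > 0" "2 * C / c < R" by (simp_all add: R_def)
 show ?thesis
 proof (rule that[OF R(1)], rule notI)
  fix z assume z: "norm z \<ge> R" and zk: "\<And>k::int. norm (z - of_real (2 * pi * k / T)) \<ge> 2 * r"
   and eq: "(trace (frame q T z))\<^sup>2 = 4"
  define M where "M = frame q T z"
  define e where "e = exp (\<bar>Im z\<bar> * T / 2)"
  define b where "b = C * e / norm z"
  have nz: "norm z > 0" "z \<noteq> 0" using z R by auto
  have M: "norm (M $ 1 $ 1 - exp (\<i> * z * T / 2)) \<le> b" "norm (M $ 1 $ 2) \<le> b" "norm (M $ 2 $ 1) \<le> b"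
   "norm (M $ 2 $ 2 - exp (- \<i> * z * T / 2)) \<le> b"
   using a(1) nz T unfolding asymp_bound_def Let_def M_def b_def e_def by auto
  have d: "M $ 1 $ 1 * M $ 2 $ 2 - M $ 1 $ 2 * M $ 2 $ 1 = 1"
   using det_frame[OF l, of T z] by (simp add: M_def det_2)
  have t: "(M $ 1 $ 1 + M $ 2 $ 2)\<^sup>2 = 4" using eq by (simp add: M_def trace_def sum_2)
  have 1: "norm (M $ 1 $ 1 - M $ 2 $ 2) \<le> 2 * b" by (rule disc_bound[OF d t M(2,3)])
  have sn: "2 * \<i> * sin (z * T / 2) = exp (\<i> * z * T / 2) - exp (- \<i> * z * T / 2)"
   by (simp add: sin_exp_eq field_simps)
  have "norm (2 * \<i> * sin (z * T / 2)) \<le> norm (M $ 1 $ 1 - M $ 2 $ 2) + norm (M $ 1 $ 1 - exp (\<i> * z * T / 2)) + norm (M $ 2 $ 2 - exp (- \<i> * z * T / 2))"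
  proof -
   have "exp (\<i> * z * T / 2) - exp (- \<i> * z * T / 2) = (M $ 1 $ 1 - M $ 2 $ 2) - (M $ 1 $ 1 - exp (\<i> * z * T / 2)) + (M $ 2 $ 2 - exp (- \<i> * z * T / 2))" by simp
   then show ?thesis unfolding sn by (metis order_trans[OF norm_triangle_ineq add_right_mono[OF norm_triangle_ineq4]])
  qed
  also have "\<dots> \<le> 4 * b" using 1 M by linarith
  finally have "norm (sin (z * T / 2)) \<le> 2 * b" by (simp add: norm_mult)
  moreover have "norm (sin (z * T / 2)) \<ge> c * exp \<bar>Im (z * T / 2)\<bar>"
  proof (rule c(2))
   fix k :: int
   have "z * T / 2 - of_real (pi * of_int k) = (z - of_real (2 * pi * k / T)) * (T / 2)"
    using T by (simp add: field_simps)
   also have "norm \<dots> = norm (z - of_real (2 * pi * k / T)) * (T / 2)" using T by (simp add: norm_mult norm_divide)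
   also have "\<dots> \<ge> 2 * r * (T / 2)" using zk[of k] T by (intro mult_right_mono) auto
   finally show "r * T \<le> norm (z * T / 2 - of_real (pi * of_int k))" by simp
  qed
  moreover have "\<bar>Im (z * T / 2)\<bar> = \<bar>Im z\<bar> * T / 2" using T by (simp add: abs_mult)
  ultimately have "c * e \<le> 2 * (C * e / norm z)" by (simp add: e_def b_def)
  then have "c * e * norm z \<le> 2 * C * e" using nz by (simp add: field_simps)
  moreover have "e > 0" by (simp add: e_def)
  moreover have "c * e * norm z = (c * norm z) * e" by simp
  ultimately have "c * norm z \<le> 2 * C" using mult_right_le_imp_le[of "c * norm z" e "2 * C"] by metis
  then have "norm z \<le> 2 * C / c" using c(1) by (simp add: field_simps)
  then show False using z R by linarith
 qed
qed

text \<open>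
 Near a double point \<open>l\<close> the matrix \<open>M z - M l\<close> is \<open>z - l\<close> times an integral which is close to
 \<open>(\<i> T / 2) diag (1, -1) M l\<close>.
\<close>

lemma double_point_local:
 assumes T: "T > 0"
 obtains r where "r > 0" "r * T \<le> 1"
  "\<And>q C. asymp_bound q T C \<Longrightarrow> C > 0 \<Longrightarrow> loc_int q \<Longrightarrow> \<exists>R>0. \<forall>z l s. norm z \<ge> R \<longrightarrow> norm l \<ge> R \<longrightarrow> \<bar>Im z\<bar> \<le> 2 * r \<longrightarrow> Im l = 0 \<longrightarrow>
    norm (z - l) \<le> 3 * r \<longrightarrow> frame q T l = mat s \<longrightarrow> norm s = 1 \<longrightarrow>
    (\<exists>X. frame q T z - mat s = mat (z - l) ** X \<and> norm (X $ 1 $ 1 - X $ 2 $ 2) \<ge> 3 / 4 * T \<and>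
     norm (X $ 1 $ 2) \<le> T / 10 \<and> norm (X $ 2 $ 1) \<le> T / 10)"
proof -
 have "((\<lambda>w::complex. exp w) \<longlongrightarrow> exp 0) (at 0)" by (intro tendsto_intros)
 from tendstoD[OF this, of "1 / 8"]
 have "\<exists>d>0. \<forall>w::complex. w \<noteq> 0 \<and> norm w < d \<longrightarrow> norm (exp w - 1) < 1 / 8"
  unfolding eventually_at dist_norm by simp
 then obtain d where d: "d > 0" "\<And>w::complex. norm w < d \<Longrightarrow> norm (exp w - 1) \<le> 1 / 8"
  by (metis cancel_comm_monoid_add_class.diff_cancel exp_zero less_eq_real_def norm_zero zero_le_divide_1_iff zero_le_numeral)
 \<comment> \<open>Depends on \<open>T\<close> only, so it can serve as the target accuracy before
   any potential is constructed. \<open>3 * r * T < d\<close> keeps exp(i (z - l) t / 2) within 1/8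
   of 1, and \<open>r * T \<le> 1 / 2\<close> keeps the free exponentials below 2.\<close>
 define r where "r = min (d / 4) (1 / 2) / T"
 have r: "r > 0" "r * T \<le> 1" "3 * r * T < d" "r * T \<le> 1 / 2" using T d by (auto simp: r_def)
 show ?thesis
 proof (rule that[OF r(1,2)])
  fix q C assume a: "asymp_bound q T C" "C > 0" and lq: "loc_int q"
  \<comment> \<open>Together with the bound 2 for the exponentials this makes every error in the
    asymptotics at most 1/200.\<close>
  define R where "R = 400 * C"
  have R: "R > 0" using a by (simp add: R_def)
  show "\<exists>R>0. \<forall>z l s. norm z \<ge> R \<longrightarrow> norm l \<ge> R \<longrightarrow> \<bar>Im z\<bar> \<le> 2 * r \<longrightarrow> Im l = 0 \<longrightarrow>
    norm (z - l) \<le> 3 * r \<longrightarrow> frame q T l = mat s \<longrightarrow> norm s = 1 \<longrightarrow>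
    (\<exists>X. frame q T z - mat s = mat (z - l) ** X \<and> norm (X $ 1 $ 1 - X $ 2 $ 2) \<ge> 3 / 4 * T \<and>
     norm (X $ 1 $ 2) \<le> T / 10 \<and> norm (X $ 2 $ 1) \<le> T / 10)"
  proof (intro exI[of _ R] conjI R allI impI)
   fix z l s :: complex
   assume z: "norm z \<ge> R" "norm l \<ge> R" "\<bar>Im z\<bar> \<le> 2 * r" "Im l = 0" "norm (z - l) \<le> 3 * r"
    and Ml: "frame q T l = mat s" and s: "norm s = 1"
   define F G where "F t = frame q t z" and "G t = frame q t l" for t
   define I where "I t = F t ** dgn (\<i> / 2) ** adj2 (G t)" for t
   have ci: "continuous_on UNIV I" unfolding I_def F_def G_def
    by (intro continuous_on_mm continuous_on_adj2 continuous_on_frame lq continuous_intros)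
   define X where "X = integral {0..T} I ** mat s"
   have eq: "frame q T z - mat s = mat (z - l) ** X"
    using frame_spectral_diff[OF lq, of T z l] T unfolding Ml X_def I_def F_def G_def by simp
   have ient: "integral {0..T} I $ i $ j = integral {0..T} (\<lambda>t. I t $ i $ j)" for i j
    using integral_linear[OF loc_int_integrable[OF loc_int_continuous[OF ci]] bounded_linear_entry, of 0 T i j] by (simp add: o_def)
   have ie: "I t $ 1 $ 1 - I t $ 2 $ 2 = \<i> / 2 * (F t $ 1 $ 1 * G t $ 2 $ 2 + F t $ 2 $ 2 * G t $ 1 $ 1 + F t $ 1 $ 2 * G t $ 2 $ 1 + F t $ 2 $ 1 * G t $ 1 $ 2)"
    "I t $ 1 $ 2 = - (\<i> / 2) * (F t $ 1 $ 1 * G t $ 1 $ 2 + F t $ 1 $ 2 * G t $ 1 $ 1)"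
    "I t $ 2 $ 1 = \<i> / 2 * (F t $ 2 $ 1 * G t $ 2 $ 2 + F t $ 2 $ 2 * G t $ 2 $ 1)" for t
    by (simp_all add: I_def mm_nth algebra_simps)
   have nz: "z \<noteq> 0" "l \<noteq> 0" "norm z > 0" "norm l > 0" using z R by auto
   \<comment> \<open>For the free frames, the difference of the diagonal entries of the integrand
     would be i times the cosine of (z - l) t / 2, which is near i, and its off-diagonal entries
     would vanish.\<close>
   have pt: "norm ((I t $ 1 $ 1 - I t $ 2 $ 2) - \<i>) \<le> 1 / 4 \<and> norm (I t $ 1 $ 2) \<le> 1 / 10 \<and> norm (I t $ 2 $ 1) \<le> 1 / 10"
    if t: "0 \<le> t" "t \<le> T" for t
   proof -
    define E where "E = exp (\<i> * z * t / 2)"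
    define E' where "E' = exp (- \<i> * z * t / 2)"
    define D where "D = exp (\<i> * l * t / 2)"
    define D' where "D' = exp (- \<i> * l * t / 2)"
    have "\<bar>Im z\<bar> * t / 2 \<le> 2 * r * T / 2" using z t by (intro divide_right_mono mult_mono) (use r in auto)
    then have ez: "\<bar>Im z\<bar> * t / 2 \<le> 1 / 2" using r(4) by simp
    have "exp (1 / 2 :: real) \<le> 2" using exp_half_le2 by simp
    then have e2: "exp (\<bar>Im z\<bar> * t / 2) \<le> 2" using ez by (meson exp_le_cancel_iff order_trans)
    have "E = exp (\<i> * z * of_real (t / 2))" "E' = exp (\<i> * z * of_real (- (t / 2)))" by (simp_all add: E_def E'_def)
    moreover have "exp (\<bar>Im z\<bar> * \<bar>t / 2\<bar>) \<le> 2" "exp (\<bar>Im z\<bar> * \<bar>- (t / 2)\<bar>) \<le> 2" using e2 t by simp_all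
    ultimately have E2: "norm E \<le> 2" "norm E' \<le> 2"
     using exp_i_bound[of z "t / 2"] exp_i_bound[of z "- (t / 2)"] by (metis order_trans)+
    have D2: "norm D = 1" "norm D' = 1" using z(4) by (simp_all add: D_def D'_def)
    have cz: "C * exp (\<bar>Im z\<bar> * t / 2) / norm z \<le> 1 / 200"
    proof -
     have "C * exp (\<bar>Im z\<bar> * t / 2) \<le> C * 2" using e2 a by (intro mult_left_mono) auto
     also have "\<dots> \<le> norm z / 200" using z by (simp add: R_def)
     finally show ?thesis using nz by (simp add: field_simps)
    qed
    have cl: "C * exp (\<bar>Im l\<bar> * t / 2) / norm l \<le> 1 / 200"
    proof -
     have "C \<le> norm l / 200" using z a by (simp add: R_def)
     then show ?thesis using nz z(4) by (simp add: field_simps)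
    qed
    have F: "norm (F t $ 1 $ 1 - E) \<le> 1 / 200" "norm (F t $ 1 $ 2) \<le> 1 / 200" "norm (F t $ 2 $ 1) \<le> 1 / 200" "norm (F t $ 2 $ 2 - E') \<le> 1 / 200"
     using a(1)[unfolded asymp_bound_def Let_def, rule_format, OF nz(1) t] cz unfolding F_def E_def E'_def by linarith+
    have G: "norm (G t $ 1 $ 1 - D) \<le> 1 / 200" "norm (G t $ 1 $ 2) \<le> 1 / 200" "norm (G t $ 2 $ 1) \<le> 1 / 200" "norm (G t $ 2 $ 2 - D') \<le> 1 / 200"
     using a(1)[unfolded asymp_bound_def Let_def, rule_format, OF nz(2) t] cl unfolding G_def D_def D'_def by linarith+
    have Fb: "norm (F t $ 1 $ 1) \<le> 3" "norm (F t $ 2 $ 2) \<le> 3"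
     using F E2 norm_triangle_sub[of "F t $ 1 $ 1" E] norm_triangle_sub[of "F t $ 2 $ 2" E'] by linarith+
    have Gb: "norm (G t $ 1 $ 1) \<le> 3" "norm (G t $ 2 $ 2) \<le> 3"
     using G D2 norm_triangle_sub[of "G t $ 1 $ 1" D] norm_triangle_sub[of "G t $ 2 $ 2" D'] by linarith+
    have prod: "norm (x * y) \<le> A * B" if "norm x \<le> A" "norm y \<le> B" for x y :: complex and A B
     unfolding norm_mult using that order_trans[OF norm_ge_zero that(1)] by (intro mult_mono) auto
    have zl: "norm ((z - l) * (t / 2)) < d" if "0 \<le> t" "t \<le> T" for t :: real
    proof -
     have "norm ((z - l) * (t / 2)) = norm (z - l) * (t / 2)" using that by (simp add: norm_mult norm_divide)
     also have "\<dots> \<le> (3 * r) * (T / 2)" using z that r by (intro mult_mono) auto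
     also have "\<dots> < d" using r T by (simp add: algebra_simps) (smt (verit) mult_pos_pos)
     finally show ?thesis .
    qed
    have ED: "E * D' = exp (\<i> * ((z - l) * (t / 2)))" "E' * D = exp (- (\<i> * ((z - l) * (t / 2))))"
     unfolding E_def D'_def E'_def D_def exp_add[symmetric] by (simp_all add: algebra_simps diff_divide_distrib)
    have b8: "norm (E * D' - 1) \<le> 1 / 8" "norm (E' * D - 1) \<le> 1 / 8"
     unfolding ED by (rule d(2); use zl[OF t] in \<open>simp add: norm_mult\<close>)+
    have p1: "norm (F t $ 1 $ 1 * G t $ 2 $ 2 - 1) \<le> 3 / 16"
    proof -
     have "F t $ 1 $ 1 * G t $ 2 $ 2 - 1 = F t $ 1 $ 1 * (G t $ 2 $ 2 - D') + (F t $ 1 $ 1 - E) * D' + (E * D' - 1)" by (simp add: algebra_simps)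
     also have "norm \<dots> \<le> norm (F t $ 1 $ 1 * (G t $ 2 $ 2 - D')) + norm ((F t $ 1 $ 1 - E) * D') + norm (E * D' - 1)"
      by (intro order_trans[OF norm_triangle_ineq] add_mono norm_triangle_ineq order_refl)
     also have "\<dots> \<le> 3 * (1 / 200) + (1 / 200) * 1 + 1 / 8"
      using prod[OF Fb(1) G(4)] prod[OF F(1), of D' 1] D2 b8 by linarith
     finally show ?thesis by simp
    qed
    have p2: "norm (F t $ 2 $ 2 * G t $ 1 $ 1 - 1) \<le> 3 / 16"
    proof -
     have "F t $ 2 $ 2 * G t $ 1 $ 1 - 1 = F t $ 2 $ 2 * (G t $ 1 $ 1 - D) + (F t $ 2 $ 2 - E') * D + (E' * D - 1)" by (simp add: algebra_simps)
     also have "norm \<dots> \<le> norm (F t $ 2 $ 2 * (G t $ 1 $ 1 - D)) + norm ((F t $ 2 $ 2 - E') * D) + norm (E' * D - 1)"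
      by (intro order_trans[OF norm_triangle_ineq] add_mono norm_triangle_ineq order_refl)
     also have "\<dots> \<le> 3 * (1 / 200) + (1 / 200) * 1 + 1 / 8"
      using prod[OF Fb(2) G(1)] prod[OF F(4), of D 1] D2 b8 by linarith
     finally show ?thesis by simp
    qed
    have half: "norm (\<i> / 2 :: complex) = 1 / 2" by (simp add: norm_divide)
    have "(I t $ 1 $ 1 - I t $ 2 $ 2) - \<i> = \<i> / 2 * ((F t $ 1 $ 1 * G t $ 2 $ 2 - 1) + (F t $ 2 $ 2 * G t $ 1 $ 1 - 1) + F t $ 1 $ 2 * G t $ 2 $ 1 + F t $ 2 $ 1 * G t $ 1 $ 2)"
     unfolding ie by (simp add: algebra_simps)
    also have "norm \<dots> \<le> 1 / 2 * (3 / 16 + 3 / 16 + (1 / 200) * (1 / 200) + (1 / 200) * (1 / 200))"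
     unfolding norm_mult[of "\<i> / 2"] half
     by (intro mult_left_mono order_trans[OF norm_triangle_ineq] add_mono prod p1 p2 F G order_refl) simp
    also have "\<dots> \<le> 1 / 4" by simp
    finally have A: "norm ((I t $ 1 $ 1 - I t $ 2 $ 2) - \<i>) \<le> 1 / 4" .
    have "norm (I t $ 1 $ 2) \<le> 1 / 2 * (3 * (1 / 200) + (1 / 200) * 3)"
     unfolding ie norm_mult[of "- (\<i> / 2)"] norm_minus_cancel half
     by (intro mult_left_mono order_trans[OF norm_triangle_ineq] add_mono prod Fb Gb F G order_refl) simp
    moreover have "norm (I t $ 2 $ 1) \<le> 1 / 2 * ((1 / 200) * 3 + 3 * (1 / 200))"
     unfolding ie norm_mult[of "\<i> / 2"] half
     by (intro mult_left_mono order_trans[OF norm_triangle_ineq] add_mono prod Fb Gb F G order_refl) simp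
    ultimately show ?thesis using A by simp
   qed
   have ce: "continuous_on UNIV (\<lambda>t. I t $ i $ j)" for i j by (rule continuous_on_entry[OF ci])
   have X1: "X $ 1 $ 1 - X $ 2 $ 2 = integral {0..T} (\<lambda>t. I t $ 1 $ 1 - I t $ 2 $ 2) * s"
    using loc_int_integrable[OF loc_int_continuous[OF ce]]
    by (simp add: X_def mm_mat ient Henstock_Kurzweil_Integration.integral_diff left_diff_distrib)
   have "norm (integral {0..T} (\<lambda>t. I t $ 1 $ 1 - I t $ 2 $ 2) - T * \<i>) \<le> T * (1 / 4)"
    by (rule integral_near_const) (use pt T in \<open>auto intro!: continuous_intros ce\<close>)
   moreover have "norm (T * \<i>) = T" using T by (simp add: norm_mult)
   ultimately have "norm (integral {0..T} (\<lambda>t. I t $ 1 $ 1 - I t $ 2 $ 2)) \<ge> 3 / 4 * T"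
    using norm_triangle_ineq2[of "T * \<i>" "integral {0..T} (\<lambda>t. I t $ 1 $ 1 - I t $ 2 $ 2)"]
    by (simp add: norm_minus_commute)
   then have X1': "norm (X $ 1 $ 1 - X $ 2 $ 2) \<ge> 3 / 4 * T" unfolding X1 norm_mult s by simp
   have "norm (integral {0..T} (\<lambda>t. I t $ 1 $ 2) - complex_of_real T * 0) \<le> T * (1 / 10)" "norm (integral {0..T} (\<lambda>t. I t $ 2 $ 1) - complex_of_real T * 0) \<le> T * (1 / 10)"
    by (rule integral_near_const; use pt T ce in auto)+
   then have X2: "norm (X $ 1 $ 2) \<le> T / 10" "norm (X $ 2 $ 1) \<le> T / 10"
    by (simp_all add: X_def mm_mat ient norm_mult s)
   show "\<exists>X. frame q T z - mat s = mat (z - l) ** X \<and> norm (X $ 1 $ 1 - X $ 2 $ 2) \<ge> 3 / 4 * T \<and>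
     norm (X $ 1 $ 2) \<le> T / 10 \<and> norm (X $ 2 $ 1) \<le> T / 10"
    using eq X1' X2 by blast
  qed
 qed
qed

lemma zorder_entire_nonzero:
 assumes "f holomorphic_on UNIV" "\<exists>w. f w \<noteq> 0"
 shows "f z \<noteq> 0 \<Longrightarrow> zorder f z = 0" "zorder f z \<ge> 0" "f z = 0 \<Longrightarrow> zorder f z \<ge> 1"
proof -
 have "\<exists>w\<in>UNIV. f w \<noteq> 0" using assms(2) by simp
 from zorder_exist_zero[OF assms(1) open_UNIV connected_UNIV UNIV_I this, of z]
 have "if f z = 0 then zorder f z > 0 else zorder f z = 0" by blast
 then show "f z \<noteq> 0 \<Longrightarrow> zorder f z = 0" "zorder f z \<ge> 0" "f z = 0 \<Longrightarrow> zorder f z \<ge> 1"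
  by (auto split: if_splits)
qed

lemma zorder_factor:
 assumes "g holomorphic_on UNIV" "g z \<noteq> 0" "\<And>w. f w = g w * (w - z) ^ n"
 shows "zorder f z = int n"
 by (rule zorder_eqI[of UNIV z g]) (use assms in \<open>auto simp: power_int_of_nat\<close>)

lemma entire_divide_root:
 assumes "f holomorphic_on UNIV" "f a = 0"
 obtains g where "g holomorphic_on UNIV" "\<And>z. f z = g z * (z - a)"
proof -
 have "(\<lambda>z. if z = a then deriv f a else (f z - f a) / (z - a)) holomorphic_on UNIV"
  by (rule pole_lemma[OF assms(1)]) simp
 then show ?thesis by (rule that) (use assms(2) in auto)
qed

text \<open>For quotients by powers of \<open>w - z\<close>, whose lower bounds are only known away
  from the point \<open>z\<close> itself.\<close>

lemma continuous_lower_bound: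
 fixes f :: "complex \<Rightarrow> complex"
 assumes "f holomorphic_on UNIV" "r > 0" "c > 0" "\<And>w. w \<noteq> z \<Longrightarrow> norm (w - z) < r \<Longrightarrow> norm (f w) \<ge> c"
 shows "f z \<noteq> 0"
proof -
 have "isCont f z" using holomorphic_on_imp_continuous_on[OF assms(1)] by (simp add: continuous_on_eq_continuous_at)
 then have "((\<lambda>w. norm (f w)) \<longlongrightarrow> norm (f z)) (at z)" by (intro tendsto_norm) (simp add: isCont_def)
 moreover have "\<forall>\<^sub>F w in at z. c \<le> norm (f w)"
  unfolding eventually_at dist_norm by (intro exI[of _ r]) (use assms(2,4) in blast)
 ultimately have "c \<le> norm (f z)" by (rule tendsto_lowerbound) simp
 then show ?thesis using assms(3) by auto
qed

section \<open>Absolutely convergent Fourier series\<close>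

definition ex :: "real \<Rightarrow> int \<Rightarrow> real \<Rightarrow> complex" where
 "ex \<omega> n t = exp ((\<i> * of_real (\<omega> * of_int n)) * of_real t)"

definition fsr :: "real \<Rightarrow> (int \<Rightarrow> complex) \<Rightarrow> real \<Rightarrow> complex" where
 "fsr \<omega> a t = infsum (\<lambda>n. a n * ex \<omega> n t) UNIV"

lemma norm_ex [simp]: "norm (ex \<omega> n t) = 1" by (simp add: ex_def)

lemma ex_0 [simp]: "ex \<omega> 0 t = 1" by (simp add: ex_def)

lemma ex_add: "ex \<omega> m t * ex \<omega> n t = ex \<omega> (m + n) t"
 unfolding ex_def exp_add[symmetric] by (simp add: algebra_simps)

lemma ex_cnj: "cnj (ex \<omega> n t) = ex \<omega> (- n) t" by (simp add: ex_def exp_cnj)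

lemma continuous_on_ex: "continuous_on UNIV (ex \<omega> n)" unfolding ex_def by (intro continuous_intros)

lemma ex_periodic:
 assumes "T > 0" shows "ex (2 * pi / T) n (t + T) = ex (2 * pi / T) n t"
proof -
 have "(\<i> * of_real (2 * pi / T * of_int n)) * of_real (t + T) = (\<i> * of_real (2 * pi / T * of_int n)) * of_real t + 2 * of_int n * of_real pi * \<i>"
  using assms by (simp add: field_simps)
 moreover have "exp (2 * of_int n * of_real pi * \<i>) = (1 :: complex)" using exp_integer_2pi[OF Ints_of_int[of n]] by simp
 ultimately show ?thesis unfolding ex_def by (simp only: exp_add mult_1_right)
qed

lemma fsr_abs_summable: "bnd 2 A a \<Longrightarrow> (\<lambda>n. norm (a n * ex \<omega> n t)) summable_on UNIV"
 using bnd_abs_summable[of 2 A a] by (simp add: norm_mult)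

lemma fsr_summable: "bnd 2 A a \<Longrightarrow> (\<lambda>n. a n * ex \<omega> n t) summable_on UNIV"
 by (rule abs_summable_summable[OF fsr_abs_summable])

lemma norm_fsr_le:
 assumes "bnd 2 A a" shows "norm (fsr \<omega> a t) \<le> A * wsum 2"
proof -
 have "norm (fsr \<omega> a t) \<le> infsum (\<lambda>n. norm (a n * ex \<omega> n t)) UNIV"
  unfolding fsr_def by (rule norm_infsum_bound[OF fsr_abs_summable[OF assms]])
 also have "\<dots> \<le> infsum (\<lambda>n. A * wt 2 n) UNIV"
  by (rule infsum_mono[OF fsr_abs_summable[OF assms] summable_on_cmult_right[OF wt_summable]])
   (use bndD[OF assms] in \<open>auto simp: norm_mult\<close>)
 also have "\<dots> = A * wsum 2" by (simp add: infsum_cmult_right' wsum_def)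
 finally show ?thesis .
qed

lemma fsr_add: "bnd 2 A a \<Longrightarrow> bnd 2 B b \<Longrightarrow> fsr \<omega> (\<lambda>n. a n + b n) t = fsr \<omega> a t + fsr \<omega> b t"
 unfolding fsr_def distrib_right by (rule infsum_add[OF fsr_summable fsr_summable])

lemma fsr_scale: "fsr \<omega> (\<lambda>n. c * a n) t = c * fsr \<omega> a t"
 unfolding fsr_def mult.assoc by (rule infsum_cmult_right')

lemma fsr_diff:
 assumes "bnd 2 A a" "bnd 2 B b"
 shows "fsr \<omega> (\<lambda>n. a n - b n) t = fsr \<omega> a t - fsr \<omega> b t"
 using fsr_add[OF assms(1) bnd_minus[OF assms(2)], of \<omega> t] fsr_scale[of \<omega> "-1" b t] by simp

lemma fsr_cnj: "cnj (fsr \<omega> a t) = fsr \<omega> (rv a) t"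
proof -
 have "cnj (fsr \<omega> a t) = infsum (\<lambda>n. cnj (a n) * ex \<omega> (- n) t) UNIV"
  unfolding fsr_def infsum_cnj[symmetric] by (simp add: ex_cnj)
 also have "\<dots> = infsum (\<lambda>n. rv a n * ex \<omega> n t) UNIV"
  using summable_flip(2)[of "\<lambda>n. rv a n * ex \<omega> n t" 0] by (simp add: rv_def)
 finally show ?thesis by (simp add: fsr_def)
qed

lemma fsr_periodic: "T > 0 \<Longrightarrow> fsr (2 * pi / T) a (t + T) = fsr (2 * pi / T) a t"
 by (simp add: fsr_def ex_periodic)

lemma fsr_finite:
 assumes "finite S" "\<And>n. n \<notin> S \<Longrightarrow> a n = 0"
 shows "fsr \<omega> a t = (\<Sum>n\<in>S. a n * ex \<omega> n t)"
proof -
 have "fsr \<omega> a t = infsum (\<lambda>n. a n * ex \<omega> n t) S"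
  unfolding fsr_def by (rule infsum_cong_neutral) (use assms in auto)
 then show ?thesis using assms(1) by simp
qed

lemma continuous_on_fsr:
 assumes "bnd 2 A a" shows "continuous_on UNIV (fsr \<omega> a)"
proof -
 have "uniform_limit UNIV (\<lambda>S t. \<Sum>n\<in>S. a n * ex \<omega> n t) (\<lambda>t. \<Sum>\<^sub>\<infinity>n\<in>UNIV. a n * ex \<omega> n t) (finite_subsets_at_top UNIV)"
  by (rule Weierstrass_m_test_general[where M = "\<lambda>n. norm (a n)"])
   (use bnd_abs_summable[OF assms] in \<open>auto simp: norm_mult\<close>)
 then have "continuous_on UNIV (\<lambda>t. \<Sum>\<^sub>\<infinity>n\<in>UNIV. a n * ex \<omega> n t)"
  by (rule uniform_limit_theorem[rotated])
   (auto intro!: always_eventually continuous_on_sum continuous_on_mult continuous_on_const continuous_on_ex)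
 then show ?thesis by (simp add: fsr_def[abs_def])
qed

lemma fsr_partial_sums:
 assumes "bnd 2 A a"
 shows "(\<lambda>N. \<Sum>n\<in>{- int N..int N}. a n * ex \<omega> n t) \<longlonglongrightarrow> fsr \<omega> a t"
proof -
 have "((\<lambda>n. a n * ex \<omega> n t) has_sum fsr \<omega> a t) UNIV"
  unfolding fsr_def by (rule has_sum_infsum[OF fsr_summable[OF assms]])
 then have l: "((\<lambda>S. \<Sum>n\<in>S. a n * ex \<omega> n t) \<longlongrightarrow> fsr \<omega> a t) (finite_subsets_at_top UNIV)"
  by (simp add: has_sum_def)
 have f: "filterlim (\<lambda>N. {- int N..int N}) (finite_subsets_at_top UNIV) sequentially"
  unfolding filterlim_finite_subsets_at_top
 proof (intro allI impI)
  fix X :: "int set" assume X: "finite X \<and> X \<subseteq> UNIV"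
  define m where "m = Max (insert 0 (abs ` X))"
  have m: "\<bar>x\<bar> \<le> m" if "x \<in> X" for x unfolding m_def by (rule Max_ge) (use X that in auto)
  show "\<forall>\<^sub>F N in sequentially. finite {- int N..int N} \<and> X \<subseteq> {- int N..int N} \<and> {- int N..int N} \<subseteq> UNIV"
   using eventually_ge_at_top[of "nat m"]
  proof eventually_elim
   case (elim N)
   then have "m \<le> int N" by linarith
   then show ?case using m by (force simp: abs_le_iff)
  qed
 qed
 show ?thesis using filterlim_compose[OF l f] by simp
qed

text \<open>The identity is first obtained in integrated form, by dominated convergence of symmetric
  partial sums; continuity of the derived series then gives the derivative at every point.\<close>

lemma fsr_vd:
 assumes a: "bnd 2 A a" and b: "bnd 2 B (\<lambda>n. of_int n * a n)"
 shows "(fsr \<omega> a has_vector_derivative fsr \<omega> (\<lambda>n. \<i> * of_real \<omega> * (of_int n * a n)) t) (at t)"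
proof -
 define g where "g n = \<i> * of_real \<omega> * (of_int n * a n)" for n
 have bg: "bnd 2 (norm (\<i> * of_real \<omega> :: complex) * B) g" unfolding g_def by (rule bnd_scale[OF b])
 define B' where "B' = norm (\<i> * of_real \<omega> :: complex) * B"
 define S where "S N t = (\<Sum>n\<in>{- int N..int N}. a n * ex \<omega> n t)" for N t
 define S' where "S' N t = (\<Sum>n\<in>{- int N..int N}. g n * ex \<omega> n t)" for N t
 have cg: "continuous_on UNIV (fsr \<omega> g)" by (rule continuous_on_fsr[OF bg])
 have cS': "continuous_on UNIV (S' N)" for N
  unfolding S'_def by (intro continuous_on_sum continuous_on_mult continuous_on_const continuous_on_ex)
 have exd: "(ex \<omega> n has_vector_derivative (\<i> * of_real (\<omega> * of_int n)) * ex \<omega> n t) (at t)" for n t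
  unfolding ex_def[abs_def]
  by (rule has_ac_imp_vector_derivative[OF has_ac_exp]) (intro continuous_intros)
 have "(S N has_vector_derivative S' N t) (at t)" for N t
  unfolding S_def[abs_def] S'_def
 proof (rule has_vector_derivative_sum)
  fix n
  have "((\<lambda>t. a n * ex \<omega> n t) has_vector_derivative a n * ((\<i> * of_real (\<omega> * of_int n)) * ex \<omega> n t)) (at t)"
   by (rule bounded_linear.has_vector_derivative[OF bounded_linear_mult_right exd])
  then show "((\<lambda>t. a n * ex \<omega> n t) has_vector_derivative g n * ex \<omega> n t) (at t)"
   by (simp add: g_def ac_simps)
 qed
 then have acS: "has_ac_derivative (S N) (S' N)" for N by (intro has_vector_derivative_imp_ac cS')
 have "has_ac_derivative (fsr \<omega> a) (fsr \<omega> g)"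
 proof (rule has_acI[OF loc_int_continuous[OF cg]])
  fix x y :: real assume "x \<le> y"
  have bd: "norm (S' N t) \<le> B' * wsum 2" for N t
  proof -
   have "norm (S' N t) \<le> (\<Sum>n\<in>{- int N..int N}. norm (g n * ex \<omega> n t))" unfolding S'_def by (rule norm_sum)
   also have "\<dots> \<le> (\<Sum>n\<in>{- int N..int N}. B' * wt 2 n)"
    by (intro sum_mono) (use bndD[OF bg] in \<open>auto simp: norm_mult B'_def\<close>)
   also have "\<dots> = B' * (\<Sum>n\<in>{- int N..int N}. wt 2 n)" by (simp add: sum_distrib_left)
   also have "\<dots> \<le> B' * wsum 2"
   proof (intro mult_left_mono)
    have "infsum (wt 2) {- int N..int N} \<le> infsum (wt 2) UNIV"
     by (intro infsum_mono_neutral wt_summable) (auto intro: summable_on_finite)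
    then show "(\<Sum>n\<in>{- int N..int N}. wt 2 n) \<le> wsum 2" by (simp add: wsum_def)
    show "0 \<le> B'" using bnd_nonneg[OF bg] by (simp add: B'_def)
   qed
   finally show ?thesis .
  qed
  have "(\<lambda>N. integral {x..y} (S' N)) \<longlonglongrightarrow> integral {x..y} (fsr \<omega> g)"
   by (rule dominated_convergence(2)[where h = "\<lambda>_. B' * wsum 2"])
    (use bd fsr_partial_sums[OF bg] loc_int_integrable[OF loc_int_continuous[OF cS']] in \<open>auto simp: S'_def\<close>)
  moreover have "integral {x..y} (S' N) = S N y - S N x" for N by (rule has_ac_integral[OF acS \<open>x \<le> y\<close>])
  moreover have "(\<lambda>N. S N y - S N x) \<longlonglongrightarrow> fsr \<omega> a y - fsr \<omega> a x"
   unfolding S_def by (intro tendsto_diff fsr_partial_sums[OF a])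
  ultimately show "integral {x..y} (fsr \<omega> g) = fsr \<omega> a y - fsr \<omega> a x" using LIMSEQ_unique by auto
 qed
 from has_ac_imp_vector_derivative[OF this cg, of t] show ?thesis unfolding g_def[abs_def] .
qed

text \<open>Absolute summability of the double family allows the exchange of the sums, after which
  the inner sum is a translate of the series of \<open>b\<close>.\<close>

lemma fsr_conv:
 assumes a: "bnd 2 A a" and b: "bnd 2 B b"
 shows "fsr \<omega> (conv a b) t = fsr \<omega> a t * fsr \<omega> b t"
proof -
 let ?f = "\<lambda>j n. a j * b (n - j) * ex \<omega> n t"
 have nb: "(\<lambda>n. norm (b n)) summable_on UNIV" by (rule bnd_abs_summable[OF b]) simp
 have "(\<lambda>x. norm (case x of (j, n) \<Rightarrow> ?f j n)) summable_on (UNIV \<times> UNIV)"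
  unfolding Infinite_Sum.abs_summable_on_Sigma_iff
 proof (intro conjI ballI)
  fix j :: int
  have "(\<lambda>n. norm (a j) * norm (b (n - j))) summable_on UNIV"
  proof (rule summable_on_cmult_right)
   have bij: "bij_betw (\<lambda>n. n - j) UNIV UNIV" by (rule bij_betwI[where g = "\<lambda>n. n + j"]) auto
   show "(\<lambda>n. norm (b (n - j))) summable_on UNIV"
    using summable_on_reindex_bij_betw[OF bij, of "\<lambda>n. norm (b n)"] nb by simp
  qed
  then show "(\<lambda>n. norm (case (j, n) of (j, n) \<Rightarrow> ?f j n)) summable_on UNIV" by (simp add: norm_mult)
 next
  have "infsum (\<lambda>n. norm (b (n - j))) UNIV = infsum (\<lambda>n. norm (b n)) UNIV" for j
  proof -
   have bij: "bij_betw (\<lambda>n. n - j) UNIV UNIV" by (rule bij_betwI[where g = "\<lambda>n. n + j"]) auto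
   show ?thesis using infsum_reindex_bij_betw[OF bij, of "\<lambda>n. norm (b n)"] by simp
  qed
  then have pw: "infsum (\<lambda>n. norm (case (j, n) of (j, n) \<Rightarrow> ?f j n)) UNIV = norm (a j) * infsum (\<lambda>n. norm (b n)) UNIV" for j
   by (simp add: norm_mult infsum_cmult_right')
  have "(\<lambda>j. norm (norm (a j) * infsum (\<lambda>n. norm (b n)) UNIV)) summable_on UNIV"
  proof -
   have "infsum (\<lambda>n. norm (b n)) UNIV \<ge> 0" by (rule infsum_nonneg) simp
   then show ?thesis using summable_on_cmult_left[OF bnd_abs_summable[OF a], of "infsum (\<lambda>n. norm (b n)) UNIV"] by simp
  qed
  then show "(\<lambda>j. norm (infsum (\<lambda>n. norm (case (j, n) of (j, n) \<Rightarrow> ?f j n)) UNIV)) summable_on UNIV" unfolding pw .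
 qed
 then have s: "(\<lambda>(j, n). ?f j n) summable_on (UNIV \<times> UNIV)" by (rule abs_summable_summable)
 have "fsr \<omega> (conv a b) t = infsum (\<lambda>n. infsum (\<lambda>j. ?f j n) UNIV) UNIV"
  unfolding fsr_def conv_def by (simp add: infsum_cmult_left')
 also have "\<dots> = infsum (\<lambda>j. infsum (\<lambda>n. ?f j n) UNIV) UNIV" by (rule infsum_swap_banach[OF s, symmetric])
 also have "\<dots> = infsum (\<lambda>j. (a j * ex \<omega> j t) * fsr \<omega> b t) UNIV"
 proof (rule infsum_cong)
  fix j :: int
  have bij: "bij_betw (\<lambda>n. n + j) UNIV UNIV" by (rule bij_betwI[where g = "\<lambda>n. n - j"]) auto
  have "infsum (\<lambda>n. ?f j n) UNIV = infsum (\<lambda>n. ?f j (n + j)) UNIV"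
   by (rule infsum_reindex_bij_betw[OF bij, symmetric])
  also have "\<dots> = infsum (\<lambda>n. (a j * ex \<omega> j t) * (b n * ex \<omega> n t)) UNIV"
   by (rule infsum_cong) (simp add: ex_add[symmetric])
  also have "\<dots> = (a j * ex \<omega> j t) * fsr \<omega> b t" unfolding fsr_def by (rule infsum_cmult_right')
  finally show "infsum (\<lambda>n. ?f j n) UNIV = (a j * ex \<omega> j t) * fsr \<omega> b t" .
 qed
 also have "\<dots> = fsr \<omega> a t * fsr \<omega> b t" unfolding fsr_def by (rule infsum_cmult_left')
 finally show ?thesis .
qed

section \<open>Potentials with double points\<close>

text \<open>
 Conservation of \<open>\<bar>a\<bar>\<^sup>2 + \<bar>b\<bar>\<^sup>2\<close> over one period forces the spectral parameter to be real; then
 \<open>(- cnj b, cnj a)\<close> is a second periodic row solution.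
\<close>

lemma double_point_of_row:
 assumes T: "T > 0" and q: "continuous_on UNIV q"
  and a: "\<And>t. (a has_vector_derivative (\<i> * l * a t - cnj (q t) * b t) / 2) (at t)"
  and b: "\<And>t. (b has_vector_derivative (q t * a t - \<i> * l * b t) / 2) (at t)"
  and per: "a T = s * a 0" "b T = s * b 0" "norm s = 1"
  and ab: "\<And>t. norm (b t) < norm (a t)"
 shows "Im l = 0" "s\<^sup>2 = 1 \<Longrightarrow> frame q T l = mat s"
proof -
 have lq: "loc_int q" by (rule loc_int_continuous[OF q])
 have cnjd: "(f has_vector_derivative f') (at t) \<Longrightarrow> ((\<lambda>t. cnj (f t)) has_vector_derivative cnj f') (at t)" for f f' and t :: real
  by (rule bounded_linear.has_vector_derivative[OF bounded_linear_cnj])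
 define E where "E t = (norm (a t))\<^sup>2 + (norm (b t))\<^sup>2" for t
 have Ed: "(E has_real_derivative - Im l * ((norm (a t))\<^sup>2 - (norm (b t))\<^sup>2)) (at t)" for t
 proof -
  have "((\<lambda>t. a t * cnj (a t) + b t * cnj (b t)) has_vector_derivative
   ((a t * cnj ((\<i> * l * a t - cnj (q t) * b t) / 2) + ((\<i> * l * a t - cnj (q t) * b t) / 2) * cnj (a t)) +
    (b t * cnj ((q t * a t - \<i> * l * b t) / 2) + ((q t * a t - \<i> * l * b t) / 2) * cnj (b t)))) (at t)"
   by (intro has_vector_derivative_add has_vector_derivative_mult cnjd a b)
  from bounded_linear.has_vector_derivative[OF bounded_linear_Re this]
  have "((\<lambda>t. Re (a t * cnj (a t) + b t * cnj (b t))) has_vector_derivative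
   Re ((a t * cnj ((\<i> * l * a t - cnj (q t) * b t) / 2) + ((\<i> * l * a t - cnj (q t) * b t) / 2) * cnj (a t)) +
    (b t * cnj ((q t * a t - \<i> * l * b t) / 2) + ((q t * a t - \<i> * l * b t) / 2) * cnj (b t)))) (at t)" .
  moreover have "Re (a t * cnj (a t) + b t * cnj (b t)) = E t" for t
   unfolding E_def cmod_power2 by (simp add: power2_eq_square)
  moreover have "Re ((a t * cnj ((\<i> * l * a t - cnj (q t) * b t) / 2) + ((\<i> * l * a t - cnj (q t) * b t) / 2) * cnj (a t)) +
    (b t * cnj ((q t * a t - \<i> * l * b t) / 2) + ((q t * a t - \<i> * l * b t) / 2) * cnj (b t))) = - Im l * ((norm (a t))\<^sup>2 - (norm (b t))\<^sup>2)"
   unfolding cmod_power2 by (simp add: power2_eq_square algebra_simps)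
  ultimately show ?thesis by (simp add: has_real_derivative_iff_has_vector_derivative)
 qed
 \<comment> \<open>By the mean value theorem the derivative of \<open>E\<close> vanishes somewhere
   in the period, and there |b| < |a| leaves only Im l = 0.\<close>
 obtain \<xi> where "E T - E 0 = (T - 0) * (- Im l * ((norm (a \<xi>))\<^sup>2 - (norm (b \<xi>))\<^sup>2))"
  using MVT2[OF T, of E "\<lambda>t. - Im l * ((norm (a t))\<^sup>2 - (norm (b t))\<^sup>2)"] Ed by blast
 moreover have "E T = E 0" by (simp add: E_def per norm_mult)
 moreover have "(norm (b \<xi>))\<^sup>2 < (norm (a \<xi>))\<^sup>2" using ab[of \<xi>] by (simp add: power_strict_mono)
 ultimately have "Im l * ((norm (a \<xi>))\<^sup>2 - (norm (b \<xi>))\<^sup>2) = 0" "(norm (a \<xi>))\<^sup>2 - (norm (b \<xi>))\<^sup>2 \<noteq> 0"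
  using T by (simp_all only: mult_eq_0_iff) auto
 then show Im: "Im l = 0" by simp
 \<comment> \<open>A quaternionic matrix of solutions; its determinant |a|^2 + |b|^2 is positive, so
   the frame can be recovered from it.\<close>
 define G where "G t = mk2 (a t) (b t) (- cnj (b t)) (cnj (a t))" for t
 have cv: "continuous_on UNIV a" "continuous_on UNIV b"
  using a b by (meson continuous_at_imp_continuous_on has_vector_derivative_continuous)+
 have cl: "cnj l = l" using Im by (simp add: complex_eq_iff)
 have "has_ac_derivative G (\<lambda>t. mk2 ((\<i> * l * a t - cnj (q t) * b t) / 2) ((q t * a t - \<i> * l * b t) / 2)
   (- cnj ((q t * a t - \<i> * l * b t) / 2)) (cnj ((\<i> * l * a t - cnj (q t) * b t) / 2)))"
  unfolding G_def
  by (intro has_ac_mk2 has_vector_derivative_imp_ac has_vector_derivative_minus cnjd a b continuous_intros cv q continuous_on_cnj) auto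
 then have "has_ac_derivative G (\<lambda>t. G t ** alpha q l t)"
  by (rule has_ac_eq_rhs) (simp add: G_def cmat2_eq_iff mm_nth cl field_simps)
 from frame_solution[OF lq this, of T] have "G T = G 0 ** frame q T l" .
 moreover have "G T = G 0 ** mat s" if "s\<^sup>2 = 1"
 proof -
  have "s = 1 \<or> s = -1" using that by (simp add: power2_eq_1_iff)
  then have "cnj s = s" by auto
  then show ?thesis by (simp add: G_def cmat2_eq_iff mm_mat per)
 qed
 moreover have "det (G 0) \<noteq> 0"
 proof -
  have "det (G 0) = of_real ((norm (a 0))\<^sup>2 + (norm (b 0))\<^sup>2)"
   unfolding of_real_add complex_norm_square by (simp add: G_def det_2)
  moreover have "(norm (a 0))\<^sup>2 > 0" using ab[of 0] norm_ge_zero[of "b 0"] by (intro zero_less_power) linarith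
  ultimately show ?thesis by (metis add_pos_nonneg less_irrefl of_real_eq_0_iff zero_le_power2)
 qed
 ultimately show "frame q T l = mat s" if "s\<^sup>2 = 1"
 proof -
  have "adj2 (G 0) ** (G 0 ** frame q T l) = adj2 (G 0) ** (G 0 ** mat s)"
   using \<open>G T = G 0 ** frame q T l\<close> \<open>s\<^sup>2 = 1 \<Longrightarrow> G T = G 0 ** mat s\<close>[OF that] by simp
  then have "mat (det (G 0)) ** frame q T l = mat (det (G 0)) ** mat s"
   by (simp add: matrix_mul_assoc adj2_mult)
  then show ?thesis using \<open>det (G 0) \<noteq> 0\<close> by (simp add: cmat2_eq_iff mat_mm)
 qed
qed

text \<open>The coordinates of the fixed point are turned back into functions. Smallness of the
  coefficients keeps x near 1 and y near 0, which gives the strict inequality demanded by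
  \<open>double_point_of_row\<close>.\<close>

lemma fixpoint_double_point:
 assumes T: "T > 0" and \<omega>: "\<omega> = 2 * pi / T" and K: "\<bar>k\<bar> \<ge> K"
  and fp: "Phi \<omega> K P z = z" and P: "bnd 3 Q (qpot K P z)"
  and z: "\<And>i. norm (z i) \<le> wgt \<delta> \<beta> c i" and small: "\<beta> * wsum 2 \<le> 1 / 4" "c * wsum 2 \<le> 1 / 4" "0 < \<beta>" "0 < c"
 shows "\<exists>l :: real. \<bar>l - \<omega> * of_int k\<bar> \<le> 2 * \<beta> \<and> (\<exists>s. s\<^sup>2 = 1 \<and> frame (fsr \<omega> (qpot K P z)) T (of_real l) = mat s)"
proof -
 have \<omega>0: "\<omega> > 0" using T \<omega> by simp
 define qc where "qc = qpot K P z"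
 define \<nu> where "\<nu> = z (Vc k)"
 define X where "X = Xt z k"
 define xc where "xc n = (if n = 0 then 1 else X n)" for n
 define yc where "yc = Yt z k"
 have bq: "bnd 3 Q qc" "bnd 2 Q qc" "bnd 2 Q (rv qc)"
  using P bnd_32[OF P] bnd_flip[OF bnd_32[OF P]] by (simp_all add: qc_def rv_def[abs_def])
 have bX: "bnd 3 \<beta> X" using z[of "Xc k _"] small by (auto simp: bnd_def X_def Xt_def)
 have by': "bnd 2 c yc" using z[of "Yc k _"] small by (auto simp: bnd_def yc_def Yt_def)
 have bx: "bnd 3 (1 + \<beta>) xc"
  unfolding bnd_def
 proof
  fix n show "norm (xc n) \<le> (1 + \<beta>) * wt 3 n"
  proof (cases "n = 0")
   case False
   then have "norm (xc n) \<le> \<beta> * wt 3 n" using bndD[OF bX, of n] by (simp add: xc_def)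
   also have "\<dots> \<le> (1 + \<beta>) * wt 3 n" by (intro mult_right_mono) auto
   finally show ?thesis .
  qed (use small in \<open>simp add: xc_def\<close>)
 qed
 have bx2: "bnd 2 (1 + \<beta>) xc" by (rule bnd_32[OF bx])
 have nbx: "bnd 2 A (\<lambda>n. of_int n * a n)" if "bnd 3 A a" for A a
  unfolding bnd_def
 proof
  fix n :: int
  have "norm (of_int n * a n) \<le> \<bar>of_int n\<bar> * (A * wt 3 n)" using bndD[OF that, of n] by (simp add: norm_mult mult_left_mono)
  also have "\<dots> \<le> (1 + \<bar>of_int n\<bar>) * (A * wt 3 n)" using bnd_nonneg[OF that] by (intro mult_right_mono) auto
  finally show "norm (of_int n * a n) \<le> A * wt 2 n" by (simp add: wt_32 ac_simps)
 qed
 \<comment> \<open>Separates the resonant coefficient x_0 = 1, whose contribution to the convolution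
   is \<open>qc n\<close>.\<close>
 have cqx: "conv qc xc n = qc n + conv qc X n" for n
 proof -
  have "conv qc X n = infsum (\<lambda>j. qc j * xc (n - j) - (if j = n then qc n else 0)) UNIV"
   unfolding conv_def by (rule infsum_cong) (auto simp: xc_def X_def Xt_def)
  also have "\<dots> = infsum (\<lambda>j. qc j * xc (n - j)) UNIV - infsum (\<lambda>j. if j = n then qc n else 0) UNIV"
  proof -
   have s1: "(\<lambda>j. qc j * xc (n - j)) summable_on UNIV"
    by (rule abs_summable_summable[OF conv_abs_summable[OF bq(2) bx2]]) simp
   have s2: "(\<lambda>j. if j = n then qc n else 0) summable_on UNIV"
    by (rule finite_nonzero_values_imp_summable_on) simp
   show ?thesis using infsum_add[OF s1 summable_on_uminus[THEN iffD2, OF s2]] by (simp add: infsum_uminus)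
  qed
  also have "infsum (\<lambda>j. if j = n then qc n else 0) UNIV = qc n"
  proof -
   have "infsum (\<lambda>j. if j = n then qc n else 0) UNIV = infsum (\<lambda>j. qc n) {n}"
    by (rule infsum_cong_neutral) auto
   then show ?thesis by simp
  qed
  finally show ?thesis by (simp add: conv_def)
 qed
 have eqV: "\<nu> = - (\<i> / 2) * conv (rv qc) yc 0"
  using fun_cong[OF fp, of "Vc k"] K by (simp add: \<nu>_def qc_def yc_def)
 have eqX: "of_int n * xc n = (\<nu> * xc n + (\<i> / 2) * conv (rv qc) yc n) / of_real \<omega>" for n
 proof (cases "n = 0")
  case True then show ?thesis using \<omega>0 eqV by (simp add: xc_def)
 next
  case False
  have "z (Xc k n) = (\<nu> * z (Xc k n) + (\<i> / 2) * conv (rv qc) yc n) / of_real (\<omega> * of_int n)"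
   using fun_cong[OF fp, of "Xc k n"] K False by (simp add: \<nu>_def qc_def yc_def)
  moreover have "xc n = z (Xc k n)" using False by (simp add: xc_def X_def Xt_def)
  ultimately have "xc n = (\<nu> * xc n + (\<i> / 2) * conv (rv qc) yc n) / of_real (\<omega> * of_int n)" by metis
  then have "of_int n * xc n = of_int n * ((\<nu> * xc n + (\<i> / 2) * conv (rv qc) yc n) / of_real (\<omega> * of_int n))" by metis
  then show ?thesis using False by simp
 qed
 have eqY: "of_int (n + k) * yc n = (- (\<i> / 2) * conv qc xc n - \<nu> * yc n) / of_real \<omega>" for n
 proof (cases "n = - k")
  case True
  \<comment> \<open>At n = - k both sides vanish: this is the resonance condition, guaranteed by the
    component \<open>Uc (- k)\<close>.\<close>
  have "qc (- k) = - conv qc X (- k)"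
   using fun_cong[OF fp, of "Uc (- k)"] K by (simp add: qc_def X_def qpot_def)
  then have "conv qc xc n = 0" using True by (simp add: cqx)
  then show ?thesis using True by (simp add: yc_def Yt_def)
 next
  case False
  have nk: "of_int (n + k) \<noteq> (0 :: complex)" using False by (simp only: of_int_eq_0_iff)
  have "z (Yc k n) = (- (\<i> / 2) * conv qc xc n - \<nu> * z (Yc k n)) / of_real (\<omega> * of_int (n + k))"
   unfolding cqx using fun_cong[OF fp, of "Yc k n"] K False by (simp add: \<nu>_def qc_def X_def del: of_int_add)
  moreover have "yc n = z (Yc k n)" using False by (simp add: yc_def Yt_def)
  ultimately have "yc n = (- (\<i> / 2) * conv qc xc n - \<nu> * yc n) / of_real (\<omega> * of_int (n + k))" by metis
  then have "of_int (n + k) * yc n = of_int (n + k) * ((- (\<i> / 2) * conv qc xc n - \<nu> * yc n) / of_real (\<omega> * of_int (n + k)))" by metis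
  then show ?thesis using nk by (simp del: of_int_add)
 qed
 note bc1 = bnd_conv[OF bq(2) bx2 order_refl]
 note bc2 = bnd_conv[OF bq(3) by' order_refl]
 have wcomb: "bnd 2 (norm (1 / of_real \<omega> :: complex) * (norm h * A + norm g * B)) (\<lambda>n. (h * a n + g * b n) / of_real \<omega>)"
  if "bnd 2 A a" "bnd 2 B b" for h g :: complex and a b A B
  using bnd_scale[OF bnd_add[OF bnd_scale[OF that(1), of h] bnd_scale[OF that(2), of g]], of "1 / of_real \<omega>"]
  by simp
 have iw: "\<i> * of_real \<omega> * ((h * a + g * b) / of_real \<omega>) = \<i> * h * a + \<i> * g * b" for h a g b :: complex
 proof -
  have "of_real \<omega> * (u / of_real \<omega>) = u" for u :: complex using \<omega>0 by simp
  then show ?thesis unfolding mult.assoc by (simp only: distrib_left)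
 qed
 define x where "x = fsr \<omega> xc"
 define y where "y = fsr \<omega> yc"
 define q where "q = fsr \<omega> qc"
 have xd: "(x has_vector_derivative \<i> * \<nu> * x t - cnj (q t) * y t / 2) (at t)" for t
 proof -
  have "(x has_vector_derivative fsr \<omega> (\<lambda>n. \<i> * of_real \<omega> * (of_int n * xc n)) t) (at t)"
   unfolding x_def by (rule fsr_vd[OF bx2 nbx[OF bx]])
  also have "(\<lambda>n. \<i> * of_real \<omega> * (of_int n * xc n)) = (\<lambda>n. \<i> * \<nu> * xc n + \<i> * (\<i> / 2) * conv (rv qc) yc n)"
   unfolding eqX iw ..
  also have "fsr \<omega> \<dots> t = \<i> * \<nu> * x t + \<i> * (\<i> / 2) * (cnj (q t) * y t)"
   unfolding fsr_add[OF bnd_scale[OF bx2] bnd_scale[OF bc2]] fsr_scale fsr_conv[OF bq(3) by'] x_def y_def q_def fsr_cnj by simp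
  finally show ?thesis by simp
 qed
 \<comment> \<open>A priori y has only order 2, too little for termwise differentiation. Its own
   equation shows that n y_n is of order 2 as well.\<close>
 have yn: "of_int n * yc n = ((- \<nu> - of_real \<omega> * of_int k) * yc n + (- (\<i> / 2)) * conv qc xc n) / of_real \<omega>" for n
 proof -
  have "of_int n * yc n = of_int (n + k) * yc n - of_int k * yc n" by (simp add: algebra_simps)
  also have "of_int k * yc n = (of_real \<omega> * of_int k * yc n) / of_real \<omega>" using \<omega>0 by simp
  also have "of_int (n + k) * yc n - (of_real \<omega> * of_int k * yc n) / of_real \<omega> =
    ((- (\<i> / 2) * conv qc xc n - \<nu> * yc n) - of_real \<omega> * of_int k * yc n) / of_real \<omega>"
   unfolding eqY diff_divide_distrib ..
  also have "(- (\<i> / 2) * conv qc xc n - \<nu> * yc n) - of_real \<omega> * of_int k * yc n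
    = (- \<nu> - of_real \<omega> * of_int k) * yc n + (- (\<i> / 2)) * conv qc xc n" by (simp add: algebra_simps)
  finally show ?thesis .
 qed
 have yd: "(y has_vector_derivative \<i> * (- \<nu> - of_real \<omega> * of_int k) * y t + q t * x t / 2) (at t)" for t
 proof -
  have "bnd 2 (norm (1 / of_real \<omega> :: complex) * (norm (- \<nu> - of_real \<omega> * of_int k) * c + norm (- (\<i> / 2) :: complex) * (2 * 2 ^ 2 * wsum 2 * Q * (1 + \<beta>)))) (\<lambda>n. of_int n * yc n)"
   unfolding yn by (rule wcomb[OF by' bc1])
  then have "(y has_vector_derivative fsr \<omega> (\<lambda>n. \<i> * of_real \<omega> * (of_int n * yc n)) t) (at t)"
   unfolding y_def by (rule fsr_vd[OF by'])
  also have "(\<lambda>n. \<i> * of_real \<omega> * (of_int n * yc n)) = (\<lambda>n. \<i> * (- \<nu> - of_real \<omega> * of_int k) * yc n + \<i> * (- (\<i> / 2)) * conv qc xc n)"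
   unfolding yn iw ..
  also have "fsr \<omega> \<dots> t = \<i> * (- \<nu> - of_real \<omega> * of_int k) * y t + \<i> * (- (\<i> / 2)) * (q t * x t)"
   unfolding fsr_add[OF bnd_scale[OF by'] bnd_scale[OF bc1]] fsr_scale fsr_conv[OF bq(2) bx2] x_def y_def q_def by simp
  finally show ?thesis by simp
 qed
 \<comment> \<open>Over one period this factor picks up exp(i pi k), a sign; this is the value
   \<plusminus>1 of the monodromy.\<close>
 define g where "g = (\<lambda>t. exp ((\<i> * of_real (\<omega> * of_int k / 2)) * complex_of_real t))"
 have gd: "(g has_vector_derivative (\<i> * of_real (\<omega> * of_int k / 2)) * g t) (at t)" for t
  unfolding g_def by (rule has_ac_imp_vector_derivative[OF has_ac_exp]) (intro continuous_intros)
 define l where "l = of_real (\<omega> * of_int k) + 2 * \<nu>"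
 define a where "a t = g t * x t" for t
 define b where "b t = g t * y t" for t
 have ad: "(a has_vector_derivative (\<i> * l * a t - cnj (q t) * b t) / 2) (at t)" for t
  unfolding a_def[abs_def] by (rule has_vector_derivative_eq_rhs[OF has_vector_derivative_mult[OF gd xd]])
   (simp add: a_def b_def l_def algebra_simps add_divide_distrib diff_divide_distrib)
 have bd: "(b has_vector_derivative (q t * a t - \<i> * l * b t) / 2) (at t)" for t
  unfolding b_def[abs_def] by (rule has_vector_derivative_eq_rhs[OF has_vector_derivative_mult[OF gd yd]])
   (simp add: a_def b_def l_def algebra_simps add_divide_distrib diff_divide_distrib)
 have ng: "norm (g t) = 1" for t by (simp add: g_def)
 define s where "s = g T"
 have gT: "g T = exp (\<i> * of_real pi * of_int k)" unfolding g_def \<omega> using T by (intro arg_cong[where f = exp]) (simp add: field_simps)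
 have s2: "s\<^sup>2 = 1"
 proof -
  have "s\<^sup>2 = exp (2 * of_int k * of_real pi * \<i>)" unfolding s_def gT power2_eq_square exp_add[symmetric] by (simp add: algebra_simps)
  also have "\<dots> = 1" using exp_integer_2pi[OF Ints_of_int[of k]] by simp
  finally show ?thesis .
 qed
 have g0: "g 0 = 1" by (simp add: g_def)
 have per: "x T = x 0" "y T = y 0"
  using fsr_periodic[OF T, of xc 0] fsr_periodic[OF T, of yc 0] by (simp_all add: x_def y_def \<omega>)
 have xX: "x t = 1 + fsr \<omega> X t" for t
 proof -
  have be: "bnd 2 1 (\<lambda>n. if n = 0 then 1 else 0)" by (simp add: bnd_def)
  have "xc = (\<lambda>n. (if n = 0 then 1 else 0) + X n)" by (auto simp: xc_def X_def Xt_def)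
  then have "x t = fsr \<omega> (\<lambda>n. if n = 0 then 1 else 0) t + fsr \<omega> X t"
   unfolding x_def using fsr_add[OF be bnd_32[OF bX]] by simp
  moreover have "fsr \<omega> (\<lambda>n. if n = 0 then 1 else 0) t = 1" by (subst fsr_finite[of "{0}"]) auto
  ultimately show ?thesis by simp
 qed
 have ab: "norm (b t) < norm (a t)" for t
 proof -
  have "norm (y t) \<le> 1 / 4" using norm_fsr_le[OF by', of \<omega> t] small by (simp add: y_def)
  moreover have "norm (fsr \<omega> X t) \<le> 1 / 4" using norm_fsr_le[OF bnd_32[OF bX], of \<omega> t] small by simp
  moreover have "1 - norm (fsr \<omega> X t) \<le> norm (x t)" unfolding xX using norm_diff_ineq[of 1 "fsr \<omega> X t"] by simp
  ultimately show ?thesis by (simp add: a_def b_def norm_mult ng)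
 qed
 have cq: "continuous_on UNIV q" unfolding q_def by (rule continuous_on_fsr[OF bq(2)])
 have pab: "a T = s * a 0" "b T = s * b 0" by (simp_all add: a_def b_def s_def per g0)
 have ns: "norm s = 1" by (simp add: s_def ng)
 note dp = double_point_of_row[OF T cq ad bd pab ns ab]
 have lr: "l = of_real (Re l)" using dp(1) by (simp add: complex_eq_iff)
 have "\<bar>Re l - \<omega> * of_int k\<bar> = \<bar>Re (2 * \<nu>)\<bar>" by (simp add: l_def)
 also have "\<dots> \<le> norm (2 * \<nu>)" by (rule abs_Re_le_cmod)
 also have "\<dots> \<le> 2 * \<beta>" using z[of "Vc k"] by (simp add: \<nu>_def norm_mult)
 finally have "\<bar>Re l - \<omega> * of_int k\<bar> \<le> 2 * \<beta>" .
 moreover have "frame (fsr \<omega> (qpot K P z)) T (of_real (Re l)) = mat s"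
  using dp(2)[OF s2] lr by (simp add: q_def qc_def)
 ultimately show ?thesis using s2 by blast
qed

section \<open>Vanishing orders and the finite gap criterion\<close>

lemma mat_zorder_eqI:
 fixes G :: "complex \<Rightarrow> cmat2"
 assumes "\<exists>w. G w $ i $ j \<noteq> 0" "zorder (\<lambda>w. G w $ i $ j) z = m"
  and "\<And>i j. \<exists>w. G w $ i $ j \<noteq> 0 \<Longrightarrow> m \<le> zorder (\<lambda>w. G w $ i $ j) z"
 shows "mat_zorder G z = m"
 unfolding mat_zorder_def
proof (rule Min_eqI)
 have "{zorder (\<lambda>\<mu>. G \<mu> $ i $ j) z | i j. \<exists>\<mu>. G \<mu> $ i $ j \<noteq> 0} \<subseteq> (\<lambda>(i, j). zorder (\<lambda>\<mu>. G \<mu> $ i $ j) z) ` (UNIV :: (2 \<times> 2) set)"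
  by auto
 then show "finite {zorder (\<lambda>\<mu>. G \<mu> $ i $ j) z | i j. \<exists>\<mu>. G \<mu> $ i $ j \<noteq> 0}"
  by (rule finite_subset) simp
 show "m \<le> y" if "y \<in> {zorder (\<lambda>\<mu>. G \<mu> $ i $ j) z | i j. \<exists>\<mu>. G \<mu> $ i $ j \<noteq> 0}" for y
  using that assms(3) by blast
 show "m \<in> {zorder (\<lambda>\<mu>. G \<mu> $ i $ j) z | i j. \<exists>\<mu>. G \<mu> $ i $ j \<noteq> 0}"
  using assms(1,2) by blast
qed

text \<open>Where the squared trace differs from 4, both orders are 0. Far out, the remaining points
  lie near some 2 pi k / T and hence near a double point, which is then the only zero in its
  neighbourhood, of order 2 for the discriminant and 1 for \<open>N_mat\<close>. So nonzero summands
  occur only at zeros in a compact disc, and these are finitely many. The radius \<open>r\<close> is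
  obtained from \<open>T\<close> alone.\<close>

lemma finite_gap_criterion:
 assumes T: "T > 0"
 obtains r where "r > 0"
  "\<And>q q' K. (\<And>t. (q has_vector_derivative q' t) (at t)) \<Longrightarrow> continuous_on UNIV q' \<Longrightarrow>
    (\<And>k::int. \<bar>k\<bar> \<ge> K \<Longrightarrow> \<exists>l :: real. \<bar>l - 2 * pi / T * of_int k\<bar> \<le> r \<and>
      (\<exists>s. s\<^sup>2 = 1 \<and> frame q T (of_real l) = mat s)) \<Longrightarrow> finite_gap T q"
proof -
 obtain r where r: "r > 0" "r * T \<le> 1"
  "\<And>q C. asymp_bound q T C \<Longrightarrow> C > 0 \<Longrightarrow> loc_int q \<Longrightarrow> \<exists>R>0. \<forall>z l s. norm z \<ge> R \<longrightarrow> norm l \<ge> R \<longrightarrow> \<bar>Im z\<bar> \<le> 2 * r \<longrightarrow> Im l = 0 \<longrightarrow>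
    norm (z - l) \<le> 3 * r \<longrightarrow> frame q T l = mat s \<longrightarrow> norm s = 1 \<longrightarrow>
    (\<exists>X. frame q T z - mat s = mat (z - l) ** X \<and> norm (X $ 1 $ 1 - X $ 2 $ 2) \<ge> 3 / 4 * T \<and>
     norm (X $ 1 $ 2) \<le> T / 10 \<and> norm (X $ 2 $ 1) \<le> T / 10)"
  by (rule double_point_local[OF T]) (rule that)
 show ?thesis
 proof (rule that[OF r(1)])
  fix q q' :: "real \<Rightarrow> complex" and K :: int
  assume q: "\<And>t. (q has_vector_derivative q' t) (at t)" "continuous_on UNIV q'"
   and dbl: "\<And>k::int. \<bar>k\<bar> \<ge> K \<Longrightarrow> \<exists>l :: real. \<bar>l - 2 * pi / T * of_int k\<bar> \<le> r \<and>
      (\<exists>s. s\<^sup>2 = 1 \<and> frame q T (of_real l) = mat s)"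
  have lq: "loc_int q" by (rule loc_int_continuous[OF vd_continuous[OF q(1)]])
  obtain C where C: "C > 0" "asymp_bound q T C" by (rule frame_asymp[OF q T])
  obtain R1 where R1: "R1 > 0" "\<And>z. norm z \<ge> R1 \<Longrightarrow> (\<And>k::int. norm (z - of_real (2 * pi * k / T)) \<ge> 2 * r) \<Longrightarrow>
   (trace (frame q T z))\<^sup>2 \<noteq> 4"
   by (rule no_roots_off_lattice[OF C(2,1) T lq r(1,2)]) (rule that, assumption, blast)
  obtain R2 where R2: "R2 > 0" "\<And>z l s. norm z \<ge> R2 \<Longrightarrow> norm l \<ge> R2 \<Longrightarrow> \<bar>Im z\<bar> \<le> 2 * r \<Longrightarrow> Im l = 0 \<Longrightarrow>
    norm (z - l) \<le> 3 * r \<Longrightarrow> frame q T l = mat s \<Longrightarrow> norm s = 1 \<Longrightarrow>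
    (\<exists>X. frame q T z - mat s = mat (z - l) ** X \<and> norm (X $ 1 $ 1 - X $ 2 $ 2) \<ge> 3 / 4 * T \<and>
     norm (X $ 1 $ 2) \<le> T / 10 \<and> norm (X $ 2 $ 1) \<le> T / 10)"
   using r(3)[OF C(2,1) lq] by blast
  define M where "M z = frame q T z" for z
  define n11 where "n11 z = (M z $ 1 $ 1 - M z $ 2 $ 2) / 2" for z
  define f where "f z = (Delta T q z)\<^sup>2 - 4" for z
  have hM: "(\<lambda>z. M z $ i $ j) holomorphic_on UNIV" for i j
   unfolding M_def by (rule frame_holomorphic[OF lq]) (use T in simp)
  have D: "Delta T q z = M z $ 1 $ 1 + M z $ 2 $ 2" for z
   by (simp add: Delta_def monodromy_def M_def trace_def sum_2)
  have det: "M z $ 1 $ 1 * M z $ 2 $ 2 - M z $ 1 $ 2 * M z $ 2 $ 1 = 1" for z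
   using det_frame[OF lq, of T z] by (simp add: M_def det_2)
  \<comment> \<open>The discriminant is -4 times the determinant of the trace-free part
    \<open>N_mat\<close>.\<close>
  have f4: "f z = 4 * ((n11 z)\<^sup>2 + M z $ 1 $ 2 * M z $ 2 $ 1)" for z
  proof -
   have "f z = (M z $ 1 $ 1 + M z $ 2 $ 2)\<^sup>2 - 4 * (M z $ 1 $ 1 * M z $ 2 $ 2 - M z $ 1 $ 2 * M z $ 2 $ 1)"
    unfolding det by (simp add: f_def D)
   moreover have "(a + d)\<^sup>2 - 4 * (a * d - b * c) = 4 * (((a - d) / 2)\<^sup>2 + b * c)" for a b c d :: complex
    by (simp add: power2_eq_square field_simps)
   ultimately show ?thesis unfolding n11_def by metis
  qed
  have N: "N_mat T q z $ 1 $ 1 = n11 z" "N_mat T q z $ 2 $ 2 = - n11 z" "N_mat T q z $ 1 $ 2 = M z $ 1 $ 2" "N_mat T q z $ 2 $ 1 = M z $ 2 $ 1" for z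
   unfolding N_mat_def D by (simp_all add: monodromy_def M_def[symmetric] n11_def field_simps)
  have hn: "n11 holomorphic_on UNIV" unfolding n11_def[abs_def] by (intro holomorphic_intros hM) simp
  have hf: "f holomorphic_on UNIV" unfolding f4[abs_def] by (intro holomorphic_intros hM hn)
  have hN: "(\<lambda>z. N_mat T q z $ i $ j) holomorphic_on UNIV" for i j
   using exhaust_2[of i] exhaust_2[of j] hn hM by (auto simp: N intro!: holomorphic_intros)
  define trm where "trm z = zorder f z - 2 * mat_zorder (N_mat T q) z" for z
  have term1: "trm z = 0" if "f z \<noteq> 0" for z
  proof -
   have "zorder f z = 0" by (rule zorder_entire_nonzero(1)[OF hf]) (use that in auto)
   moreover have "\<exists>i j. N_mat T q z $ i $ j \<noteq> 0"
   proof (rule ccontr)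
    assume "\<not> (\<exists>i j. N_mat T q z $ i $ j \<noteq> 0)"
    then have "n11 z = 0" "M z $ 1 $ 2 = 0" using N(1,3)[of z] by metis+
    then show False using that by (simp add: f4)
   qed
   then obtain i j where ij: "N_mat T q z $ i $ j \<noteq> 0" by blast
   have "mat_zorder (N_mat T q) z = 0"
   proof (rule mat_zorder_eqI[of _ i j])
    show "\<exists>w. N_mat T q w $ i $ j \<noteq> 0" using ij by blast
    then show "zorder (\<lambda>w. N_mat T q w $ i $ j) z = 0" by (rule zorder_entire_nonzero(1)[OF hN _ ij])
    show "0 \<le> zorder (\<lambda>w. N_mat T q w $ i $ j) z" if "\<exists>w. N_mat T q w $ i $ j \<noteq> 0" for i j
     by (rule zorder_entire_nonzero(2)[OF hN that])
   qed
   ultimately show ?thesis by (simp add: trm_def)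
  qed
  \<comment> \<open>If |z| >= R and z is within 2 r of 2 pi k / T, then |k| >= K, and both the
    double point and every w within 2 r of 2 pi k / T still lie outside radius \<open>R2\<close>;
    the summand 5 r covers these distances.\<close>
  define R where "R = R1 + R2 + 5 * r + 2 * pi / T * \<bar>of_int K\<bar>"
  have K0: "2 * pi / T * \<bar>of_int K :: real\<bar> \<ge> 0" using T by simp
  have main: "trm z = 0" if z: "norm z \<ge> R" for z
  proof (cases "\<forall>k::int. norm (z - of_real (2 * pi * k / T)) \<ge> 2 * r")
   case True
   have "norm z \<ge> R1" using z R2(1) r(1) K0 by (simp add: R_def)
   then have "(trace (frame q T z))\<^sup>2 \<noteq> 4" using R1(2) True by blast
   then have "f z \<noteq> 0" by (simp add: f_def Delta_def monodromy_def)
   then show ?thesis by (rule term1)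
  next
   case False
   then obtain k :: int where k: "norm (z - of_real (2 * pi * k / T)) < 2 * r" by (auto simp: not_le)
   define p where "p = 2 * pi / T * of_int k"
   have pk: "norm (z - of_real p) < 2 * r" using k by (simp add: p_def)
   have "norm z - \<bar>p\<bar> \<le> norm (z - of_real p)" using norm_triangle_ineq2[of z "of_real p"] by simp
   then have "2 * pi / T * \<bar>of_int K\<bar> \<le> \<bar>p\<bar>" using pk z R1(1) R2(1) r(1) by (simp add: R_def)
   also have "\<bar>p\<bar> = 2 * pi / T * \<bar>of_int k\<bar>" using T by (simp add: p_def abs_mult)
   finally have "\<bar>real_of_int K\<bar> \<le> \<bar>real_of_int k\<bar>" using T by (simp add: field_simps)
   then have "\<bar>k\<bar> \<ge> K" by linarith
   from dbl[OF this] obtain l :: real and s where l: "\<bar>l - p\<bar> \<le> r" "s\<^sup>2 = 1" "frame q T (of_real l) = mat s"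
    unfolding p_def by blast
   have lp: "norm (complex_of_real l - of_real p) \<le> r" using l(1) by (simp flip: of_real_diff)
   have s: "norm s = 1" using l(2) by (auto simp: power2_eq_1_iff)
   have X: "\<exists>X. M w - mat s = mat (w - of_real l) ** X \<and> norm (X $ 1 $ 1 - X $ 2 $ 2) \<ge> 3 / 4 * T \<and>
     norm (X $ 1 $ 2) \<le> T / 10 \<and> norm (X $ 2 $ 1) \<le> T / 10" if w: "norm (w - of_real p) \<le> 2 * r" for w
    unfolding M_def
   proof (rule R2(2)[OF _ _ _ _ _ l(3) s])
    have a: "norm z \<le> norm (z - of_real p) + \<bar>p\<bar>" using norm_triangle_ineq[of "z - of_real p" "of_real p"] by simp
    have b: "\<bar>p\<bar> \<le> norm (w - of_real p) + norm w" using norm_triangle_ineq4[of w "w - of_real p"] by simp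
    have c: "\<bar>p\<bar> \<le> \<bar>l - p\<bar> + \<bar>l\<bar>" by simp
    show "R2 \<le> norm w" using a b z pk w R1(1) r(1) K0 by (simp add: R_def)
    show "R2 \<le> norm (complex_of_real l)" using a c z pk l(1) R1(1) r(1) K0 by (simp add: R_def)
    have "\<bar>Im w\<bar> = \<bar>Im (w - of_real p)\<bar>" by simp
    also have "\<dots> \<le> norm (w - of_real p)" by (rule abs_Im_le_cmod)
    finally show "\<bar>Im w\<bar> \<le> 2 * r" using w by simp
    show "Im (complex_of_real l) = 0" by simp
    have "w - of_real l = (w - of_real p) - (of_real l - of_real p)" by simp
    then have "norm (w - of_real l) \<le> norm (w - of_real p) + norm (complex_of_real l - of_real p)" by (metis norm_triangle_ineq4)
    then show "norm (w - of_real l) \<le> 3 * r" using w lp by simp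
   qed
   have fw: "norm (n11 w) \<ge> norm (w - of_real l) * (3 / 8 * T) \<and> norm (f w) \<ge> norm (w - of_real l) * norm (w - of_real l) * (T * T / 2)"
    if w: "norm (w - of_real p) \<le> 2 * r" for w
   proof -
    obtain X where X: "M w - mat s = mat (w - of_real l) ** X" "norm (X $ 1 $ 1 - X $ 2 $ 2) \<ge> 3 / 4 * T"
     "norm (X $ 1 $ 2) \<le> T / 10" "norm (X $ 2 $ 1) \<le> T / 10" using X[OF w] by blast
    have e: "(M w - mat s) $ i $ j = (w - of_real l) * X $ i $ j" for i j unfolding X(1) mat_mm ..
    have e2: "M w $ 1 $ 1 - s = (w - of_real l) * X $ 1 $ 1" "M w $ 2 $ 2 - s = (w - of_real l) * X $ 2 $ 2"
     "M w $ 1 $ 2 = (w - of_real l) * X $ 1 $ 2" "M w $ 2 $ 1 = (w - of_real l) * X $ 2 $ 1"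
     using e[of 1 1] e[of 2 2] e[of 1 2] e[of 2 1] by simp_all
    have "n11 w = ((M w $ 1 $ 1 - s) - (M w $ 2 $ 2 - s)) / 2" by (simp add: n11_def)
    then have n: "n11 w = (w - of_real l) * ((X $ 1 $ 1 - X $ 2 $ 2) / 2)" unfolding e2 by (simp add: algebra_simps)
    have fX: "f w = (w - of_real l) * (w - of_real l) * ((X $ 1 $ 1 - X $ 2 $ 2)\<^sup>2 + 4 * (X $ 1 $ 2 * X $ 2 $ 1))"
    proof -
     have gen: "4 * ((d * (a / 2))\<^sup>2 + (d * b) * (d * c)) = d * d * (a\<^sup>2 + 4 * (b * c))" for a b c d :: complex
      by (simp add: power2_eq_square field_simps)
     show ?thesis unfolding f4 n e2 by (rule gen)
    qed
    have "norm (4 * (X $ 1 $ 2 * X $ 2 $ 1)) \<le> 4 * (T / 10 * (T / 10))"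
     unfolding norm_mult using X(3,4) T by (intro mult_mono) auto
    moreover have "norm ((X $ 1 $ 1 - X $ 2 $ 2)\<^sup>2) \<ge> (3 / 4 * T) * (3 / 4 * T)"
     unfolding norm_power power2_eq_square[of "norm _"] using X(2) T by (intro mult_mono) auto
    moreover have "norm ((X $ 1 $ 1 - X $ 2 $ 2)\<^sup>2) - norm (4 * (X $ 1 $ 2 * X $ 2 $ 1)) \<le> norm ((X $ 1 $ 1 - X $ 2 $ 2)\<^sup>2 + 4 * (X $ 1 $ 2 * X $ 2 $ 1))"
     by (rule norm_diff_ineq)
    \<comment> \<open>Here 209/400 = 9/16 - 4/100: the square of 3/4 minus four times the square of
      1/10.\<close>
    ultimately have "norm ((X $ 1 $ 1 - X $ 2 $ 2)\<^sup>2 + 4 * (X $ 1 $ 2 * X $ 2 $ 1)) \<ge> 209 / 400 * (T * T)" by simp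
    moreover have "209 / 400 * (T * T) \<ge> T * T / 2" using T by simp
    ultimately have "norm ((X $ 1 $ 1 - X $ 2 $ 2)\<^sup>2 + 4 * (X $ 1 $ 2 * X $ 2 $ 1)) \<ge> T * T / 2" by linarith
    then have "norm (f w) \<ge> norm (w - of_real l) * norm (w - of_real l) * (T * T / 2)"
     unfolding fX norm_mult by (intro mult_left_mono) auto
    moreover have "norm (n11 w) \<ge> norm (w - of_real l) * (3 / 8 * T)"
     unfolding n norm_mult by (intro mult_left_mono) (use X(2) in \<open>auto simp: norm_divide\<close>)
    ultimately show ?thesis by blast
   qed
   show ?thesis
   proof (cases "z = of_real l")
    case False
    have "norm (f z) \<ge> norm (z - of_real l) * norm (z - of_real l) * (T * T / 2)" using fw[of z] pk by simp
    moreover have "norm (z - of_real l) * norm (z - of_real l) * (T * T / 2) > 0" using False T by simp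
    ultimately have "f z \<noteq> 0" by auto
    then show ?thesis by (rule term1)
   next
    case True
    have Ml: "M z = mat s" using l(3) True by (simp add: M_def)
    have z0: "n11 z = 0" "M z $ 1 $ 2 = 0" "M z $ 2 $ 1 = 0" by (simp_all add: n11_def Ml)
    \<comment> \<open>At the double point all entries of \<open>N_mat\<close> vanish. Dividing
      \<open>w - z\<close> out of each leaves \<open>g11\<close> and the cofactor \<open>h\<close>
      of the discriminant, both nonzero at \<open>z\<close> by the bounds \<open>fw\<close>
      nearby.\<close>
    obtain g11 where g11: "g11 holomorphic_on UNIV" "\<And>w. n11 w = g11 w * (w - z)" using entire_divide_root[OF hn z0(1)] by blast
    obtain g12 where g12: "g12 holomorphic_on UNIV" "\<And>w. M w $ 1 $ 2 = g12 w * (w - z)" using entire_divide_root[OF hM z0(2)] by blast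
    obtain g21 where g21: "g21 holomorphic_on UNIV" "\<And>w. M w $ 2 $ 1 = g21 w * (w - z)" using entire_divide_root[OF hM z0(3)] by blast
    have near: "norm (w - of_real p) \<le> 2 * r" if "norm (w - z) < r" for w
    proof -
     have "w - of_real p = (w - z) + (of_real l - of_real p)" using True by simp
     then have "norm (w - of_real p) \<le> norm (w - z) + norm (complex_of_real l - of_real p)" by (metis norm_triangle_ineq)
     then show ?thesis using that lp by linarith
    qed
    have "norm (g11 w) \<ge> 3 / 8 * T" if "w \<noteq> z" "norm (w - z) < r" for w
    proof -
     have "norm (w - z) * (3 / 8 * T) \<le> norm (g11 w) * norm (w - z)"
      using fw[OF near[OF that(2)]] True by (simp add: g11(2) norm_mult)
     then show ?thesis using that(1) by (simp add: mult.commute[of "norm (w - z)"])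
    qed
    then have g11z: "g11 z \<noteq> 0" using T by (intro continuous_lower_bound[OF g11(1) r(1), of "3 / 8 * T"]) auto
    define h where "h w = 4 * ((g11 w)\<^sup>2 + g12 w * g21 w)" for w
    have hh: "h holomorphic_on UNIV" unfolding h_def by (intro holomorphic_intros g11 g12 g21)
    have fh: "f w = h w * (w - z) ^ 2" for w
     unfolding f4 g11(2) g12(2) g21(2) h_def by (simp add: power2_eq_square algebra_simps)
    have "norm (h w) \<ge> T * T / 2" if "w \<noteq> z" "norm (w - z) < r" for w
    proof -
     have "norm (w - z) * norm (w - z) * (T * T / 2) \<le> norm (h w) * (norm (w - z) * norm (w - z))"
      using fw[OF near[OF that(2)]] True by (simp add: fh norm_mult norm_power power2_eq_square)
     then show ?thesis using that(1) by (simp add: mult.commute[of "norm (w - z) * norm (w - z)"])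
    qed
    then have hz: "h z \<noteq> 0" using T by (intro continuous_lower_bound[OF hh r(1), of "T * T / 2"]) auto
    have "zorder f z = int 2" by (rule zorder_factor[OF hh hz fh])
    moreover have "mat_zorder (N_mat T q) z = 1"
    proof (rule mat_zorder_eqI[of _ 1 1])
     have "zorder n11 z = int 1" by (rule zorder_factor[OF g11(1) g11z]) (simp add: g11(2))
     then show "zorder (\<lambda>w. N_mat T q w $ 1 $ 1) z = 1" by (simp add: N)
     have "n11 (z + of_real (r / 2)) \<noteq> 0"
     proof
      assume a: "n11 (z + of_real (r / 2)) = 0"
      have "norm (z + of_real (r / 2) - of_real p) \<le> 2 * r" using r(1) by (intro near) simp
      from fw[OF this] have "T * r \<le> 0" using a True r(1) T by simp
      with mult_pos_pos[OF T r(1)] show False by linarith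
     qed
     then show "\<exists>w. N_mat T q w $ 1 $ 1 \<noteq> 0" unfolding N by blast
     show "1 \<le> zorder (\<lambda>w. N_mat T q w $ i $ j) z" if "\<exists>w. N_mat T q w $ i $ j \<noteq> 0" for i j
     proof (rule zorder_entire_nonzero(3)[OF hN that])
      show "N_mat T q z $ i $ j = 0" using exhaust_2[of i] exhaust_2[of j] z0 by (auto simp: N)
     qed
    qed
    ultimately show ?thesis by (simp add: trm_def)
   qed
  qed
  \<comment> \<open>The discriminant is not identically zero, as a point high on the imaginary axis
    is far from all 2 pi k / T.\<close>
  have "\<exists>w. f w \<noteq> 0"
  proof -
   define w where "w = \<i> * of_real (R1 + 2 * r)"
   have "norm w = R1 + 2 * r" unfolding w_def norm_mult norm_of_real using R1 r by simp
   then have "norm w \<ge> R1" using r by simp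
   moreover have "norm (w - of_real (2 * pi * k / T)) \<ge> 2 * r" for k :: int
   proof -
    have "2 * r \<le> \<bar>Im (w - of_real (2 * pi * k / T))\<bar>" using R1 r by (simp add: w_def)
    also have "\<dots> \<le> norm (w - of_real (2 * pi * k / T))" by (rule abs_Im_le_cmod)
    finally show ?thesis .
   qed
   ultimately have "(trace (frame q T w))\<^sup>2 \<noteq> 4" by (rule R1(2))
   then show ?thesis by (auto simp: f_def Delta_def monodromy_def)
  qed
  have "finite {z \<in> cball 0 R. f z = 0}"
  proof (cases "f constant_on UNIV")
   case True
   then have "{z \<in> cball 0 R. f z = 0} = {}" using \<open>\<exists>w. f w \<noteq> 0\<close> by (force simp: constant_on_def)
   then show ?thesis by (simp only: finite.emptyI)
  next
   case False
   then show ?thesis by (intro holomorphic_compact_finite_zeros[OF hf open_UNIV connected_UNIV]) auto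
  qed
  moreover have "{z. trm z \<noteq> 0} \<subseteq> {z \<in> cball 0 R. f z = 0}"
   using main term1 by (force simp: not_le)
  ultimately have "finite {z. trm z \<noteq> 0}" by (rule finite_subset[rotated])
  then have "finite {x \<in> UNIV. real_of_int (trm x) \<noteq> 0}" by simp
  then have "(\<lambda>z. real_of_int (trm z)) summable_on UNIV" by (rule finite_nonzero_values_imp_summable_on)
  then show "finite_gap T q" unfolding finite_gap_def trm_def f_def[abs_def] .
 qed
qed

section \<open>The family of potentials with slaved high modes\<close>

definition dbl_pts :: "real \<Rightarrow> real \<Rightarrow> (real \<Rightarrow> complex) \<Rightarrow> bool" where
 "dbl_pts T r q \<longleftrightarrow> (\<exists>K. \<forall>k::int. \<bar>k\<bar> \<ge> K \<longrightarrow> (\<exists>l :: real. \<bar>l - 2 * pi / T * of_int k\<bar> \<le> r \<and>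
      (\<exists>s. s\<^sup>2 = 1 \<and> frame q T (of_real l) = mat s)))"

lemma dphase_pi: "dphase (2 * pi * of_int m) = mat (cis (pi * of_int m))" "(cis (pi * of_int m))\<^sup>2 = 1"
proof -
 have e: "cis (2 * pi * of_int m) = 1" by (rule cis_multiple_2pi) simp
 have "pi * of_int m + pi * of_int m = 2 * pi * of_int m" by simp
 then show s: "(cis (pi * of_int m))\<^sup>2 = 1" unfolding power2_eq_square cis_mult e by (simp only: e)
 have "cis (- (pi * of_int m)) * (cis (pi * of_int m) * cis (pi * of_int m)) = cis (- (pi * of_int m))"
  using s by (simp add: power2_eq_square)
 then have "cis (- (pi * of_int m)) = cis (pi * of_int m)" by (simp add: cis_mult)
 then show "dphase (2 * pi * of_int m) = mat (cis (pi * of_int m))" by (simp add: cmat2_eq_iff)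
qed

text \<open>A gauge by 2 pi m / T moves the spectral parameter by this amount and multiplies the
  monodromy by exp(i pi m), a sign. The double point for k thus comes from the one for k - m, and
  adding |m| to the threshold keeps |k - m| large enough.\<close>

lemma dbl_pts_shift:
 assumes T: "T > 0" and q: "loc_int q" and d: "dbl_pts T r q"
 shows "dbl_pts T r (\<lambda>t. cis (- (2 * pi * of_int m / T) * t) * q t)"
proof -
 obtain K where K: "\<And>k::int. \<bar>k\<bar> \<ge> K \<Longrightarrow> \<exists>l :: real. \<bar>l - 2 * pi / T * of_int k\<bar> \<le> r \<and>
      (\<exists>s. s\<^sup>2 = 1 \<and> frame q T (of_real l) = mat s)" using d unfolding dbl_pts_def by blast
 show ?thesis unfolding dbl_pts_def
 proof (intro exI[of _ "K + \<bar>m\<bar>"] allI impI)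
  fix k :: int assume "K + \<bar>m\<bar> \<le> \<bar>k\<bar>"
  then have "K \<le> \<bar>k - m\<bar>" by linarith
  from K[OF this] obtain l :: real and s where l: "\<bar>l - 2 * pi / T * of_int (k - m)\<bar> \<le> r" "s\<^sup>2 = 1" "frame q T (of_real l) = mat s" by blast
  define c where "c = 2 * pi * of_int m / T"
  have cT: "c * T = 2 * pi * of_int m" using T by (simp add: c_def)
  have "frame (\<lambda>t. cis (- c * t) * q t) T (of_real (l + c)) = mat s ** mat (cis (pi * of_int m))"
   using frame_gauge[OF q, of T "of_real l" c] unfolding cT dphase_pi l(3) by simp
  also have "\<dots> = mat (s * cis (pi * of_int m))" by (simp add: cmat2_eq_iff mat_mm)
  finally have 1: "frame (\<lambda>t. cis (- c * t) * q t) T (of_real (l + c)) = mat (s * cis (pi * of_int m))" .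
  have 2: "(s * cis (pi * of_int m))\<^sup>2 = 1" using l(2) dphase_pi(2)[of m] by (simp add: power_mult_distrib)
  have "l + c - 2 * pi / T * of_int k = l - 2 * pi / T * of_int (k - m)" using T by (simp add: c_def field_simps)
  then have 3: "\<bar>l + c - 2 * pi / T * of_int k\<bar> \<le> r" using l(1) by simp
  show "\<exists>l :: real. \<bar>l - 2 * pi / T * of_int k\<bar> \<le> r \<and>
      (\<exists>s. s\<^sup>2 = 1 \<and> frame (\<lambda>t. cis (- (2 * pi * of_int m / T) * t) * q t) T (of_real l) = mat s)"
   using 1 2 3 unfolding c_def by blast
 qed
qed

lemma wsum2_ge1: "wsum 2 \<ge> 1"
proof -
 have "infsum (wt 2) {0} \<le> infsum (wt 2) UNIV"
  by (rule infsum_mono_neutral) (auto intro: wt_summable)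
 then show ?thesis by (simp add: wsum_def)
qed

text \<open>The threshold \<open>K0\<close> depends only on the size \<open>Q\<close> of the low
  modes and the tolerances, so that \<open>K\<close> may afterwards be taken beyond the degree of
  any given trigonometric polynomial. The Lipschitz clause supplies the continuity needed for
  Brouwer's theorem.\<close>

lemma finite_gap_family:
 assumes T: "T > 0" and r: "r > 0" and Q: "Q \<ge> 1" and \<delta>: "0 < \<delta>" "\<delta> \<le> 1"
 obtains K0 :: int where "\<And>K. K \<ge> K0 \<Longrightarrow> \<exists>S.
  (\<forall>P. bnd 3 Q P \<longrightarrow> (\<forall>n. \<bar>n\<bar> < K \<longrightarrow> S P n = P n) \<and> (\<forall>n. \<bar>n\<bar> \<ge> K \<longrightarrow> norm (S P n) \<le> \<delta> * wt 3 n) \<and>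
    bnd 3 Q (S P) \<and> dbl_pts T r (fsr (2 * pi / T) (S P))) \<and>
  (\<forall>P P' e. bnd 3 Q P \<longrightarrow> bnd 3 Q P' \<longrightarrow> bnd 3 e (\<lambda>n. P n - P' n) \<longrightarrow> bnd 3 (2 * e) (\<lambda>n. S P n - S P' n))"
proof -
 define \<omega> where "\<omega> = 2 * pi / T"
 have \<omega>: "\<omega> > 0" using T by (simp add: \<omega>_def)
 define C where "C = max 1 (max (2 * 2 ^ 2 * wsum 2) (2 * 2 ^ 3 * wsum 3))"
 have C: "C \<ge> 1" "2 * 2 ^ 2 * wsum 2 \<le> C" "2 * 2 ^ 3 * wsum 3 \<le> C" by (auto simp: C_def)
 have CQ: "C * Q > 0" "C * Q \<noteq> 0" using C Q by auto
 have W: "wsum 2 > 0" using wsum2_ge1 by linarith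
 \<comment> \<open>The first two bounds serve \<open>Phi_estimate\<close>; \<open>r / 2\<close>
   keeps the double points within 2 \<beta> <= r of 2 pi k / T, and the last keeps x near 1. The
   constant \<open>c\<close> is then chosen relative to \<beta>, and \<open>K0\<close> relative to
   \<open>c\<close>.\<close>
 define \<beta> where "\<beta> = Min {\<delta> / (4 * (C * Q)), \<omega> / 8, r / 2, 1 / (4 * wsum 2)}"
 have \<beta>: "\<beta> > 0" "\<beta> \<le> \<delta> / (4 * (C * Q))" "\<beta> \<le> \<omega> / 8" "\<beta> \<le> r / 2" "\<beta> \<le> 1 / (4 * wsum 2)"
  using \<delta> \<omega> r CQ W by (auto simp: \<beta>_def)
 define c where "c = Min {\<beta> / (2 * (C * Q)), \<omega> * \<beta> / (8 * (C * Q)), 1 / (4 * wsum 2)}"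
 have c: "c > 0" "c \<le> \<beta> / (2 * (C * Q))" "c \<le> \<omega> * \<beta> / (8 * (C * Q))" "c \<le> 1 / (4 * wsum 2)"
  using \<delta> \<omega> r CQ W \<beta>(1) by (auto simp: c_def)
 define K0 where "K0 = max 1 \<lceil>4 * Q / (\<omega> * c)\<rceil>"
 have par: "C * Q * \<beta> \<le> \<delta> / 4" "C * Q * c \<le> \<beta> / 2" "8 * (C * Q * c) \<le> \<omega> * \<beta>" "\<beta> * wsum 2 \<le> 1 / 4" "c * wsum 2 \<le> 1 / 4"
  using \<beta>(2,5) c(2-4) CQ W by (simp_all add: field_simps)
 show ?thesis
 proof (rule that[of K0])
  fix K assume "K \<ge> K0"
  then have K1: "K \<ge> 1" and "4 * Q / (\<omega> * c) \<le> of_int K" unfolding K0_def by linarith+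
  then have K2: "4 * Q \<le> \<omega> * of_int K * c" using \<omega> c(1) by (simp add: field_simps)
  note est = Phi_estimate[OF C Q \<delta> \<beta>(1) c(1) \<omega> par(1) \<beta>(3) par(2,3) K1 K2]
  let ?w = "wgt \<delta> \<beta> c"
  have w0: "?w i \<ge> 0" for i using \<delta> \<beta>(1) c(1) by (cases i) auto
  have b0: "bnd 3 0 (\<lambda>n. P n - P n)" for P by (simp add: bnd_def)
  have ex: "\<exists>z. (\<forall>i. norm (z i) \<le> ?w i) \<and> Phi \<omega> K P z = z" if P: "bnd 3 Q P" for P
  proof -
   have contr: "norm (Phi \<omega> K P z i - Phi \<omega> K P z' i) \<le> d / 2 * ?w i"
    if "\<And>i. norm (z i) \<le> ?w i" "\<And>i. norm (z' i) \<le> ?w i" "d \<ge> 0" "\<And>i. norm (z i - z' i) \<le> d * ?w i" for z z' d i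
    using est[OF P P order_refl b0 that] by simp
   \<comment> \<open>The value at 0 fills at most half of the box and the contraction at most the
     other half, so the box is mapped into itself. Only \<open>Yc\<close> is nonzero at 0; it is the
     forcing by the low modes.\<close>
   have zero: "norm (Phi \<omega> K P (\<lambda>_. 0) i) \<le> 1 / 2 * ?w i" for i
   proof (cases i)
    case (Uc n) then show ?thesis using \<delta> by (simp add: conv_def Xt_def)
   next
    case (Vc n) then show ?thesis using \<beta> by (simp add: conv_def Yt_def)
   next
    case (Xc k n) then show ?thesis using \<beta> by (simp add: conv_def Yt_def)
   next
    case (Yc k n)
    show ?thesis
    proof (cases "\<bar>k\<bar> \<ge> K \<and> n \<noteq> - k \<and> \<bar>n\<bar> < K")
     case True
     define m where "m = \<bar>real_of_int (n + k)\<bar>"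
     have "1 \<le> \<bar>n + k\<bar>" using True by linarith
     then have "real_of_int 1 \<le> real_of_int \<bar>n + k\<bar>" by (simp only: of_int_le_iff)
     then have m1: "m \<ge> 1" by (simp add: m_def)
     define l where "l = 1 + \<bar>real_of_int n\<bar>"
     have "real_of_int K \<le> \<bar>real_of_int k\<bar>" using True by linarith
     also have "\<dots> \<le> \<bar>real_of_int n\<bar> + m" unfolding m_def by simp
     also have "\<dots> \<le> \<bar>real_of_int n\<bar> * m + m" using m1 mult_left_mono[OF m1, of "\<bar>real_of_int n\<bar>"] by simp
     also have "\<dots> = l * m" by (simp add: l_def algebra_simps)
     finally have Kl: "of_int K \<le> l * m" .
     have "4 * Q \<le> \<omega> * of_int K * c" by (rule K2)
     also have "\<dots> \<le> \<omega> * (l * m) * c" using Kl \<omega> c by (intro mult_left_mono mult_right_mono) auto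
     finally have Qm: "4 * Q \<le> \<omega> * (l * m) * c" .
     have "Phi \<omega> K P (\<lambda>_. 0) (Yc k n) = (- (\<i> / 2) * P n) / of_real (\<omega> * of_int (n + k))"
      using True by (simp add: conv_def Xt_def qpot_def del: of_int_add)
     then have "norm (Phi \<omega> K P (\<lambda>_. 0) (Yc k n)) = norm (P n) / 2 / (\<omega> * m)"
      using \<omega> unfolding m_def by (simp only: norm_divide norm_of_real abs_mult norm_mult norm_minus_cancel) simp
     also have "\<dots> \<le> (Q * wt 3 n) / 2 / (\<omega> * m)"
      using bndD[OF P, of n] \<omega> m1 by (intro divide_right_mono) auto
     also have "\<dots> \<le> (\<omega> * (l * m) * c / 4 * wt 3 n) / 2 / (\<omega> * m)"
      using Qm \<omega> m1 by (intro divide_right_mono mult_right_mono) auto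
     also have "\<dots> = 1 / 8 * (c * (l * wt 3 n))" using \<omega> m1 by (simp add: field_simps)
     also have "l * wt 3 n = wt 2 n" by (simp add: l_def wt_32)
     also have "1 / 8 * (c * wt 2 n) \<le> 1 / 2 * (c * wt 2 n)" using c by (intro mult_right_mono) auto
     finally show ?thesis using Yc by simp
    next
     case False
     then have "Phi \<omega> K P (\<lambda>_. 0) (Yc k n) = 0" by (auto simp: conv_def Xt_def qpot_def)
     then show ?thesis using Yc c by simp
    qed
   qed
   obtain z where "\<And>i. norm (z i) \<le> ?w i" "Phi \<omega> K P z = z"
   proof (rule weighted_fixpoint[of ?w "Phi \<omega> K P"])
    show "norm (Phi \<omega> K P z i) \<le> ?w i" if "\<And>i. norm (z i) \<le> ?w i" for z i
    proof -
     have "norm (Phi \<omega> K P z i - Phi \<omega> K P (\<lambda>_. 0) i) \<le> 1 / 2 * ?w i"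
      by (rule contr) (use that w0 in auto)
     then show ?thesis using zero[of i] norm_triangle_sub[of "Phi \<omega> K P z i" "Phi \<omega> K P (\<lambda>_. 0) i"] by linarith
    qed
   qed (use w0 contr in blast)+
   then show ?thesis by blast
  qed
  define Z where "Z P = (SOME z. (\<forall>i. norm (z i) \<le> ?w i) \<and> Phi \<omega> K P z = z)" for P
  have Z: "norm (Z P i) \<le> ?w i" "Phi \<omega> K P (Z P) = Z P" if "bnd 3 Q P" for P i
   using someI_ex[OF ex[OF that]] unfolding Z_def by blast+
  define S where "S P = qpot K P (Z P)" for P
  have tail: "norm (S P n) \<le> \<delta> * wt 3 n" if "bnd 3 Q P" "\<bar>n\<bar> \<ge> K" for P n
   using Z(1)[OF that(1), of "Uc n"] that(2) by (simp add: S_def qpot_def)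
  have bS: "bnd 3 Q (S P)" if "bnd 3 Q P" for P
   unfolding bnd_def
  proof
   fix n
   show "norm (S P n) \<le> Q * wt 3 n"
   proof (cases "\<bar>n\<bar> < K")
    case True then show ?thesis using bndD[OF that, of n] by (simp add: S_def qpot_def)
   next
    case False
    then have "norm (S P n) \<le> \<delta> * wt 3 n" using tail[OF that] by simp
    also have "\<dots> \<le> Q * wt 3 n" using \<delta> Q by (intro mult_right_mono) auto
    finally show ?thesis .
   qed
  qed
  have dS: "dbl_pts T r (fsr (2 * pi / T) (S P))" if "bnd 3 Q P" for P
   unfolding dbl_pts_def
  proof (intro exI[of _ K] allI impI)
   fix k :: int assume k: "K \<le> \<bar>k\<bar>"
   have "\<exists>l :: real. \<bar>l - \<omega> * of_int k\<bar> \<le> 2 * \<beta> \<and> (\<exists>s. s\<^sup>2 = 1 \<and> frame (fsr \<omega> (qpot K P (Z P))) T (of_real l) = mat s)"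
    by (rule fixpoint_double_point[OF T \<omega>_def k Z(2)[OF that] bS[OF that, unfolded S_def] Z(1)[OF that] par(4,5) \<beta>(1) c(1)])
   then show "\<exists>l. \<bar>l - 2 * pi / T * of_int k\<bar> \<le> r \<and> (\<exists>s. s\<^sup>2 = 1 \<and> frame (fsr (2 * pi / T) (S P)) T (complex_of_real l) = mat s)"
    using \<beta>(4) unfolding \<omega>_def[symmetric] S_def by force
  qed
  have lip: "bnd 3 (2 * e) (\<lambda>n. S P n - S P' n)"
   if P: "bnd 3 Q P" "bnd 3 Q P'" and e: "bnd 3 e (\<lambda>n. P n - P' n)" for P P' e
  proof -
   have e0: "e \<ge> 0" by (rule bnd_nonneg[OF e])
   \<comment> \<open>Two fixed points in the box differ by at most 2, and an error d improves to d /
     2 + e; iterating, the bound tends to 2 e.\<close>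
   have d: "norm (Z P i - Z P' i) \<le> (2 * (1 / 2) ^ m + 2 * e) * ?w i" for i m
   proof (induction m arbitrary: i)
    case 0
    have "norm (Z P i - Z P' i) \<le> norm (Z P i) + norm (Z P' i)" by (rule norm_triangle_ineq4)
    also have "\<dots> \<le> 2 * ?w i" using Z(1)[OF P(1), of i] Z(1)[OF P(2), of i] by linarith
    also have "\<dots> \<le> (2 * (1 / 2) ^ 0 + 2 * e) * ?w i" using e0 w0 by (intro mult_right_mono) auto
    finally show ?case .
   next
    case (Suc m)
    have "norm (Phi \<omega> K P (Z P) i - Phi \<omega> K P' (Z P') i) \<le> ((2 * (1 / 2) ^ m + 2 * e) / 2 + e) * ?w i"
     by (rule est[OF P e0 e Z(1)[OF P(1)] Z(1)[OF P(2)] _ Suc]) (use e0 in simp)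
    moreover have "(2 * (1 / 2) ^ m + 2 * e) / 2 + e = 2 * (1 / 2) ^ Suc m + 2 * e" by simp
    ultimately show ?case unfolding Z(2)[OF P(1)] Z(2)[OF P(2)] by metis
   qed
   have "norm (Z P i - Z P' i) \<le> 2 * e * ?w i" for i
   proof (rule LIMSEQ_le_const)
    show "(\<lambda>m. (2 * (1 / 2) ^ m + 2 * e) * ?w i) \<longlonglongrightarrow> 2 * e * ?w i"
    proof -
     have "(\<lambda>m. (2 * (1 / 2 :: real) ^ m + 2 * e) * ?w i) \<longlonglongrightarrow> (2 * 0 + 2 * e) * ?w i"
      by (intro tendsto_intros LIMSEQ_power_zero) simp
     then show ?thesis by simp
    qed
    show "\<exists>N. \<forall>n\<ge>N. norm (Z P i - Z P' i) \<le> (2 * (1 / 2) ^ n + 2 * e) * ?w i" using d by blast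
   qed
   then have zU: "norm (Z P (Uc n) - Z P' (Uc n)) \<le> 2 * e * (\<delta> * wt 3 n)" for n by (metis wgt.simps(1))
   show ?thesis unfolding bnd_def
   proof
    fix n
    have "2 * e * (\<delta> * wt 3 n) \<le> 2 * e * (1 * wt 3 n)" using \<delta> e0 by (intro mult_left_mono mult_right_mono) auto
    moreover have "e * wt 3 n \<le> 2 * e * wt 3 n" using e0 by (intro mult_right_mono) auto
    ultimately show "norm (S P n - S P' n) \<le> 2 * e * wt 3 n"
     using zU[of n] bndD[OF e, of n] by (simp add: S_def qpot_def)
   qed
  qed
  show "\<exists>S. (\<forall>P. bnd 3 Q P \<longrightarrow> (\<forall>n. \<bar>n\<bar> < K \<longrightarrow> S P n = P n) \<and> (\<forall>n. \<bar>n\<bar> \<ge> K \<longrightarrow> norm (S P n) \<le> \<delta> * wt 3 n) \<and>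
    bnd 3 Q (S P) \<and> dbl_pts T r (fsr (2 * pi / T) (S P))) \<and>
   (\<forall>P P' e. bnd 3 Q P \<longrightarrow> bnd 3 Q P' \<longrightarrow> bnd 3 e (\<lambda>n. P n - P' n) \<longrightarrow> bnd 3 (2 * e) (\<lambda>n. S P n - S P' n))"
  proof (intro exI[of _ S] conjI allI impI)
   fix P n assume "bnd 3 Q P" "\<bar>n\<bar> < K"
   then show "S P n = P n" by (simp add: S_def qpot_def)
  qed (use tail bS dS lip in blast)+
 qed
qed

section \<open>Curves and their complex curvature\<close>

text \<open>Normal form of the curves in \<open>complex_curvature\<close>: the inverse of the frame
  at \<open>- \<i>\<close> is the adjoint of the frame at \<open>\<i>\<close>, and \<open>A\<close>
  is the inverse of the matrix used there.\<close>

definition hcurve :: "cmat2 \<Rightarrow> (real \<Rightarrow> complex) \<Rightarrow> real \<Rightarrow> cmat2" where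
 "hcurve A q t = (A ** frame q t \<i>) ** conj_transpose (A ** frame q t \<i>)"

definition hvel :: "cmat2 \<Rightarrow> (real \<Rightarrow> complex) \<Rightarrow> real \<Rightarrow> cmat2" where
 "hvel A q t = (A ** frame q t \<i>) ** dgn (-1) ** conj_transpose (A ** frame q t \<i>)"

definition hacc :: "cmat2 \<Rightarrow> (real \<Rightarrow> complex) \<Rightarrow> real \<Rightarrow> cmat2" where
 "hacc A q t = (A ** frame q t \<i>) ** mk2 1 (q t) (cnj (q t)) 1 ** conj_transpose (A ** frame q t \<i>)"

lemma bounded_linear_mk2_herm: "bounded_linear (\<lambda>c. mk2 0 c (cnj c) 0)"
proof -
 have "linear (\<lambda>c. mk2 0 c (cnj c) 0)" by (intro linearI) (auto simp: cmat2_eq_iff)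
 then show ?thesis by (simp add: linear_conv_bounded_linear)
qed

lemma L2_loc_bounded_by:
 assumes g: "loc_int g" and f: "L2_loc f"
  and b: "\<And>a b. \<exists>c. \<forall>t\<in>{a..b}. norm (g t) \<le> c * (1 + norm (f t))"
 shows "L2_loc g"
 unfolding L2_loc_def
proof (intro conjI allI)
 show m: "g \<in> borel_measurable lebesgue" by (rule loc_int_measurable[OF g])
 fix a b :: real
 obtain c where c: "\<And>t. t \<in> {a..b} \<Longrightarrow> norm (g t) \<le> c * (1 + norm (f t))" using b by blast
 have m2: "(\<lambda>t. (norm (g t))\<^sup>2) \<in> borel_measurable (lebesgue_on {a..b})"
  by (rule measurable_restrict_space1) (use m in measurable)
 have i: "(\<lambda>t. 2 * c\<^sup>2 * (1 + (norm (f t))\<^sup>2)) integrable_on {a..b}"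
  using f unfolding L2_loc_def absolutely_integrable_on_def
  by (intro integrable_on_mult_right integrable_add) auto
 show "(\<lambda>t. (norm (g t))\<^sup>2) absolutely_integrable_on {a..b}"
 proof (rule measurable_bounded_by_integrable_imp_absolutely_integrable[OF m2 _ i])
  fix t assume t: "t \<in> {a..b}"
  have "(norm (g t))\<^sup>2 \<le> (c * (1 + norm (f t)))\<^sup>2" by (rule power_mono[OF c[OF t]]) simp
  also have "\<dots> = c\<^sup>2 * (1 + norm (f t))\<^sup>2" by (simp add: power_mult_distrib)
  also have "\<dots> \<le> c\<^sup>2 * (2 * (1 + (norm (f t))\<^sup>2))"
  proof (intro mult_left_mono)
   show "(1 + norm (f t))\<^sup>2 \<le> 2 * (1 + (norm (f t))\<^sup>2)"
    using sum_squares_bound[of 1 "norm (f t)"] by (simp add: power2_sum)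
  qed simp
  finally show "norm ((norm (g t))\<^sup>2) \<le> 2 * c\<^sup>2 * (1 + (norm (f t))\<^sup>2)" by (simp add: algebra_simps)
 qed simp
qed

lemma continuous_bounded_Icc:
 fixes f :: "real \<Rightarrow> 'a::real_normed_vector"
 assumes "continuous_on UNIV f"
 obtains c where "c > 0" "\<And>t. t \<in> {a..b} \<Longrightarrow> norm (f t) \<le> c"
proof -
 have "bounded (f ` {a..b})"
  by (intro compact_imp_bounded compact_continuous_image compact_Icc continuous_on_subset[OF assms]) simp
 then obtain c where "\<forall>x\<in>f ` {a..b}. norm x \<le> c" unfolding bounded_iff by meson
 then show ?thesis by (intro that[of "max 1 c"]) (auto simp: le_max_iff_disj)
qed

lemma L2_loc_conjugate:
 fixes A B :: "real \<Rightarrow> cmat2"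
 assumes "continuous_on UNIV A" "continuous_on UNIV B" "L2_loc f" "loc_int g"
  and n: "\<And>t. norm (g t) \<le> c0 * (1 + norm (f t))"
 shows "L2_loc (\<lambda>t. A t ** g t ** B t)"
proof (rule L2_loc_bounded_by[OF _ assms(3)])
 show "loc_int (\<lambda>t. A t ** g t ** B t)"
  by (intro loc_int_bilinear_right[OF bounded_bilinear_mm] loc_int_bilinear[OF bounded_bilinear_mm] assms)
 fix a b :: real
 obtain K where K: "K \<ge> 1" "\<And>(A :: cmat2) (B :: cmat2). norm (A ** B) \<le> K * norm A * norm B"
  using norm_mm_bound by blast
 obtain c1 where c1: "c1 > 0" "\<And>t. t \<in> {a..b} \<Longrightarrow> norm (A t) \<le> c1" using continuous_bounded_Icc[OF assms(1)] by blast
 obtain c2 where c2: "c2 > 0" "\<And>t. t \<in> {a..b} \<Longrightarrow> norm (B t) \<le> c2" using continuous_bounded_Icc[OF assms(2)] by blast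
 show "\<exists>c. \<forall>t\<in>{a..b}. norm (A t ** g t ** B t) \<le> c * (1 + norm (f t))"
 proof (intro exI ballI)
  fix t assume t: "t \<in> {a..b}"
  have "norm (A t ** g t) \<le> K * c1 * norm (g t)"
   by (rule order_trans[OF K(2)]) (use c1(2)[OF t] K(1) in \<open>auto intro!: mult_right_mono mult_left_mono\<close>)
  then have "K * norm (A t ** g t) * norm (B t) \<le> K * (K * c1 * norm (g t)) * c2"
   using c2(2)[OF t] K(1) c1(1) by (intro mult_mono) auto
  then have "norm (A t ** g t ** B t) \<le> K * (K * c1 * norm (g t)) * c2"
   using K(2)[of "A t ** g t" "B t"] by linarith
  also have "\<dots> \<le> K * (K * c1 * (c0 * (1 + norm (f t)))) * c2"
   using n[of t] K(1) c1(1) c2(1) by (intro mult_right_mono mult_left_mono) auto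
  finally show "norm (A t ** g t ** B t) \<le> (K * (K * c1 * c0) * c2) * (1 + norm (f t))" by (simp add: ac_simps)
 qed
qed

lemma has_ac_AE_unique:
 assumes "has_ac_derivative f g" "has_ac_derivative f h"
 shows "AE t in lebesgue. g t = h t"
proof -
 have "has_ac_derivative (\<lambda>t. 0) (\<lambda>t. g t - h t)" using has_ac_diff[OF assms] by simp
 from integral_zero_imp_AE_zero[OF has_ac_loc_int[OF this]] has_ac_integral[OF this]
 show ?thesis by simp
qed

text \<open>At the spectral value \<open>\<i>\<close> the sum of \<open>alpha\<close> and its
  adjoint is diag(-1, 1), free of the potential. So \<open>q\<close> enters only the second
  derivative, and there affinely.\<close>

lemma has_ac_hcurve:
 assumes "loc_int q"
 shows "has_ac_derivative (hcurve A q) (hvel A q)" "has_ac_derivative (hvel A q) (hacc A q)"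
proof -
 have F: "has_ac_derivative (\<lambda>t. A ** frame q t \<i>) (\<lambda>t. A ** frame q t \<i> ** alpha q \<i> t)"
  by (rule has_ac_eq_rhs[OF has_ac_const_mm[OF has_ac_frame[OF assms]]]) (simp add: mm_assoc)
 note Fc = has_ac_linear[OF bounded_linear_ct F]
 have a1: "alpha q \<i> t + conj_transpose (alpha q \<i> t) = dgn (-1)" for t by (simp add: cmat2_eq_iff)
 have a2: "alpha q \<i> t ** dgn (-1) + dgn (-1) ** conj_transpose (alpha q \<i> t) = mk2 1 (q t) (cnj (q t)) 1" for t
  by (simp add: cmat2_eq_iff mm_nth)
 show "has_ac_derivative (hcurve A q) (hvel A q)"
  unfolding hcurve_def[abs_def] hvel_def[abs_def]
  by (rule has_ac_eq_rhs[OF has_ac_mm[OF F Fc]]) (simp add: ct_mm mm_assoc a1 flip: mm.add_left mm.add_right)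
 show "has_ac_derivative (hvel A q) (hacc A q)"
  unfolding hvel_def[abs_def] hacc_def[abs_def] a2[symmetric]
  by (rule has_ac_eq_rhs[OF has_ac_mm[OF has_ac_mm_const[OF F] Fc]]) (simp only: ct_mm mm_assoc mm.add_left mm.add_right)
qed

lemma hvel_vd:
 assumes "loc_int q" shows "(hcurve A q has_vector_derivative hvel A q t) (at t)"
 by (rule has_ac_imp_vector_derivative[OF has_ac_hcurve(1)[OF assms] has_ac_continuous[OF has_ac_hcurve(2)[OF assms]]])

lemma velocity_hcurve: "loc_int q \<Longrightarrow> velocity (hcurve A q) = hvel A q"
 using vector_derivative_at[OF hvel_vd] by blast

lemma L2_loc_hacc:
 assumes "L2_loc q" shows "L2_loc (hacc A q)"
 unfolding hacc_def[abs_def]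
proof (rule L2_loc_conjugate[where f = q and ?c0.0 = 2])
 have l: "loc_int q" by (rule L2_loc_imp_loc_int[OF assms])
 show "continuous_on UNIV (\<lambda>t. A ** frame q t \<i>)" "continuous_on UNIV (\<lambda>t. conj_transpose (A ** frame q t \<i>))"
  by (intro continuous_on_ct continuous_on_mm continuous_on_frame l continuous_on_const)+
 have e: "mk2 1 c (cnj c) 1 = mat 1 + mk2 0 c (cnj c) 0" for c by (simp add: cmat2_eq_iff)
 show "loc_int (\<lambda>t. mk2 1 (q t) (cnj (q t)) 1)"
  unfolding e by (intro loc_int_add loc_int_const loc_int_linear[OF bounded_linear_mk2_herm] l)
 show "norm (mk2 1 (q t) (cnj (q t)) 1) \<le> 2 * (1 + norm (q t))" for t
  by (rule order_trans[OF norm_le_entries]) simp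
qed (rule assms)

lemma W22_loc_hcurve: "L2_loc q \<Longrightarrow> W22_loc (hcurve A q)"
 unfolding W22_loc_def using L2_loc_imp_loc_int[of q]
 by (auto simp: velocity_hcurve intro!: exI[of _ "hacc A q"] has_ac_hcurve L2_loc_hacc differentiableI_vector[OF hvel_vd])

lemma hcurve_H3: "L2_loc q \<Longrightarrow> A \<in> SL2C \<Longrightarrow> hcurve A q t \<in> H3"
 using det_frame[OF L2_loc_imp_loc_int[of q], of t \<i>]
 by (auto simp: H3_def SL2C_def hcurve_def det_mm)

lemma hyp_norm_hvel:
 assumes "L2_loc q" "A \<in> SL2C" shows "hyp_norm (hvel A q t) = 1"
proof -
 have d: "det A = 1" "det (frame q t \<i>) = 1"
  using assms det_frame[OF L2_loc_imp_loc_int] by (auto simp: SL2C_def)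
 have "det (dgn (-1)) = -1" by (simp add: det_2)
 then have "det (hvel A q t) = -1" by (simp add: hvel_def det_mm d)
 then show ?thesis by (simp add: hyp_norm_def)
qed

lemma complex_curvature_iff:
 "complex_curvature \<gamma> q \<longleftrightarrow> L2_loc q \<and> (\<exists>A\<in>SL2C. \<gamma> = hcurve A q)"
proof -
 have key: "(\<forall>t. A ** \<gamma> t ** conj_transpose A = frame q t \<i> ** matrix_inv (frame q t (- \<i>))) \<longleftrightarrow> \<gamma> = hcurve (adj2 A) q"
  if "L2_loc q" "det A = 1" for A
 proof -
  have l: "loc_int q" by (rule L2_loc_imp_loc_int[OF that(1)])
  have i: "matrix_inv (frame q t (- \<i>)) = conj_transpose (frame q t \<i>)" for t
   using matrix_inv_frame[OF l, of t \<i>] by simp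
  note c = adj2_cancel[OF that(2)]
  have dc: "det (conj_transpose A) = 1" using that(2) by simp
  note cc = adj2_cancel[OF dc]
  have "A ** X ** conj_transpose A = Y \<longleftrightarrow> X = adj2 A ** Y ** conj_transpose (adj2 A)" for X Y
  proof
   assume "A ** X ** conj_transpose A = Y"
   then show "X = adj2 A ** Y ** conj_transpose (adj2 A)"
    by (auto simp: mm_assoc c ct_adj2 cc)
  next
   assume "X = adj2 A ** Y ** conj_transpose (adj2 A)"
   then show "A ** X ** conj_transpose A = Y" by (auto simp: mm_assoc c ct_adj2 cc)
  qed
  then show ?thesis unfolding i fun_eq_iff hcurve_def by (simp add: ct_mm mm_assoc)
 qed
 show ?thesis
  unfolding complex_curvature_def
 proof (intro conj_cong refl iffI)
  assume L: "L2_loc q"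
  { assume "\<exists>A\<in>SL2C. \<forall>t. A ** \<gamma> t ** conj_transpose A = frame q t \<i> ** matrix_inv (frame q t (- \<i>))"
   then obtain A where "det A = 1" "\<gamma> = hcurve (adj2 A) q" using key[OF L] by (auto simp: SL2C_def)
   then show "\<exists>A\<in>SL2C. \<gamma> = hcurve A q" by (intro bexI[of _ "adj2 A"]) (auto simp: SL2C_def) }
  { assume "\<exists>A\<in>SL2C. \<gamma> = hcurve A q"
   then obtain A where A: "det A = 1" "\<gamma> = hcurve A q" by (auto simp: SL2C_def)
   then show "\<exists>A\<in>SL2C. \<forall>t. A ** \<gamma> t ** conj_transpose A = frame q t \<i> ** matrix_inv (frame q t (- \<i>))"
    using key[OF L, of "adj2 A"] by (intro bexI[of _ "adj2 A"]) (auto simp: SL2C_def) }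
 qed
qed

text \<open>The eigenvalues are -1 and 1, and the columns of \<open>U\<close> are normalised
  eigenvectors. For a = 1 the formula degenerates; there V = diag(1, -1), and a quarter turn
  exchanges the axes.\<close>

lemma hermitian_diagonalise:
 assumes herm: "conj_transpose V = V" and tr: "trace V = 0" and det: "det V = -1"
 obtains U where "U ** conj_transpose U = mat 1" "det U = 1" "V = U ** dgn (-1) ** conj_transpose U"
proof -
 define a where "a = Re (V $ 1 $ 1)"
 define b where "b = V $ 1 $ 2"
 have "cnj (V $ 1 $ 1) = V $ 1 $ 1" using herm by (metis ct_nth)
 then have v11: "V $ 1 $ 1 = of_real a" by (simp add: a_def complex_eq_iff)
 have v21: "V $ 2 $ 1 = cnj b" using herm by (metis b_def ct_nth)
 have v22: "V $ 2 $ 2 = - of_real a" using tr v11 by (simp add: trace_def sum_2 add_eq_0_iff)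
 have "of_real (a * a) + b * cnj b = (1 :: complex)" using det by (simp add: det_2 v11 v21 v22 b_def[symmetric] algebra_simps minus_equation_iff)
 then have "of_real (a * a + (norm b)\<^sup>2) = (1 :: complex)" unfolding of_real_add complex_norm_square .
 then have ab: "a * a + (norm b)\<^sup>2 = 1" using of_real_eq_1_iff by blast
 show ?thesis
 proof (cases "a = 1")
  case True
  then have b0: "b = 0" using ab by simp
  have "V = mk2 0 1 (-1) 0 ** dgn (-1) ** conj_transpose (mk2 0 1 (-1) 0)"
   by (simp add: cmat2_eq_iff mm_nth v11 v21 v22 b_def[symmetric] True b0)
  then show ?thesis by (intro that[of "mk2 0 1 (-1) 0"]) (auto simp: m2)
 next
  case False
  have "a * a \<le> 1" using ab by (smt (verit) zero_le_power2)
  then have "a \<le> 1" by (metis abs_le_square_iff abs_one abs_ge_self order_trans power2_eq_square mult_1)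
  then have a1: "a < 1" using False by simp
  \<comment> \<open>The length of the eigenvector (a - 1, cnj b) for the eigenvalue -1: its square
    is (a - 1)^2 + |b|^2 = 2 - 2 a.\<close>
  define n where "n = sqrt (2 - 2 * a)"
  have n0: "n > 0" "n * n = 2 - 2 * a" using a1 by (simp_all add: n_def)
  define u where "u = complex_of_real ((a - 1) / n)"
  define v where "v = b / of_real n"
  have uu: "u * u = of_real ((1 - a) / 2)"
  proof -
   have "(a - 1) / n * ((a - 1) / n) = (a - 1) * (a - 1) / (n * n)" by simp
   also have "\<dots> = (1 - a) / 2" unfolding n0 using a1 by (simp add: field_simps)
   finally show ?thesis by (simp only: u_def of_real_mult[symmetric])
  qed
  have vv: "v * cnj v = of_real ((1 + a) / 2)"
  proof -
   have "v * cnj v = (b * cnj b) / of_real (n * n)" by (simp add: v_def)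
   also have "\<dots> = of_real ((norm b)\<^sup>2 / (n * n))" unfolding complex_norm_square[symmetric] of_real_divide ..
   also have "(norm b)\<^sup>2 / (n * n) = (1 + a) / 2" unfolding n0 using ab a1 by (simp add: field_simps)
   finally show ?thesis .
  qed
  have uv: "u * v = - b / 2"
  proof -
   have "u * v = of_real ((a - 1) / (n * n)) * b" by (simp add: u_def v_def)
   also have "(a - 1) / (n * n) = - (1 / 2)" unfolding n0 using a1 by (simp add: field_simps)
   finally show ?thesis by simp
  qed
  have cu: "cnj u = u" by (simp add: u_def)
  define U where "U = mk2 u (- v) (cnj v) u"
  have uvc: "u * cnj v = - cnj b / 2" using arg_cong[OF uv, of cnj] by (simp add: cu)
  have s1: "u * u + v * cnj v = 1" unfolding uu vv of_real_add[symmetric] by (simp add: field_simps)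
  have s2: "- (u * u) + v * cnj v = of_real a" unfolding uu vv by (simp add: field_simps)
  show ?thesis
  proof (rule that[of U])
   show "U ** conj_transpose U = mat 1" using s1 by (simp add: U_def cmat2_eq_iff mm_nth cu algebra_simps)
   show "det U = 1" using s1 by (simp add: U_def det_2)
   show "V = U ** dgn (-1) ** conj_transpose U"
    using s2 uv uvc by (simp add: U_def cmat2_eq_iff mm_nth cu v11 v21 v22 b_def[symmetric] algebra_simps)
  qed
 qed
qed

lemma vd_transform:
 assumes "bounded_linear h" "(f has_vector_derivative f') (at t)" "\<And>s. h (f s) = c s" "(c has_vector_derivative c') (at t)"
 shows "h f' = c'"
proof -
 have "((\<lambda>s. h (f s)) has_vector_derivative h f') (at t)" by (rule bounded_linear.has_vector_derivative[OF assms(1,2)])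
 then have "(c has_vector_derivative h f') (at t)" by (simp add: assms(3))
 then show ?thesis using assms(4) by (rule vector_derivative_unique_at)
qed

text \<open>
 \<open>S = \<gamma>' inv \<gamma>\<close> is an involution. The parallel frame \<open>G\<close> solves \<open>G' = B G\<close> with
 \<open>B = (S + S' S) / 2\<close>, the coefficient found from \<open>\<gamma> = G G*\<close>, \<open>S = G diag (-1, 1) inv G\<close>.
\<close>

lemma complex_curvature_exists:
 assumes W: "W22_loc \<gamma>" and H: "range \<gamma> \<subseteq> H3" and u: "\<And>t. hyp_norm (velocity \<gamma> t) = 1"
 obtains A q where "A \<in> SL2C" "L2_loc q" "\<gamma> = hcurve A q"
proof -
 define v where "v = velocity \<gamma>"
 obtain g0 where g0: "L2_loc g0" "has_ac_derivative v g0" using W unfolding W22_loc_def v_def by blast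
 have vd: "(\<gamma> has_vector_derivative v t) (at t)" for t
  using W unfolding W22_loc_def v_def by (simp add: vector_derivative_works)
 have cv: "continuous_on UNIV v" by (rule has_ac_continuous[OF g0(2)])
 have ac\<gamma>: "has_ac_derivative \<gamma> v" by (rule has_vector_derivative_imp_ac[OF vd cv])
 have c\<gamma>: "continuous_on UNIV \<gamma>" by (rule has_ac_continuous[OF ac\<gamma>])
 have h\<gamma>: "conj_transpose (\<gamma> t) = \<gamma> t" "det (\<gamma> t) = 1" for t
 proof -
  obtain h where "\<gamma> t = h ** conj_transpose h" "det h = 1" using H by (auto simp: H3_def SL2C_def)
  then show "conj_transpose (\<gamma> t) = \<gamma> t" "det (\<gamma> t) = 1" by (simp_all add: ct_mm det_mm)
 qed
 note \<gamma>c = adj2_cancel[OF h\<gamma>(2)]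
 have hv: "conj_transpose (v t) = v t" for t
  by (rule vd_transform[OF bounded_linear_ct vd h\<gamma>(1) vd])
 have detv: "det (v t) = -1" for t
 proof -
  have "cnj (det (v t)) = det (v t)" using det_ct[of "v t"] hv by simp
  moreover have "Re (det (v t)) = -1" using u[of t] by (simp add: hyp_norm_def v_def)
  ultimately show ?thesis by (simp add: complex_eq_iff)
 qed
 define S where "S t = v t ** adj2 (\<gamma> t)" for t
 have trS: "trace (S t) = 0" for t
 proof -
  have "has_ac_derivative (\<lambda>t. \<gamma> t ** adj2 (\<gamma> t)) (\<lambda>t. v t ** adj2 (\<gamma> t) + \<gamma> t ** adj2 (v t))"
   by (rule has_ac_mm[OF ac\<gamma> has_ac_linear[OF bounded_linear_adj2 ac\<gamma>]])
  moreover have "continuous_on UNIV (\<lambda>t. v t ** adj2 (\<gamma> t) + \<gamma> t ** adj2 (v t))"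
   by (intro continuous_on_add continuous_on_mm continuous_on_adj2 cv c\<gamma>)
  ultimately have "((\<lambda>t. \<gamma> t ** adj2 (\<gamma> t)) has_vector_derivative v t ** adj2 (\<gamma> t) + \<gamma> t ** adj2 (v t)) (at t)"
   by (rule has_ac_imp_vector_derivative)
  then have "((\<lambda>t. mat 1 :: cmat2) has_vector_derivative v t ** adj2 (\<gamma> t) + \<gamma> t ** adj2 (v t)) (at t)" by (simp add: \<gamma>c)
  then have "v t ** adj2 (\<gamma> t) + \<gamma> t ** adj2 (v t) = 0"
   by (rule vector_derivative_unique_at[OF _ has_vector_derivative_const])
  from arg_cong[OF this, of trace] have "trace (v t ** adj2 (\<gamma> t)) + trace (\<gamma> t ** adj2 (v t)) = 0"
   by (simp add: trace_def sum_2 algebra_simps)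
  moreover have "trace (\<gamma> t ** adj2 (v t)) = trace (v t ** adj2 (\<gamma> t))" by (simp add: m2 algebra_simps)
  ultimately show ?thesis by (simp add: S_def)
 qed
 have detS: "det (S t) = -1" for t by (simp add: S_def det_mm detv h\<gamma>)
 have SS: "S t ** S t = mat 1" for t
 proof -
  have "X ** X = mat (- det X)" if "trace X = 0" for X :: cmat2
  proof -
   have "X $ 2 $ 2 = - X $ 1 $ 1" using that by (simp add: trace_def sum_2 add_eq_0_iff)
   then show ?thesis by (simp add: m2 algebra_simps)
  qed
  from this[OF trS] show ?thesis by (simp add: detS)
 qed
 have S\<gamma>: "S t ** \<gamma> t = v t" for t by (simp add: S_def mm_assoc \<gamma>c)
 \<comment> \<open>The derivative of \<open>S\<close>; the term - 1 is \<open>v\<close> times its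
   adjugate, that is the determinant -1 of the velocity.\<close>
 define S' where "S' t = g0 t ** adj2 (\<gamma> t) - mat 1" for t
 have vav: "v t ** adj2 (v t) = - mat 1" for t by (simp add: adj2_mult detv cmat2_eq_iff)
 have acS: "has_ac_derivative S S'"
  unfolding S_def[abs_def]
  by (rule has_ac_eq_rhs[OF has_ac_mm[OF g0(2) has_ac_linear[OF bounded_linear_adj2 ac\<gamma>]]]) (simp add: S'_def vav)
 have cS: "continuous_on UNIV S" by (rule has_ac_continuous[OF acS])
 have lS': "loc_int S'" by (rule has_ac_loc_int[OF acS])
 \<comment> \<open>Differentiating \<open>S ** S = mat 1\<close>: the derivative anticommutes with
   \<open>S\<close>.\<close>
 have ae1: "AE t in lebesgue. S' t ** S t + S t ** S' t = 0"
  by (rule has_ac_AE_unique[OF has_ac_mm[OF acS acS]]) (simp add: SS has_ac_const)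
 have "has_ac_derivative v (\<lambda>t. conj_transpose (g0 t))"
  using has_ac_linear[OF bounded_linear_ct g0(2)] by (simp add: hv)
 then have ae2: "AE t in lebesgue. conj_transpose (g0 t) = g0 t" by (rule has_ac_AE_unique[OF _ g0(2)])
 define B where "B t = mat (1/2) ** (S t + S' t ** S t)" for t
 have lB: "loc_int B" unfolding B_def
  by (intro loc_int_linear[OF mm.bounded_linear_right] loc_int_add loc_int_continuous[OF cS] loc_int_bilinear_right[OF bounded_bilinear_mm cS lS'])
 obtain h where h: "\<gamma> 0 = h ** conj_transpose h" "det h = 1" using H by (auto simp: H3_def SL2C_def)
 note hc = adj2_cancel[OF h(2)]
 have dch: "det (conj_transpose h) = 1" using h by simp
 note hcc = adj2_cancel[OF dch]
 \<comment> \<open>The rotation turns the initial direction into diag(-1, 1), so that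
   \<open>G0\<close> carries the base point and the velocity at time 0 simultaneously.\<close>
 obtain U where U: "U ** conj_transpose U = mat 1" "det U = 1" "adj2 h ** v 0 ** conj_transpose (adj2 h) = U ** dgn (-1) ** conj_transpose U"
 proof (rule hermitian_diagonalise)
  let ?V = "adj2 h ** v 0 ** conj_transpose (adj2 h)"
  show "conj_transpose ?V = ?V" by (simp add: ct_mm hv mm_assoc)
  show "det ?V = -1" by (simp add: det_mm h detv)
  have "trace ?V = trace (v 0 ** (conj_transpose (adj2 h) ** adj2 h))" by (simp add: m2 algebra_simps)
  also have "conj_transpose (adj2 h) ** adj2 h = adj2 (\<gamma> 0)" by (simp add: h adj2_mm ct_adj2)
  finally show "trace ?V = 0" using trS[of 0] by (simp add: S_def)
 qed
 define G0 where "G0 = h ** U"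
 have dG0: "det G0 = 1" by (simp add: G0_def det_mm h U)
 have UU: "U ** (conj_transpose U ** X) = X" for X using U(1) by (metis matrix_mul_assoc matrix_mul_lid)
 have aU: "adj2 U = conj_transpose U"
  using arg_cong[OF U(1), of "\<lambda>X. adj2 U ** X"] by (simp add: adj2_cancel[OF U(2)])
 have \<gamma>0: "\<gamma> 0 = G0 ** conj_transpose G0" by (simp add: G0_def ct_mm mm_assoc UU h)
 obtain G where G: "G 0 = G0" "has_ac_derivative G (\<lambda>t. B t ** G t)"
  by (rule linear_ode_exists[OF bounded_bilinear.flip[OF bounded_bilinear_mm] lB, of G0])
 have cG: "continuous_on UNIV G" by (rule has_ac_continuous[OF G(2)])
 have trSS: "trace (S' t ** S t) = 0" if "S' t ** S t + S t ** S' t = 0" for t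
 proof -
  have "trace (S' t ** S t) + trace (S t ** S' t) = 0" using arg_cong[OF that, of trace] by (simp add: trace_def sum_2 algebra_simps)
  moreover have "trace (S t ** S' t) = trace (S' t ** S t)" by (simp add: m2 algebra_simps)
  ultimately show ?thesis by simp
 qed
 have trB: "trace (B t) = 0" if "S' t ** S t + S t ** S' t = 0" for t
 proof -
  have t1: "trace (mat (1/2) ** X) = trace X / 2" for X :: cmat2 by (simp add: trace_def sum_2 mat_mm add_divide_distrib)
  have t2: "trace (X + Y) = trace X + trace Y" for X Y :: cmat2 by (simp add: trace_def sum_2 algebra_simps)
  show ?thesis unfolding B_def t1 t2 using trSS[OF that] trS[of t] by simp
 qed
 have acaG: "has_ac_derivative (\<lambda>t. adj2 (G t)) (\<lambda>t. - (adj2 (G t) ** B t))"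
 proof (rule has_ac_cong_AE[OF has_ac_linear[OF bounded_linear_adj2 G(2)]])
  show "AE t in lebesgue. adj2 (B t ** G t) = - (adj2 (G t) ** B t)"
   using ae1 by eventually_elim (simp add: adj2_mm adj2_trace0[OF trB] mm.minus_right)
 qed
 have dG: "det (G t) = 1" for t
 proof -
  have "has_ac_derivative (\<lambda>t. adj2 (G t) ** G t) (\<lambda>t. 0)"
   by (rule has_ac_eq_rhs[OF has_ac_mm[OF acaG G(2)]]) (simp add: mm.minus_left mm_assoc)
  then have "adj2 (G t) ** G t = adj2 (G 0) ** G 0" by (rule has_ac_zero_imp_const)
  then have "(mat (det (G t)) :: cmat2) = mat 1" by (simp add: adj2_mult G(1) dG0)
  then show ?thesis by (simp add: cmat2_eq_iff)
 qed
 note Gc = adj2_cancel[OF dG]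
 have dcG: "det (conj_transpose (G t)) = 1" for t using dG by simp
 note Gcc = adj2_cancel[OF dcG]
 have half2: "mat (1/2) ** X + mat (1/2) ** X = X" for X :: cmat2 by (simp add: cmat2_eq_iff mat_mm)
 \<comment> \<open>\<open>B\<close> is built so that its commutator with \<open>S\<close> is the
   derivative of \<open>S\<close>; hence \<open>S\<close> is constant in the moving frame.\<close>
 have Uconst: "adj2 (G t) ** S t ** G t = dgn (-1)" for t
 proof -
  have "has_ac_derivative (\<lambda>t. adj2 (G t) ** S t ** G t) (\<lambda>t. 0)"
  proof (rule has_ac_cong_AE[OF has_ac_mm[OF has_ac_mm[OF acaG acS] G(2)]])
   show "AE t in lebesgue. (- (adj2 (G t) ** B t) ** S t + adj2 (G t) ** S' t) ** G t + adj2 (G t) ** S t ** (B t ** G t) = 0"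
    using ae1
   proof eventually_elim
    case (elim t)
    have e: "S t ** S' t = - (S' t ** S t)" using elim by (simp add: eq_neg_iff_add_eq_0 add.commute)
    have e2: "S t ** (S' t ** S t) = - S' t" using e by (metis SS matrix_mul_assoc matrix_mul_rid mm.minus_left)
    then have sb: "S t ** B t = mat (1/2) ** (mat 1 - S' t)"
     by (simp add: B_def mat_left_commute mm.add_right mm.diff_right SS e2 mm.minus_right)
    have bs: "B t ** S t = mat (1/2) ** (mat 1 + S' t)"
     by (simp add: B_def mm_assoc mm.add_left SS)
    have "- (B t ** S t) + S' t + S t ** B t = 0" unfolding sb bs by (simp add: cmat2_eq_iff mat_mm field_simps)
    then have "adj2 (G t) ** (- (B t ** S t) + S' t + S t ** B t) ** G t = 0" by (simp add: mm.zero_right mm.zero_left)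
    then show ?case by (simp add: mm.add_left mm.add_right mm.diff_left mm.diff_right mm_assoc mm.minus_left mm.minus_right)
   qed
  qed
  then have "adj2 (G t) ** S t ** G t = adj2 (G 0) ** S 0 ** G 0" by (rule has_ac_zero_imp_const)
  also have "\<dots> = adj2 U ** (adj2 h ** v 0 ** conj_transpose (adj2 h)) ** adj2 (conj_transpose U)"
  proof -
   have "adj2 (\<gamma> 0) ** G0 = conj_transpose (adj2 h) ** adj2 (conj_transpose U)"
    unfolding \<gamma>0 adj2_mm by (simp add: mm_assoc adj2_cancel[OF dG0]) (simp add: G0_def ct_mm adj2_mm ct_adj2)
   then show ?thesis unfolding G(1) S_def by (simp add: G0_def adj2_mm mm_assoc)
  qed
  also have "\<dots> = dgn (-1)"
  proof -
   have "conj_transpose U ** adj2 (conj_transpose U) = mat 1" using U(2) by (simp add: adj2_mult)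
   then show ?thesis unfolding U(3) by (simp add: mm_assoc adj2_cancel[OF U(2)])
  qed
  finally show ?thesis .
 qed
 \<comment> \<open>The matrix S' S \<gamma> is skew-Hermitian, because the second derivative is
   Hermitian and S' anticommutes with S. This makes \<open>\<gamma>\<close> agree with
   \<open>G\<close> times its adjoint and later makes \<open>w\<close> skew-Hermitian.\<close>
 have ae3: "AE t in lebesgue. S' t ** S t ** \<gamma> t + \<gamma> t ** conj_transpose (S t) ** conj_transpose (S' t) = 0"
  using ae1 ae2
 proof eventually_elim
  case (elim t)
  have cS': "conj_transpose (S' t) = adj2 (\<gamma> t) ** g0 t - mat 1"
   using elim(2) by (simp add: S'_def ct_mm ct_adj2 h\<gamma> linear_diff[OF bounded_linear.linear[OF bounded_linear_ct]])
  have "\<gamma> t ** conj_transpose (S t) = v t" using arg_cong[OF S\<gamma>[of t], of conj_transpose] by (simp add: ct_mm h\<gamma> hv)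
  then have "\<gamma> t ** conj_transpose (S t) ** conj_transpose (S' t) = S t ** g0 t - v t"
   unfolding cS' by (simp add: mm.diff_right S_def mm_assoc)
  moreover have "S' t ** \<gamma> t = g0 t - \<gamma> t" by (simp add: S'_def mm.diff_left mm_assoc \<gamma>c)
  then have "S t ** S' t ** \<gamma> t = S t ** g0 t - v t" by (simp add: mm_assoc mm.diff_right S\<gamma>)
  ultimately have "S' t ** S t ** \<gamma> t + \<gamma> t ** conj_transpose (S t) ** conj_transpose (S' t) = (S' t ** S t + S t ** S' t) ** \<gamma> t"
   by (simp add: mm.add_left)
  then show ?case using elim(1) by (simp add: mm.zero_left)
 qed
 have \<gamma>G: "\<gamma> t = G t ** conj_transpose (G t)" for t
 proof -
  note acct = has_ac_linear[OF bounded_linear_ct acaG]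
  have "has_ac_derivative (\<lambda>t. adj2 (G t) ** \<gamma> t ** conj_transpose (adj2 (G t))) (\<lambda>t. 0)"
  proof (rule has_ac_cong_AE[OF has_ac_mm[OF has_ac_mm[OF acaG ac\<gamma>] acct]])
   show "AE t in lebesgue. (- (adj2 (G t) ** B t) ** \<gamma> t + adj2 (G t) ** v t) ** conj_transpose (adj2 (G t)) +
     adj2 (G t) ** \<gamma> t ** conj_transpose (- (adj2 (G t) ** B t)) = 0"
    using ae3
   proof eventually_elim
    case (elim t)
    have b1: "B t ** \<gamma> t = mat (1/2) ** (v t + S' t ** S t ** \<gamma> t)"
     by (simp add: B_def mm_assoc mm.add_left S\<gamma>)
    have gv: "\<gamma> t ** conj_transpose (S t) = v t" using arg_cong[OF S\<gamma>[of t], of conj_transpose] by (simp add: ct_mm h\<gamma> hv)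
    have cB: "conj_transpose (B t) = mat (1/2) ** (conj_transpose (S t) + conj_transpose (S t) ** conj_transpose (S' t))"
     by (simp add: B_def cmat2_eq_iff mm_nth mat_mm)
    have "\<gamma> t ** conj_transpose (B t) = mat (1/2) ** (\<gamma> t ** conj_transpose (S t) + \<gamma> t ** conj_transpose (S t) ** conj_transpose (S' t))"
     unfolding cB by (simp only: mat_left_commute mm.add_right mm_assoc)
    then have b2: "\<gamma> t ** conj_transpose (B t) = mat (1/2) ** (v t + \<gamma> t ** conj_transpose (S t) ** conj_transpose (S' t))"
     by (metis gv)
    have "B t ** \<gamma> t + \<gamma> t ** conj_transpose (B t) = mat (1/2) ** (v t + v t + (S' t ** S t ** \<gamma> t + \<gamma> t ** conj_transpose (S t) ** conj_transpose (S' t)))"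
     unfolding b1 b2 mm.add_right by (simp add: ac_simps)
    also have "\<dots> = v t" unfolding elim add_0_right mm.add_right by (rule half2)
    finally have "v t - B t ** \<gamma> t - \<gamma> t ** conj_transpose (B t) = 0" by (simp add: algebra_simps)
    then have "adj2 (G t) ** (v t - B t ** \<gamma> t - \<gamma> t ** conj_transpose (B t)) ** conj_transpose (adj2 (G t)) = 0"
     by (simp add: mm.zero_left mm.zero_right)
    moreover have "conj_transpose (- (adj2 (G t) ** B t)) = - (conj_transpose (B t) ** conj_transpose (adj2 (G t)))"
     by (simp add: cmat2_eq_iff mm_nth)
    ultimately show ?case
     by (simp add: mm.diff_left mm.diff_right mm.add_left mm.add_right mm_assoc mm.minus_left mm.minus_right algebra_simps)
   qed
  qed
  then have "adj2 (G t) ** \<gamma> t ** conj_transpose (adj2 (G t)) = adj2 (G 0) ** \<gamma> 0 ** conj_transpose (adj2 (G 0))"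
   by (rule has_ac_zero_imp_const)
  also have "\<dots> = mat 1"
   using dG0 by (simp add: G(1) \<gamma>0 mm_assoc adj2_cancel ct_adj2)
  finally have "G t ** (adj2 (G t) ** \<gamma> t ** conj_transpose (adj2 (G t))) ** conj_transpose (G t) = G t ** conj_transpose (G t)" by simp
  then show ?thesis by (simp add: mm_assoc Gc ct_adj2 Gcc)
 qed
 \<comment> \<open>In the moving frame S' S anticommutes with diag(-1, 1), hence is off-diagonal,
   and it is skew-Hermitian by \<open>ae3\<close>: half of it has exactly the shape
   \<open>offd (q t)\<close>.\<close>
 define w where "w t = adj2 (G t) ** (S' t ** S t) ** G t" for t
 define q where "q t = w t $ 1 $ 2" for t
 have lw: "loc_int w" unfolding w_def
  by (intro loc_int_bilinear_right[OF bounded_bilinear_mm cG] loc_int_bilinear[OF bounded_bilinear_mm continuous_on_adj2[OF cG]]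
    loc_int_bilinear_right[OF bounded_bilinear_mm cS lS'])
 have lq: "loc_int q" unfolding q_def by (rule loc_int_linear[OF bounded_linear_entry lw])
 have wq: "AE t in lebesgue. mat (1/2) ** w t = offd (q t)"
  using ae1 ae3
 proof eventually_elim
  case (elim t)
  have e: "S t ** S' t = - (S' t ** S t)" using elim(1) by (simp add: eq_neg_iff_add_eq_0 add.commute)
  have "w t ** dgn (-1) + dgn (-1) ** w t = adj2 (G t) ** (S' t ** S t ** S t + S t ** S' t ** S t) ** G t"
   unfolding Uconst[of t, symmetric] w_def by (simp add: mm_assoc Gc mm.add_left mm.add_right)
  also have "S' t ** S t ** S t + S t ** S' t ** S t = 0" unfolding e by (simp add: mm.minus_left)
  finally have d: "w t ** dgn (-1) + dgn (-1) ** w t = 0" by (simp add: mm.zero_left mm.zero_right)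
  have w0: "w t $ 1 $ 1 = 0" "w t $ 2 $ 2 = 0"
   using d by (simp_all add: cmat2_eq_iff mm_nth add_eq_0_iff)
  have "adj2 (G t) ** (S' t ** S t ** \<gamma> t + \<gamma> t ** conj_transpose (S t) ** conj_transpose (S' t)) ** conj_transpose (adj2 (G t)) = w t + conj_transpose (w t)"
   unfolding \<gamma>G[of t] w_def by (simp add: ct_mm mm_assoc Gc ct_adj2 Gcc mm.add_left mm.add_right)
  then have "w t + conj_transpose (w t) = 0" unfolding elim(2) by (simp add: mm.zero_left mm.zero_right)
  then have "w t $ 2 $ 1 = - cnj (q t)" by (simp add: cmat2_eq_iff q_def eq_neg_iff_add_eq_0)
  then show ?case using w0 by (simp add: cmat2_eq_iff mat_mm q_def)
 qed
 have "has_ac_derivative G (\<lambda>t. G t ** alpha q \<i> t)"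
 proof (rule has_ac_cong_AE[OF G(2)])
  show "AE t in lebesgue. B t ** G t = G t ** alpha q \<i> t"
   using wq
  proof eventually_elim
   case (elim t)
   have "alpha q \<i> t = mat (1/2) ** dgn (-1) + mat (1/2) ** w t" unfolding elim by (simp add: cmat2_eq_iff mat_mm)
   also have "\<dots> = mat (1/2) ** (adj2 (G t) ** (S t + S' t ** S t) ** G t)"
    unfolding Uconst[of t, symmetric] w_def by (simp add: mm.add_left mm.add_right mm_assoc)
   finally have "G t ** alpha q \<i> t = mat (1/2) ** ((S t + S' t ** S t) ** G t)"
    by (simp add: mat_left_commute mm_assoc Gc)
   then show ?case by (simp add: B_def mm_assoc)
  qed
 qed
 from frame_solution[OF lq this] have GF: "G t = G0 ** frame q t \<i>" for t by (simp add: G(1))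
 have "\<gamma> = hcurve G0 q" by (rule ext) (simp add: \<gamma>G hcurve_def GF)
 moreover have "G0 \<in> SL2C" using dG0 by (simp add: SL2C_def)
 moreover have "L2_loc q"
 proof (rule L2_loc_bounded_by[OF lq g0(1)])
  fix a b :: real
  obtain K where K: "K \<ge> 1" "\<And>(A :: cmat2) (B :: cmat2). norm (A ** B) \<le> K * norm A * norm B"
   using norm_mm_bound by blast
  have cc: "continuous_on UNIV (\<lambda>t. adj2 (\<gamma> t) ** S t ** G t)" "continuous_on UNIV (\<lambda>t. adj2 (G t))" "continuous_on UNIV (\<lambda>t. adj2 (G t) ** S t ** G t)"
   by (intro continuous_on_mm continuous_on_adj2 c\<gamma> cS cG)+
  obtain c1 where c1: "c1 > 0" "\<And>t. t \<in> {a..b} \<Longrightarrow> norm (adj2 (\<gamma> t) ** S t ** G t) \<le> c1" using continuous_bounded_Icc[OF cc(1)] by blast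
  obtain c2 where c2: "c2 > 0" "\<And>t. t \<in> {a..b} \<Longrightarrow> norm (adj2 (G t)) \<le> c2" using continuous_bounded_Icc[OF cc(2)] by blast
  obtain c3 where c3: "c3 > 0" "\<And>t. t \<in> {a..b} \<Longrightarrow> norm (adj2 (G t) ** S t ** G t) \<le> c3" using continuous_bounded_Icc[OF cc(3)] by blast
  show "\<exists>c. \<forall>t\<in>{a..b}. norm (q t) \<le> c * (1 + norm (g0 t))"
  proof (intro exI ballI)
   fix t assume t: "t \<in> {a..b}"
   have e: "w t = adj2 (G t) ** (g0 t ** (adj2 (\<gamma> t) ** S t ** G t)) - adj2 (G t) ** S t ** G t"
    by (simp add: w_def S'_def mm.diff_left mm.diff_right mm_assoc)
   have "norm (g0 t ** (adj2 (\<gamma> t) ** S t ** G t)) \<le> K * norm (g0 t) * c1"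
    by (rule order_trans[OF K(2)]) (use c1(2)[OF t] K(1) in \<open>auto intro!: mult_left_mono\<close>)
   then have "K * norm (adj2 (G t)) * norm (g0 t ** (adj2 (\<gamma> t) ** S t ** G t)) \<le> K * c2 * (K * norm (g0 t) * c1)"
    using c2(2)[OF t] c2(1) K(1) by (intro mult_mono) auto
   then have 1: "norm (adj2 (G t) ** (g0 t ** (adj2 (\<gamma> t) ** S t ** G t))) \<le> K * c2 * (K * norm (g0 t) * c1)"
    using K(2) order_trans by blast
   have "norm (q t) \<le> norm (w t)" unfolding q_def by (rule norm_entry_le)
   also have "\<dots> \<le> K * c2 * (K * norm (g0 t) * c1) + c3"
    unfolding e by (rule order_trans[OF norm_triangle_ineq4 add_mono[OF 1 c3(2)[OF t]]])
   also have "\<dots> \<le> (K * c2 * (K * c1) + c3) * (1 + norm (g0 t))"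
    using K(1) c1(1) c2(1) c3(1) by (simp add: algebra_simps add_nonneg_nonneg)
   finally show "norm (q t) \<le> (K * c2 * (K * c1) + c3) * (1 + norm (g0 t))" .
  qed
 qed
 ultimately show ?thesis using that by blast
qed

text \<open>Two frames over one curve share base point and velocity, so their quotient
  \<open>H\<close> is unitary and commutes with diag(-1, 1); it is diagonal with unit entries. The
  diagonal part of its equation makes it constant, the off-diagonal part relates the two potentials
  by the squared entry.\<close>

lemma hcurve_unique:
 assumes q: "loc_int q1" "loc_int q2" and A: "det A1 = 1" "det A2 = 1" and eq: "hcurve A1 q1 = hcurve A2 q2"
 obtains c where "norm c = 1" "AE t in lebesgue. q2 t = c\<^sup>2 * q1 t" "adj2 A2 ** A1 = mk2 c 0 0 (cnj c)"
proof -
 define P1 where "P1 t = A1 ** frame q1 t \<i>" for t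
 define P2 where "P2 t = A2 ** frame q2 t \<i>" for t
 have d: "det (P1 t) = 1" "det (P2 t) = 1" for t
  by (simp_all add: P1_def P2_def det_mm A det_frame q)
 have dc: "det (conj_transpose (P2 t)) = 1" for t by (simp add: d)
 have h: "P1 t ** conj_transpose (P1 t) = P2 t ** conj_transpose (P2 t)" for t
  using fun_cong[OF eq, of t] by (simp add: hcurve_def P1_def P2_def)
 have v: "P1 t ** dgn (-1) ** conj_transpose (P1 t) = P2 t ** dgn (-1) ** conj_transpose (P2 t)" for t
 proof -
  have "hvel A1 q1 = hvel A2 q2" using velocity_hcurve[OF q(1), of A1] velocity_hcurve[OF q(2), of A2] eq by simp
  from fun_cong[OF this, of t] show ?thesis by (simp add: hvel_def P1_def P2_def)
 qed
 define H where "H t = adj2 (P2 t) ** P1 t" for t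
 have dH: "det (H t) = 1" for t by (simp add: H_def det_mm d)
 note c2 = adj2_cancel[OF d(2)] and c2c = adj2_cancel[OF dc]
 have HH: "H t ** conj_transpose (H t) = mat 1" for t
 proof -
  have "H t ** conj_transpose (H t) = adj2 (P2 t) ** (P1 t ** conj_transpose (P1 t)) ** conj_transpose (adj2 (P2 t))"
   by (simp add: H_def ct_mm mm_assoc)
  then show ?thesis unfolding h by (simp add: mm_assoc c2 ct_adj2 c2c)
 qed
 have HD: "H t ** dgn (-1) ** conj_transpose (H t) = dgn (-1)" for t
 proof -
  have "H t ** dgn (-1) ** conj_transpose (H t) = adj2 (P2 t) ** (P1 t ** dgn (-1) ** conj_transpose (P1 t)) ** conj_transpose (adj2 (P2 t))"
   by (simp add: H_def ct_mm mm_assoc)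
  then show ?thesis unfolding v by (simp add: mm_assoc c2 ct_adj2 c2c)
 qed
 have aH: "conj_transpose (H t) = adj2 (H t)" for t
  using arg_cong[OF HH[of t], of "\<lambda>X. adj2 (H t) ** X"] by (simp add: adj2_cancel[OF dH])
 have comm: "H t ** dgn (-1) = dgn (-1) ** H t" for t
  using arg_cong[OF HD[of t], of "\<lambda>X. X ** H t"] unfolding aH by (simp add: mm_assoc adj2_cancel[OF dH])
 have off: "H t $ 1 $ 2 = 0" "H t $ 2 $ 1 = 0" for t
  using comm[of t] by (simp_all add: cmat2_eq_iff mm_nth eq_neg_iff_add_eq_0 neg_eq_iff_add_eq_0)
 have H22: "H t $ 2 $ 2 = cnj (H t $ 1 $ 1)" for t using aH[of t] by (simp add: cmat2_eq_iff)
 have n1: "norm (H t $ 1 $ 1) = 1" for t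
 proof -
  have "H t $ 1 $ 1 * cnj (H t $ 1 $ 1) = 1" using dH[of t] by (simp add: det_2 off H22)
  then have "of_real ((norm (H t $ 1 $ 1))\<^sup>2) = (1 :: complex)" unfolding complex_norm_square .
  then have "(norm (H t $ 1 $ 1))\<^sup>2 = 1" using of_real_eq_1_iff by blast
  then show ?thesis by (simp add: power2_eq_1_iff) (smt (verit) norm_ge_zero)
 qed
 have ac1: "has_ac_derivative P1 (\<lambda>t. P1 t ** alpha q1 \<i> t)"
  unfolding P1_def by (rule has_ac_eq_rhs[OF has_ac_const_mm[OF has_ac_frame[OF q(1)]]]) (simp add: mm_assoc)
 have ac2: "has_ac_derivative P2 (\<lambda>t. P2 t ** alpha q2 \<i> t)"
  unfolding P2_def by (rule has_ac_eq_rhs[OF has_ac_const_mm[OF has_ac_frame[OF q(2)]]]) (simp add: mm_assoc)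
 have acH: "has_ac_derivative H (\<lambda>t. H t ** alpha q1 \<i> t - alpha q2 \<i> t ** H t)"
  unfolding H_def[abs_def]
  by (rule has_ac_eq_rhs[OF has_ac_mm[OF ode_adj2[OF ac2 trace_alpha] ac1]]) (simp add: mm_assoc mm.minus_left)
 have "has_ac_derivative (\<lambda>t. H t $ 1 $ 1) (\<lambda>t. 0)"
  by (rule has_ac_eq_rhs[OF has_ac_linear[OF bounded_linear_entry acH]]) (simp add: mm_nth off)
 then have const0: "H t $ 1 $ 1 = H 0 $ 1 $ 1" for t by (rule has_ac_zero_imp_const)
 define c where "c = H 0 $ 1 $ 1"
 have const: "H t $ 1 $ 1 = c" for t unfolding c_def by (rule const0)
 have nc: "norm c = 1" by (simp add: c_def n1)
 then have cc: "c * cnj c = 1" using complex_norm_square[of c] by simp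
 have "has_ac_derivative (\<lambda>t. 0) (\<lambda>t. c * q1 t / 2 - q2 t * cnj c / 2)"
  by (rule has_ac_eq_rhs[OF has_ac_linear[OF bounded_linear_entry acH, of 1 2, unfolded off]])
   (simp add: mm_nth off H22 const)
 then have "AE t in lebesgue. c * q1 t / 2 - q2 t * cnj c / 2 = 0" by (rule has_ac_AE_unique[OF _ has_ac_const])
 then have ae: "AE t in lebesgue. q2 t = c\<^sup>2 * q1 t"
 proof eventually_elim
  case (elim t)
  then have "c * (c * q1 t) = q2 t * (c * cnj c)" by (simp add: algebra_simps)
  then show ?case unfolding cc by (simp add: power2_eq_square mult.assoc)
 qed
 have "H 0 = adj2 A2 ** A1" by (simp add: H_def P1_def P2_def q)
 moreover have "H 0 = mk2 c 0 0 (cnj c)" by (simp add: cmat2_eq_iff off H22 c_def)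
 ultimately show ?thesis using that nc ae by metis
qed

lemma AE_shift:
 fixes T :: real
 assumes "AE t in lebesgue. P t" shows "AE t in lebesgue. P (t + T)"
proof -
 obtain N where N: "negligible N" "\<And>t. t \<notin> N \<Longrightarrow> P t" using AE_imp_negligible[OF assms] by blast
 have "negligible ((\<lambda>x. - T + x) ` N)" by (rule negligible_translation[OF N(1)])
 then show ?thesis
 proof (rule negligible_imp_AE)
  fix t assume "t \<notin> (\<lambda>x. - T + x) ` N"
  then have "t + T \<notin> N" by (auto simp: image_iff)
  then show "P (t + T)" by (rule N(2))
 qed
qed

text \<open>A closed curve coincides with its shift by T, whose frame starts from the monodromy.
  Uniqueness then shows that the monodromy at \<open>\<i>\<close> is diagonal, with the same unit
  number that governs the quasi-period.\<close>

lemma hcurve_periodic_data: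
 assumes Aq: "A \<in> SL2C" "L2_loc q" and per: "\<And>t. hcurve A q (t + T) = hcurve A q t"
 obtains c where "norm c = 1" "AE t in lebesgue. q (t + T) = c\<^sup>2 * q t" "frame q T \<i> = mk2 (cnj c) 0 0 c"
proof -
 have l: "loc_int q" by (rule L2_loc_imp_loc_int[OF Aq(2)])
 have dA: "det A = 1" using Aq(1) by (simp add: SL2C_def)
 define M where "M = frame q T \<i>"
 have dM: "det M = 1" by (simp add: M_def det_frame[OF l])
 have "hcurve A q = hcurve (A ** M) (\<lambda>t. q (t + T))"
 proof
  fix t
  have "hcurve A q t = hcurve A q (t + T)" using per[of t] by simp
  also have "\<dots> = hcurve (A ** M) (\<lambda>t. q (t + T)) t" by (simp add: hcurve_def frame_shift[OF l] mm_assoc M_def)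
  finally show "hcurve A q t = hcurve (A ** M) (\<lambda>t. q (t + T)) t" .
 qed
 from hcurve_unique[OF l loc_int_shift[OF l] dA _ this] dA dM
 obtain c where c: "norm c = 1" "AE t in lebesgue. q (t + T) = c\<^sup>2 * q t" "adj2 (A ** M) ** A = mk2 c 0 0 (cnj c)"
  by (auto simp: det_mm)
 have "adj2 (A ** M) ** A = adj2 M" by (simp add: adj2_mm mm_assoc adj2_cancel[OF dA])
 then have "adj2 M = mk2 c 0 0 (cnj c)" using c(3) by simp
 then have "M = mk2 (cnj c) 0 0 c" using arg_cong[of "adj2 M" _ adj2] by (simp add: cmat2_eq_iff)
 then show ?thesis using that c unfolding M_def by blast
qed

lemma cis_add_period: "cis (- \<theta> * (t + T)) * cis (\<theta> * T) = cis (- \<theta> * t)"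
 by (simp add: cis_mult algebra_simps)

lemma L2_loc_phase:
 assumes "L2_loc q" shows "L2_loc (\<lambda>t. cis (\<theta> * t) * q t)"
proof -
 have c: "continuous_on UNIV (\<lambda>t. cis (\<theta> * t))" by (rule has_ac_continuous[OF has_ac_cis])
 show ?thesis
  by (rule L2_loc_bounded_by[OF loc_int_bilinear[OF bounded_bilinear_mult c L2_loc_imp_loc_int[OF assms]] assms])
   (auto simp: norm_mult intro!: exI[of _ 1])
qed

text \<open>The gauge by \<theta> multiplies diag(cnj c, c) by half-angle phases. The resulting
  entry cnj c * exp(i \<theta> T / 2) squares to 1 because exp(i \<theta> T) = c^2, so the monodromy
  becomes a sign.\<close>

lemma periodic_monodromy:
 assumes q: "loc_int q" and c: "norm c = 1" "AE t in lebesgue. q (t + T) = c\<^sup>2 * q t"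
  and M: "frame q T \<i> = mk2 (cnj c) 0 0 c" and \<theta>: "cis (\<theta> * T) = c\<^sup>2"
 obtains s where "s\<^sup>2 = 1" "frame (\<lambda>t. cis (- \<theta> * t) * q t) T (\<i> + of_real \<theta>) = mat s"
  "AE t in lebesgue. cis (- \<theta> * (t + T)) * q (t + T) = cis (- \<theta> * t) * q t"
proof -
 have cc: "c * cnj c = 1" using c(1) complex_norm_square[of c] by simp
 define s where "s = cnj c * cis (\<theta> * T / 2)"
 have "cis (\<theta> * T / 2) * cis (\<theta> * T / 2) = c\<^sup>2" unfolding cis_mult using \<theta> by (simp add: mult.commute)
 then have "s\<^sup>2 = (c * cnj c) * (c * cnj c)" by (simp add: s_def power2_eq_square ac_simps)
 then have s2: "s\<^sup>2 = 1" unfolding cc by simp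
 then have sc: "cnj s = s" by (auto simp: power2_eq_1_iff)
 have "c * cis (- (\<theta> * T) / 2) = cnj s" by (simp add: s_def cis_cnj)
 then have c2: "c * cis (- (\<theta> * T) / 2) = s" unfolding sc .
 have "frame (\<lambda>t. cis (- \<theta> * t) * q t) T (\<i> + of_real \<theta>) = mk2 (cnj c) 0 0 c ** dphase (\<theta> * T)"
  using frame_gauge[OF q, of T \<i> \<theta>] M by simp
 also have "\<dots> = mat s" using c2 by (simp add: cmat2_eq_iff mm_nth s_def)
 finally have 1: "frame (\<lambda>t. cis (- \<theta> * t) * q t) T (\<i> + of_real \<theta>) = mat s" .
 have 2: "AE t in lebesgue. cis (- \<theta> * (t + T)) * q (t + T) = cis (- \<theta> * t) * q t"
  using c(2)
 proof eventually_elim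
  case (elim t)
  show ?case unfolding elim \<theta>[symmetric] mult.assoc[symmetric] cis_add_period ..
 qed
 show ?thesis by (rule that[OF s2 1 2])
qed

text \<open>In the product of the frame with its adjoint the gauge factor and the sign of the
  monodromy cancel, so the curve closes even if its frame closes only up to sign.\<close>

lemma closed_from_potential:
 assumes T: "T > 0" and p: "L2_loc p" "\<And>t. p (t + T) = p t" and A: "A \<in> SL2C"
  and M: "frame p T (\<i> + of_real \<theta>) = mat s" "s\<^sup>2 = 1"
 defines "q \<equiv> \<lambda>t. cis (\<theta> * t) * p t"
 shows "hcurve A q \<in> closed_curves T" "complex_curvature (hcurve A q) q" "quasi_periodic T \<theta> q"
  "(\<lambda>t. cis (- \<theta> * t) * q t) = p" "L2_loc q"
proof -
 show Lq: "L2_loc q" unfolding q_def by (rule L2_loc_phase[OF p(1)])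
 have l: "loc_int q" by (rule L2_loc_imp_loc_int[OF Lq])
 have lp: "loc_int p" by (rule L2_loc_imp_loc_int[OF p(1)])
 show pq: "(\<lambda>t. cis (- \<theta> * t) * q t) = p"
  by (rule ext) (simp add: q_def mult.assoc[symmetric] cis_mult)
 have qp: "q (t + T) = cis (\<theta> * T) * q t" for t
 proof -
  have "cis (\<theta> * (t + T)) = cis (\<theta> * T) * cis (\<theta> * t)" by (simp add: cis_mult algebra_simps)
  then show ?thesis by (simp add: q_def p(2) mult.assoc)
 qed
 then show "quasi_periodic T \<theta> q" by (simp add: quasi_periodic_def)
 show cc: "complex_curvature (hcurve A q) q" unfolding complex_curvature_iff using Lq A by blast
 have s: "s * cnj s = 1" using M(2) by (auto simp: power2_eq_1_iff)
 have g: "hcurve A q t = A ** (frame p t (\<i> + of_real \<theta>) ** conj_transpose (frame p t (\<i> + of_real \<theta>))) ** conj_transpose A" for t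
 proof -
  have e: "frame p t (\<i> + of_real \<theta>) = frame q t \<i> ** dphase (\<theta> * t)"
   using frame_gauge[OF l, of t \<i> \<theta>] pq by simp
  have "dphase x ** (dphase (- x) ** Y) = Y" for x and Y :: cmat2 by (simp add: matrix_mul_assoc dphase_mm)
  then show ?thesis unfolding e by (simp add: hcurve_def ct_mm mm_assoc ct_dphase)
 qed
 have per: "hcurve A q (t + T) = hcurve A q t" for t
 proof -
  have f: "frame p (t + T) (\<i> + of_real \<theta>) = mat s ** frame p t (\<i> + of_real \<theta>)"
   by (simp add: frame_periodic[OF lp] p(2) M(1))
  have "mat s ** X ** conj_transpose (mat s ** X) = X ** conj_transpose X" for X :: cmat2
  proof -
   have "mat s ** X ** conj_transpose (mat s ** X) = mat (s * cnj s) ** (X ** conj_transpose X)"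
    by (simp add: cmat2_eq_iff mm_nth mat_mm algebra_simps)
   then show ?thesis unfolding s by simp
  qed
  then show ?thesis unfolding g f by simp
 qed
 show "hcurve A q \<in> closed_curves T"
  unfolding closed_curves_def using W22_loc_hcurve[OF Lq] hcurve_H3[OF Lq A] hyp_norm_hvel[OF Lq A] per
  by (auto simp: fun_cong[OF velocity_hcurve[OF l]])
qed

lemma complex_curvature_unique:
 assumes "complex_curvature \<gamma> q1" "complex_curvature \<gamma> q2"
 obtains c where "norm c = 1" "AE t in lebesgue. q2 t = c * q1 t"
proof -
 obtain A1 A2 where A: "A1 \<in> SL2C" "A2 \<in> SL2C" "hcurve A1 q1 = hcurve A2 q2" "L2_loc q1" "L2_loc q2"
  using assms unfolding complex_curvature_iff by auto
 obtain c where "norm c = 1" "AE t in lebesgue. q2 t = c\<^sup>2 * q1 t"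
  using hcurve_unique[OF L2_loc_imp_loc_int[OF A(4)] L2_loc_imp_loc_int[OF A(5)] _ _ A(3)] A(1,2)
  by (auto simp: SL2C_def)
 then show ?thesis by (intro that[of "c\<^sup>2"]) (auto simp: norm_power)
qed

lemma quasi_periodic_phase:
 assumes "AE t in lebesgue. q2 t = c * q1 t" "quasi_periodic T \<theta> q1"
 shows "quasi_periodic T \<theta> q2"
 using AE_shift[OF assms(1), of T] assms unfolding quasi_periodic_def
 by eventually_elim (simp add: ac_simps)

section \<open>The Sobolev distance of nearby curves\<close>

lemma second_derivative_hcurve:
 assumes "L2_loc q" shows "AE t in lebesgue. second_derivative (hcurve A q) t = hacc A q t"
proof -
 have l: "loc_int q" by (rule L2_loc_imp_loc_int[OF assms])
 have "\<exists>g. L2_loc g \<and> has_ac_derivative (velocity (hcurve A q)) g"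
  using L2_loc_hacc[OF assms] has_ac_hcurve(2)[OF l] by (auto simp: velocity_hcurve[OF l])
 from someI_ex[OF this] have "has_ac_derivative (hvel A q) (second_derivative (hcurve A q))"
  unfolding second_derivative_def by (simp add: velocity_hcurve[OF l])
 then show ?thesis by (rule has_ac_AE_unique[OF _ has_ac_hcurve(2)[OF l]])
qed

text \<open>The pointwise inequality |h| <= |h|^2 / d + d plays the role of the Cauchy-Schwarz
  inequality.\<close>

lemma L1_le_L2:
 fixes h :: "real \<Rightarrow> complex"
 assumes T: "T > 0" and h: "loc_int h" "(\<lambda>t. (norm (h t))\<^sup>2) integrable_on {0..T}" and d: "d > 0"
  and s: "integral {0..T} (\<lambda>t. (norm (h t))\<^sup>2) \<le> d\<^sup>2"
 shows "integral {0..T} (\<lambda>t. norm (h t)) \<le> (1 + T) * d"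
proof -
 have b: "norm x \<le> (norm x)\<^sup>2 / d + d" for x :: complex
 proof -
  have "2 * (norm x * d) \<le> (norm x)\<^sup>2 + d\<^sup>2" using sum_squares_bound[of "norm x" d] by simp
  then have "norm x * d \<le> (norm x)\<^sup>2 + d\<^sup>2" using d norm_ge_zero[of x] mult_nonneg_nonneg[of "norm x" d] by linarith
  then show ?thesis using d by (simp add: field_simps power2_eq_square)
 qed
 have "integral {0..T} (\<lambda>t. norm (h t)) \<le> integral {0..T} (\<lambda>t. (norm (h t))\<^sup>2 / d + d)"
  by (intro integral_le loc_int_norm_integrable[OF h(1)] b integrable_add integrable_on_divide h(2)) auto
 also have "\<dots> = integral {0..T} (\<lambda>t. (norm (h t))\<^sup>2) / d + T * d"
  using T by (subst Henstock_Kurzweil_Integration.integral_add) (auto intro!: integrable_on_divide h(2))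
 also have "\<dots> \<le> d\<^sup>2 / d + T * d" using s d by (intro add_mono divide_right_mono) auto
 also have "\<dots> = (1 + T) * d" using d by (simp add: power2_eq_square algebra_simps)
 finally show ?thesis .
qed

text \<open>Curve, velocity and second derivative have the common form frame, middle matrix, adjoint
  frame, with a middle matrix that is constant or affine in the potential. One estimate of such
  triple products treats all three, with the frames controlled in L1 by
  \<open>frame_stability\<close>.\<close>

lemma W22_small:
 assumes q: "L2_loc q" and T: "T > 0" and e: "e > 0"
 obtains d where "d > 0"
  "\<And>p. L2_loc p \<Longrightarrow> integral {0..T} (\<lambda>t. (norm (p t - q t))\<^sup>2) \<le> d\<^sup>2 \<Longrightarrow> W22_dist T (hcurve A p) (hcurve A q) < e"
proof -
 have l: "loc_int q" by (rule L2_loc_imp_loc_int[OF q])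
 obtain B where B: "B > 0"
  "\<And>p d t. loc_int p \<Longrightarrow> integral {0..T} (\<lambda>s. norm (p s - q s)) \<le> d \<Longrightarrow> B * d \<le> 1 \<Longrightarrow> 0 \<le> t \<Longrightarrow> t \<le> T \<Longrightarrow>
    norm (frame p t \<i> - frame q t \<i>) \<le> B * d"
  by (rule frame_stability[OF l less_imp_le[OF T], of \<i>]) (rule that, assumption, blast)
 obtain K where K: "K \<ge> 1" "\<And>(A :: cmat2) (B :: cmat2). norm (A ** B) \<le> K * norm A * norm B"
  using norm_mm_bound by blast
 obtain Kc where Kc: "Kc \<ge> 1" "\<And>X :: cmat2. norm (conj_transpose X) \<le> Kc * norm X"
 proof -
  obtain k where k: "k > 0" "\<And>X. norm (conj_transpose X) \<le> norm X * k" using bounded_linear.pos_bounded[OF bounded_linear_ct] by blast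
  have "norm (conj_transpose X) \<le> max k 1 * norm X" for X :: cmat2
   by (rule order_trans[OF k(2)], subst mult.commute, intro mult_right_mono) auto
  then show ?thesis by (intro that[of "max k 1"]) auto
 qed
 have cF: "continuous_on UNIV (\<lambda>t. A ** frame q t \<i>)" by (intro continuous_on_mm continuous_on_frame l continuous_on_const)
 obtain c where c: "c > 0" "\<And>t. t \<in> {0..T} \<Longrightarrow> norm (A ** frame q t \<i>) \<le> c" using continuous_bounded_Icc[OF cF] by blast
 define D where "D = K * norm A * B * (1 + T)"
 have D0: "D \<ge> 0" using K B T by (simp add: D_def)
 define L where "L = 4 * K * K * Kc * (c + 1) * (c + 1) + 1"
 have L0: "L \<ge> 1" using K Kc c by (simp add: L_def)
 define Iq where "Iq = integral {0..T} (\<lambda>t. 1 + (norm (q t))\<^sup>2)"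
 have iq: "(\<lambda>t. (norm (q t))\<^sup>2) integrable_on {0..T}" using q by (simp add: L2_loc_def absolutely_integrable_on_def)
 have Iq0: "Iq \<ge> 0" unfolding Iq_def by (rule integral_nonneg) (auto intro!: integrable_add iq)
 define G where "G = 6 * L\<^sup>2 * (2 * D\<^sup>2 * Iq + 4) + 1"
 have G0: "G \<ge> 1" using Iq0 by (simp add: G_def)
 \<comment> \<open>In this order: the stability estimate applies to the L1 bound (1 + T) d, the
   frame error \<open>D * d\<close> is at most 1, and the final bound \<open>G * d\<close> is at
   most e / 2.\<close>
 define d where "d = Min {1 / (B * (1 + T) + 1), 1 / (D + 1), e / (2 * G)}"
 have BT: "B * (1 + T) > 0" using B T by simp
 have d: "d > 0" "d \<le> 1 / (B * (1 + T) + 1)" "d \<le> 1 / (D + 1)" "d \<le> e / (2 * G)"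
  using BT D0 e G0 by (auto simp: d_def)
 have d1: "B * ((1 + T) * d) \<le> 1" "D * d \<le> 1" "2 * G * d \<le> e"
 proof -
  have "d * (B * (1 + T) + 1) \<le> 1" using d(2) BT by (simp add: pos_le_divide_eq)
  then have "B * ((1 + T) * d) + d \<le> 1" by (simp add: algebra_simps)
  then show "B * ((1 + T) * d) \<le> 1" using d(1) by linarith
  have "d * (D + 1) \<le> 1" using d(3) D0 by (simp add: pos_le_divide_eq)
  then have "D * d + d \<le> 1" by (simp add: algebra_simps)
  then show "D * d \<le> 1" using d(1) by linarith
  show "2 * G * d \<le> e" using d(4) G0 by (simp add: pos_le_divide_eq mult.commute)
 qed
 show ?thesis
 proof (rule that[OF d(1)])
  fix p assume p: "L2_loc p" and pq: "integral {0..T} (\<lambda>t. (norm (p t - q t))\<^sup>2) \<le> d\<^sup>2"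
  have lp: "loc_int p" by (rule L2_loc_imp_loc_int[OF p])
  have lpq: "loc_int (\<lambda>t. p t - q t)" by (intro loc_int_diff lp l)
  have ipq: "(\<lambda>t. (norm (p t - q t))\<^sup>2) integrable_on {0..T}"
  proof -
   have ip: "(\<lambda>t. (norm (p t))\<^sup>2) integrable_on {0..T}" using p by (simp add: L2_loc_def absolutely_integrable_on_def)
   show ?thesis
   proof (rule measurable_bounded_by_integrable_imp_integrable)
    show "(\<lambda>t. (norm (p t - q t))\<^sup>2) \<in> borel_measurable (lebesgue_on {0..T})"
     by (intro measurable_restrict_space1 borel_measurable_power loc_int_measurable[OF loc_int_norm[OF lpq]])
    show "(\<lambda>t. 2 * (norm (p t))\<^sup>2 + 2 * (norm (q t))\<^sup>2) integrable_on {0..T}"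
     by (intro integrable_add integrable_on_mult_right ip iq)
    show "norm ((norm (p t - q t))\<^sup>2) \<le> 2 * (norm (p t))\<^sup>2 + 2 * (norm (q t))\<^sup>2" for t
    proof -
     have "(norm (p t - q t))\<^sup>2 \<le> (norm (p t) + norm (q t))\<^sup>2" by (intro power_mono norm_triangle_ineq4) simp
     then show ?thesis using sum_squares_bound[of "norm (p t)" "norm (q t)"] by (simp add: power2_sum)
    qed
   qed simp
  qed
  have L1: "integral {0..T} (\<lambda>t. norm (p t - q t)) \<le> (1 + T) * d" by (rule L1_le_L2[OF T lpq ipq d(1) pq])
  define \<epsilon> where "\<epsilon> = D * d"
  have \<epsilon>: "0 \<le> \<epsilon>" "\<epsilon> \<le> 1" using D0 d d1 by (simp_all add: \<epsilon>_def)
  define P where "P t = A ** frame p t \<i>" for t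
  define R where "R t = A ** frame q t \<i>" for t
  have PR: "norm (P t - R t) \<le> \<epsilon>" if "t \<in> {0..T}" for t
  proof -
   have "norm (frame p t \<i> - frame q t \<i>) \<le> B * ((1 + T) * d)"
    using B(2)[OF lp L1 d1(1)] that by auto
   then have "K * norm A * norm (frame p t \<i> - frame q t \<i>) \<le> K * norm A * (B * ((1 + T) * d))"
    using K(1) by (intro mult_left_mono) auto
   then have "norm (A ** (frame p t \<i> - frame q t \<i>)) \<le> K * norm A * (B * ((1 + T) * d))"
    using K(2) order_trans by blast
   then show ?thesis by (simp add: P_def R_def mm.diff_right \<epsilon>_def D_def ac_simps)
  qed
  have Rb: "norm (R t) \<le> c + 1" "norm (P t) \<le> c + 1" if "t \<in> {0..T}" for t
   using c(2)[OF that] PR[OF that] \<epsilon> norm_triangle_sub[of "P t" "R t"] by (auto simp: R_def)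
  define b where "b t = L * (\<epsilon> * (1 + norm (q t)) + 2 * norm (p t - q t))" for t
  have tri: "norm (P t ** X ** conj_transpose (P t) - R t ** Y ** conj_transpose (R t)) \<le> b t"
   if t: "t \<in> {0..T}" and X: "norm X \<le> 2 * (1 + norm (p t))" and XY: "norm (X - Y) \<le> 2 * norm (p t - q t)" for t X Y
  proof -
   define k where "k = K * K * Kc * (c + 1)"
   have k0: "k \<ge> 0" using K Kc c by (simp add: k_def)
   have t3: "norm (U ** V ** conj_transpose W) \<le> K * K * Kc * (norm U * norm V * norm W)" for U V W :: cmat2
   proof -
    have "norm (U ** V ** conj_transpose W) \<le> K * norm (U ** V) * norm (conj_transpose W)" by (rule K(2))
    also have "\<dots> \<le> K * (K * norm U * norm V) * (Kc * norm W)"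
     using K Kc by (intro mult_mono) auto
    finally show ?thesis by (simp add: ac_simps)
   qed
   have Xb: "norm X \<le> 2 * (1 + norm (q t) + norm (p t - q t))"
    using norm_triangle_sub[of "p t" "q t"] by (intro order_trans[OF X]) simp
   \<comment> \<open>The three factors are exchanged one at a time; the frame differences meet
     \<open>X\<close>, which grows with the potential and is therefore only square
     integrable.\<close>
   have eq: "P t ** X ** conj_transpose (P t) - R t ** Y ** conj_transpose (R t) =
     (P t - R t) ** X ** conj_transpose (P t) + R t ** X ** conj_transpose (P t - R t) + R t ** (X - Y) ** conj_transpose (R t)"
    by (simp add: mm.diff_left mm.diff_right linear_diff[OF bounded_linear.linear[OF bounded_linear_ct]])
   have A1: "norm ((P t - R t) ** X ** conj_transpose (P t)) \<le> k * (\<epsilon> * norm X)"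
   proof -
    have "norm (P t - R t) * norm X * norm (P t) \<le> \<epsilon> * norm X * (c + 1)"
     using PR[OF t] Rb[OF t] \<epsilon> by (intro mult_mono) auto
    then have "K * K * Kc * (norm (P t - R t) * norm X * norm (P t)) \<le> K * K * Kc * (\<epsilon> * norm X * (c + 1))"
     using K Kc by (intro mult_left_mono) auto
    then show ?thesis using t3[of "P t - R t" X "P t"] by (simp add: k_def ac_simps)
   qed
   have A2: "norm (R t ** X ** conj_transpose (P t - R t)) \<le> k * (\<epsilon> * norm X)"
   proof -
    have "norm (R t) * norm X * norm (P t - R t) \<le> (c + 1) * norm X * \<epsilon>"
     using PR[OF t] Rb[OF t] \<epsilon> c by (intro mult_mono) auto
    then have "K * K * Kc * (norm (R t) * norm X * norm (P t - R t)) \<le> K * K * Kc * ((c + 1) * norm X * \<epsilon>)"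
     using K Kc by (intro mult_left_mono) auto
    then show ?thesis using t3[of "R t" X "P t - R t"] by (simp add: k_def ac_simps)
   qed
   have A3: "norm (R t ** (X - Y) ** conj_transpose (R t)) \<le> k * (c + 1) * (2 * norm (p t - q t))"
   proof -
    have "norm (R t) * norm (X - Y) * norm (R t) \<le> (c + 1) * (2 * norm (p t - q t)) * (c + 1)"
     using XY Rb[OF t] c by (intro mult_mono) auto
    then have "K * K * Kc * (norm (R t) * norm (X - Y) * norm (R t)) \<le> K * K * Kc * ((c + 1) * (2 * norm (p t - q t)) * (c + 1))"
     using K Kc by (intro mult_left_mono) auto
    then show ?thesis using t3[of "R t" "X - Y" "R t"] by (simp add: k_def ac_simps)
   qed
   have "\<epsilon> * norm X \<le> 2 * (\<epsilon> * (1 + norm (q t))) + 2 * norm (p t - q t)"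
   proof -
    have "\<epsilon> * norm X \<le> \<epsilon> * (2 * (1 + norm (q t) + norm (p t - q t)))" by (intro mult_left_mono Xb \<epsilon>)
    moreover have "\<epsilon> * norm (p t - q t) \<le> 1 * norm (p t - q t)" by (intro mult_right_mono \<epsilon>) simp
    ultimately show ?thesis by (simp add: algebra_simps)
   qed
   then have A4: "k * (\<epsilon> * norm X) \<le> k * (2 * (\<epsilon> * (1 + norm (q t))) + 2 * norm (p t - q t))" by (rule mult_left_mono[OF _ k0])
   have "norm (P t ** X ** conj_transpose (P t) - R t ** Y ** conj_transpose (R t)) \<le>
     k * (\<epsilon> * norm X) + k * (\<epsilon> * norm X) + k * (c + 1) * (2 * norm (p t - q t))"
    unfolding eq using A1 A2 A3 by (intro order_trans[OF norm_triangle_ineq] add_mono)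
   also have "\<dots> \<le> 4 * k * (\<epsilon> * (1 + norm (q t))) + 4 * k * norm (p t - q t) + 2 * (k * (c + 1)) * norm (p t - q t)"
    using A4 by (simp add: algebra_simps)
   also have "\<dots> \<le> L * (\<epsilon> * (1 + norm (q t))) + L * norm (p t - q t) + L * norm (p t - q t)"
   proof (intro add_mono mult_right_mono)
    have kc: "k \<le> k * (c + 1)" using k0 c by (simp add: mult_le_cancel_left1)
    have L4: "L = 4 * (k * (c + 1)) + 1" by (simp add: L_def k_def)
    show "4 * k \<le> L" "4 * k \<le> L" "2 * (k * (c + 1)) \<le> L" using kc k0 c unfolding L4 by linarith+
   qed (use \<epsilon> in auto)
   also have "\<dots> = b t" by (simp add: b_def algebra_simps)
   finally show ?thesis .
  qed
  have b1: "norm (hcurve A p t - hcurve A q t) \<le> b t" "norm (hvel A p t - hvel A q t) \<le> b t" "norm (hacc A p t - hacc A q t) \<le> b t"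
   if t: "t \<in> {0..T}" for t
  proof -
   have n2: "norm (mat 1 :: cmat2) \<le> 2" by (rule order_trans[OF norm_le_entries]) simp
   have n3: "norm (dgn (-1)) \<le> 2" by (rule order_trans[OF norm_le_entries]) simp
   have n4: "norm (mk2 1 (p t) (cnj (p t)) 1) \<le> 2 * (1 + norm (p t))" by (rule order_trans[OF norm_le_entries]) simp
   have n5: "norm (mk2 1 (p t) (cnj (p t)) 1 - mk2 1 (q t) (cnj (q t)) 1) \<le> 2 * norm (p t - q t)"
   proof (rule order_trans[OF norm_le_entries])
    have "norm (cnj (p t) - cnj (q t)) = norm (p t - q t)" by (simp only: complex_cnj_diff[symmetric] complex_mod_cnj)
    then show "norm ((mk2 1 (p t) (cnj (p t)) 1 - mk2 1 (q t) (cnj (q t)) 1) $ 1 $ 1) + norm ((mk2 1 (p t) (cnj (p t)) 1 - mk2 1 (q t) (cnj (q t)) 1) $ 1 $ 2)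
     + norm ((mk2 1 (p t) (cnj (p t)) 1 - mk2 1 (q t) (cnj (q t)) 1) $ 2 $ 1) + norm ((mk2 1 (p t) (cnj (p t)) 1 - mk2 1 (q t) (cnj (q t)) 1) $ 2 $ 2) \<le> 2 * norm (p t - q t)" by simp
   qed
   have pn: "2 \<le> 2 * (1 + norm (p t))" by simp
   have "norm (P t ** mat 1 ** conj_transpose (P t) - R t ** mat 1 ** conj_transpose (R t)) \<le> b t"
    by (rule tri[OF t order_trans[OF n2 pn]]) simp
   then show "norm (hcurve A p t - hcurve A q t) \<le> b t" by (simp add: hcurve_def P_def R_def)
   have "norm (P t ** dgn (-1) ** conj_transpose (P t) - R t ** dgn (-1) ** conj_transpose (R t)) \<le> b t"
    by (rule tri[OF t order_trans[OF n3 pn]]) simp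
   then show "norm (hvel A p t - hvel A q t) \<le> b t" by (simp add: hvel_def P_def R_def)
   have "norm (P t ** mk2 1 (p t) (cnj (p t)) 1 ** conj_transpose (P t) - R t ** mk2 1 (q t) (cnj (q t)) 1 ** conj_transpose (R t)) \<le> b t"
    by (rule tri[OF t n4 n5])
   then show "norm (hacc A p t - hacc A q t) \<le> b t" by (simp add: hacc_def P_def R_def)
  qed
  define f where "f t = 6 * L\<^sup>2 * (2 * \<epsilon>\<^sup>2 * (1 + (norm (q t))\<^sup>2) + 4 * (norm (p t - q t))\<^sup>2)" for t
  have b2: "3 * (b t)\<^sup>2 \<le> f t" for t
  proof -
   have s2: "(x + y)\<^sup>2 \<le> 2 * x\<^sup>2 + 2 * y\<^sup>2" for x y :: real using sum_squares_bound[of x y] by (simp add: power2_sum)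
   have "(\<epsilon> * (1 + norm (q t)) + 2 * norm (p t - q t))\<^sup>2 \<le> 2 * (\<epsilon> * (1 + norm (q t)))\<^sup>2 + 2 * (2 * norm (p t - q t))\<^sup>2" by (rule s2)
   also have "(\<epsilon> * (1 + norm (q t)))\<^sup>2 \<le> \<epsilon>\<^sup>2 * (2 * 1\<^sup>2 + 2 * (norm (q t))\<^sup>2)"
    unfolding power_mult_distrib by (intro mult_left_mono s2) simp
   finally have "(\<epsilon> * (1 + norm (q t)) + 2 * norm (p t - q t))\<^sup>2 \<le> 2 * (2 * \<epsilon>\<^sup>2 * (1 + (norm (q t))\<^sup>2) + 4 * (norm (p t - q t))\<^sup>2)"
    by (simp add: power_mult_distrib algebra_simps)
   then have "3 * L\<^sup>2 * (\<epsilon> * (1 + norm (q t)) + 2 * norm (p t - q t))\<^sup>2 \<le> 3 * L\<^sup>2 * (2 * (2 * \<epsilon>\<^sup>2 * (1 + (norm (q t))\<^sup>2) + 4 * (norm (p t - q t))\<^sup>2))"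
    by (rule mult_left_mono) simp
   moreover have "(b t)\<^sup>2 = L\<^sup>2 * (\<epsilon> * (1 + norm (q t)) + 2 * norm (p t - q t))\<^sup>2" by (simp add: b_def power_mult_distrib)
   ultimately show ?thesis by (simp add: f_def algebra_simps)
  qed
  have fi: "f integrable_on {0..T}" unfolding f_def
   by (intro integrable_on_mult_right integrable_add ipq iq) auto
  have If: "integral {0..T} f \<le> (G * d)\<^sup>2"
  proof -
   have "integral {0..T} f = 6 * L\<^sup>2 * (2 * \<epsilon>\<^sup>2 * Iq + 4 * integral {0..T} (\<lambda>t. (norm (p t - q t))\<^sup>2))"
    unfolding f_def Iq_def
    by (simp only: Henstock_Kurzweil_Integration.integral_mult_right)
     (subst Henstock_Kurzweil_Integration.integral_add, auto intro!: integrable_on_mult_right integrable_add ipq iq)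
   also have "\<dots> \<le> 6 * L\<^sup>2 * (2 * \<epsilon>\<^sup>2 * Iq + 4 * d\<^sup>2)" using pq by (intro mult_left_mono add_left_mono) auto
   also have "\<dots> = (6 * L\<^sup>2 * (2 * D\<^sup>2 * Iq + 4)) * d\<^sup>2" by (simp add: \<epsilon>_def power_mult_distrib algebra_simps)
   also have "\<dots> \<le> G * d\<^sup>2" by (intro mult_right_mono) (auto simp: G_def)
   also have "\<dots> \<le> G * G * d\<^sup>2" using G0 by (intro mult_right_mono) (auto simp: mult_le_cancel_left1)
   finally show ?thesis by (simp add: power2_eq_square ac_simps)
  qed
  define W where "W t = (norm (hcurve A p t - hcurve A q t))\<^sup>2 + (norm (hvel A p t - hvel A q t))\<^sup>2 + (norm (hacc A p t - hacc A q t))\<^sup>2" for t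
  have Wf: "W t \<le> f t" if "t \<in> {0..T}" for t
   using power_mono[OF b1(1)[OF that], of 2] power_mono[OF b1(2)[OF that], of 2] power_mono[OF b1(3)[OF that], of 2] b2[of t]
   by (simp add: W_def)
  have "AE t in lebesgue. (norm (hcurve A p t - hcurve A q t))\<^sup>2 + (norm (velocity (hcurve A p) t - velocity (hcurve A q) t))\<^sup>2
   + (norm (second_derivative (hcurve A p) t - second_derivative (hcurve A q) t))\<^sup>2 = W t"
   using second_derivative_hcurve[OF p, of A] second_derivative_hcurve[OF q, of A]
   by eventually_elim (simp add: W_def fun_cong[OF velocity_hcurve[OF lp]] fun_cong[OF velocity_hcurve[OF l]])
  then obtain N where N: "negligible N" "\<And>t. t \<notin> N \<Longrightarrow> (norm (hcurve A p t - hcurve A q t))\<^sup>2 + (norm (velocity (hcurve A p) t - velocity (hcurve A q) t))\<^sup>2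
   + (norm (second_derivative (hcurve A p) t - second_derivative (hcurve A q) t))\<^sup>2 = W t" using AE_imp_negligible by blast
  have "W22_dist T (hcurve A p) (hcurve A q) = sqrt (integral {0..T} W)"
   unfolding W22_dist_def by (intro arg_cong[where f = sqrt] integral_spike[OF N(1)]) (use N(2) in auto)
  also have "integral {0..T} W \<le> (G * d)\<^sup>2"
  proof (cases "W integrable_on {0..T}")
   case True
   have "integral {0..T} W \<le> integral {0..T} f" by (rule integral_le[OF True fi Wf])
   then show ?thesis using If by linarith
  next
   \<comment> \<open>The integral of a function that is not integrable is 0 by convention, so the
     bound holds in this case as well.\<close>
   case False
   then show ?thesis by (simp add: not_integrable_integral)
  qed
  finally have "W22_dist T (hcurve A p) (hcurve A q) \<le> sqrt ((G * d)\<^sup>2)" by simp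
  also have "\<dots> = G * d" using G0 d(1) by simp
  also have "\<dots> < e" using d1(3) e G0 d(1) mult_pos_pos[of G d] by linarith
  finally show "W22_dist T (hcurve A p) (hcurve A q) < e" .
 qed
qed

section \<open>Approximation by trigonometric polynomials\<close>

text \<open>Trigonometric polynomials. The inductive form lets closure under products and the
  passage to coefficient sequences run by rule induction.\<close>

inductive trig :: "real \<Rightarrow> (real \<Rightarrow> complex) \<Rightarrow> bool" for \<omega> where
 mode: "trig \<omega> (\<lambda>t. c * ex \<omega> n t)"
| add: "trig \<omega> f \<Longrightarrow> trig \<omega> g \<Longrightarrow> trig \<omega> (\<lambda>t. f t + g t)"

lemma trig_const: "trig \<omega> (\<lambda>t. c)"
 using trig.mode[of \<omega> c 0] by simp

lemma trig_mult_mode: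
 assumes "trig \<omega> g" shows "trig \<omega> (\<lambda>t. c * ex \<omega> n t * g t)"
 using assms
proof induction
 case (mode d m)
 have e: "c * ex \<omega> n t * (d * ex \<omega> m t) = (c * d) * ex \<omega> (n + m) t" for t
  unfolding ex_add[symmetric] by (simp only: ac_simps)
 show ?case unfolding e by (rule trig.mode)
qed (simp add: distrib_left trig.add)

lemma trig_mult:
 assumes "trig \<omega> f" "trig \<omega> g" shows "trig \<omega> (\<lambda>t. f t * g t)"
 using assms(1) by induction (simp_all add: trig_mult_mode[OF assms(2)] distrib_right trig.add)

lemma trig_scale: "trig \<omega> f \<Longrightarrow> trig \<omega> (\<lambda>t. c * f t)"
 using trig_mult[OF trig_const] .

lemma trig_coeffs:
 assumes "trig \<omega> f"
 shows "\<exists>a A N. bnd 3 A a \<and> (\<forall>n. \<bar>n\<bar> \<ge> N \<longrightarrow> a n = 0) \<and> f = fsr \<omega> a"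
 using assms
proof induction
 case (mode c n)
 have "wt 3 n \<noteq> 0" using wt_pos[of 3 n] by linarith
 then have "bnd 3 (norm c / wt 3 n) (\<lambda>k. if k = n then c else 0)" by (simp add: bnd_def)
 moreover have "(\<lambda>t. c * ex \<omega> n t) = fsr \<omega> (\<lambda>k. if k = n then c else 0)"
  by (rule ext) (subst fsr_finite[of "{n}"], auto)
 ultimately show ?case by (intro exI[of _ "\<lambda>k. if k = n then c else 0"] exI[of _ "norm c / wt 3 n"] exI[of _ "\<bar>n\<bar> + 1"]) auto
next
 case (add f g)
 then obtain a A N b B M where a: "bnd 3 A a" "\<forall>n. \<bar>n\<bar> \<ge> N \<longrightarrow> a n = 0" "f = fsr \<omega> a"
  and b: "bnd 3 B b" "\<forall>n. \<bar>n\<bar> \<ge> M \<longrightarrow> b n = 0" "g = fsr \<omega> b" by blast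
 have "(\<lambda>t. f t + g t) = fsr \<omega> (\<lambda>n. a n + b n)"
  unfolding a(3) b(3) by (rule ext) (rule fsr_add[OF bnd_32[OF a(1)] bnd_32[OF b(1)], symmetric])
 then show ?case using bnd_add[OF a(1) b(1)] a(2) b(2)
  by (intro exI[of _ "\<lambda>n. a n + b n"] exI[of _ "A + B"] exI[of _ "max N M"]) auto
qed

lemma trig_continuous: "trig \<omega> f \<Longrightarrow> continuous_on UNIV f"
 by (induction rule: trig.induct) (intro continuous_intros continuous_on_ex; assumption)+

text \<open>On the unit circle a real-linear form is a combination of w and cnj w, which are the
  modes 1 and -1; sums and products follow by induction.\<close>

lemma trig_polynomial:
 assumes "real_polynomial_function f"
 shows "trig \<omega> (\<lambda>t. of_real (f (ex \<omega> 1 t)))"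
 using assms
proof (induction rule: real_polynomial_function.induct)
 case (linear f)
 have "of_real (f (ex \<omega> 1 t)) = (of_real (f 1) - \<i> * of_real (f \<i>)) / 2 * ex \<omega> 1 t
   + (of_real (f 1) + \<i> * of_real (f \<i>)) / 2 * ex \<omega> (-1) t" for t
 proof -
  define w where "w = ex \<omega> 1 t"
  have "w = Re w *\<^sub>R 1 + Im w *\<^sub>R \<i>" by (simp add: complex_eq_iff)
  then have "f w = f (Re w *\<^sub>R 1 + Im w *\<^sub>R \<i>)" by (rule arg_cong)
  also have "\<dots> = Re w * f 1 + Im w * f \<i>"
   using linear_add[OF bounded_linear.linear[OF linear]] linear_cmul[OF bounded_linear.linear[OF linear]] by simp
  finally have "of_real (f w) = (of_real (f 1) - \<i> * of_real (f \<i>)) / 2 * w + (of_real (f 1) + \<i> * of_real (f \<i>)) / 2 * cnj w"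
   by (simp add: complex_eq_iff field_simps)
  then show ?thesis by (simp add: w_def ex_cnj)
 qed
 then show ?case by (simp only:) (intro trig.add trig.mode)
next
 case (const c) then show ?case by (rule trig_const)
next
 case (add f g) then show ?case by (simp add: trig.add)
next
 case (mult f g) then show ?case by (simp add: trig_mult)
qed

text \<open>The function is transported to the unit circle by the angle, where the polynomial
  Stone-Weierstrass theorem applies.\<close>

lemma trig_dense_uniform:
 assumes T: "T > 0" and g: "continuous_on {0..T} g" "g 0 = g T" and e: "e > 0"
 obtains f where "trig (2 * pi / T) f" "\<And>t. t \<in> {0..T} \<Longrightarrow> norm (f t - g t) < e"
proof -
 define \<omega> where "\<omega> = 2 * pi / T"
 have \<omega>: "\<omega> > 0" using T by (simp add: \<omega>_def)
 define h where "h w = g (Arg2pi w / \<omega>)" for w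
 have he: "h (ex \<omega> 1 t) = g t" if t: "t \<in> {0..T}" for t
 proof (cases "t = T")
  case True
  have "ex \<omega> 1 T = ex \<omega> 1 0" using ex_periodic[OF T, of 1 0] by (simp add: \<omega>_def)
  then have "ex \<omega> 1 T = 1" by (simp add: ex_def)
  then show ?thesis using True g(2) by (simp add: h_def Arg2pi_of_real[of 1, simplified])
 next
  case False
  then have "\<omega> * t < \<omega> * T" using t \<omega> by simp
  then have "\<omega> * t < 2 * pi" using T by (simp add: \<omega>_def)
  then have "Arg2pi (ex \<omega> 1 t) = \<omega> * t"
   using t \<omega> by (intro Arg2pi_unique[of 1]) (auto simp: ex_def mult.assoc)
  then show ?thesis using \<omega> by (simp add: h_def)
 qed
 have im: "\<exists>t\<in>{0..T}. ex \<omega> 1 t = w" if "norm w = 1" for w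
 proof
  have "w = exp (\<i> * of_real (Arg2pi w))" using Arg2pi_eq[of w] that by simp
  then show "ex \<omega> 1 (Arg2pi w / \<omega>) = w" using \<omega> by (simp add: ex_def)
  have "Arg2pi w \<le> \<omega> * T" using Arg2pi_lt_2pi[of w] T by (simp add: \<omega>_def)
  then show "Arg2pi w / \<omega> \<in> {0..T}" using Arg2pi_ge_0[of w] \<omega> by (simp add: pos_divide_le_eq mult.commute)
 qed
 \<comment> \<open>The angle jumps at w = 1. Instead of treating the seam, closed preimages are
   recognised as images of compact subsets of [0, T]; the equality of the end values enters through
   \<open>he\<close>.\<close>
 have ch: "continuous_on (sphere 0 1) h"
 proof (subst continuous_on_closed_vimage[OF closed_sphere], intro allI impI)
  fix B :: "complex set" assume B: "closed B"
  have "h -` B \<inter> sphere 0 1 = ex \<omega> 1 ` ({0..T} \<inter> g -` B)"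
  proof (intro set_eqI iffI)
   fix w assume w: "w \<in> h -` B \<inter> sphere 0 1"
   then have "norm w = 1" by simp
   from im[OF this] obtain t where t: "t \<in> {0..T}" "ex \<omega> 1 t = w" by blast
   then have "g t \<in> B" using he[OF t(1)] w by simp
   then show "w \<in> ex \<omega> 1 ` ({0..T} \<inter> g -` B)" using t by blast
  qed (use he in auto)
  moreover have "compact ({0..T} \<inter> g -` B)"
   using continuous_closed_preimage[OF g(1) closed_atLeastAtMost B]
   by (auto simp: compact_eq_bounded_closed intro: bounded_subset[OF bounded_closed_interval])
  then have "compact (ex \<omega> 1 ` ({0..T} \<inter> g -` B))"
   by (intro compact_continuous_image continuous_on_subset[OF continuous_on_ex]) auto
  ultimately show "closed (h -` B \<inter> sphere 0 1)" by (simp add: compact_imp_closed)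
 qed
 obtain p where p: "polynomial_function p" "\<And>w. w \<in> sphere 0 1 \<Longrightarrow> norm (h w - p w) < e"
  using Stone_Weierstrass_polynomial_function[OF compact_sphere ch e] by blast
 have rp: "real_polynomial_function (Re \<circ> p)" "real_polynomial_function (Im \<circ> p)"
  using p(1) bounded_linear_Re bounded_linear_Im unfolding polynomial_function_def by blast+
 have "trig \<omega> (\<lambda>t. of_real ((Re \<circ> p) (ex \<omega> 1 t)) + \<i> * of_real ((Im \<circ> p) (ex \<omega> 1 t)))"
  by (intro trig.add trig_scale trig_polynomial rp)
 also have "(\<lambda>t. of_real ((Re \<circ> p) (ex \<omega> 1 t)) + \<i> * of_real ((Im \<circ> p) (ex \<omega> 1 t))) = (\<lambda>t. p (ex \<omega> 1 t))"
  by (simp add: complex_eq[symmetric])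
 finally show ?thesis
 proof (rule that[unfolded \<omega>_def[symmetric]])
  show "norm (p (ex \<omega> 1 t) - g t) < e" if "t \<in> {0..T}" for t
   using p(2)[of "ex \<omega> 1 t"] he[OF that] by (simp add: norm_minus_commute)
 qed
qed

lemma L2_diff_integrable:
 assumes "L2_loc p" "f \<in> borel_measurable lebesgue" "\<And>t. norm (f t) \<le> B"
 shows "(\<lambda>t. (norm (f t - p t))\<^sup>2) integrable_on {0..T}"
proof (rule measurable_bounded_by_integrable_imp_integrable)
 have pm: "p \<in> borel_measurable lebesgue" using assms(1) by (simp add: L2_loc_def)
 show "(\<lambda>t. (norm (f t - p t))\<^sup>2) \<in> borel_measurable (lebesgue_on {0..T})"
  by (intro measurable_restrict_space1) (use assms(2) pm in measurable)
 show "(\<lambda>t. 2 * B\<^sup>2 + 2 * (norm (p t))\<^sup>2) integrable_on {0..T}"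
  using assms(1) by (intro integrable_add integrable_on_mult_right) (auto simp: L2_loc_def absolutely_integrable_on_def)
 show "norm ((norm (f t - p t))\<^sup>2) \<le> 2 * B\<^sup>2 + 2 * (norm (p t))\<^sup>2" for t
 proof -
  have "norm (f t - p t) \<le> B + norm (p t)" using assms(3)[of t] norm_triangle_ineq4[of "f t" "p t"] by linarith
  then have "(norm (f t - p t))\<^sup>2 \<le> (B + norm (p t))\<^sup>2" by (intro power_mono) auto
  then show ?thesis using sum_squares_bound[of B "norm (p t)"] by (simp add: power2_sum)
 qed
qed simp

text \<open>Four steps with three errors: truncation in value, approximation by continuous functions
  cut off at the endpoints, and uniform approximation of the result by trigonometric
  polynomials.\<close>

lemma L2_trig_dense:
 assumes T: "T > 0" and p: "L2_loc p" and e: "e > 0"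
 obtains f where "trig (2 * pi / T) f" "integral {0..T} (\<lambda>t. (norm (f t - p t))\<^sup>2) \<le> e"
proof -
 have pm: "p \<in> borel_measurable lebesgue" using p by (simp add: L2_loc_def)
 have pi: "(\<lambda>t. (norm (p t))\<^sup>2) integrable_on {0..T}" using p by (simp add: L2_loc_def absolutely_integrable_on_def)
 define u where "u m t = (if norm (p t) \<le> real m then p t else 0)" for m t
 have um: "u m \<in> borel_measurable lebesgue" for m unfolding u_def[abs_def] using pm by measurable
 have ub: "norm (u m t) \<le> real m" for m t by (simp add: u_def)
 have ui: "(\<lambda>t. (norm (u m t - p t))\<^sup>2) integrable_on {0..T}" for m by (rule L2_diff_integrable[OF p um ub])
 have "(\<lambda>m. integral {0..T} (\<lambda>t. (norm (u m t - p t))\<^sup>2)) \<longlonglongrightarrow> integral {0..T} (\<lambda>t. 0)"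
 proof (rule dominated_convergence(2)[OF ui pi])
  show "norm ((norm (u m t - p t))\<^sup>2) \<le> (norm (p t))\<^sup>2" for m t by (simp add: u_def)
  fix t
  have "\<forall>\<^sub>F m in sequentially. (norm (u m t - p t))\<^sup>2 = 0"
   using eventually_ge_at_top[of "nat \<lceil>norm (p t)\<rceil>"] by eventually_elim (auto simp: u_def)
  then show "(\<lambda>m. (norm (u m t - p t))\<^sup>2) \<longlonglongrightarrow> 0" by (rule tendsto_eventually)
 qed
 from order_tendstoD(2)[OF this, of "e / 9"] e
 obtain m where m: "integral {0..T} (\<lambda>t. (norm (u m t - p t))\<^sup>2) < e / 9" by (auto dest: eventually_happens)
 obtain g N where N: "negligible N" and g: "\<And>n. continuous_on UNIV (g n)" "\<And>n t. norm (g n t) \<le> real m"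
  and lim: "\<And>t. t \<notin> N \<Longrightarrow> (\<lambda>n::nat. g n t) \<longlonglongrightarrow> u m t"
  by (rule bounded_continuous_approx[OF um ub]) (rule that)
 \<comment> \<open>The cut-off vanishes at 0 and T, which makes the end values agree, and equals 1
   at any interior point for large n.\<close>
 define v where "v n t = of_real (max 0 (min 1 (real n * (t * (T - t))))) * g n t" for n t
 have vc: "continuous_on UNIV (v n)" for n unfolding v_def by (intro continuous_intros g)
 have vb: "norm (v n t) \<le> real m" for n t
 proof -
  have "\<bar>max 0 (min 1 (real n * (t * (T - t))))\<bar> * norm (g n t) \<le> 1 * real m" by (intro mult_mono g) auto
  then show ?thesis by (simp add: v_def norm_mult)
 qed
 have uL: "L2_loc (u m)"
  unfolding L2_loc_def
 proof (intro conjI allI um measurable_bounded_by_integrable_imp_absolutely_integrable)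
  show "(\<lambda>t. (norm (u m t))\<^sup>2) \<in> borel_measurable (lebesgue_on {a..b})" for a b
   by (intro measurable_restrict_space1) (use um in measurable)
  show "norm ((norm (u m t))\<^sup>2) \<le> (real m)\<^sup>2" for t using power_mono[OF ub, of m t 2] by simp
 qed auto
 have vm: "v n \<in> borel_measurable lebesgue" for n by (rule loc_int_measurable[OF loc_int_continuous[OF vc]])
 have vi: "(\<lambda>t. (norm (v n t - u m t))\<^sup>2) integrable_on {0..T}" for n by (rule L2_diff_integrable[OF uL vm vb])
 define N' where "N' = N \<union> {0, T}"
 have N': "negligible N'" using N by (simp add: N'_def)
 define F where "F n t = (if t \<in> N' then 0 else (norm (v n t - u m t))\<^sup>2)" for n t
 have Fi: "F n integrable_on {0..T}" for n
  by (rule integrable_spike[OF vi N']) (simp add: F_def)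
 have "(\<lambda>n. integral {0..T} (F n)) \<longlonglongrightarrow> integral {0..T} (\<lambda>t. 0)"
 proof (rule dominated_convergence(2)[OF Fi])
  show "(\<lambda>t. (2 * real m)\<^sup>2) integrable_on {0..T}" by auto
  show "norm (F n t) \<le> (2 * real m)\<^sup>2" for n t
   using power_mono[OF order_trans[OF norm_triangle_ineq4 add_mono[OF vb ub]] norm_ge_zero, of n t m t 2] by (simp add: F_def)
  fix t assume t: "t \<in> {0..T}"
  show "(\<lambda>n. F n t) \<longlonglongrightarrow> 0"
  proof (cases "t \<in> N'")
   case False
   then have tt: "0 < t * (T - t)" "t \<notin> N" using t by (auto simp: N'_def)
   obtain n0 where n0: "1 < real n0 * (t * (T - t))" using reals_Archimedean3[OF tt(1)] by blast
   have "\<forall>\<^sub>F n in sequentially. g n t = v n t"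
    using eventually_ge_at_top[of n0]
   proof eventually_elim
    case (elim n)
    then have "real n0 * (t * (T - t)) \<le> real n * (t * (T - t))" using tt by (intro mult_right_mono) auto
    then show ?case using n0 by (simp add: v_def)
   qed
   then have "(\<lambda>n. v n t) \<longlonglongrightarrow> u m t" by (rule Lim_transform_eventually[OF lim[OF tt(2)]])
   then have "(\<lambda>n. (norm (v n t - u m t))\<^sup>2) \<longlonglongrightarrow> (norm (u m t - u m t))\<^sup>2" by (intro tendsto_intros)
   then show ?thesis using False by (simp add: F_def)
  qed (simp add: F_def)
 qed
 from order_tendstoD(2)[OF this, of "e / 9"] e
 obtain n where "integral {0..T} (F n) < e / 9" by (auto dest: eventually_happens)
 moreover have "integral {0..T} (F n) = integral {0..T} (\<lambda>t. (norm (v n t - u m t))\<^sup>2)"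
  by (rule integral_spike[OF N']) (simp add: F_def)
 ultimately have n: "integral {0..T} (\<lambda>t. (norm (v n t - u m t))\<^sup>2) < e / 9" by simp
 \<comment> \<open>Then T \<epsilon>^2 = e / 9, as for the other two errors; the factor 3 from
   squaring a sum of three terms brings the total to e.\<close>
 define \<epsilon> where "\<epsilon> = sqrt (e / (9 * T))"
 have \<epsilon>: "\<epsilon> > 0" "\<epsilon>\<^sup>2 = e / (9 * T)" using e T by (auto simp: \<epsilon>_def)
 obtain f where f: "trig (2 * pi / T) f" "\<And>t. t \<in> {0..T} \<Longrightarrow> norm (f t - v n t) < \<epsilon>"
  by (rule trig_dense_uniform[OF T continuous_on_subset[OF vc[of n]] _ \<epsilon>(1)]) (auto simp: v_def intro: that)
 have b: "(norm (f t - p t))\<^sup>2 \<le> 3 * (\<epsilon>\<^sup>2 + (norm (v n t - u m t))\<^sup>2 + (norm (u m t - p t))\<^sup>2)" if t: "t \<in> {0..T}" for t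
 proof -
  have s3: "(x + y + z)\<^sup>2 \<le> 3 * (x\<^sup>2 + y\<^sup>2 + z\<^sup>2)" for x y z :: real
   using sum_squares_bound[of x y] sum_squares_bound[of x z] sum_squares_bound[of y z]
   by (simp add: power2_eq_square algebra_simps)
  have "norm (f t - p t) \<le> norm (f t - v n t) + norm (v n t - u m t) + norm (u m t - p t)"
   using norm_triangle_ineq[of "f t - v n t + (v n t - u m t)" "u m t - p t"] norm_triangle_ineq[of "f t - v n t" "v n t - u m t"] by simp
  also have "\<dots> \<le> \<epsilon> + norm (v n t - u m t) + norm (u m t - p t)" using f(2)[OF t] by simp
  finally have "(norm (f t - p t))\<^sup>2 \<le> (\<epsilon> + norm (v n t - u m t) + norm (u m t - p t))\<^sup>2" by (rule power_mono) simp
  then show ?thesis using s3 order_trans by blast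
 qed
 obtain Bf where Bf: "Bf > 0" "\<And>t. t \<in> {0..T} \<Longrightarrow> norm (f t) \<le> Bf" using continuous_bounded_Icc[OF trig_continuous[OF f(1)]] by blast
 have i3: "(\<lambda>t. 3 * (\<epsilon>\<^sup>2 + (norm (v n t - u m t))\<^sup>2 + (norm (u m t - p t))\<^sup>2)) integrable_on {0..T}"
  by (intro integrable_on_mult_right integrable_add vi ui) auto
 have "integral {0..T} (\<lambda>t. (norm (f t - p t))\<^sup>2) \<le> integral {0..T} (\<lambda>t. 3 * (\<epsilon>\<^sup>2 + (norm (v n t - u m t))\<^sup>2 + (norm (u m t - p t))\<^sup>2))"
 proof (cases "(\<lambda>t. (norm (f t - p t))\<^sup>2) integrable_on {0..T}")
  case True then show ?thesis by (rule integral_le[OF _ i3 b])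
 next
  case False
  moreover have "0 \<le> integral {0..T} (\<lambda>t. 3 * (\<epsilon>\<^sup>2 + (norm (v n t - u m t))\<^sup>2 + (norm (u m t - p t))\<^sup>2))"
   by (rule integral_nonneg[OF i3]) simp
  ultimately show ?thesis by (simp add: not_integrable_integral)
 qed
 also have "\<dots> = 3 * (T * \<epsilon>\<^sup>2 + integral {0..T} (\<lambda>t. (norm (v n t - u m t))\<^sup>2) + integral {0..T} (\<lambda>t. (norm (u m t - p t))\<^sup>2))"
 proof -
  have "integral {0..T} (\<lambda>t. \<epsilon>\<^sup>2 + (norm (v n t - u m t))\<^sup>2 + (norm (u m t - p t))\<^sup>2) =
    integral {0..T} (\<lambda>t. \<epsilon>\<^sup>2 + (norm (v n t - u m t))\<^sup>2) + integral {0..T} (\<lambda>t. (norm (u m t - p t))\<^sup>2)"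
   by (intro Henstock_Kurzweil_Integration.integral_add integrable_add vi ui) auto
  moreover have "integral {0..T} (\<lambda>t. \<epsilon>\<^sup>2 + (norm (v n t - u m t))\<^sup>2) = integral {0..T} (\<lambda>t. \<epsilon>\<^sup>2) + integral {0..T} (\<lambda>t. (norm (v n t - u m t))\<^sup>2)"
   by (intro Henstock_Kurzweil_Integration.integral_add vi) auto
  moreover have "integral {0..T} (\<lambda>t. \<epsilon>\<^sup>2) = T * \<epsilon>\<^sup>2" using T by simp
  ultimately show ?thesis by (simp only: Henstock_Kurzweil_Integration.integral_mult_right)
 qed
 also have "\<dots> \<le> 3 * (e / 9 + e / 9 + e / 9)" using m n T by (intro mult_left_mono add_mono) (auto simp: \<epsilon>(2))
 finally show ?thesis using that[OF f(1)] by simp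
qed

text \<open>For a continuous potential with matching end values the same approximant is also
  uniformly close. This is what later keeps the phases together when a torsion function
  exists.\<close>

lemma trig_approx:
 assumes T: "T > 0" and p: "L2_loc p" and e: "e > 0"
 obtains f where "trig (2 * pi / T) f" "integral {0..T} (\<lambda>t. (norm (f t - p t))\<^sup>2) \<le> e"
  "continuous_on {0..T} p \<Longrightarrow> p 0 = p T \<Longrightarrow> \<forall>t\<in>{0..T}. norm (f t - p t) \<le> e"
proof (cases "continuous_on {0..T} p \<and> p 0 = p T")
 case True
 define \<epsilon> where "\<epsilon> = min e (sqrt (e / T))"
 have \<epsilon>: "\<epsilon> > 0" "\<epsilon> \<le> e" "\<epsilon> \<le> sqrt (e / T)" using e T by (auto simp: \<epsilon>_def)
 obtain f where f: "trig (2 * pi / T) f" "\<And>t. t \<in> {0..T} \<Longrightarrow> norm (f t - p t) < \<epsilon>"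
  using trig_dense_uniform[OF T _ _ \<epsilon>(1), of p] True by blast
 have b: "(norm (f t - p t))\<^sup>2 \<le> e / T" if "t \<in> {0..T}" for t
 proof -
  have "(norm (f t - p t))\<^sup>2 \<le> (sqrt (e / T))\<^sup>2" using f(2)[OF that] \<epsilon>(3) by (intro power_mono) auto
  then show ?thesis using e T by simp
 qed
 have c: "continuous_on {0..T} (\<lambda>t. (norm (f t - p t))\<^sup>2)"
  using True by (intro continuous_intros continuous_on_subset[OF trig_continuous[OF f(1)]]) auto
 have unif: "norm (f t - p t) \<le> e" if "t \<in> {0..T}" for t using f(2)[OF that] \<epsilon>(2) by linarith
 have "integral {0..T} (\<lambda>t. (norm (f t - p t))\<^sup>2) \<le> integral {0..T} (\<lambda>t. e / T)"
  by (intro integral_le integrable_continuous_interval c b) auto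
 also have "\<dots> = e" using T by simp
 finally show ?thesis using unif by (intro that[OF f(1)]) auto
next
 case False
 then show ?thesis using L2_trig_dense[OF T p e] that by metis
qed

section \<open>Surjectivity of the derivative of the monodromy\<close>

text \<open>The first variation of the monodromy according to \<open>frame_stability\<close>,
  without the right factor \<open>frame p T z\<close>, which is a sign in the application.\<close>

definition mono_deriv :: "(real \<Rightarrow> complex) \<Rightarrow> complex \<Rightarrow> real \<Rightarrow> (real \<Rightarrow> complex) \<Rightarrow> cmat2" where
 "mono_deriv p z T h = integral {0..T} (\<lambda>s. frame p s z ** offd (h s) ** adj2 (frame p s z))"

text \<open>Coordinates on trace-free matrices, with real dimension six. For the monodromy itself
  the fourth entry is recovered from the determinant.\<close>

definition upper :: "cmat2 \<Rightarrow> complex \<times> complex \<times> complex" where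
 "upper X = (X $ 1 $ 1, X $ 1 $ 2, X $ 2 $ 1)"

lemma bounded_linear_upper: "bounded_linear upper"
 unfolding upper_def by (intro bounded_linear_Pair bounded_linear_entry)

lemma loc_int_conj_offd:
 assumes "loc_int p" "loc_int h"
 shows "loc_int (\<lambda>s. frame p s z ** offd (h s) ** adj2 (frame p s z))"
 by (intro loc_int_bilinear_right[OF bounded_bilinear_mm] loc_int_bilinear[OF bounded_bilinear_mm]
   continuous_on_adj2 continuous_on_frame assms loc_int_linear[OF bounded_linear_offd])

lemma mono_deriv_add:
 assumes "loc_int p" "loc_int h" "loc_int g"
 shows "mono_deriv p z T (\<lambda>t. h t + g t) = mono_deriv p z T h + mono_deriv p z T g"
proof -
 have "offd (h s + g s) = offd (h s) + offd (g s)" for s by (simp add: cmat2_eq_iff add_divide_distrib)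
 then show ?thesis unfolding mono_deriv_def
  by (simp add: mm.add_left mm.add_right Henstock_Kurzweil_Integration.integral_add[OF loc_int_integrable loc_int_integrable]
    loc_int_conj_offd assms)
qed

lemma mono_deriv_scale: "mono_deriv p z T (\<lambda>t. of_real r * h t) = r *\<^sub>R mono_deriv p z T h"
proof -
 have "of_real r * h s = r *\<^sub>R h s" for s by (simp add: scaleR_conv_of_real)
 then have "offd (of_real r * h s) = r *\<^sub>R offd (h s)" for s
  by (simp only: linear_cmul[OF bounded_linear.linear[OF bounded_linear_offd]])
 then show ?thesis unfolding mono_deriv_def by (simp add: mm.scaleR_left mm.scaleR_right)
qed

lemma trig_loc_int: "trig \<omega> f \<Longrightarrow> loc_int f"
 by (rule loc_int_continuous[OF trig_continuous])

lemma periodic_int: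
 fixes f :: "real \<Rightarrow> 'a"
 assumes "\<And>t. f (t + T) = f t" shows "f (t + of_int n * T) = f t"
proof (induction n rule: int_induct[where k = 0])
 case (step1 i)
 have "t + of_int (i + 1) * T = t + of_int i * T + T" by (simp add: algebra_simps)
 then show ?case using step1(2) by (simp only: assms)
next
 case (step2 i)
 have "t + of_int i * T = t + of_int (i - 1) * T + T" by (simp add: algebra_simps)
 then show ?case using step2 assms by metis
qed simp

text \<open>Approximating the conjugate of \<open>k\<close> uniformly by a trigonometric polynomial
  would give a bound of the integral of |k|^2 by a small multiple of the integral of |k|.\<close>

lemma trig_orthogonal_zero:
 assumes T: "T > 0" and k: "continuous_on UNIV k" "\<And>t. k (t + T) = k t"
  and o: "\<And>h. trig (2 * pi / T) h \<Longrightarrow> integral {0..T} (\<lambda>t. Re (h t * k t)) = 0"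
 shows "k t = 0"
proof -
 define J where "J = integral {0..T} (\<lambda>t. (norm (k t))\<^sup>2)"
 define I where "I = integral {0..T} (\<lambda>t. norm (k t))"
 have kc: "continuous_on S k" for S using k(1) continuous_on_subset by blast
 have I0: "I \<ge> 0" unfolding I_def by (intro integral_nonneg integrable_continuous_interval continuous_intros kc) auto
 have "J \<le> 0"
 proof (rule ccontr)
  assume "\<not> ?thesis"
  then have J: "J > 0" by simp
  \<comment> \<open>Chosen so that \<epsilon> I < J, which contradicts the estimate J <= \<epsilon>
    I derived below.\<close>
  define \<epsilon> where "\<epsilon> = J / (2 * (I + 1))"
  have \<epsilon>: "\<epsilon> > 0" using J I0 by (simp add: \<epsilon>_def)
  obtain h where h: "trig (2 * pi / T) h" "\<And>t. t \<in> {0..T} \<Longrightarrow> norm (h t - cnj (k t)) < \<epsilon>"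
   by (rule trig_dense_uniform[OF T _ _ \<epsilon>, of "\<lambda>t. cnj (k t)"]) (use k(2)[of 0] in \<open>auto intro!: continuous_intros kc intro: that\<close>)
  have hc: "continuous_on S h" for S using trig_continuous[OF h(1)] continuous_on_subset by blast
  have "J = integral {0..T} (\<lambda>t. Re ((cnj (k t) - h t) * k t) + Re (h t * k t))"
  proof -
   have "(norm (k t))\<^sup>2 = Re ((cnj (k t) - h t) * k t) + Re (h t * k t)" for t
    by (simp only: plus_complex.sel(1)[symmetric] left_diff_distrib diff_add_cancel) (simp add: cmod_power2, simp add: power2_eq_square)
   then show ?thesis by (simp add: J_def)
  qed
  also have "\<dots> = integral {0..T} (\<lambda>t. Re ((cnj (k t) - h t) * k t)) + integral {0..T} (\<lambda>t. Re (h t * k t))"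
   by (intro Henstock_Kurzweil_Integration.integral_add integrable_continuous_interval continuous_intros kc hc)
  also have "\<dots> = integral {0..T} (\<lambda>t. Re ((cnj (k t) - h t) * k t))" using o[OF h(1)] by simp
  also have "\<dots> \<le> integral {0..T} (\<lambda>t. \<epsilon> * norm (k t))"
  proof (intro integral_le integrable_continuous_interval continuous_intros kc hc)
   fix t assume t: "t \<in> {0..T}"
   have "Re ((cnj (k t) - h t) * k t) \<le> norm ((cnj (k t) - h t) * k t)" by (rule complex_Re_le_cmod)
   also have "\<dots> \<le> \<epsilon> * norm (k t)" unfolding norm_mult using h(2)[OF t] by (intro mult_right_mono) (auto simp: norm_minus_commute)
   finally show "Re ((cnj (k t) - h t) * k t) \<le> \<epsilon> * norm (k t)" .
  qed
  also have "\<dots> = \<epsilon> * I" by (simp add: I_def)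
  also have "\<dots> < J"
  proof -
   have "0 < I * J + J * 2" using J I0 by (intro add_nonneg_pos mult_nonneg_nonneg) auto
   then show ?thesis using J I0 by (simp add: \<epsilon>_def field_simps)
  qed
  finally show False by simp
 qed
 moreover have "J \<ge> 0" unfolding J_def by (intro integral_nonneg integrable_continuous_interval continuous_intros kc) auto
 ultimately have "J = 0" by simp
 have "continuous_on {0..T} (\<lambda>t. (norm (k t))\<^sup>2)" by (intro continuous_intros kc)
 from integral_eq_0_iff[OF this T] \<open>J = 0\<close> have z: "k t = 0" if "t \<in> {0..T}" for t using that by (simp add: J_def)
 define n where "n = - \<lfloor>t / T\<rfloor>"
 have "of_int \<lfloor>t / T\<rfloor> * T \<le> t" "t < (of_int \<lfloor>t / T\<rfloor> + 1) * T"
  by (rule floor_divide_lower[OF T], rule floor_divide_upper[OF T])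
 then have "t + of_int n * T \<in> {0..T}" by (auto simp: n_def algebra_simps)
 from z[OF this] show ?thesis using periodic_int[of k T t n, OF k(2)] by simp
qed

text \<open>Pairing with a constant trace-free matrix \<open>B\<close>, the derivative in direction \<open>h\<close> only sees the
 off-diagonal part of \<open>C = F\<^sup>-\<^sup>1 B F\<close>. If that part is skew, the Lax equation for \<open>C\<close> forces the
 potential to be a single exponential.\<close>

lemma lax_skew_degenerate:
 assumes T: "T > 0" and p: "loc_int p" "AE t in lebesgue. p (t + T) = p t" and z: "Im z = 1"
  and B: "trace B = 0" "B \<noteq> 0"
 defines "C \<equiv> \<lambda>t. adj2 (frame p t z) ** (B ** frame p t z)"
 assumes skew: "\<And>t. C t $ 2 $ 1 = cnj (C t $ 1 $ 2)"
 shows "\<exists>a m. AE t in lebesgue. p t = a * ex (2 * pi / T) m t"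
proof -
 define c u where "c t = C t $ 1 $ 1" and "u t = C t $ 1 $ 2" for t
 have tr: "C t $ 2 $ 2 = - c t" for t
 proof -
  have "trace (C t) = trace (B ** frame p t z ** adj2 (frame p t z))"
   unfolding C_def by (rule trace_mul_sym)
  also have "\<dots> = trace B" by (simp add: mm_assoc adj2_mult det_frame[OF p(1)])
  finally have "C t $ 1 $ 1 + C t $ 2 $ 2 = 0" using B by (simp add: trace_def sum_2)
  then show ?thesis by (simp add: c_def add_eq_0_iff)
 qed
 have acC: "has_ac_derivative C (\<lambda>t. C t ** alpha p z t - alpha p z t ** C t)"
  unfolding C_def
  by (rule has_ac_eq_rhs[OF has_ac_mm[OF ode_adj2[OF has_ac_frame[OF p(1)] trace_alpha] has_ac_const_mm[OF has_ac_frame[OF p(1)]]]])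
   (simp add: mm_assoc mm.minus_left)
 have acc: "has_ac_derivative c (\<lambda>t. - (u t * cnj (p t) + p t * cnj (u t)) / 2)"
  unfolding c_def[abs_def]
  by (rule has_ac_eq_rhs[OF has_ac_linear[OF bounded_linear_entry acC]]) (simp add: mm_nth skew u_def field_simps)
 have acu: "has_ac_derivative u (\<lambda>t. c t * p t - \<i> * z * u t)"
  unfolding u_def[abs_def]
  by (rule has_ac_eq_rhs[OF has_ac_linear[OF bounded_linear_entry acC]]) (simp add: mm_nth tr c_def field_simps)
 have acv: "has_ac_derivative (\<lambda>t. cnj (u t)) (\<lambda>t. \<i> * z * cnj (u t) + c t * cnj (p t))"
  by (rule has_ac_eq_rhs[OF has_ac_linear[OF bounded_linear_entry acC, of 2 1, unfolded skew, folded u_def]])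
   (simp add: mm_nth tr skew u_def[symmetric] c_def[symmetric] field_simps)
 \<comment> \<open>The skew symmetry yields two equations for the conjugate of \<open>u\<close>; as
   z and cnj z differ by 2 i, comparing them expresses \<open>u\<close> by the potential. Inserted
   into the equation of \<open>c\<close>, this makes \<open>c\<close> constant.\<close>
 have AEu: "AE t in lebesgue. u t = - \<i> * of_real (Im (c t)) * p t"
  using has_ac_AE_unique[OF acv has_ac_linear[OF bounded_linear_cnj acu]]
 proof eventually_elim
  case (elim t)
  have zc: "cnj z = z - 2 * \<i>" using z by (simp add: complex_eq_iff)
  have cc: "cnj (c t) = c t - 2 * \<i> * of_real (Im (c t))" by (simp add: complex_eq_iff)
  have "2 * (cnj (u t) - \<i> * of_real (Im (c t)) * cnj (p t)) = 0" using elim by (simp add: zc cc algebra_simps)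
  then have "cnj (cnj (u t)) = cnj (\<i> * of_real (Im (c t)) * cnj (p t))" by simp
  then show ?case by simp
 qed
 have "has_ac_derivative c (\<lambda>t. 0)"
  by (rule has_ac_cong_AE[OF acc]) (use AEu in eventually_elim, simp add: algebra_simps)
 then have cc: "c t = c 0" for t by (rule has_ac_zero_imp_const)
 define \<sigma> where "\<sigma> = Im (c 0)"
 have AEu: "AE t in lebesgue. u t = - \<i> * of_real \<sigma> * p t"
  using AEu by eventually_elim (subst (asm) cc, simp add: \<sigma>_def)
 show ?thesis
 proof (cases "\<sigma> = 0")
  \<comment> \<open>Here \<open>u\<close> vanishes almost everywhere, hence everywhere by
    continuity, so c_0 times the potential is 0. As c_0 = 0 would force \<open>B = 0\<close>, the
    potential vanishes, a degenerate exponential.\<close>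
  case True
  have cu: "continuous_on UNIV u" by (rule has_ac_continuous[OF acu])
  obtain N where N: "negligible N" "\<And>t. t \<notin> N \<Longrightarrow> u t = 0"
   using AE_imp_negligible[OF AEu] True by auto
  have "open {t. u t \<noteq> 0}" by (intro open_Collect_neq cu continuous_on_const)
  moreover have "negligible {t. u t \<noteq> 0}" by (rule negligible_subset[OF N(1)]) (use N(2) in auto)
  ultimately have u0: "u t = 0" for t using open_not_negligible by blast
  have "has_ac_derivative (\<lambda>t. 0) (\<lambda>t. c 0 * p t)"
   by (rule has_ac_eq_rhs[OF acu[unfolded u0]]) (subst cc, simp)
  then have "AE t in lebesgue. c 0 * p t = 0" by (rule has_ac_AE_unique[OF _ has_ac_const])
  moreover have "c 0 \<noteq> 0"
  proof
   assume "c 0 = 0"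
   then have "C 0 = 0" using tr[of 0] skew[of 0] u0[of 0] by (simp add: cmat2_eq_iff c_def u_def)
   then show False using B(2) by (simp add: C_def p(1) cmat2_eq_iff mm_nth)
  qed
  ultimately show ?thesis by (intro exI[of _ 0] exI[of _ 0]) auto
 next
  case False
  \<comment> \<open>With the potential replaced by a multiple of \<open>u\<close>, the equation of
    \<open>u\<close> becomes u' = i \<nu> u with this real \<nu>: the imaginary part cancels since
    Im z = 1. Periodicity then makes \<nu> a multiple of 2 pi / T.\<close>
  define \<nu> where "\<nu> = Re (c 0) / \<sigma> - Re z"
  have AEp: "AE t in lebesgue. p t = \<i> / of_real \<sigma> * u t"
   using AEu by eventually_elim (use False in \<open>simp add: field_simps\<close>)
  have acu2: "has_ac_derivative u (\<lambda>t. \<i> * of_real \<nu> * u t)"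
  proof (rule has_ac_cong_AE[OF acu])
   have "c 0 * (\<i> / of_real \<sigma>) - \<i> * z = \<i> * of_real \<nu>"
    using False z by (simp add: complex_eq_iff \<nu>_def \<sigma>_def Re_divide Im_divide power2_eq_square field_simps)
   moreover have "c 0 * (\<i> / of_real \<sigma> * x) - \<i> * z * x = (c 0 * (\<i> / of_real \<sigma>) - \<i> * z) * x" for x by (simp add: algebra_simps)
   ultimately have e: "c 0 * (\<i> / of_real \<sigma> * x) - \<i> * z * x = \<i> * of_real \<nu> * x" for x by simp
   show "AE t in lebesgue. c t * p t - \<i> * z * u t = \<i> * of_real \<nu> * u t"
    using AEp by eventually_elim (subst cc, simp only: e)
  qed
  have "has_ac_derivative (\<lambda>t. cis (- \<nu> * t) * u t) (\<lambda>t. 0)"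
   by (rule has_ac_eq_rhs[OF has_ac_bilinear[OF bounded_bilinear_mult has_ac_cis acu2]]) (simp add: algebra_simps)
  then have "cis (- \<nu> * t) * u t = cis (- \<nu> * 0) * u 0" for t by (rule has_ac_zero_imp_const)
  then have c1: "cis (- \<nu> * t) * u t = u 0" for t by simp
  have ut: "u t = u 0 * cis (\<nu> * t)" for t
   using arg_cong[OF c1[of t], of "\<lambda>x. x * cis (\<nu> * t)"] by (simp add: ac_simps cis_mult mult.assoc[symmetric])
  define b where "b = \<i> / of_real \<sigma> * u 0"
  have AEp: "AE t in lebesgue. p t = b * cis (\<nu> * t)" using AEp by eventually_elim (subst (asm) ut, simp add: b_def)
  show ?thesis
  proof (cases "b = 0")
   case True then show ?thesis using AEp by (intro exI[of _ 0] exI[of _ 0]) simp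
  next
   case b: False
   have "AE t in lebesgue. b * cis (\<nu> * (t + T)) = b * cis (\<nu> * t)" using AEp AE_shift[OF AEp, of T] p(2)
    by eventually_elim metis
   then obtain N where "negligible N" "\<And>t. t \<notin> N \<Longrightarrow> b * cis (\<nu> * (t + T)) = b * cis (\<nu> * t)" using AE_imp_negligible by blast
   moreover from this(1) obtain t where "t \<notin> N" using non_negligible_UNIV by (metis UNIV_eq_I)
   ultimately have "cis (\<nu> * (t + T)) = cis (\<nu> * t)" using b by simp
   moreover have "cis (\<nu> * (t + T)) = cis (\<nu> * t) * cis (\<nu> * T)" by (simp add: cis_mult distrib_left)
   ultimately have "cis (\<nu> * T) = 1" by simp
   then obtain m :: int where "\<nu> * T = of_int m * (2 * pi)" unfolding cis_eq_1_iff by blast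
   then have m: "\<nu> = 2 * pi / T * of_int m" using T by (simp add: field_simps)
   have e: "cis (\<nu> * t) = ex (2 * pi / T) m t" for t by (simp add: m ex_def cis_conv_exp mult.assoc)
   show ?thesis using AEp unfolding e by blast
  qed
 qed
qed

text \<open>The attained values form a real subspace. If it is proper, some nonzero real functional
  annihilates it; this functional is pairing with a trace-free matrix, and testing against all
  trigonometric polynomials gives the skewness that \<open>lax_skew_degenerate\<close>
  excludes.\<close>

lemma mono_deriv_surj:
 assumes T: "T > 0" and p: "loc_int p" "AE t in lebesgue. p (t + T) = p t" and z: "Im z = 1"
  and M: "frame p T z = mat s" "s\<^sup>2 = 1"
  and nd: "\<nexists>a m. AE t in lebesgue. p t = a * ex (2 * pi / T) m t"
 shows "\<exists>h. trig (2 * pi / T) h \<and> upper (mono_deriv p z T h) = v"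
proof (rule ccontr)
 assume nv: "\<not> ?thesis"
 define R where "R = {upper (mono_deriv p z T h) | h. trig (2 * pi / T) h}"
 interpret up: bounded_linear upper by (rule bounded_linear_upper)
 have "subspace R"
 proof (rule subspaceI)
  have "upper (mono_deriv p z T (\<lambda>t. of_real 0 * 0)) = 0" unfolding mono_deriv_scale by (simp add: up.zero)
  then show "0 \<in> R" unfolding R_def using trig_const[of _ "of_real 0 * 0"] by fastforce
  show "x + y \<in> R" if xy: "x \<in> R" "y \<in> R" for x y
  proof -
   obtain h g where h: "trig (2 * pi / T) h" "x = upper (mono_deriv p z T h)" "trig (2 * pi / T) g" "y = upper (mono_deriv p z T g)"
    using xy unfolding R_def by blast
   have "x + y = upper (mono_deriv p z T (\<lambda>t. h t + g t))"
    by (simp add: h mono_deriv_add[OF p(1) trig_loc_int[OF h(1)] trig_loc_int[OF h(3)]] up.add)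
   then show ?thesis unfolding R_def using trig.add[OF h(1,3)] by blast
  qed
  show "r *\<^sub>R x \<in> R" if xR: "x \<in> R" for r x
  proof -
   obtain h where h: "trig (2 * pi / T) h" "x = upper (mono_deriv p z T h)" using xR unfolding R_def by blast
   have "r *\<^sub>R x = upper (mono_deriv p z T (\<lambda>t. of_real r * h t))" by (simp add: h mono_deriv_scale up.scaleR)
   then show ?thesis unfolding R_def using trig_scale[OF h(1)] by blast
  qed
 qed
 then have sR: "span R = R" by (rule span_eq_iff[THEN iffD2])
 have "v \<notin> R" using nv by (auto simp: R_def)
 then have "span R \<noteq> UNIV" unfolding sR by blast
 from span_not_UNIV_orthogonal[OF this] obtain a1 a2 a3 where a: "(a1, a2, a3) \<noteq> 0" "\<And>x. x \<in> R \<Longrightarrow> (a1, a2, a3) \<bullet> x = 0"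
  unfolding sR by (metis prod_cases3)
 \<comment> \<open>Represents the functional as X -> Re (trace (B X)) on trace-free X. The diagonal
   entry is halved since X_11 is seen twice, and \<open>a2\<close> and \<open>a3\<close> change
   places because the trace pairs (1,2) with (2,1).\<close>
 define B where "B = mk2 (cnj a1 / 2) (cnj a3) (cnj a2) (- cnj a1 / 2)"
 have B: "trace B = 0" "B \<noteq> 0" using a(1) by (auto simp: B_def trace_def sum_2 cmat2_eq_iff zero_prod_def)
 define F where "F t = frame p t z" for t
 have dF: "det (F t) = 1" for t by (simp add: F_def det_frame[OF p(1)])
 define C where "C t = adj2 (F t) ** (B ** F t)" for t
 define k where "k t = C t $ 2 $ 1 - cnj (C t $ 1 $ 2)" for t
 have cF: "continuous_on UNIV F" unfolding F_def by (rule continuous_on_frame[OF p(1)])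
 have cC: "continuous_on UNIV C" unfolding C_def by (intro continuous_on_mm continuous_on_adj2 continuous_on_const cF)
 have ck: "continuous_on UNIV k" unfolding k_def by (intro continuous_intros continuous_on_entry cC)
 have FT: "F (t + T) = mat s ** F t" for t unfolding F_def by (simp add: frame_periodic[OF p] M)
 have CT: "C (t + T) = C t" for t
 proof -
  have "adj2 (mat s ** X) ** (B ** (mat s ** X)) = mat (s * s) ** (adj2 X ** (B ** X))" for X :: cmat2
   by (simp add: cmat2_eq_iff mm_nth algebra_simps)
  then show ?thesis using M(2) unfolding C_def FT by (simp add: power2_eq_square)
 qed
 have L: "(a1, a2, a3) \<bullet> upper (F t ** offd x ** adj2 (F t)) = Re (x * k t) / 2" for t x
 proof -
  define X where "X = F t ** offd x ** adj2 (F t)"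
  have "trace X = trace (adj2 (F t) ** (F t ** offd x))" unfolding X_def by (rule trace_mul_sym)
  also have "\<dots> = 0" by (simp add: adj2_cancel[OF dF] trace_def sum_2)
  finally have X22: "X $ 2 $ 2 = - X $ 1 $ 1" by (simp add: trace_def sum_2 add_eq_0_iff)
  have "(a1, a2, a3) \<bullet> upper X = Re (trace (B ** X))"
   by (simp add: upper_def inner_complex_def trace_def sum_2 mm_nth B_def X22)
  also have "trace (B ** X) = trace ((B ** F t ** offd x) ** adj2 (F t))" by (simp add: X_def mm_assoc)
  also have "\<dots> = trace (adj2 (F t) ** (B ** F t ** offd x))" by (rule trace_mul_sym)
  also have "\<dots> = trace (C t ** offd x)" by (simp add: C_def mm_assoc)
  also have "Re \<dots> = Re (x * k t) / 2" by (simp add: trace_def sum_2 mm_nth k_def field_simps)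
  finally show ?thesis by (simp add: X_def)
 qed
 have "integral {0..T} (\<lambda>t. Re (h t * k t)) = 0" if h: "trig (2 * pi / T) h" for h
 proof -
  have "(a1, a2, a3) \<bullet> upper (mono_deriv p z T h) = 0" by (rule a(2)) (use h in \<open>unfold R_def, blast\<close>)
  moreover have "(a1, a2, a3) \<bullet> upper (mono_deriv p z T h) = integral {0..T} (\<lambda>t. (a1, a2, a3) \<bullet> upper (F t ** offd (h t) ** adj2 (F t)))"
   using integral_linear[OF loc_int_integrable[OF loc_int_conj_offd[OF p(1) trig_loc_int[OF h]]]
     bounded_linear_compose[OF bounded_linear_inner_right bounded_linear_upper], of 0 T "(a1, a2, a3)" z]
   by (simp add: o_def mono_deriv_def F_def)
  ultimately show ?thesis unfolding L by simp
 qed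
 from trig_orthogonal_zero[OF T ck _ this] CT have "k t = 0" for t by (simp add: k_def)
 then have "C t $ 2 $ 1 = cnj (C t $ 1 $ 2)" for t by (simp add: k_def)
 from lax_skew_degenerate[OF T p z B this[unfolded C_def F_def]] nd show False by blast
qed

section \<open>Closing a perturbed potential\<close>

lemma mono_deriv_bound:
 assumes p: "loc_int p"
 obtains c where "c > 0" "\<And>h. loc_int h \<Longrightarrow> norm (mono_deriv p z T h) \<le> c * integral {0..T} (\<lambda>t. norm (h t))"
proof -
 obtain K where K: "K \<ge> 1" "\<And>(A :: cmat2) (B :: cmat2). norm (A ** B) \<le> K * norm A * norm B"
  using norm_mm_bound by blast
 let ?F = "\<lambda>t. frame p t z"
 obtain a where a: "a > 0" "\<And>t. t \<in> {0..T} \<Longrightarrow> norm (?F t) \<le> a" using continuous_bounded_Icc[OF continuous_on_frame[OF p]] by blast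
 obtain b where b: "b > 0" "\<And>t. t \<in> {0..T} \<Longrightarrow> norm (adj2 (?F t)) \<le> b"
  using continuous_bounded_Icc[OF continuous_on_adj2[OF continuous_on_frame[OF p]]] by blast
 show ?thesis
 proof (rule that[of "K * K * a * b"])
  show "K * K * a * b > 0" using K a b by simp
  fix h :: "real \<Rightarrow> complex" assume h: "loc_int h"
  have "norm (mono_deriv p z T h) \<le> integral {0..T} (\<lambda>t. K * K * a * b * norm (h t))"
   unfolding mono_deriv_def
  proof (rule integral_norm_bound_integral[OF loc_int_integrable[OF loc_int_conj_offd[OF p h]]])
   show "(\<lambda>t. K * K * a * b * norm (h t)) integrable_on {0..T}"
    by (intro integrable_on_mult_right loc_int_norm_integrable h)
   fix t assume t: "t \<in> {0..T}"
   have "norm (?F t ** offd (h t) ** adj2 (?F t)) \<le> K * norm (?F t ** offd (h t)) * norm (adj2 (?F t))" by (rule K(2))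
   also have "\<dots> \<le> K * (K * a * norm (h t)) * b"
   proof (intro mult_mono)
    have "norm (?F t ** offd (h t)) \<le> K * norm (?F t) * norm (offd (h t))" by (rule K(2))
    also have "\<dots> \<le> K * a * norm (h t)" using K(1) a t by (intro mult_mono norm_offd_le) auto
    finally show "norm (?F t ** offd (h t)) \<le> K * a * norm (h t)" .
   qed (use K a b t in auto)
   finally show "norm (?F t ** offd (h t) ** adj2 (?F t)) \<le> K * K * a * b * norm (h t)" by (simp add: ac_simps)
  qed
  then show "norm (mono_deriv p z T h) \<le> K * K * a * b * integral {0..T} (\<lambda>t. norm (h t))" by simp
 qed
qed

lemma norm_upper_le: "norm (upper X) \<le> 3 * norm X"
proof -
 have "norm (upper X) \<le> norm (X $ 1 $ 1) + (norm (X $ 1 $ 2) + norm (X $ 2 $ 1))"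
  unfolding upper_def by (rule order_trans[OF norm_Pair_le]) (intro add_left_mono norm_Pair_le)
 then show ?thesis using norm_entry_le[of X 1 1] norm_entry_le[of X 1 2] norm_entry_le[of X 2 1] by linarith
qed

lemma loc_int_fsr: "bnd 3 A a \<Longrightarrow> loc_int (fsr \<omega> a)"
 by (rule loc_int_continuous[OF continuous_on_fsr[OF bnd_32]])

lemma fsr_sum:
 assumes "finite B" "\<And>b. bnd 3 (A b) (co b)" "loc_int p"
 shows "bnd 3 (\<Sum>b\<in>B. \<bar>r b\<bar> * A b) (\<lambda>n. \<Sum>b\<in>B. of_real (r b) * co b n) \<and>
  upper (mono_deriv p z T (fsr \<omega> (\<lambda>n. \<Sum>b\<in>B. of_real (r b) * co b n))) = (\<Sum>b\<in>B. r b *\<^sub>R upper (mono_deriv p z T (fsr \<omega> (co b))))"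
 using assms(1)
proof induction
 case empty
 interpret up: bounded_linear upper by (rule bounded_linear_upper)
 have "fsr \<omega> (\<lambda>n. 0) = (\<lambda>t. of_real 0 * 0)" by (simp add: fsr_def fun_eq_iff)
 then have "upper (mono_deriv p z T (fsr \<omega> (\<lambda>n. 0))) = 0" by (simp only: mono_deriv_scale up.scaleR scaleR_zero_left up.zero)
 then show ?case by (simp add: bnd_def)
next
 case (insert b B)
 interpret up: bounded_linear upper by (rule bounded_linear_upper)
 let ?R = "\<lambda>n. \<Sum>b\<in>B. of_real (r b) * co b n"
 have b1: "bnd 3 (\<bar>r b\<bar> * A b) (\<lambda>n. of_real (r b) * co b n)" using bnd_scale[OF assms(2)[of b], of "of_real (r b)"] by simp
 have b2: "bnd 3 (\<Sum>b\<in>B. \<bar>r b\<bar> * A b) ?R" using insert by blast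
 have "fsr \<omega> (\<lambda>n. of_real (r b) * co b n + ?R n) = (\<lambda>t. of_real (r b) * fsr \<omega> (co b) t + fsr \<omega> ?R t)"
  by (rule ext) (simp only: fsr_add[OF bnd_32[OF b1] bnd_32[OF b2]] fsr_scale)
 moreover have "mono_deriv p z T (\<lambda>t. of_real (r b) * fsr \<omega> (co b) t + fsr \<omega> ?R t) =
   r b *\<^sub>R mono_deriv p z T (fsr \<omega> (co b)) + mono_deriv p z T (fsr \<omega> ?R)"
  unfolding mono_deriv_scale[symmetric]
  by (intro mono_deriv_add assms(3) loc_int_fsr[OF b2] loc_int_bilinear[OF bounded_bilinear_mult continuous_on_const] loc_int_fsr[OF assms(2)])
 ultimately show ?case using bnd_add[OF b1 b2] insert by (simp add: up.add up.scaleR)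
qed

text \<open>The high Fourier modes are slaved to the low ones by \<open>finite_gap_family\<close>; six real parameters
 among the low ones are then adjusted by Brouwer's theorem so that the monodromy closes up.\<close>

lemma finite_gap_closing:
 assumes T: "T > 0" and r: "r > 0" and p0: "L2_loc p0" "AE t in lebesgue. p0 (t + T) = p0 t" and z: "Im z = 1"
  and M: "frame p0 T z = mat s" "s\<^sup>2 = 1"
  and nd: "\<nexists>a m. AE t in lebesgue. p0 t = a * ex (2 * pi / T) m t" and e: "e > 0"
 obtains a A where "bnd 3 A a" "frame (fsr (2 * pi / T) a) T z = mat s" "dbl_pts T r (fsr (2 * pi / T) a)"
  "integral {0..T} (\<lambda>t. (norm (fsr (2 * pi / T) a t - p0 t))\<^sup>2) \<le> e"
  "continuous_on {0..T} p0 \<Longrightarrow> p0 0 = p0 T \<Longrightarrow> \<forall>t\<in>{0..T}. norm (fsr (2 * pi / T) a t - p0 t) \<le> e"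
proof -
 define \<omega> where "\<omega> = 2 * pi / T"
 have l0: "loc_int p0" by (rule L2_loc_imp_loc_int[OF p0(1)])
 interpret up: bounded_linear upper by (rule bounded_linear_upper)
 let ?D = "\<lambda>h. mono_deriv p0 z T h"
 \<comment> \<open>Preimages under the derivative may be taken as trigonometric polynomials, so they
   involve finitely many modes and can stay below the threshold of the slaved ones.\<close>
 have "\<forall>v. \<exists>c A N. bnd 3 A c \<and> (\<forall>n. \<bar>n\<bar> \<ge> N \<longrightarrow> c n = 0) \<and> upper (?D (fsr \<omega> c)) = v"
 proof
  fix v
  obtain h where h: "trig \<omega> h" "upper (?D h) = v" using mono_deriv_surj[OF T l0 p0(2) z M nd, of v] unfolding \<omega>_def by blast
  from trig_coeffs[OF h(1)] h(2) show "\<exists>c A N. bnd 3 A c \<and> (\<forall>n. \<bar>n\<bar> \<ge> N \<longrightarrow> c n = 0) \<and> upper (?D (fsr \<omega> c)) = v" by metis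
 qed
 then obtain co A N where co: "\<And>v. bnd 3 (A v) (co v)" "\<And>v n. \<bar>n\<bar> \<ge> N v \<Longrightarrow> co v n = 0" "\<And>v. upper (?D (fsr \<omega> (co v))) = v" by metis
 \<comment> \<open>A linear right inverse of the derivative, assembled from preimages of the six
   basis vectors.\<close>
 define X where "X x n = (\<Sum>b\<in>Basis. of_real (x \<bullet> b) * co b n)" for x n
 define S1 where "S1 = (\<Sum>b\<in>Basis. A b)"
 have A0: "A v \<ge> 0" for v by (rule bnd_nonneg[OF co(1)])
 have S1: "S1 \<ge> 0" unfolding S1_def by (intro sum_nonneg A0)
 have bX: "bnd 3 (norm x * S1) (X x)" for x
 proof -
  have "(\<Sum>b\<in>Basis. \<bar>x \<bullet> b\<bar> * A b) \<le> norm x * S1" unfolding S1_def sum_distrib_left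
   by (intro sum_mono mult_right_mono Basis_le_norm A0)
  then show ?thesis using fsr_sum[where A = A and co = co and r = "\<lambda>b. x \<bullet> b", OF finite_Basis co(1) l0, of z T \<omega>] bnd_mono unfolding X_def[abs_def] by blast
 qed
 have DX: "upper (?D (fsr \<omega> (X x))) = x" for x
  using fsr_sum[where A = A and co = co and r = "\<lambda>b. x \<bullet> b", OF finite_Basis co(1) l0, of z T \<omega>] unfolding X_def[abs_def] by (simp add: co(3) euclidean_representation)
 have Xd: "X x n - X y n = X (x - y) n" for x y n
  by (simp add: X_def inner_diff_left left_diff_distrib sum_subtractf)
 obtain NX where NX: "\<And>x n. \<bar>n\<bar> \<ge> NX \<Longrightarrow> X x n = 0"
 proof (rule that[of "Max (N ` Basis)"])
  fix x :: "complex \<times> complex \<times> complex" and n :: int assume n: "Max (N ` Basis) \<le> \<bar>n\<bar>"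
  have "co b n = 0" if b: "b \<in> Basis" for b :: "complex \<times> complex \<times> complex"
  proof (rule co(2))
   have "N b \<le> Max (N ` Basis)" using b by (intro Max_ge) auto
   then show "N b \<le> \<bar>n\<bar>" using n by linarith
  qed
  then show "X x n = 0" by (simp add: X_def)
 qed
 define w where "w = wsum 2"
 have w: "w \<ge> 1" using wsum2_ge1 by (simp add: w_def)
 obtain B where B: "B > 0"
  "\<And>p d t. loc_int p \<Longrightarrow> integral {0..T} (\<lambda>s. norm (p s - p0 s)) \<le> d \<Longrightarrow> B * d \<le> 1 \<Longrightarrow> 0 \<le> t \<Longrightarrow> t \<le> T \<Longrightarrow>
    norm (frame p t z - frame p0 t z) \<le> B * d \<and>
    norm (frame p t z - frame p0 t z - integral {0..t} (\<lambda>s. frame p0 s z **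
     offd (p s - p0 s) ** adj2 (frame p0 s z)) ** frame p0 t z) \<le> B * d\<^sup>2"
  by (rule frame_stability[OF l0 less_imp_le[OF T], of z]) (rule that)
 obtain CD where CD: "CD > 0" "\<And>h. loc_int h \<Longrightarrow> norm (?D h) \<le> CD * integral {0..T} (\<lambda>t. norm (h t))"
  by (rule mono_deriv_bound[OF l0]) (rule that)
 \<comment> \<open>\<open>C1 * \<rho>\<close> bounds the distance to the approximating polynomial,
   \<open>C0 * \<rho>\<close> the L1 distance to \<open>p0\<close>, \<open>C2 * \<rho>^2\<close> the
   deviation of the closing map from the identity, and \<open>C3 * \<rho>\<close> the final
   distances.\<close>
 define C1 where "C1 = S1 * w + w"
 define C0 where "C0 = 1 + T + T * C1"
 define C2 where "C2 = 3 * B * C0\<^sup>2 + 3 * CD * (1 + T + T * w)"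
 define C3 where "C3 = 2 + 2 * T * C1\<^sup>2 + C1"
 have C1: "C1 \<ge> 1" proof -
  have "S1 * w \<ge> 0" using S1 w by (intro mult_nonneg_nonneg) auto
  then show ?thesis unfolding C1_def using w by linarith
 qed
 have C0: "C0 > 0" unfolding C0_def using C1 T by (intro add_pos_nonneg mult_nonneg_nonneg) auto
 have C2: "C2 > 0" unfolding C2_def using B CD T w using C0 by (intro add_pos_nonneg mult_pos_pos mult_nonneg_nonneg add_nonneg_nonneg zero_less_power) auto
 have C3: "C3 > 0" unfolding C3_def using C1 T by (intro add_nonneg_pos) auto
 define \<rho> where "\<rho> = Min {1, 1 / (B * C0), 1 / C2, e / C3}"
 have \<rho>: "\<rho> > 0" "\<rho> \<le> 1" "\<rho> \<le> 1 / (B * C0)" "\<rho> \<le> 1 / C2" "\<rho> \<le> e / C3" using B C0 C2 C3 e by (auto simp: \<rho>_def)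
 have \<rho>': "B * (C0 * \<rho>) \<le> 1" "C2 * \<rho> \<le> 1" "C3 * \<rho> \<le> e"
  using \<rho>(3-5) B C0 C2 C3 by (simp_all add: pos_le_divide_eq ac_simps)
 have \<rho>2: "\<rho>\<^sup>2 \<le> \<rho>" "\<rho>\<^sup>2 > 0" "(\<rho>\<^sup>2)\<^sup>2 \<le> \<rho>\<^sup>2" using \<rho>(1,2) by (simp_all add: power2_eq_square mult_le_cancel_left1 mult_le_one)
 \<comment> \<open>The approximation is of order \<rho>^2 in L2, and its square therefore of order
   \<rho>^4: its effect on the monodromy must be of second order in the parameter radius
   \<rho>.\<close>
 obtain f where f: "trig \<omega> f" "integral {0..T} (\<lambda>t. (norm (f t - p0 t))\<^sup>2) \<le> (\<rho>\<^sup>2)\<^sup>2"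
  "continuous_on {0..T} p0 \<Longrightarrow> p0 0 = p0 T \<Longrightarrow> \<forall>t\<in>{0..T}. norm (f t - p0 t) \<le> (\<rho>\<^sup>2)\<^sup>2"
  by (rule trig_approx[OF T p0(1) zero_less_power[OF \<rho>2(2), of 2], folded \<omega>_def]) (rule that)
 obtain P0 Q0 N0 where P0: "bnd 3 Q0 P0" "\<And>n. \<bar>n\<bar> \<ge> N0 \<Longrightarrow> P0 n = 0" "f = fsr \<omega> P0" using trig_coeffs[OF f(1)] by blast
 have lf: "loc_int f" by (rule trig_loc_int[OF f(1)])
 have fi2: "(\<lambda>t. (norm (f t - p0 t))\<^sup>2) integrable_on {0..T}"
 proof -
  obtain b where b: "b > 0" "\<And>t. norm (f t) \<le> b"
  proof (rule that[of "max 1 (Q0 * w)"])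
   show "norm (f t) \<le> max 1 (Q0 * w)" for t unfolding P0(3) w_def using norm_fsr_le[OF bnd_32[OF P0(1)], of \<omega> t] by linarith
  qed simp
  show ?thesis by (rule L2_diff_integrable[OF p0(1) loc_int_measurable[OF lf] b(2)])
 qed
 have lfp: "loc_int (\<lambda>t. f t - p0 t)" by (intro loc_int_diff lf l0)
 have f1: "integral {0..T} (\<lambda>t. norm (f t - p0 t)) \<le> (1 + T) * \<rho>\<^sup>2"
  by (rule L1_le_L2[OF T lfp fi2 \<rho>2(2) f(2)])
 \<comment> \<open>A common bound for all potentials \<open>P x\<close> with |x| <= \<rho> <= 1; it
   must be known before the threshold \<open>K0\<close> is obtained.\<close>
 define Q where "Q = max 1 (Q0 + S1)"
 have Q: "Q \<ge> 1" by (simp add: Q_def)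
 obtain K0 :: int where K0: "\<And>K. K \<ge> K0 \<Longrightarrow> \<exists>S.
  (\<forall>P. bnd 3 Q P \<longrightarrow> (\<forall>n. \<bar>n\<bar> < K \<longrightarrow> S P n = P n) \<and> (\<forall>n. \<bar>n\<bar> \<ge> K \<longrightarrow> norm (S P n) \<le> \<rho>\<^sup>2 * wt 3 n) \<and>
    bnd 3 Q (S P) \<and> dbl_pts T r (fsr (2 * pi / T) (S P))) \<and>
  (\<forall>P P' e. bnd 3 Q P \<longrightarrow> bnd 3 Q P' \<longrightarrow> bnd 3 e (\<lambda>n. P n - P' n) \<longrightarrow> bnd 3 (2 * e) (\<lambda>n. S P n - S P' n))"
  by (rule finite_gap_family[OF T r Q \<rho>2(2) order_trans[OF \<rho>2(1) \<rho>(2)]]) (rule that)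
 \<comment> \<open>Beyond all modes of the polynomial and of the parameter directions: these are
   left untouched by \<open>S\<close>, and the slaved modes are pure additions of size
   \<rho>^2.\<close>
 define K where "K = max K0 (max N0 NX)"
 have "K \<ge> K0" by (simp add: K_def)
 from K0[OF this] obtain S where S0:
  "\<forall>P. bnd 3 Q P \<longrightarrow> (\<forall>n. \<bar>n\<bar> < K \<longrightarrow> S P n = P n) \<and> (\<forall>n. \<bar>n\<bar> \<ge> K \<longrightarrow> norm (S P n) \<le> \<rho>\<^sup>2 * wt 3 n) \<and>
    bnd 3 Q (S P) \<and> dbl_pts T r (fsr (2 * pi / T) (S P))"
  "\<forall>P P' e. bnd 3 Q P \<longrightarrow> bnd 3 Q P' \<longrightarrow> bnd 3 e (\<lambda>n. P n - P' n) \<longrightarrow> bnd 3 (2 * e) (\<lambda>n. S P n - S P' n)" by (elim exE conjE)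
 have S: "\<And>P n. bnd 3 Q P \<Longrightarrow> \<bar>n\<bar> < K \<Longrightarrow> S P n = P n"
  "\<And>P n. bnd 3 Q P \<Longrightarrow> \<bar>n\<bar> \<ge> K \<Longrightarrow> norm (S P n) \<le> \<rho>\<^sup>2 * wt 3 n"
  "\<And>P. bnd 3 Q P \<Longrightarrow> bnd 3 Q (S P)" "\<And>P. bnd 3 Q P \<Longrightarrow> dbl_pts T r (fsr \<omega> (S P))"
  "\<And>P P' e. bnd 3 Q P \<Longrightarrow> bnd 3 Q P' \<Longrightarrow> bnd 3 e (\<lambda>n. P n - P' n) \<Longrightarrow> bnd 3 (2 * e) (\<lambda>n. S P n - S P' n)"
  using S0(1) apply blast
  using S0(1) apply blast
  using S0(1) apply blast
  using S0(1) unfolding \<omega>_def apply blast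
  by (rule S0(2)[rule_format])
 define P where "P x n = P0 n + X x n" for x n
 define p where "p x = fsr \<omega> (S (P x))" for x
 have bP: "bnd 3 Q (P x)" if "norm x \<le> \<rho>" for x
 proof -
  have "norm x * S1 \<le> 1 * S1" using that \<rho>(2) S1 by (intro mult_right_mono) auto
  then show ?thesis using bnd_mono[OF bnd_add[OF P0(1) bX[of x]], of Q] unfolding P_def[abs_def] Q_def by auto
 qed
 have bS: "bnd 3 (\<rho>\<^sup>2) (\<lambda>n. S (P x) n - P x n)" if x: "norm x \<le> \<rho>" for x unfolding bnd_def
 proof
  fix n
  show "norm (S (P x) n - P x n) \<le> \<rho>\<^sup>2 * wt 3 n"
  proof (cases "\<bar>n\<bar> < K")
   case True then show ?thesis using S(1)[OF bP[OF x]] by simp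
  next
   case False
   then have n: "K \<le> \<bar>n\<bar>" "N0 \<le> \<bar>n\<bar>" "NX \<le> \<bar>n\<bar>" by (auto simp: K_def)
   show ?thesis using S(2)[OF bP[OF x] n(1)] P0(2)[OF n(2)] NX[OF n(3), of x] by (simp add: P_def)
  qed
 qed
 define \<eta> where "\<eta> x = fsr \<omega> (\<lambda>n. S (P x) n - P x n)" for x
 have lX: "loc_int (fsr \<omega> (X x))" for x by (rule loc_int_fsr[OF bX])
 have l\<eta>: "loc_int (\<eta> x)" if "norm x \<le> \<rho>" for x unfolding \<eta>_def by (rule loc_int_fsr[OF bS[OF that]])
 have lp: "loc_int (p x)" if "norm x \<le> \<rho>" for x unfolding p_def by (rule loc_int_fsr[OF S(3)[OF bP[OF that]]])
 have dec: "p x t - p0 t = fsr \<omega> (X x) t + ((f t - p0 t) + \<eta> x t)" if x: "norm x \<le> \<rho>" for x t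
 proof -
  have "\<eta> x t = p x t - fsr \<omega> (P x) t"
   unfolding \<eta>_def p_def by (rule fsr_diff[OF bnd_32[OF S(3)[OF bP[OF x]]] bnd_32[OF bP[OF x]]])
  moreover have "fsr \<omega> (P x) t = f t + fsr \<omega> (X x) t"
   unfolding P_def P0(3) by (rule fsr_add[OF bnd_32[OF P0(1)] bnd_32[OF bX]])
  ultimately show ?thesis by simp
 qed
 have nX: "norm (fsr \<omega> (X x) t) \<le> \<rho> * (S1 * w)" if x: "norm x \<le> \<rho>" for x t
 proof -
  have "norm (fsr \<omega> (X x) t) \<le> norm x * S1 * w" unfolding w_def by (rule norm_fsr_le[OF bnd_32[OF bX]])
  also have "\<dots> \<le> \<rho> * S1 * w" using x S1 w by (intro mult_right_mono) auto
  finally show ?thesis by (simp add: mult.assoc)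
 qed
 have n\<eta>: "norm (\<eta> x t) \<le> \<rho>\<^sup>2 * w" if x: "norm x \<le> \<rho>" for x t
  unfolding \<eta>_def w_def by (rule norm_fsr_le[OF bnd_32[OF bS[OF x]]])
 have g1: "norm (p x t - f t) \<le> C1 * \<rho>" if x: "norm x \<le> \<rho>" for x t
 proof -
  have "p x t - f t = fsr \<omega> (X x) t + \<eta> x t" using dec[OF x, of t] by (simp add: algebra_simps)
  then have "norm (p x t - f t) \<le> \<rho> * (S1 * w) + \<rho>\<^sup>2 * w" using nX[OF x, of t] n\<eta>[OF x, of t] norm_triangle_ineq[of "fsr \<omega> (X x) t" "\<eta> x t"] by simp
  also have "\<dots> \<le> \<rho> * (S1 * w) + \<rho> * w" using \<rho>2 w by (intro add_left_mono mult_right_mono) auto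
  finally show ?thesis by (simp add: C1_def algebra_simps)
 qed
 have L1: "integral {0..T} (\<lambda>t. norm (p x t - p0 t)) \<le> C0 * \<rho>" if x: "norm x \<le> \<rho>" for x
 proof -
  have "integral {0..T} (\<lambda>t. norm (p x t - p0 t)) \<le> integral {0..T} (\<lambda>t. C1 * \<rho> + norm (f t - p0 t))"
  proof (intro integral_le loc_int_norm_integrable loc_int_diff lp[OF x] lf l0 integrable_add)
   show "norm (p x t - p0 t) \<le> C1 * \<rho> + norm (f t - p0 t)" for t
    using g1[OF x, of t] norm_triangle_ineq[of "p x t - f t" "f t - p0 t"] by simp
  qed auto
  also have "\<dots> = T * (C1 * \<rho>) + integral {0..T} (\<lambda>t. norm (f t - p0 t))"
   using T by (subst Henstock_Kurzweil_Integration.integral_add) (auto intro!: loc_int_norm_integrable[OF lfp])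
  also have "\<dots> \<le> T * (C1 * \<rho>) + (1 + T) * \<rho>"
  proof (rule add_left_mono, rule order_trans[OF f1])
   show "(1 + T) * \<rho>\<^sup>2 \<le> (1 + T) * \<rho>" using T by (intro mult_left_mono \<rho>2) auto
  qed
  finally show ?thesis by (simp add: C0_def algebra_simps)
 qed
 have ss: "mat s ** mat s = (mat 1 :: cmat2)" using M(2) by (simp add: mat_mm cmat2_eq_iff power2_eq_square)
 have ns: "norm (mat s ** Y) = norm Y" for Y :: cmat2
 proof -
  have "s = 1 \<or> s = -1" using M(2) by (simp add: power2_eq_1_iff)
  then show ?thesis
  proof
   assume "s = -1"
   then have "mat s ** Y = - Y" by (simp add: cmat2_eq_iff mat_mm)
   then show ?thesis by simp
  qed simp
 qed
 define E where "E x = frame (p x) T z - mat s" for x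
 \<comment> \<open>A fixed point \<open>G x = x\<close> means that three entries of the closing
   error vanish. The factor \<open>mat s\<close> removes the sign of the monodromy.\<close>
 define G where "G x = x - upper (mat s ** E x)" for x
 have Gb: "norm (G x) \<le> \<rho>" if x: "norm x \<le> \<rho>" for x
 proof -
  have lr: "loc_int (\<lambda>t. (f t - p0 t) + \<eta> x t)" by (intro loc_int_add lfp l\<eta>[OF x])
  have D: "?D (\<lambda>t. p x t - p0 t) = ?D (fsr \<omega> (X x)) + ?D (\<lambda>t. (f t - p0 t) + \<eta> x t)"
   unfolding dec[OF x] by (rule mono_deriv_add[OF l0 lX lr])
  have r0: "norm (E x - ?D (\<lambda>t. p x t - p0 t) ** mat s) \<le> B * (C0 * \<rho>)\<^sup>2"
   using B(2)[OF lp[OF x] L1[OF x] \<rho>'(1), of T] T by (simp add: E_def M mono_deriv_def)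
  have r0': "mat s ** (E x - ?D (\<lambda>t. p x t - p0 t) ** mat s) = mat s ** E x - ?D (\<lambda>t. p x t - p0 t)"
  proof -
   have c: "Y ** mat s = mat s ** Y" for Y :: cmat2 by (simp add: cmat2_eq_iff mat_mm mm_mat mult.commute)
   have "mat s ** (Y ** mat s) = Y" for Y :: cmat2 unfolding c[of Y] matrix_mul_assoc ss by simp
   then show ?thesis by (simp add: mm.diff_right)
  qed
  have r1: "norm (mat s ** E x - ?D (\<lambda>t. p x t - p0 t)) \<le> B * (C0 * \<rho>)\<^sup>2" unfolding r0'[symmetric] ns by (rule r0)
  have r2: "norm (?D (\<lambda>t. (f t - p0 t) + \<eta> x t)) \<le> CD * ((1 + T + T * w) * \<rho>\<^sup>2)"
  proof (rule order_trans[OF CD(2)[OF lr]], rule mult_left_mono)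
   have "integral {0..T} (\<lambda>t. norm ((f t - p0 t) + \<eta> x t)) \<le> integral {0..T} (\<lambda>t. \<rho>\<^sup>2 * w + norm (f t - p0 t))"
   proof (intro integral_le loc_int_norm_integrable lr integrable_add lfp)
    show "norm ((f t - p0 t) + \<eta> x t) \<le> \<rho>\<^sup>2 * w + norm (f t - p0 t)" for t
     using n\<eta>[OF x, of t] norm_triangle_ineq[of "f t - p0 t" "\<eta> x t"] by simp
   qed auto
   also have "\<dots> = T * (\<rho>\<^sup>2 * w) + integral {0..T} (\<lambda>t. norm (f t - p0 t))"
    using T by (subst Henstock_Kurzweil_Integration.integral_add) (auto intro!: loc_int_norm_integrable[OF lfp])
   finally show "integral {0..T} (\<lambda>t. norm ((f t - p0 t) + \<eta> x t)) \<le> (1 + T + T * w) * \<rho>\<^sup>2" using f1 by (simp add: algebra_simps)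
  qed (use CD in simp)
  have tri: "norm (- a - b) \<le> norm a + norm b" for a b :: "complex \<times> complex \<times> complex" using norm_triangle_ineq4[of "- a" b] by simp
  \<comment> \<open>The derivative in the direction \<open>X x\<close> is exactly \<open>x\<close>
    and cancels; the Taylor remainder and the effect of the approximation and of the slaved tail are
    left.\<close>
  have Gx: "G x = - upper (mat s ** E x - ?D (\<lambda>t. p x t - p0 t)) - upper (?D (\<lambda>t. (f t - p0 t) + \<eta> x t))"
   unfolding D by (simp add: G_def up.diff up.add DX)
  have "norm (G x) \<le> norm (upper (mat s ** E x - ?D (\<lambda>t. p x t - p0 t))) + norm (upper (?D (\<lambda>t. (f t - p0 t) + \<eta> x t)))"
   unfolding Gx by (rule tri)
  also have "\<dots> \<le> 3 * (B * (C0 * \<rho>)\<^sup>2) + 3 * (CD * ((1 + T + T * w) * \<rho>\<^sup>2))"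
   using order_trans[OF norm_upper_le mult_left_mono[OF r1]] order_trans[OF norm_upper_le mult_left_mono[OF r2]] by (intro add_mono) auto
  also have "\<dots> = (C2 * \<rho>) * \<rho>" by (simp add: C2_def power2_eq_square algebra_simps)
  also have "\<dots> \<le> 1 * \<rho>" using \<rho>'(2) \<rho>(1) by (intro mult_right_mono) auto
  finally show ?thesis by simp
 qed
 have lip: "norm (p y t - p x t) \<le> norm (y - x) * (2 * S1 * w)" if x: "norm x \<le> \<rho>" "norm y \<le> \<rho>" for x y t
 proof -
  have "bnd 3 (norm (y - x) * S1) (\<lambda>n. P y n - P x n)" using bX[of "y - x"] by (simp add: P_def Xd)
  from S(5)[OF bP[OF x(2)] bP[OF x(1)] this] have b: "bnd 3 (2 * (norm (y - x) * S1)) (\<lambda>n. S (P y) n - S (P x) n)" .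
  have "p y t - p x t = fsr \<omega> (\<lambda>n. S (P y) n - S (P x) n) t"
   unfolding p_def by (rule fsr_diff[OF bnd_32[OF S(3)[OF bP[OF x(2)]]] bnd_32[OF S(3)[OF bP[OF x(1)]]], symmetric])
  then show ?thesis using norm_fsr_le[OF bnd_32[OF b], of \<omega> t] by (simp add: w_def ac_simps)
 qed
 have cE: "continuous_on (cball 0 \<rho>) (\<lambda>x. frame (p x) T z)"
  unfolding continuous_on_iff
 proof (intro ballI allI impI)
  fix x :: "complex \<times> complex \<times> complex" and \<epsilon> :: real assume x: "x \<in> cball 0 \<rho>" and \<epsilon>: "\<epsilon> > 0"
  then have nx: "norm x \<le> \<rho>" by simp
  obtain b where b: "b > 0"
   "\<And>q d t. loc_int q \<Longrightarrow> integral {0..T} (\<lambda>s. norm (q s - p x s)) \<le> d \<Longrightarrow> b * d \<le> 1 \<Longrightarrow> 0 \<le> t \<Longrightarrow> t \<le> T \<Longrightarrow>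
    norm (frame q t z - frame (p x) t z) \<le> b * d"
   by (rule frame_stability[OF lp[OF nx] less_imp_le[OF T], of z]) (rule that, assumption, blast)
  define L where "L = b * T * (2 * S1 * w) + 1"
  have L: "L \<ge> 1" using b T S1 w by (simp add: L_def)
  show "\<exists>d>0. \<forall>y\<in>cball 0 \<rho>. dist y x < d \<longrightarrow> dist (frame (p y) T z) (frame (p x) T z) < \<epsilon>"
  proof (intro exI[of _ "min 1 \<epsilon> / L"] conjI ballI impI)
   show "min 1 \<epsilon> / L > 0" using \<epsilon> L by simp
   fix y assume y: "y \<in> cball 0 \<rho>" and d: "dist y x < min 1 \<epsilon> / L"
   have ny: "norm y \<le> \<rho>" using y by simp
   define D where "D = T * (norm (y - x) * (2 * S1 * w))"
   have "norm (y - x) * L < min 1 \<epsilon>" using d L by (simp add: dist_norm pos_less_divide_eq)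
   moreover have "b * D \<le> norm (y - x) * L" by (simp add: D_def L_def algebra_simps)
   ultimately have bD: "b * D < min 1 \<epsilon>" by linarith
   have "integral {0..T} (\<lambda>s. norm (p y s - p x s)) \<le> integral {0..T} (\<lambda>s. norm (y - x) * (2 * S1 * w))"
    by (intro integral_le loc_int_norm_integrable loc_int_diff lp nx ny lip) auto
   also have "\<dots> = D" using T by (simp add: D_def)
   finally have "norm (frame (p y) T z - frame (p x) T z) \<le> b * D"
    using bD T by (intro b(2) lp ny) auto
   then show "dist (frame (p y) T z) (frame (p x) T z) < \<epsilon>" using bD by (simp add: dist_norm)
  qed
 qed
 have cG: "continuous_on (cball 0 \<rho>) G"
  unfolding G_def E_def
  by (intro continuous_intros bounded_linear.continuous_on[OF bounded_linear_upper] continuous_on_mm cE)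
 obtain x where x: "x \<in> cball 0 \<rho>" "G x = x"
  by (rule brouwer_ball[OF \<rho>(1) cG]) (use Gb in auto)
 then have nx: "norm x \<le> \<rho>" by simp
 \<comment> \<open>Three entries of the monodromy now agree with those of \<open>mat s\<close>; the
   remaining one follows from determinant 1 and s^2 = 1.\<close>
 have "upper (mat s ** E x) = 0" using x(2) by (simp add: G_def)
 moreover have s0: "s \<noteq> 0" using M(2) by auto
 ultimately have En: "frame (p x) T z $ 1 $ 1 = s" "frame (p x) T z $ 1 $ 2 = 0" "frame (p x) T z $ 2 $ 1 = 0"
  by (simp_all add: upper_def zero_prod_def mat_mm E_def)
 have "s * frame (p x) T z $ 2 $ 2 = s * s" using det_frame[OF lp[OF nx], of T z] En M(2) by (simp add: det_2 power2_eq_square)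
 then have mono: "frame (p x) T z = mat s" using En s0 by (simp add: cmat2_eq_iff)
 show ?thesis
 proof (rule that[of Q "S (P x)", folded \<omega>_def])
  show "bnd 3 Q (S (P x))" by (rule S(3)[OF bP[OF nx]])
  show "frame (fsr \<omega> (S (P x))) T z = mat s" using mono by (simp add: p_def)
  show "dbl_pts T r (fsr \<omega> (S (P x)))" by (rule S(4)[OF bP[OF nx]])
  have s2: "(norm (p x t - p0 t))\<^sup>2 \<le> 2 * (C1 * \<rho>)\<^sup>2 + 2 * (norm (f t - p0 t))\<^sup>2" for t
  proof -
   have "norm (p x t - p0 t) \<le> C1 * \<rho> + norm (f t - p0 t)" using g1[OF nx, of t] norm_triangle_ineq[of "p x t - f t" "f t - p0 t"] by simp
   then have "(norm (p x t - p0 t))\<^sup>2 \<le> (C1 * \<rho> + norm (f t - p0 t))\<^sup>2" by (rule power_mono) simp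
   then show ?thesis using sum_squares_bound[of "C1 * \<rho>" "norm (f t - p0 t)"] by (simp add: power2_sum)
  qed
  have i2: "(\<lambda>t. 2 * (C1 * \<rho>)\<^sup>2 + 2 * (norm (f t - p0 t))\<^sup>2) integrable_on {0..T}"
   by (intro integrable_add integrable_on_mult_right fi2) auto
  have "integral {0..T} (\<lambda>t. (norm (p x t - p0 t))\<^sup>2) \<le> integral {0..T} (\<lambda>t. 2 * (C1 * \<rho>)\<^sup>2 + 2 * (norm (f t - p0 t))\<^sup>2)"
  proof (cases "(\<lambda>t. (norm (p x t - p0 t))\<^sup>2) integrable_on {0..T}")
   case True then show ?thesis by (rule integral_le[OF _ i2 s2])
  next
   case False
   moreover have "0 \<le> integral {0..T} (\<lambda>t. 2 * (C1 * \<rho>)\<^sup>2 + 2 * (norm (f t - p0 t))\<^sup>2)" by (rule integral_nonneg[OF i2]) simp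
   ultimately show ?thesis by (simp add: not_integrable_integral)
  qed
  also have "\<dots> = T * (2 * (C1 * \<rho>)\<^sup>2) + 2 * integral {0..T} (\<lambda>t. (norm (f t - p0 t))\<^sup>2)"
   using T by (subst Henstock_Kurzweil_Integration.integral_add) (auto intro!: integrable_on_mult_right fi2)
  also have "\<dots> \<le> T * (2 * (C1 * \<rho>)\<^sup>2) + 2 * \<rho>\<^sup>2" using f(2) \<rho>2(3) by simp
  also have "\<dots> = (2 + 2 * T * C1\<^sup>2) * \<rho>\<^sup>2" by (simp add: power_mult_distrib algebra_simps)
  also have "\<dots> \<le> C3 * \<rho>" using \<rho>2 C1 T by (intro mult_mono) (auto simp: C3_def)
  finally show "integral {0..T} (\<lambda>t. (norm (fsr \<omega> (S (P x)) t - p0 t))\<^sup>2) \<le> e" using \<rho>'(3) by (simp add: p_def)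
  assume c: "continuous_on {0..T} p0" "p0 0 = p0 T"
  show "\<forall>t\<in>{0..T}. norm (fsr \<omega> (S (P x)) t - p0 t) \<le> e"
  proof
   fix t assume "t \<in> {0..T}"
   then have "norm (f t - p0 t) \<le> \<rho>" using f(3)[OF c] \<rho>2 by fastforce
   then have "norm (p x t - p0 t) \<le> C1 * \<rho> + 1 * \<rho>" using g1[OF nx, of t] norm_triangle_ineq[of "p x t - f t" "f t - p0 t"] by simp
   also have "\<dots> \<le> C3 * \<rho>"
    unfolding distrib_right[symmetric] using \<rho>(1) C1 T by (intro mult_right_mono) (auto simp: C3_def)
   finally show "norm (fsr \<omega> (S (P x)) t - p0 t) \<le> e" using \<rho>'(3) by (simp add: p_def)
  qed
 qed
qed

section \<open>Total torsion\<close>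

lemma continuous_AE_eq_Icc:
 fixes f g :: "real \<Rightarrow> complex"
 assumes c: "continuous_on {a..b} f" "continuous_on {a..b} g" and ab: "a < b" and ae: "AE t in lebesgue. f t = g t"
  and t: "t \<in> {a..b}"
 shows "f t = g t"
proof -
 obtain N where N: "negligible N" "\<And>t. t \<notin> N \<Longrightarrow> f t = g t" using AE_imp_negligible[OF ae] by blast
 have "integral {a..b} (\<lambda>t. norm (f t - g t)) = integral {a..b} (\<lambda>t. 0)"
  by (rule integral_spike[OF N(1)]) (simp add: N(2))
 then have i: "integral {a..b} (\<lambda>t. norm (f t - g t)) = 0" by simp
 have "continuous_on {a..b} (\<lambda>t. norm (f t - g t))" by (intro continuous_intros c)
 from integral_eq_0_iff[OF this ab] i have "\<forall>t\<in>{a..b}. norm (f t - g t) = 0" by simp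
 then show ?thesis using t by simp
qed

lemma torsion_primitive:
 fixes \<tau> :: "real \<Rightarrow> real" and b :: real
 assumes "continuous_on UNIV \<tau>"
 shows "continuous_on {0..b} (\<lambda>t. LBINT s=0..ereal t. \<tau> s)"
proof -
 have "(LBINT s=0..ereal t. \<tau> s) = integral {0..t} \<tau>" if "t \<in> {0..b}" for t
  using interval_integral_eq_integral[of 0 t \<tau>] that borel_integrable_atLeastAtMost'[OF continuous_on_subset[OF assms], of 0 t]
  by (simp add: zero_ereal_def)
 moreover have "continuous_on {0..b} (\<lambda>t. integral {0..t} \<tau>)"
  by (intro indefinite_integral_continuous_1 integrable_continuous_interval continuous_on_subset[OF assms]) simp
 ultimately show ?thesis by (auto elim!: continuous_on_eq)
qed

text \<open>The phases \<open>\<phi>'\<close> and \<open>\<phi>\<close> never differ by a quarter turn, so their difference stays in one window.\<close>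

lemma phase_close:
 fixes \<phi> \<phi>' :: "real \<Rightarrow> real"
 assumes T: "T > 0" and c: "continuous_on {0..T} \<phi>" "continuous_on {0..T} \<phi>'" "\<phi> 0 = 0" "\<phi>' 0 = 0"
  and k: "\<And>t. \<kappa> t > 0" "\<And>t. \<kappa>' t > (0 :: real)" and d: "norm d = 1"
  and cl: "\<And>t. t \<in> {0..T} \<Longrightarrow> norm (of_real (\<kappa>' t) * cis (\<phi>' t) - d * (of_real (\<kappa> t) * cis (\<phi> t))) < \<kappa> t"
  and e: "cis (\<phi>' T) = cis (\<phi> T)"
 shows "\<phi>' T = \<phi> T"
proof -
 define \<psi> where "\<psi> = Arg d"
 have d0: "d \<noteq> 0" using d by auto
 have dc: "d = cis \<psi>" using d rcis_cmod_Arg[of d] by (simp add: \<psi>_def rcis_def)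
 define x where "x t = \<phi>' t - \<phi> t - \<psi>" for t
 have cos0: "cos (x t) > 0" if t: "t \<in> {0..T}" for t
 proof -
  \<comment> \<open>Dividing out a unit factor leaves |\<kappa>' exp(i x) - \<kappa>| < \<kappa>, so
    the real part \<kappa>' cos x is positive.\<close>
  have "of_real (\<kappa>' t) * cis (\<phi>' t) - d * (of_real (\<kappa> t) * cis (\<phi> t)) = cis (\<psi> + \<phi> t) * (of_real (\<kappa>' t) * cis (x t) - of_real (\<kappa> t))"
  proof -
   have "cis (\<phi>' t) = cis (\<psi> + \<phi> t) * cis (x t)" "d * cis (\<phi> t) = cis (\<psi> + \<phi> t)"
    by (simp_all add: cis_mult x_def dc)
   then show ?thesis by (simp add: algebra_simps)
  qed
  then have "norm (of_real (\<kappa>' t) * cis (x t) - of_real (\<kappa> t)) < \<kappa> t" using cl[OF t] by (simp add: norm_mult)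
  moreover have "\<bar>Re (of_real (\<kappa>' t) * cis (x t) - of_real (\<kappa> t))\<bar> \<le> norm (of_real (\<kappa>' t) * cis (x t) - of_real (\<kappa> t))" by (rule abs_Re_le_cmod)
  ultimately have "\<kappa>' t * cos (x t) > 0" by simp
  then show ?thesis using k(2)[of t] by (simp add: zero_less_mult_iff)
 qed
 have cx: "continuous_on {0..T} x" unfolding x_def by (intro continuous_intros c)
 have x0: "x 0 = - \<psi>" by (simp add: x_def c)
 have b0: "\<bar>\<psi>\<bar> < pi / 2"
 proof -
  have "cos \<psi> > 0" using cos0[of 0] T x0 by simp
  then have "Re d > 0" by (simp add: dc)
  then show ?thesis unfolding \<psi>_def Arg_Re_pos by simp
 qed
 have x0b: "x 0 \<le> pi / 2" "- (pi / 2) \<le> x 0" using x0 b0 by linarith+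
 have win: "\<bar>x T\<bar> < pi / 2"
 proof (rule ccontr)
  assume "\<not> ?thesis"
  then consider "x T \<ge> pi / 2" | "x T \<le> - (pi / 2)" by linarith
  then have "\<exists>t\<in>{0..T}. cos (x t) = 0"
  proof cases
   case 1
   then obtain t where "0 \<le> t" "t \<le> T" "x t = pi / 2" using IVT'[OF x0b(1) 1 less_imp_le[OF T] cx] by blast
   moreover from this(3) have "cos (x t) = 0" by (simp only: cos_pi_half)
   ultimately show ?thesis using atLeastAtMost_iff by blast
  next
   case 2
   then obtain t where "0 \<le> t" "t \<le> T" "x t = - (pi / 2)" using IVT2'[OF 2 x0b(2) less_imp_le[OF T] cx] by blast
   moreover from this(3) have "cos (x t) = 0" by (simp only: cos_minus cos_pi_half)
   ultimately show ?thesis using atLeastAtMost_iff by blast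
  qed
  then show False using cos0 by fastforce
 qed
 have "cis (\<phi>' T - \<phi> T) = 1" using e by (simp add: cis_divide[symmetric])
 then obtain n :: int where n: "\<phi>' T - \<phi> T = of_int n * (2 * pi)" unfolding cis_eq_1_iff by blast
 \<comment> \<open>Two quarter turns: one bounds \<open>x T\<close>, the other the constant phase
   \<psi>. A multiple of 2 pi below pi is 0.\<close>
 have "\<bar>\<phi>' T - \<phi> T\<bar> < pi" using win b0 by (simp add: x_def abs_if split: if_splits)
 then have "\<bar>real_of_int n\<bar> * (2 * pi) < pi" by (simp add: n abs_mult)
 moreover have "1 * (2 * pi) \<le> \<bar>real_of_int n\<bar> * (2 * pi)" if "\<bar>real_of_int n\<bar> \<ge> 1" using that by (intro mult_right_mono) auto
 ultimately have "\<bar>real_of_int n\<bar> < 1" using pi_gt_zero by fastforce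
 then have "n = 0" by linarith
 then show ?thesis using n by simp
qed

text \<open>The expression with curvature and torsion is a continuous complex curvature and agrees
  with \<open>q\<close> up to a constant phase. Its quasi-periodicity therefore holds at every
  point, in particular at 0, where modulus and phase can be compared.\<close>

lemma torsion_cis:
 assumes T: "T > 0" and g: "complex_curvature \<gamma> q" "quasi_periodic T \<theta> q" and ct: "curvature_torsion \<gamma> \<kappa> \<tau>"
 shows "cis (LBINT s=0..T. \<tau> s) = cis (\<theta> * T)" "\<kappa> T = \<kappa> 0"
proof -
 define \<phi> where "\<phi> t = (LBINT s=0..ereal t. \<tau> s)" for t
 define k where "k t = complex_of_real (\<kappa> t) * cis (\<phi> t)" for t
 have pos: "\<kappa> t > 0" for t using ct by (simp add: curvature_torsion_def)
 have ck: "continuous_on S \<kappa>" for S using ct unfolding curvature_torsion_def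
  by (intro continuous_at_imp_continuous_on ballI differentiable_imp_continuous_within) auto
 have c\<phi>: "continuous_on {0..b} \<phi>" for b unfolding \<phi>_def by (rule torsion_primitive) (use ct in \<open>simp add: curvature_torsion_def\<close>)
 have kc: "continuous_on {0..b} k" for b unfolding k_def by (intro continuous_intros ck c\<phi>)
 have "complex_curvature \<gamma> k" using ct by (simp add: curvature_torsion_def k_def[abs_def] \<phi>_def)
 then obtain c where c: "norm c = 1" "AE t in lebesgue. k t = c * q t" by (rule complex_curvature_unique[OF g(1)])
 have "AE t in lebesgue. k (t + T) = cis (\<theta> * T) * k t"
  using quasi_periodic_phase[OF c(2) g(2)] by (simp add: quasi_periodic_def)
 then have "k (0 + T) = cis (\<theta> * T) * k 0"
 proof (rule continuous_AE_eq_Icc[of 0 T "\<lambda>t. k (t + T)" "\<lambda>t. cis (\<theta> * T) * k t", rotated 3])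
  show "continuous_on {0..T} (\<lambda>t. k (t + T))"
   by (rule continuous_on_compose2[OF kc[of "2 * T"]]) (auto intro!: continuous_intros)
 qed (use T in \<open>auto intro!: continuous_intros kc\<close>)
 moreover have "\<phi> 0 = 0" by (simp add: \<phi>_def zero_ereal_def)
 ultimately have e: "of_real (\<kappa> T) * cis (\<phi> T) = of_real (\<kappa> 0) * cis (\<theta> * T)" by (simp add: k_def)
 from arg_cong[OF this, of norm] show "\<kappa> T = \<kappa> 0" using pos[of 0] pos[of T] by (simp add: norm_mult)
 then show "cis (LBINT s=0..T. \<tau> s) = cis (\<theta> * T)" using e pos[of 0] by (simp add: \<phi>_def)
qed

text \<open>The curvature and torsion functions of \<eta> determine \<open>q\<close> only up to a
  constant phase, which is the phase \<open>d\<close> allowed in \<open>phase_close\<close>.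
  Closeness below \<kappa> keeps the two curvatures within a quarter turn of each other.\<close>

lemma torsion_close:
 assumes T: "T > 0" and a: "curvature_torsion \<gamma> \<kappa> \<tau>" and b: "complex_curvature \<eta> q" "curvature_torsion \<eta> \<kappa>' \<tau>'"
  and q: "continuous_on {0..T} q"
  and cl: "\<And>t. t \<in> {0..T} \<Longrightarrow> norm (q t - of_real (\<kappa> t) * cis (LBINT s=0..t. \<tau> s)) < \<kappa> t"
  and e: "cis (LBINT s=0..T. \<tau>' s) = cis (LBINT s=0..T. \<tau> s)"
 shows "(LBINT s=0..T. \<tau>' s) = (LBINT s=0..T. \<tau> s)"
proof -
 define k where "k t = complex_of_real (\<kappa>' t) * cis (LBINT s=0..ereal t. \<tau>' s)" for t
 have pos: "\<kappa> t > 0" "\<kappa>' t > 0" for t using a b by (auto simp: curvature_torsion_def)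
 have tc: "continuous_on UNIV \<tau>" "continuous_on UNIV \<tau>'" using a b by (auto simp: curvature_torsion_def)
 have ck: "continuous_on S \<kappa>'" for S using b unfolding curvature_torsion_def
  by (intro continuous_at_imp_continuous_on ballI differentiable_imp_continuous_within) auto
 have kc: "continuous_on {0..T} k" unfolding k_def by (intro continuous_intros ck torsion_primitive tc)
 have "complex_curvature \<eta> k" using b by (simp add: curvature_torsion_def k_def[abs_def])
 then obtain c where c: "norm c = 1" "AE t in lebesgue. k t = c * q t" by (rule complex_curvature_unique[OF b(1)])
 have kq: "k t = c * q t" if "t \<in> {0..T}" for t
  by (rule continuous_AE_eq_Icc[OF kc _ T c(2) that]) (intro continuous_intros q)
 show ?thesis
 proof (rule phase_close[OF T torsion_primitive[OF tc(1)] torsion_primitive[OF tc(2)] _ _ pos c(1) _ e])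
  fix t assume t: "t \<in> {0..T}"
  have "complex_of_real (\<kappa>' t) * cis (LBINT s=0..ereal t. \<tau>' s) - c * (of_real (\<kappa> t) * cis (LBINT s=0..t. \<tau> s))
    = c * (q t - of_real (\<kappa> t) * cis (LBINT s=0..t. \<tau> s))"
   using kq[OF t] by (simp add: k_def algebra_simps)
  then show "norm (complex_of_real (\<kappa>' t) * cis (LBINT s=0..ereal t. \<tau>' s) - c * (of_real (\<kappa> t) * cis (LBINT s=0..t. \<tau> s))) < \<kappa> t"
   using cl[OF t] c(1) by (simp add: norm_mult)
 qed (simp_all add: zero_ereal_def)
qed

text \<open>Any other pair of curvature and torsion functions of the same curve has the same total
  torsion: \<open>torsion_close\<close> is applied to the curve itself, at distance 0.\<close>

lemma average_torsion_unique:
 assumes T: "T > 0" and g: "complex_curvature \<gamma> q" "quasi_periodic T \<theta> q" and ct: "curvature_torsion \<gamma> \<kappa> \<tau>"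
  and \<theta>: "(LBINT s=0..T. \<tau> s) = \<theta> * T"
 shows "average_torsion T \<gamma> \<theta>"
 unfolding average_torsion_def
proof (intro conjI allI impI)
 show "\<exists>q. complex_curvature \<gamma> q \<and> quasi_periodic T \<theta> q" using g by blast
 fix \<kappa>' \<tau>' assume b: "curvature_torsion \<gamma> \<kappa>' \<tau>'"
 have tc: "continuous_on UNIV \<tau>" and pos: "\<kappa> t > 0" for t using ct by (auto simp: curvature_torsion_def)
 have ck: "continuous_on {0..T} \<kappa>" using ct unfolding curvature_torsion_def
  by (intro continuous_at_imp_continuous_on ballI differentiable_imp_continuous_within) auto
 have "continuous_on {0..T} (\<lambda>t. of_real (\<kappa> t) * cis (LBINT s=0..ereal t. \<tau> s))"
  by (intro continuous_intros ck torsion_primitive[OF tc])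
 then have "(LBINT s=0..T. \<tau>' s) = (LBINT s=0..T. \<tau> s)"
  using torsion_close[OF T ct _ b, of "\<lambda>t. of_real (\<kappa> t) * cis (LBINT s=0..ereal t. \<tau> s)"] ct pos torsion_cis(1)[OF T g b] torsion_cis(1)[OF T g ct]
  by (simp add: curvature_torsion_def)
 then show "\<theta> = (LBINT s=0..T. \<tau>' s) / T" using \<theta> T by simp
qed

lemma average_torsion_vacuous:
 assumes "complex_curvature \<gamma> q" "quasi_periodic T \<theta> q" "\<And>\<kappa> \<tau>. \<not> curvature_torsion \<gamma> \<kappa> \<tau>"
 shows "average_torsion T \<gamma> \<theta>"
 using assms unfolding average_torsion_def by blast

section \<open>Potentials of constant modulus\<close>

lemma scaleR_mat1: "r *\<^sub>R (mat 1 :: cmat2) = mat (of_real r)"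
 by (simp add: cmat2_eq_iff of_real_def)

text \<open>The coefficient matrix squares to -w^2, so its exponential is cos(w t) + sin(w t) / w
  times the matrix.\<close>

lemma frame_const:
 assumes w: "w \<noteq> 0" "4 * w\<^sup>2 = l\<^sup>2 + (norm a)\<^sup>2"
 shows "frame (\<lambda>t. a) t (of_real l) = cos (w * t) *\<^sub>R mat 1 + (sin (w * t) / w) *\<^sub>R alpha (\<lambda>t. a) (of_real l) 0"
proof -
 define A where "A = alpha (\<lambda>t. a) (of_real l) 0"
 have A: "alpha (\<lambda>t. a) (of_real l) t = A" for t by (simp add: A_def alpha_def)
 have AA: "A ** A = - w\<^sup>2 *\<^sub>R mat 1"
 proof -
  have w2: "w\<^sup>2 = (l\<^sup>2 + (norm a)\<^sup>2) / 4" using w by simp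
  have "of_real (w\<^sup>2) = (of_real l * of_real l + a * cnj a) / 4" unfolding w2 complex_norm_square[symmetric] by (simp add: power2_eq_square)
  then have "- of_real (w\<^sup>2) = - (of_real l * of_real l + a * cnj a) / (4 :: complex)" by simp
  then show ?thesis unfolding scaleR_mat1 cmat2_eq_iff mm_nth mat_nth A_def alpha_nth
   by (simp add: field_simps)
 qed
 define F where "F t = cos (w * t) *\<^sub>R mat 1 + (sin (w * t) / w) *\<^sub>R A" for t
 have FA: "F t ** A = (- w * sin (w * t)) *\<^sub>R mat 1 + cos (w * t) *\<^sub>R A" for t
  using w(1) by (simp add: F_def mm.add_left mm.scaleR_left AA power2_eq_square)
 have d1: "((\<lambda>t. cos (w * t) *\<^sub>R X) has_vector_derivative (- w * sin (w * t)) *\<^sub>R X) (at t)" for X :: cmat2 and t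
 proof -
  have "((\<lambda>t. cos (w * t) *\<^sub>R X) has_vector_derivative cos (w * t) *\<^sub>R 0 + (- w * sin (w * t)) *\<^sub>R X) (at t)"
   by (rule has_vector_derivative_scaleR[OF _ has_vector_derivative_const]) (auto intro!: derivative_eq_intros)
  then show ?thesis by simp
 qed
 have d2: "((\<lambda>t. (sin (w * t) / w) *\<^sub>R X) has_vector_derivative cos (w * t) *\<^sub>R X) (at t)" for X :: cmat2 and t
 proof -
  have "((\<lambda>t. (sin (w * t) / w) *\<^sub>R X) has_vector_derivative (sin (w * t) / w) *\<^sub>R 0 + cos (w * t) *\<^sub>R X) (at t)"
   by (rule has_vector_derivative_scaleR[OF _ has_vector_derivative_const]) (use w(1) in \<open>auto intro!: derivative_eq_intros\<close>)
  then show ?thesis by simp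
 qed
 have "(F has_vector_derivative (- w * sin (w * t)) *\<^sub>R mat 1 + cos (w * t) *\<^sub>R A) (at t)" for t
  unfolding F_def[abs_def] by (rule has_vector_derivative_add[OF d1 d2])
 then have "(F has_vector_derivative F t ** alpha (\<lambda>t. a) (of_real l) t) (at t)" for t unfolding A FA .
 moreover have "continuous_on UNIV (\<lambda>t. F t ** alpha (\<lambda>t. a) (of_real l) t)"
  unfolding A FA by (intro continuous_intros)
 ultimately have "has_ac_derivative F (\<lambda>t. F t ** alpha (\<lambda>t. a) (of_real l) t)" by (rule has_vector_derivative_imp_ac)
 moreover have "F 0 = mat 1" by (simp add: F_def)
 moreover have "loc_int (\<lambda>t. a)" by (rule loc_int_const)
 ultimately show ?thesis using frame_eqI[of "\<lambda>t. a" F "of_real l" t] by (simp add: F_def A_def)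
qed

text \<open>The monodromy is a sign as soon as w T is a multiple of pi, that is l^2 + |a|^2 = (2 pi
  k / T)^2; such l approach 2 pi k / T as |k| grows.\<close>

lemma dbl_pts_const:
 assumes T: "T > 0" and r: "r > 0" shows "dbl_pts T r (\<lambda>t. a)"
 unfolding dbl_pts_def
proof (intro exI[of _ "max 1 (max \<lceil>norm a * T\<rceil> \<lceil>(norm a)\<^sup>2 * T / r\<rceil>)"] allI impI)
 \<comment> \<open>The threshold makes W = 2 pi |k| / T at least |a|, so that the square root is
   real, and |a|^2 / W at most r.\<close>
 fix k :: int assume k: "max 1 (max \<lceil>norm a * T\<rceil> \<lceil>(norm a)\<^sup>2 * T / r\<rceil>) \<le> \<bar>k\<bar>"
 define x W where "x = norm a" and "W = 2 * pi / T * \<bar>of_int k\<bar>"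
 have k1: "\<bar>real_of_int k\<bar> \<ge> 1" "\<bar>real_of_int k\<bar> \<ge> x * T" "\<bar>real_of_int k\<bar> \<ge> x\<^sup>2 * T / r"
  using k by (simp_all add: x_def ceiling_le_iff) linarith+
 have WT: "W * T = 2 * pi * \<bar>of_int k\<bar>" using T by (simp add: W_def)
 have W1: "W * T \<ge> \<bar>of_int k\<bar>"
 proof -
  have "1 * \<bar>real_of_int k\<bar> \<le> (2 * pi) * \<bar>of_int k\<bar>" using pi_gt3 by (intro mult_right_mono) auto
  then show ?thesis using WT by simp
 qed
 have "x * T \<le> W * T" using W1 k1 by linarith
 then have xW: "x \<le> W" using T by simp
 have "0 < W * T" using W1 k1 by linarith
 then have W0: "W > 0" using T by (simp add: zero_less_mult_iff)
 have x0: "x \<ge> 0" by (simp add: x_def)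
 have "x\<^sup>2 * T / r \<le> W * T" using W1 k1 by linarith
 then have "x\<^sup>2 * T \<le> W * r * T" using r by (simp add: pos_divide_le_eq ac_simps)
 then have "x\<^sup>2 \<le> W * r" using T by simp
 then have xr: "x\<^sup>2 / W \<le> r" using W0 by (simp add: pos_divide_le_eq mult.commute)
 have x2: "x\<^sup>2 \<le> W\<^sup>2" using xW x0 by (intro power_mono)
 define S where "S = sqrt (W\<^sup>2 - x\<^sup>2)"
 have S2: "S\<^sup>2 = W\<^sup>2 - x\<^sup>2" using x2 by (simp add: S_def)
 have SW: "S \<le> W" using W0 by (auto simp: S_def intro!: real_le_lsqrt)
 \<comment> \<open>Squaring reduces this to (x^2 / W)^2 <= x^2, which holds because x <= W.\<close>
 have "W - x\<^sup>2 / W \<le> S" unfolding S_def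
 proof (rule real_le_rsqrt)
  have "(x\<^sup>2 / W)\<^sup>2 = x\<^sup>2 * (x\<^sup>2 / W\<^sup>2)" by (simp add: power2_eq_square)
  also have "\<dots> \<le> x\<^sup>2 * 1" using x2 W0 by (intro mult_left_mono) auto
  finally show "(W - x\<^sup>2 / W)\<^sup>2 \<le> W\<^sup>2 - x\<^sup>2" using W0 by (simp add: power2_diff)
 qed
 then have Wr: "\<bar>W - S\<bar> \<le> r" using xr SW by linarith
 define l where "l = (if k > 0 then S else - S)"
 have l2: "l\<^sup>2 = W\<^sup>2 - x\<^sup>2" using S2 by (simp add: l_def)
 have lk: "\<bar>l - 2 * pi / T * of_int k\<bar> \<le> r"
 proof (cases "k > 0")
  case True then show ?thesis using Wr by (simp add: l_def W_def abs_minus_commute)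
 next
  case False then show ?thesis using Wr by (simp add: l_def W_def)
 qed
 have w: "W / 2 \<noteq> 0" "4 * (W / 2)\<^sup>2 = l\<^sup>2 + (norm a)\<^sup>2" using W0 l2 by (simp_all add: power_divide x_def)
 have wT: "W / 2 * T = of_int \<bar>k\<bar> * pi" using WT by simp
 have "sin (W / 2 * T) = 0" unfolding sin_zero_iff_int2 using wT by blast
 moreover from this have "(cos (W / 2 * T))\<^sup>2 = 1" using sin_cos_squared_add[of "W / 2 * T"] by simp
 moreover have "cos (W / 2 * T) *\<^sub>R mat 1 = (mat (of_real (cos (W / 2 * T))) :: cmat2)" by (rule scaleR_mat1)
 ultimately have "frame (\<lambda>t. a) T (of_real l) = mat (of_real (cos (W / 2 * T)))" "(of_real (cos (W / 2 * T)) :: complex)\<^sup>2 = 1"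
  using frame_const[OF w, of T] by (simp_all flip: of_real_power)
 then show "\<exists>l. \<bar>l - 2 * pi / T * of_int k\<bar> \<le> r \<and> (\<exists>s. s\<^sup>2 = 1 \<and> frame (\<lambda>t. a) T (complex_of_real l) = mat s)"
  using lk by blast
qed

text \<open>A single exponential is a constant potential in another gauge.\<close>

lemma dbl_pts_mode:
 assumes "T > 0" "r > 0" shows "dbl_pts T r (\<lambda>t. a * ex (2 * pi / T) m t)"
proof -
 have "cis (- (2 * pi * of_int (- m) / T) * t) * a = a * ex (2 * pi / T) m t" for t
  by (simp add: ex_def cis_conv_exp mult.assoc)
 then have e: "(\<lambda>t. cis (- (2 * pi * of_int (- m) / T) * t) * a) = (\<lambda>t. a * ex (2 * pi / T) m t)" by (rule ext)
 show ?thesis using dbl_pts_shift[OF assms(1) loc_int_const dbl_pts_const[OF assms], of "- m" a] unfolding e .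
qed

section \<open>Density\<close>

text \<open>In the degenerate case the potential is itself a single mode and is its own
  approximation, up to a null set; otherwise the closing argument applies.\<close>

lemma finite_gap_near:
 assumes T: "T > 0" and r: "r > 0" and p0: "L2_loc p0" "AE t in lebesgue. p0 (t + T) = p0 t" and z: "Im z = 1"
  and M: "frame p0 T z = mat s" "s\<^sup>2 = 1" and e: "e > 0"
 obtains a A where "bnd 3 A a" "frame (fsr (2 * pi / T) a) T z = mat s" "dbl_pts T r (fsr (2 * pi / T) a)"
  "integral {0..T} (\<lambda>t. (norm (fsr (2 * pi / T) a t - p0 t))\<^sup>2) \<le> e"
  "continuous_on {0..T} p0 \<Longrightarrow> p0 0 = p0 T \<Longrightarrow> \<forall>t\<in>{0..T}. norm (fsr (2 * pi / T) a t - p0 t) \<le> e"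
proof (cases "\<exists>a m. AE t in lebesgue. p0 t = a * ex (2 * pi / T) m t")
 case False
 show ?thesis by (rule finite_gap_closing[OF T r p0 z M False e]) (rule that)
next
 case True
 then obtain b m where b: "AE t in lebesgue. p0 t = b * ex (2 * pi / T) m t" by blast
 obtain a A where a: "bnd 3 A a" "(\<lambda>t. b * ex (2 * pi / T) m t) = fsr (2 * pi / T) a"
  using trig_coeffs[OF trig.mode] by metis
 have ae: "AE t in lebesgue. p0 t = fsr (2 * pi / T) a t" using b unfolding a(2)[symmetric] .
 show ?thesis
 proof (rule that[OF a(1)])
  show "frame (fsr (2 * pi / T) a) T z = mat s"
   using frame_cong_AE[OF L2_loc_imp_loc_int[OF p0(1)] ae, of T z] M by simp
  show "dbl_pts T r (fsr (2 * pi / T) a)" using dbl_pts_mode[OF T r, of b m] unfolding a(2) .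
  obtain N where N: "negligible N" "\<And>t. t \<notin> N \<Longrightarrow> p0 t = fsr (2 * pi / T) a t" using AE_imp_negligible[OF ae] by blast
  have "integral {0..T} (\<lambda>t. (norm (fsr (2 * pi / T) a t - p0 t))\<^sup>2) = integral {0..T} (\<lambda>t. 0)"
   by (rule integral_spike[OF N(1)]) (simp add: N(2))
  then show "integral {0..T} (\<lambda>t. (norm (fsr (2 * pi / T) a t - p0 t))\<^sup>2) \<le> e" using e by simp
  assume c: "continuous_on {0..T} p0"
  have "p0 t = fsr (2 * pi / T) a t" if "t \<in> {0..T}" for t
   by (rule continuous_AE_eq_Icc[OF c continuous_on_subset[OF continuous_on_fsr[OF bnd_32[OF a(1)]]] T ae that]) simp
  then show "\<forall>t\<in>{0..T}. norm (fsr (2 * pi / T) a t - p0 t) \<le> e" using e by simp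
 qed
qed

text \<open>Decay of order 3 makes the potential continuously differentiable, as the criterion
  demands. The phase is included for a later change of \<theta> by 2 pi m / T.\<close>

lemma finite_gap_fsr:
 assumes T: "T > 0"
 obtains r where "r > 0"
  "\<And>A a m. bnd 3 A a \<Longrightarrow> dbl_pts T r (fsr (2 * pi / T) a) \<Longrightarrow>
    finite_gap T (\<lambda>t. cis (- (2 * pi * of_int m / T) * t) * fsr (2 * pi / T) a t)"
proof (rule finite_gap_criterion[OF T])
 fix r assume r: "r > 0"
  "\<And>q q' K. (\<And>t. (q has_vector_derivative q' t) (at t)) \<Longrightarrow> continuous_on UNIV q' \<Longrightarrow>
    (\<And>k::int. \<bar>k\<bar> \<ge> K \<Longrightarrow> \<exists>l :: real. \<bar>l - 2 * pi / T * of_int k\<bar> \<le> r \<and>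
      (\<exists>s. s\<^sup>2 = 1 \<and> frame q T (of_real l) = mat s)) \<Longrightarrow> finite_gap T q"
 show thesis
 proof (rule that[OF r(1)])
  fix A a and m :: int assume a: "bnd 3 A a" and d: "dbl_pts T r (fsr (2 * pi / T) a)"
  define \<omega> where "\<omega> = 2 * pi / T"
  define c where "c = - (2 * pi * of_int m / T)"
  have A0: "A \<ge> 0" by (rule bnd_nonneg[OF a])
  have b2: "bnd 2 A (\<lambda>n. of_int n * a n)" unfolding bnd_def
  proof
   fix n
   have "wt 3 n * (1 + \<bar>real_of_int n\<bar>) = wt 2 n" by (simp add: wt_def power2_eq_square power3_eq_cube)
   then have "wt 3 n + \<bar>real_of_int n\<bar> * wt 3 n = wt 2 n" by (simp add: algebra_simps)
   then have w: "\<bar>real_of_int n\<bar> * wt 3 n \<le> wt 2 n" using wt_nonneg[of 3 n] by linarith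
   have "norm (of_int n * a n) \<le> \<bar>real_of_int n\<bar> * (A * wt 3 n)" unfolding norm_mult by (intro mult_mono bndD[OF a]) auto
   also have "\<dots> \<le> A * wt 2 n" using mult_left_mono[OF w A0] by (simp add: ac_simps)
   finally show "norm (of_int n * a n) \<le> A * wt 2 n" .
  qed
  let ?f' = "fsr \<omega> (\<lambda>n. \<i> * of_real \<omega> * (of_int n * a n))"
  have vd: "(fsr \<omega> a has_vector_derivative ?f' t) (at t)" for t by (rule fsr_vd[OF bnd_32[OF a] b2])
  have cf: "continuous_on UNIV (fsr \<omega> a)" by (rule continuous_on_fsr[OF bnd_32[OF a]])
  have cf': "continuous_on UNIV ?f'" by (rule continuous_on_fsr[OF bnd_scale[OF b2]])
  have ccis: "continuous_on UNIV (\<lambda>t. cis (c * t))" by (rule has_ac_continuous[OF has_ac_cis])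
  have vc: "((\<lambda>t. cis (c * t)) has_vector_derivative \<i> * of_real c * cis (c * t)) (at t)" for t
   by (rule has_ac_imp_vector_derivative[OF has_ac_cis]) (intro continuous_intros ccis)
  have "dbl_pts T r (\<lambda>t. cis (c * t) * fsr \<omega> a t)"
   using dbl_pts_shift[OF T loc_int_fsr[OF a] d, of m] by (simp add: c_def \<omega>_def)
  then obtain K where K: "\<And>k::int. \<bar>k\<bar> \<ge> K \<Longrightarrow> \<exists>l :: real. \<bar>l - 2 * pi / T * of_int k\<bar> \<le> r \<and>
      (\<exists>s. s\<^sup>2 = 1 \<and> frame (\<lambda>t. cis (c * t) * fsr \<omega> a t) T (of_real l) = mat s)" unfolding dbl_pts_def by blast
  have "finite_gap T (\<lambda>t. cis (c * t) * fsr \<omega> a t)"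
   by (rule r(2)[OF has_vector_derivative_mult[OF vc vd] _ K]) (intro continuous_intros ccis cf cf')
  then show "finite_gap T (\<lambda>t. cis (- (2 * pi * of_int m / T) * t) * fsr (2 * pi / T) a t)"
   by (simp add: c_def \<omega>_def)
 qed
qed

lemma L2_loc_continuous:
 fixes f :: "real \<Rightarrow> complex"
 assumes "continuous_on UNIV f" shows "L2_loc f"
proof (rule L2_loc_bounded_by[OF loc_int_continuous[OF assms]])
 show "L2_loc (\<lambda>t. 0 :: complex)" by (simp add: L2_loc_def absolutely_integrable_on_def)
 fix a b
 obtain c where "c > 0" "\<And>t. t \<in> {a..b} \<Longrightarrow> norm (f t) \<le> c" using continuous_bounded_Icc[OF assms] by blast
 then show "\<exists>c. \<forall>t\<in>{a..b}. norm (f t) \<le> c * (1 + norm (0 :: complex))" by (intro exI[of _ c]) auto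
qed

lemma closed_curve_phase:
 assumes T: "T > 0" and \<gamma>: "\<gamma> = hcurve A q" "\<gamma> \<in> closed_curves T" "A \<in> SL2C" "L2_loc q"
 obtains c \<theta> where "norm c = 1" "AE t in lebesgue. q (t + T) = c\<^sup>2 * q t" "frame q T \<i> = mk2 (cnj c) 0 0 c" "cis (\<theta> * T) = c\<^sup>2"
proof -
 have per: "\<And>t. hcurve A q (t + T) = hcurve A q t" using \<gamma>(1,2) by (simp add: closed_curves_def)
 obtain c where c: "norm c = 1" "AE t in lebesgue. q (t + T) = c\<^sup>2 * q t" "frame q T \<i> = mk2 (cnj c) 0 0 c"
  by (rule hcurve_periodic_data[OF \<gamma>(3,4) per]) (rule that)
 have "cis (Arg (c\<^sup>2) / T * T) = c\<^sup>2" using T c(1) rcis_cmod_Arg[of "c\<^sup>2"] by (simp add: rcis_def norm_power)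
 then show ?thesis by (rule that[OF c])
qed

text \<open>Both \<theta> and the initial matrix \<open>A\<close> are kept while the periodic
  potential is changed: the new monodromy closes at the same point, the quasi-period is the same,
  and the two curves are compared from a common initial frame.\<close>

lemma closed_curve_near:
 assumes T: "T > 0" and \<gamma>: "\<gamma> = hcurve A q" "\<gamma> \<in> closed_curves T" "A \<in> SL2C" "L2_loc q" and e: "e > 0" and \<mu>: "\<mu> > 0"
  and c: "norm c = 1" "AE t in lebesgue. q (t + T) = c\<^sup>2 * q t" "frame q T \<i> = mk2 (cnj c) 0 0 c" "cis (\<theta> * T) = c\<^sup>2"
 obtains \<eta> p where "\<eta> \<in> closed_curves T" "W22_dist T \<eta> \<gamma> < e" "complex_curvature \<eta> (\<lambda>t. cis (\<theta> * t) * p t)"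
  "quasi_periodic T \<theta> (\<lambda>t. cis (\<theta> * t) * p t)" "continuous_on UNIV p"
  "\<And>m::int. finite_gap T (\<lambda>t. cis (- (2 * pi * of_int m / T) * t) * p t)"
  "continuous_on {0..T} q \<Longrightarrow> q T = cis (\<theta> * T) * q 0 \<Longrightarrow> \<forall>t\<in>{0..T}. norm (cis (\<theta> * t) * p t - q t) \<le> \<mu>"
proof -
 define p0 where "p0 t = cis (- \<theta> * t) * q t" for t
 have q: "q t = cis (\<theta> * t) * p0 t" for t by (simp add: p0_def mult.assoc[symmetric] cis_mult)
 have l: "loc_int q" by (rule L2_loc_imp_loc_int[OF \<gamma>(4)])
 obtain s where s: "s\<^sup>2 = 1" "frame (\<lambda>t. cis (- \<theta> * t) * q t) T (\<i> + of_real \<theta>) = mat s"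
  "AE t in lebesgue. cis (- \<theta> * (t + T)) * q (t + T) = cis (- \<theta> * t) * q t"
  by (rule periodic_monodromy[OF l c]) (rule that)
 have s2: "frame p0 T (\<i> + of_real \<theta>) = mat s" unfolding p0_def[abs_def] by (rule s(2))
 have s3: "AE t in lebesgue. p0 (t + T) = p0 t" unfolding p0_def by (rule s(3))
 have Lp0: "L2_loc p0" unfolding p0_def by (rule L2_loc_phase[OF \<gamma>(4)])
 obtain d where d: "d > 0" "\<And>p. L2_loc p \<Longrightarrow> integral {0..T} (\<lambda>t. (norm (p t - q t))\<^sup>2) \<le> d\<^sup>2 \<Longrightarrow> W22_dist T (hcurve A p) (hcurve A q) < e"
  by (rule W22_small[OF \<gamma>(4) T e, of A]) (rule that)
 obtain r where r: "r > 0" "\<And>A a m. bnd 3 A a \<Longrightarrow> dbl_pts T r (fsr (2 * pi / T) a) \<Longrightarrow>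
    finite_gap T (\<lambda>t. cis (- (2 * pi * of_int m / T) * t) * fsr (2 * pi / T) a t)"
  by (rule finite_gap_fsr[OF T]) (rule that)
 have e': "min (d\<^sup>2) \<mu> > 0" using d \<mu> by simp
 have Imz: "Im (\<i> + of_real \<theta>) = 1" by simp
 obtain a B where a: "bnd 3 B a" "frame (fsr (2 * pi / T) a) T (\<i> + of_real \<theta>) = mat s" "dbl_pts T r (fsr (2 * pi / T) a)"
  "integral {0..T} (\<lambda>t. (norm (fsr (2 * pi / T) a t - p0 t))\<^sup>2) \<le> min (d\<^sup>2) \<mu>"
  "continuous_on {0..T} p0 \<Longrightarrow> p0 0 = p0 T \<Longrightarrow> \<forall>t\<in>{0..T}. norm (fsr (2 * pi / T) a t - p0 t) \<le> min (d\<^sup>2) \<mu>"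
  by (rule finite_gap_near[OF T r(1) Lp0 s3 Imz s2 s(1) e']) (rule that)
 define p where "p = fsr (2 * pi / T) a"
 have cp: "continuous_on UNIV p" unfolding p_def by (rule continuous_on_fsr[OF bnd_32[OF a(1)]])
 have per: "p (t + T) = p t" for t unfolding p_def by (rule fsr_periodic[OF T])
 note cl = closed_from_potential[OF T L2_loc_continuous[OF cp] per \<gamma>(3) a(2)[folded p_def] s(1)]
 have nd: "norm (cis (\<theta> * t) * p t - q t) = norm (p t - p0 t)" for t
  by (simp add: q right_diff_distrib[symmetric] norm_mult)
 show ?thesis
 proof (rule that[OF cl(1) _ cl(2,3) cp])
  show "W22_dist T (hcurve A (\<lambda>t. cis (\<theta> * t) * p t)) \<gamma> < e"
   unfolding \<gamma>(1)
  proof (rule d(2)[OF cl(5)])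
   show "integral {0..T} (\<lambda>t. (norm (cis (\<theta> * t) * p t - q t))\<^sup>2) \<le> d\<^sup>2"
    unfolding nd using a(4) by (simp add: p_def)
  qed
  show "finite_gap T (\<lambda>t. cis (- (2 * pi * of_int m / T) * t) * p t)" for m unfolding p_def by (rule r(2)[OF a(1,3)])
  assume c: "continuous_on {0..T} q" "q T = cis (\<theta> * T) * q 0"
  have "continuous_on {0..T} p0" unfolding p0_def
   by (intro continuous_intros c continuous_on_subset[OF has_ac_continuous[OF has_ac_cis]]) simp
  moreover have "p0 0 = p0 T" by (simp add: p0_def c(2) mult.assoc[symmetric] cis_mult)
  ultimately show "\<forall>t\<in>{0..T}. norm (cis (\<theta> * t) * p t - q t) \<le> \<mu>" unfolding nd using a(5) by (simp add: p_def)
 qed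
qed

lemma finite_gap_curvesI:
 assumes "\<eta> \<in> closed_curves T" "complex_curvature \<eta> q" "quasi_periodic T \<theta> q" "average_torsion T \<eta> \<theta>"
  "finite_gap T (\<lambda>t. cis (- \<theta> * t) * q t)"
 shows "\<eta> \<in> finite_gap_curves T"
 using assms unfolding finite_gap_curves_def periodic_potential_def by blast

lemma finite_gap_curve_near:
 assumes T: "T > 0" and \<gamma>: "\<gamma> \<in> closed_curves T" and e: "e > 0"
 shows "\<exists>\<eta>\<in>finite_gap_curves T. W22_dist T \<eta> \<gamma> < e \<and> (\<exists>\<Theta>. total_torsion T \<gamma> \<Theta> \<and> total_torsion T \<eta> \<Theta>)"
proof (cases "\<exists>\<kappa> \<tau>. curvature_torsion \<gamma> \<kappa> \<tau>")
 case True
 then obtain \<kappa> \<tau> where ct: "curvature_torsion \<gamma> \<kappa> \<tau>" by blast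
 define q where "q t = complex_of_real (\<kappa> t) * cis (LBINT s=0..ereal t. \<tau> s)" for t
 have cq: "complex_curvature \<gamma> q" using ct by (simp add: curvature_torsion_def q_def[abs_def])
 then obtain A where A: "A \<in> SL2C" "L2_loc q" "\<gamma> = hcurve A q" unfolding complex_curvature_iff by blast
 obtain c \<theta>0 where c: "norm c = 1" "AE t in lebesgue. q (t + T) = c\<^sup>2 * q t" "frame q T \<i> = mk2 (cnj c) 0 0 c" "cis (\<theta>0 * T) = c\<^sup>2"
  by (rule closed_curve_phase[OF T A(3) \<gamma> A(1,2)]) (rule that)
 have \<theta>0: "quasi_periodic T \<theta>0 q" unfolding quasi_periodic_def c(4) by (rule c(2))
 define \<theta> where "\<theta> = (LBINT s=0..ereal T. \<tau> s) / T"
 have \<theta>T: "\<theta> * T = (LBINT s=0..ereal T. \<tau> s)" using T by (simp add: \<theta>_def)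
 note tc = torsion_cis[OF T cq \<theta>0 ct]
 have \<theta>c: "cis (\<theta> * T) = c\<^sup>2" unfolding \<theta>T tc(1) by (rule c(4))
 have qp: "quasi_periodic T \<theta> q" unfolding quasi_periodic_def \<theta>c by (rule c(2))
 have pos: "\<kappa> t > 0" for t using ct by (simp add: curvature_torsion_def)
 have ck: "continuous_on {0..T} \<kappa>" using ct unfolding curvature_torsion_def
  by (intro continuous_at_imp_continuous_on ballI differentiable_imp_continuous_within) auto
 have "continuous_on UNIV \<tau>" using ct by (simp add: curvature_torsion_def)
 then have cqq: "continuous_on {0..T} q" unfolding q_def by (intro continuous_intros ck torsion_primitive)
 obtain t0 where t0: "\<And>t. t \<in> {0..T} \<Longrightarrow> \<kappa> t0 \<le> \<kappa> t"
  using continuous_attains_inf[OF compact_Icc _ ck] T by force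
 have qT: "q T = cis (\<theta> * T) * q 0" by (simp add: q_def \<theta>T tc(2) zero_ereal_def)
 \<comment> \<open>Half of the minimal curvature over one period: uniform closeness below it
   satisfies the strict bound of \<open>torsion_close\<close>.\<close>
 have \<mu>: "\<kappa> t0 / 2 > 0" using pos[of t0] by simp
 obtain \<eta> p where \<eta>: "\<eta> \<in> closed_curves T" "W22_dist T \<eta> \<gamma> < e" "complex_curvature \<eta> (\<lambda>t. cis (\<theta> * t) * p t)"
  "quasi_periodic T \<theta> (\<lambda>t. cis (\<theta> * t) * p t)" "continuous_on UNIV p"
  "\<And>m::int. finite_gap T (\<lambda>t. cis (- (2 * pi * of_int m / T) * t) * p t)"
  "continuous_on {0..T} q \<Longrightarrow> q T = cis (\<theta> * T) * q 0 \<Longrightarrow> \<forall>t\<in>{0..T}. norm (cis (\<theta> * t) * p t - q t) \<le> \<kappa> t0 / 2"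
  by (rule closed_curve_near[OF T A(3) \<gamma> A(1,2) e \<mu> c(1-3) \<theta>c]) (rule that)
 have cl: "norm (cis (\<theta> * t) * p t - q t) < \<kappa> t" if t: "t \<in> {0..T}" for t
 proof -
  have "norm (cis (\<theta> * t) * p t - q t) \<le> \<kappa> t0 / 2" using \<eta>(7)[OF cqq qT] t by blast
  then show ?thesis using t0[OF t] pos[of t0] by linarith
 qed
 have at: "average_torsion T \<gamma> \<theta>" by (rule average_torsion_unique[OF T cq qp ct \<theta>T[symmetric]])
 have a\<eta>: "average_torsion T \<eta> \<theta>"
 proof (cases "\<exists>\<kappa>' \<tau>'. curvature_torsion \<eta> \<kappa>' \<tau>'")
  case True
  then obtain \<kappa>' \<tau>' where ct': "curvature_torsion \<eta> \<kappa>' \<tau>'" by blast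
  have cp: "continuous_on {0..T} (\<lambda>t. cis (\<theta> * t) * p t)"
   by (intro continuous_intros continuous_on_subset[OF has_ac_continuous[OF has_ac_cis]] continuous_on_subset[OF \<eta>(5)]) auto
  have "(LBINT s=0..ereal T. \<tau>' s) = (LBINT s=0..ereal T. \<tau> s)"
   by (rule torsion_close[OF T ct \<eta>(3) ct' cp cl[unfolded q_def]])
    (use torsion_cis(1)[OF T \<eta>(3,4) ct'] in \<open>simp_all add: \<theta>T\<close>)
  then show ?thesis using average_torsion_unique[OF T \<eta>(3,4) ct'] \<theta>T by simp
 next
  case False
  then show ?thesis using average_torsion_vacuous[OF \<eta>(3,4)] by blast
 qed
 have "(\<lambda>t. cis (- \<theta> * t) * (cis (\<theta> * t) * p t)) = p" by (rule ext) (simp add: mult.assoc[symmetric] cis_mult)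
 moreover have "finite_gap T p" using \<eta>(6)[of 0] by simp
 ultimately have "\<eta> \<in> finite_gap_curves T" using finite_gap_curvesI[OF \<eta>(1,3,4) a\<eta>] by simp
 then show ?thesis using \<eta>(2) at a\<eta> unfolding total_torsion_def by blast
next
 case False
 have W: "W22_loc \<gamma>" "range \<gamma> \<subseteq> H3" "\<And>t. hyp_norm (velocity \<gamma> t) = 1"
  using \<gamma> by (auto simp: closed_curves_def)
 \<comment> \<open>There are no curvature and torsion functions to write down a complex curvature,
   so one is obtained from the parallel frame.\<close>
 obtain A q where A: "A \<in> SL2C" "L2_loc q" "\<gamma> = hcurve A q" by (rule complex_curvature_exists[OF W])
 have cq: "complex_curvature \<gamma> q" unfolding complex_curvature_iff using A by blast
 obtain c \<theta> where c: "norm c = 1" "AE t in lebesgue. q (t + T) = c\<^sup>2 * q t" "frame q T \<i> = mk2 (cnj c) 0 0 c" "cis (\<theta> * T) = c\<^sup>2"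
  by (rule closed_curve_phase[OF T A(3) \<gamma> A(1,2)]) (rule that)
 have qp: "quasi_periodic T \<theta> q" unfolding quasi_periodic_def c(4) by (rule c(2))
 obtain \<eta> p where \<eta>: "\<eta> \<in> closed_curves T" "W22_dist T \<eta> \<gamma> < e" "complex_curvature \<eta> (\<lambda>t. cis (\<theta> * t) * p t)"
  "quasi_periodic T \<theta> (\<lambda>t. cis (\<theta> * t) * p t)" "continuous_on UNIV p"
  "\<And>m::int. finite_gap T (\<lambda>t. cis (- (2 * pi * of_int m / T) * t) * p t)"
  "continuous_on {0..T} q \<Longrightarrow> q T = cis (\<theta> * T) * q 0 \<Longrightarrow> \<forall>t\<in>{0..T}. norm (cis (\<theta> * t) * p t - q t) \<le> 1"
  by (rule closed_curve_near[OF T A(3) \<gamma> A(1,2) e zero_less_one c]) (rule that)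
 \<comment> \<open>The approximating curve may have a torsion function although the given one has
   none. Its average torsion is then forced, and \<open>torsion_cis\<close> shows that it differs
   from \<theta> by a multiple of 2 pi / T.\<close>
 obtain \<theta>' m where \<theta>': "average_torsion T \<eta> \<theta>'" "\<theta>' * T = \<theta> * T + of_int m * (2 * pi)"
 proof (cases "\<exists>\<kappa>' \<tau>'. curvature_torsion \<eta> \<kappa>' \<tau>'")
  case True
  then obtain \<kappa>' \<tau>' where ct': "curvature_torsion \<eta> \<kappa>' \<tau>'" by blast
  define x where "x = (LBINT s=0..ereal T. \<tau>' s)"
  have "cis x = cis (\<theta> * T)" unfolding x_def by (rule torsion_cis(1)[OF T \<eta>(3,4) ct'])
  then have cx: "cis (x - \<theta> * T) = 1" by (simp add: cis_divide[symmetric])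
  then obtain m where m: "x - \<theta> * T = of_int m * (2 * pi)" unfolding cis_eq_1_iff by blast
  have xT: "x / T * T = x" using T by simp
  have "quasi_periodic T (x / T) (\<lambda>t. cis (\<theta> * t) * p t)" using \<eta>(4) \<open>cis x = cis (\<theta> * T)\<close> by (simp only: quasi_periodic_def xT)
  from average_torsion_unique[OF T \<eta>(3) this ct'] show ?thesis using m xT by (intro that[of "x / T" m]) (auto simp: x_def)
 next
  case False
  then show ?thesis using average_torsion_vacuous[OF \<eta>(3,4)] by (intro that[of \<theta> 0]) auto
 qed
 have "cis (\<theta>' * T) = cis (\<theta> * T)" unfolding \<theta>'(2) cis_mult[symmetric] by (simp add: cis_eq_1_iff)
 then have qp': "quasi_periodic T \<theta>' q" "quasi_periodic T \<theta>' (\<lambda>t. cis (\<theta> * t) * p t)" using qp \<eta>(4) by (simp_all only: quasi_periodic_def)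
 \<comment> \<open>The given curve accepts the value of the approximating one, since without a
   torsion function any \<theta>' with the right quasi-period qualifies.\<close>
 have at: "average_torsion T \<gamma> \<theta>'" using average_torsion_vacuous[OF cq qp'(1)] False by blast
 have "cis (- \<theta>' * t) * (cis (\<theta> * t) * p t) = cis (- (2 * pi * of_int m / T) * t) * p t" for t
 proof -
  have "\<theta>' = \<theta> + 2 * pi * of_int m / T" using \<theta>'(2) T by (simp add: field_simps)
  then have "- \<theta>' * t + \<theta> * t = - (2 * pi * of_int m / T) * t" by (simp add: algebra_simps)
  then show ?thesis by (simp only: mult.assoc[symmetric] cis_mult)
 qed
 then have fe: "(\<lambda>t. cis (- \<theta>' * t) * (cis (\<theta> * t) * p t)) = (\<lambda>t. cis (- (2 * pi * of_int m / T) * t) * p t)" by (rule ext)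
 have "finite_gap T (\<lambda>t. cis (- \<theta>' * t) * (cis (\<theta> * t) * p t))" unfolding fe by (rule \<eta>(6))
 then have "\<eta> \<in> finite_gap_curves T" by (rule finite_gap_curvesI[OF \<eta>(1,3) qp'(2) \<theta>'(1)])
 then show ?thesis using \<eta>(2) at \<theta>'(1) unfolding total_torsion_def by blast
qed

theorem theorem5p6:
 fixes T :: real
 assumes "T > 0"
 shows "(\<forall>\<gamma>\<in>closed_curves T. \<forall>e>0. \<exists>\<eta>\<in>finite_gap_curves T. W22_dist T \<eta> \<gamma> < e) \<and>
     (\<forall>\<gamma>\<in>closed_curves T. \<forall>e>0. \<exists>\<eta>\<in>finite_gap_curves T. W22_dist T \<eta> \<gamma> < e \<and>
      (\<exists>\<Theta>. total_torsion T \<gamma> \<Theta> \<and> total_torsion T \<eta> \<Theta>))"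
 using finite_gap_curve_near[OF assms] by blast

end
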